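(* The category of Segal presheaves over $\mathrm{Tw}(\mathrm{sOp})$ is equivalent to the category of coloured (symmetric, set-) operads.
   Context: The category of coloured operads has coloured symmetric operads in sets (with an arbitrary set of colours) as objects, and morphisms may change colours. **$\mathrm{sOp}$** is the $\mathbb N$-coloured symmetric set-operad whose algebras are single-coloured symmetric operads. For $m\ge1$ the elements of $\mathrm{sOp}(n_1,\dots,n_m;n_0)$ are (isomorphism classes of) planar rooted trees with $m$ vertices numbered $1,\dots,m$, the $j$-th vertex having $n_j\ge0$ inputs, and with $n_0$ leaves numbered arbitrarily by $1,\dots,n_0$. In addition $\mathrm{sOp}(;1)=\{\mu_0\}$, where $\mu_0$ is the edge without vertices; there are no other operations of arity $0$. The composition $T\circ_i S$ substitutes the tree $S$ into the $i$-th vertex of $T$, identifying the $k$-th leaf of $S$ with the $k$-th input of this vertex and the root of $S$ with its output; substitution of $\mu_0$ erases a vertex with one input. Symmetric groups permute the numbers of vertices. Identities are corollas with leaves numbered in planar order. The grading $\psi$ of an operation is its arity minus $1$; the only operation of grading $-1$ is $\mu_0$. **Twisted arrow category $\mathrm{Tw}(P)$** of a $C$-coloured symmetric set-operad $P$. Objects: operations of $P$. A morphism with source $p\in P(c_1,\dots,c_n;c_0)$ is (uniquely) a tuple $f=(q_0;q_1,\dots,q_n;\lambda)$, where $q_0\in P$ has arity $m_0\ge 1$ and first input colour $c_0$, $q_i\in P$ ($1\le i\le n$) has arity $m_i\ge 0$ and output colour $c_i$, and $\lambda$ is a bijection from the set of leaves $\{(i,k):1\le i\le n,1\le k\le m_i\}\cup\{(0,k):2\le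 k\le m_0\}$ onto $\{1,\dots,N\}$ with $k\mapsto\lambda(i,k)$ increasing for each fixed $i$. The target is the operation $t$ with $t(x_1,\dots,x_N)=q_0\bigl(p(q_1(x_{\lambda(1,1)},\dots,x_{\lambda(1,m_1)}),\dots,q_n(x_{\lambda(n,1)},\dots)),x_{\lambda(0,2)},\dots,x_{\lambda(0,m_0)}\bigr)$. The composite of $f:p\to t$ with $g=(r_0;r_1,\dots,r_N;\mu):t\to u$ has upper vertices $q_i(r_{\lambda(i,1)},\dots,r_{\lambda(i,m_i)})$ and lower vertex $r_0\circ_1 q_0(\mathrm{id},r_{\lambda(0,2)},\dots,r_{\lambda(0,m_0)})$, with leaves numbered by $\mu$, and with inputs of each vertex (other than the first input of the lower one) then permuted so that the numbers increase. The morphism is *lower* if $q_1,\dots,q_n$ are identities and $\lambda(1,1)<\dots<\lambda(n,1)$. **Segal presheaf** over $\mathrm{Tw}(P)$ for $P$ graded by $\psi$: elementary objects are identity operations and operations of grading $-1$; $El$ is the full subcategory on elementary objects of the category $Lower$ of lower morphisms. A presheaf of sets $X$ over $\mathrm{Tw}(P)$ is Segal if its restriction to $Lower$ is the right Kan extension of its restriction to $El$, i.e. $X(p)\to\lim_{e\to p}X(e)$ is bijective for all $p$, the limit being over the comma category $El/p$ of lower morphisms from elementary objects to $p$. Morphisms of Segal presheaves are morphisms of presheaves. *)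

theory Defs
  imports "HOL-Library.FuncSet" "HOL-Combinatorics.Multiset_Permutations"
begin

section \<open>Categories\<close>

text \<open>Hom-sets need not be disjoint, so composition receives the three objects as arguments:
  \<open>cmp C a b c g f\<close> is the composite of \<open>f : a \<rightarrow> b\<close> and \<open>g : b \<rightarrow> c\<close>.\<close>

record ('o, 'm) cat =
  ob :: "'o set"
  hom :: "'o \<Rightarrow> 'o \<Rightarrow> 'm set"
  idn :: "'o \<Rightarrow> 'm"
  cmp :: "'o \<Rightarrow> 'o \<Rightarrow> 'o \<Rightarrow> 'm \<Rightarrow> 'm \<Rightarrow> 'm"

locale category =
  fixes C :: "('o, 'm) cat"
  assumes idn_hom: "a \<in> ob C \<Longrightarrow> idn C a \<in> hom C a a"
    and cmp_hom: "\<lbrakk>a \<in> ob C; b \<in> ob C; c \<in> ob C; f \<in> hom C a b; g \<in> hom C b c\<rbrakk>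
      \<Longrightarrow> cmp C a b c g f \<in> hom C a c"
    and cmp_idn_left: "\<lbrakk>a \<in> ob C; b \<in> ob C; f \<in> hom C a b\<rbrakk> \<Longrightarrow> cmp C a b b (idn C b) f = f"
    and cmp_idn_right: "\<lbrakk>a \<in> ob C; b \<in> ob C; f \<in> hom C a b\<rbrakk> \<Longrightarrow> cmp C a a b f (idn C a) = f"
    and cmp_assoc: "\<lbrakk>a \<in> ob C; b \<in> ob C; c \<in> ob C; d \<in> ob C;
      f \<in> hom C a b; g \<in> hom C b c; h \<in> hom C c d\<rbrakk>
      \<Longrightarrow> cmp C a c d h (cmp C a b c g f) = cmp C a b d (cmp C b c d h g) f"

definition opposite :: "('o, 'm) cat \<Rightarrow> ('o, 'm) cat" where
  "opposite C = \<lparr>ob = ob C, hom = (\<lambda>a b. hom C b a), idn = idn C,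
    cmp = (\<lambda>a b c g f. cmp C c b a f g)\<rparr>"

definition full_subcategory :: "('o, 'm) cat \<Rightarrow> 'o set \<Rightarrow> ('o, 'm) cat" where
  "full_subcategory C S = C\<lparr>ob := ob C \<inter> S\<rparr>"

record ('o, 'm, 'p, 'n) fnctr =
  fob :: "'o \<Rightarrow> 'p"
  fmor :: "'o \<Rightarrow> 'o \<Rightarrow> 'm \<Rightarrow> 'n"

definition is_functor :: "('o, 'm) cat \<Rightarrow> ('p, 'n) cat \<Rightarrow> ('o, 'm, 'p, 'n) fnctr \<Rightarrow> bool" where
  "is_functor C D F \<longleftrightarrow>
    (\<forall>a\<in>ob C. fob F a \<in> ob D) \<and>
    (\<forall>a\<in>ob C. \<forall>b\<in>ob C. \<forall>f\<in>hom C a b. fmor F a b f \<in> hom D (fob F a) (fob F b)) \<and>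
    (\<forall>a\<in>ob C. fmor F a a (idn C a) = idn D (fob F a)) \<and>
    (\<forall>a\<in>ob C. \<forall>b\<in>ob C. \<forall>c\<in>ob C. \<forall>f\<in>hom C a b. \<forall>g\<in>hom C b c.
      fmor F a c (cmp C a b c g f) =
        cmp D (fob F a) (fob F b) (fob F c) (fmor F b c g) (fmor F a b f))"

definition id_functor :: "('o, 'm, 'o, 'm) fnctr" where
  "id_functor = \<lparr>fob = (\<lambda>a. a), fmor = (\<lambda>a b f. f)\<rparr>"

definition comp_functor ::
  "('p, 'n, 'q, 'k) fnctr \<Rightarrow> ('o, 'm, 'p, 'n) fnctr \<Rightarrow> ('o, 'm, 'q, 'k) fnctr" where
  "comp_functor G F = \<lparr>fob = (\<lambda>a. fob G (fob F a)),
    fmor = (\<lambda>a b f. fmor G (fob F a) (fob F b) (fmor F a b f))\<rparr>"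

text \<open>Components outside the objects of \<open>C\<close> are fixed to \<open>undefined\<close>, so that
  equality of natural transformations is equality of their components.\<close>

definition nat_trans :: "('o, 'm) cat \<Rightarrow> ('p, 'n) cat \<Rightarrow> ('o, 'm, 'p, 'n) fnctr \<Rightarrow>
    ('o, 'm, 'p, 'n) fnctr \<Rightarrow> ('o \<Rightarrow> 'n) set" where
  "nat_trans C D F G = {\<alpha> \<in> extensional (ob C).
    (\<forall>a\<in>ob C. \<alpha> a \<in> hom D (fob F a) (fob G a)) \<and>
    (\<forall>a\<in>ob C. \<forall>b\<in>ob C. \<forall>f\<in>hom C a b.
      cmp D (fob F a) (fob F b) (fob G b) (\<alpha> b) (fmor F a b f) =
      cmp D (fob F a) (fob G a) (fob G b) (fmor G a b f) (\<alpha> a))}"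

definition functor_category :: "('o, 'm) cat \<Rightarrow> ('p, 'n) cat \<Rightarrow>
    (('o, 'm, 'p, 'n) fnctr, 'o \<Rightarrow> 'n) cat" where
  "functor_category C D = \<lparr>
    ob = {F. is_functor C D F},
    hom = nat_trans C D,
    idn = (\<lambda>F. \<lambda>a\<in>ob C. idn D (fob F a)),
    cmp = (\<lambda>F G H \<beta> \<alpha>. \<lambda>a\<in>ob C. cmp D (fob F a) (fob G a) (fob H a) (\<beta> a) (\<alpha> a))\<rparr>"

definition iso_set :: "('o, 'm) cat \<Rightarrow> 'o \<Rightarrow> 'o \<Rightarrow> 'm set" where
  "iso_set C a b = {f \<in> hom C a b. \<exists>g\<in>hom C b a.
    cmp C a b a g f = idn C a \<and> cmp C b a b f g = idn C b}"

definition nat_iso :: "('o, 'm) cat \<Rightarrow> ('p, 'n) cat \<Rightarrow> ('o, 'm, 'p, 'n) fnctr \<Rightarrow>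
    ('o, 'm, 'p, 'n) fnctr \<Rightarrow> ('o \<Rightarrow> 'n) set" where
  "nat_iso C D F G =
    {\<alpha> \<in> nat_trans C D F G. \<forall>a\<in>ob C. \<alpha> a \<in> iso_set D (fob F a) (fob G a)}"

definition equivalent_categories :: "('o, 'm) cat \<Rightarrow> ('p, 'n) cat \<Rightarrow> bool" where
  "equivalent_categories C D \<longleftrightarrow> category C \<and> category D \<and>
    (\<exists>F G \<eta> \<epsilon>. is_functor C D F \<and> is_functor D C G \<and>
      \<eta> \<in> nat_iso C C id_functor (comp_functor G F) \<and>
      \<epsilon> \<in> nat_iso D D (comp_functor F G) id_functor)"

text \<open>The category of sets whose elements are drawn from the type \<open>'u\<close>.\<close>

definition set_category :: "('u set, 'u \<Rightarrow> 'u) cat" where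
  "set_category = \<lparr>ob = UNIV, hom = (\<lambda>A B. A \<rightarrow>\<^sub>E B), idn = (\<lambda>A. \<lambda>x\<in>A. x),
    cmp = (\<lambda>A B D g f. compose A g f)\<rparr>"

type_synonym ('o, 'm, 'u) presheaf = "('o, 'm, 'u set, 'u \<Rightarrow> 'u) fnctr"

definition presheaf_category :: "('o, 'm) cat \<Rightarrow> (('o, 'm, 'u) presheaf, 'o \<Rightarrow> 'u \<Rightarrow> 'u) cat" where
  "presheaf_category C = functor_category (opposite C) set_category"

text \<open>The limit of a functor \<open>D\<close> from \<open>J\<close> to sets, realised as the set of compatible families.\<close>

definition set_limit :: "('j, 'k) cat \<Rightarrow> ('j, 'k, 'u set, 'u \<Rightarrow> 'u) fnctr \<Rightarrow> ('j \<Rightarrow> 'u) set" where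
  "set_limit J D = {x \<in> (\<Pi>\<^sub>E j\<in>ob J. fob D j).
    \<forall>i\<in>ob J. \<forall>j\<in>ob J. \<forall>u\<in>hom J i j. fmor D i j u (x i) = x j}"

text \<open>The comma category \<open>E/p\<close> for a subcategory \<open>E\<close> of \<open>C\<close> and an object \<open>p\<close> of \<open>C\<close>.\<close>

definition comma_over :: "('o, 'm) cat \<Rightarrow> ('o, 'm) cat \<Rightarrow> 'o \<Rightarrow> ('o \<times> 'm, 'm) cat" where
  "comma_over E C p = \<lparr>
    ob = {(e, h). e \<in> ob E \<and> h \<in> hom C e p},
    hom = (\<lambda>(e, h) (e', h'). {u \<in> hom E e e'. cmp C e e' p h' u = h}),
    idn = (\<lambda>(e, h). idn E e),
    cmp = (\<lambda>(e, h) (e', h') (e'', h''). cmp E e e' e'')\<rparr>"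

definition comma_diagram ::
  "('o, 'm, 'u) presheaf \<Rightarrow> ('o \<times> 'm, 'm, 'u set, 'u \<Rightarrow> 'u) fnctr" where
  "comma_diagram X = \<lparr>fob = (\<lambda>(e, h). fob X e), fmor = (\<lambda>(e, h) (e', h') u. fmor X e e' u)\<rparr>"


section \<open>Coloured symmetric operads\<close>

text \<open>A permutation of \<open>{..<n}\<close> is written in one-line notation, as a list. All numberings
  start from 0.\<close>

abbreviation perms :: "nat \<Rightarrow> nat list set" where
  "perms n \<equiv> permutations_of_set {..<n}"

text \<open>
  The operations of all profiles form one set \<open>Ops\<close>; \<open>p \<in> P(c\<^sub>1,\<dots>,c\<^sub>n;c\<^sub>0)\<close> is
  \<open>p \<in> Ops P \<and> inp P p = [c\<^sub>1,\<dots>,c\<^sub>n] \<and> out P p = c\<^sub>0\<close>.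
  \<open>comp P p [q\<^sub>1,\<dots>,q\<^sub>n]\<close> is \<open>p(q\<^sub>1,\<dots>,q\<^sub>n)\<close>; the partial composition \<open>p \<circ>\<^sub>i q\<close> is the case in which
  all \<open>q\<^sub>j\<close> with \<open>j \<noteq> i\<close> are identities.
  \<open>act P p L\<close> is the operation with \<open>(act P p L)(x\<^sub>0,\<dots>,x\<^bsub>n-1\<^esub>) = p(x\<^bsub>L!0\<^esub>,\<dots>,x\<^bsub>L!(n-1)\<^esub>)\<close>:
  its input number \<open>L!k\<close> is the input number \<open>k\<close> of \<open>p\<close>.
\<close>

record ('c, 'o) operad =
  Col :: "'c set"
  Ops :: "'o set"
  inp :: "'o \<Rightarrow> 'c list"
  out :: "'o \<Rightarrow> 'c"
  ident :: "'c \<Rightarrow> 'o"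
  comp :: "'o \<Rightarrow> 'o list \<Rightarrow> 'o"
  act :: "'o \<Rightarrow> nat list \<Rightarrow> 'o"

definition arity :: "('c, 'o) operad \<Rightarrow> 'o \<Rightarrow> nat" where
  "arity P p = length (inp P p)"

definition block_start :: "nat list \<Rightarrow> nat \<Rightarrow> nat" where
  "block_start ns i = sum_list (take i ns)"

text \<open>Block sum of permutations, and the permutation of consecutive blocks of sizes \<open>ns\<close> induced
  by a permutation of the blocks.\<close>

definition block_sum :: "nat list list \<Rightarrow> nat list" where
  "block_sum Ls =
    concat (map (\<lambda>i. map ((+) (block_start (map length Ls) i)) (Ls ! i)) [0..<length Ls])"

definition block_perm :: "nat list \<Rightarrow> nat list \<Rightarrow> nat list" where
  "block_perm ns L = concat (map (\<lambda>j. [block_start ns j ..< block_start ns j + ns ! j]) L)"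

definition composable :: "('c, 'o) operad \<Rightarrow> 'o \<Rightarrow> 'o list \<Rightarrow> bool" where
  "composable P p qs \<longleftrightarrow> p \<in> Ops P \<and> set qs \<subseteq> Ops P \<and> map (out P) qs = inp P p"

locale coloured_operad =
  fixes P :: "('c, 'o) operad"
  assumes inp_Col: "p \<in> Ops P \<Longrightarrow> set (inp P p) \<subseteq> Col P"
    and out_Col: "p \<in> Ops P \<Longrightarrow> out P p \<in> Col P"
    and ident_Ops: "c \<in> Col P \<Longrightarrow> ident P c \<in> Ops P"
    and ident_inp: "c \<in> Col P \<Longrightarrow> inp P (ident P c) = [c]"
    and ident_out: "c \<in> Col P \<Longrightarrow> out P (ident P c) = c"
    and comp_Ops: "composable P p qs \<Longrightarrow> comp P p qs \<in> Ops P"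
    and comp_inp: "composable P p qs \<Longrightarrow> inp P (comp P p qs) = concat (map (inp P) qs)"
    and comp_out: "composable P p qs \<Longrightarrow> out P (comp P p qs) = out P p"
    and comp_ident_left: "p \<in> Ops P \<Longrightarrow> comp P (ident P (out P p)) [p] = p"
    and comp_ident_right: "p \<in> Ops P \<Longrightarrow> comp P p (map (ident P) (inp P p)) = p"
    and comp_assoc: "\<lbrakk>composable P p qs; list_all2 (composable P) qs rss\<rbrakk>
      \<Longrightarrow> comp P (comp P p qs) (concat rss) = comp P p (map2 (comp P) qs rss)"
    and act_Ops: "\<lbrakk>p \<in> Ops P; L \<in> perms (arity P p)\<rbrakk> \<Longrightarrow> act P p L \<in> Ops P"
    and act_arity: "\<lbrakk>p \<in> Ops P; L \<in> perms (arity P p)\<rbrakk> \<Longrightarrow> arity P (act P p L) = arity P p"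
    and act_inp: "\<lbrakk>p \<in> Ops P; L \<in> perms (arity P p); k < arity P p\<rbrakk>
      \<Longrightarrow> inp P (act P p L) ! (L ! k) = inp P p ! k"
    and act_out: "\<lbrakk>p \<in> Ops P; L \<in> perms (arity P p)\<rbrakk> \<Longrightarrow> out P (act P p L) = out P p"
    and act_id: "p \<in> Ops P \<Longrightarrow> act P p [0..<arity P p] = p"
    and act_act: "\<lbrakk>p \<in> Ops P; L \<in> perms (arity P p); M \<in> perms (arity P p)\<rbrakk>
      \<Longrightarrow> act P (act P p L) M = act P p (map ((!) M) L)"
    and comp_act_inner: "\<lbrakk>composable P p qs; list_all2 (\<lambda>q L. L \<in> perms (arity P q)) qs Ls\<rbrakk>
      \<Longrightarrow> comp P p (map2 (act P) qs Ls) = act P (comp P p qs) (block_sum Ls)"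
    and comp_act_outer: "\<lbrakk>p \<in> Ops P; L \<in> perms (arity P p); composable P (act P p L) qs\<rbrakk>
      \<Longrightarrow> comp P (act P p L) qs =
        act P (comp P p (map ((!) qs) L)) (block_perm (map (arity P) qs) L)"

definition operad_hom ::
  "('c, 'o) operad \<Rightarrow> ('d, 'p) operad \<Rightarrow> (('c \<Rightarrow> 'd) \<times> ('o \<Rightarrow> 'p)) set" where
  "operad_hom P Q = {(f, g). f \<in> Col P \<rightarrow>\<^sub>E Col Q \<and> g \<in> Ops P \<rightarrow>\<^sub>E Ops Q \<and>
    (\<forall>p\<in>Ops P. inp Q (g p) = map f (inp P p) \<and> out Q (g p) = f (out P p)) \<and>
    (\<forall>c\<in>Col P. g (ident P c) = ident Q (f c)) \<and>
    (\<forall>p qs. composable P p qs \<longrightarrow> g (comp P p qs) = comp Q (g p) (map g qs)) \<and>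
    (\<forall>p\<in>Ops P. \<forall>L\<in>perms (arity P p). g (act P p L) = act Q (g p) L)}"

text \<open>All coloured operads, with arbitrary sets of colours, in the universe \<open>'u\<close> of
  \<open>set_category\<close>. When \<open>'u\<close> is infinite, this universe is closed under finite products and
  countable coproducts, which is what the passage between operads and presheaves uses.\<close>

definition operad_category ::
  "(('u, 'u) operad, ('u \<Rightarrow> 'u) \<times> ('u \<Rightarrow> 'u)) cat" where
  "operad_category = \<lparr>
    ob = {P. coloured_operad P},
    hom = operad_hom,
    idn = (\<lambda>P. (\<lambda>c\<in>Col P. c, \<lambda>p\<in>Ops P. p)),
    cmp = (\<lambda>P Q R (f', g') (f, g). (compose (Col P) f' f, compose (Ops P) g' g))\<rparr>"


section \<open>The operad of trees\<close>

text \<open>Planar rooted trees with labelled vertices and leaves. As planar trees have no nontrivial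
  isomorphisms, the elements of this type are the isomorphism classes.\<close>

datatype ('v, 'l) tree = Leaf 'l | Vertex 'v "('v, 'l) tree list"

primrec vertices :: "('v, 'l) tree \<Rightarrow> ('v \<times> nat) list" where
  "vertices (Leaf l) = []"
| "vertices (Vertex v ts) = (v, length ts) # concat (map vertices ts)"

primrec leaves :: "('v, 'l) tree \<Rightarrow> 'l list" where
  "leaves (Leaf l) = [l]"
| "leaves (Vertex v ts) = concat (map leaves ts)"

primrec graft :: "('k \<Rightarrow> ('v, 'l) tree) \<Rightarrow> ('v, 'k) tree \<Rightarrow> ('v, 'l) tree" where
  "graft s (Leaf k) = s k"
| "graft s (Vertex v ts) = Vertex v (map (graft s) ts)"

text \<open>Simultaneous substitution of the tree \<open>s v\<close> into each vertex \<open>v\<close>; the leaf number \<open>k\<close>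
  of \<open>s v\<close> is identified with the input number \<open>k\<close> of \<open>v\<close>.\<close>

primrec substitute :: "('v \<Rightarrow> ('w, nat) tree) \<Rightarrow> ('v, 'l) tree \<Rightarrow> ('w, 'l) tree" where
  "substitute s (Leaf l) = Leaf l"
| "substitute s (Vertex v ts) = graft ((!) (map (substitute s) ts)) (s v)"

text \<open>An element of \<open>Ops sOp\<close> has its vertices and its leaves numbered bijectively. The only
  such tree without vertices is \<open>Leaf 0\<close>, the edge. In a composite, the vertices coming from
  the tree \<open>Ss ! j\<close> are numbered as the \<open>j\<close>-th block.\<close>

definition sOp :: "(nat, (nat, nat) tree) operad" where
  "sOp = \<lparr>
    Col = UNIV,
    Ops = {T. map fst (vertices T) \<in> perms (length (vertices T)) \<and>
              leaves T \<in> perms (length (leaves T))},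
    inp = (\<lambda>T. map (\<lambda>j. the (map_of (vertices T) j)) [0..<length (vertices T)]),
    out = (\<lambda>T. length (leaves T)),
    ident = (\<lambda>n. Vertex 0 (map Leaf [0..<n])),
    comp = (\<lambda>T Ss. substitute
      (\<lambda>j. map_tree (\<lambda>v. block_start (map (length \<circ> vertices) Ss) j + v) (\<lambda>k. k) (Ss ! j)) T),
    act = (\<lambda>T L. map_tree ((!) L) (\<lambda>k. k) T)\<rparr>"

definition sOp_grading :: "(nat, nat) tree \<Rightarrow> int" where
  "sOp_grading T = int (arity sOp T) - 1"


section \<open>Twisted arrow categories\<close>

text \<open>
  The tuple \<open>(q\<^sub>0;q\<^sub>1,\<dots>,q\<^sub>n;\<lambda>)\<close>: \<open>low\<close> is \<open>q\<^sub>0\<close>, \<open>low_labels\<close> lists the values of \<open>\<lambda>\<close> on the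
  inputs of \<open>q\<^sub>0\<close> other than the first, \<open>upp\<close> lists \<open>q\<^sub>1,\<dots>,q\<^sub>n\<close>, and \<open>upp_labels\<close> lists, for
  each \<open>q\<^sub>i\<close>, the values of \<open>\<lambda>\<close> on the inputs of \<open>q\<^sub>i\<close>.
\<close>

record 'o tw_mor =
  low :: 'o
  low_labels :: "nat list"
  upp :: "'o list"
  upp_labels :: "nat list list"

definition tw_labels :: "'o tw_mor \<Rightarrow> nat list" where
  "tw_labels f = concat (upp_labels f) @ low_labels f"

definition tw_valid :: "('c, 'o) operad \<Rightarrow> 'o \<Rightarrow> 'o tw_mor \<Rightarrow> bool" where
  "tw_valid P p f \<longleftrightarrow>
    low f \<in> Ops P \<and> inp P (low f) \<noteq> [] \<and> hd (inp P (low f)) = out P p \<and>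
    composable P p (upp f) \<and>
    map length (upp_labels f) = map (arity P) (upp f) \<and>
    Suc (length (low_labels f)) = arity P (low f) \<and>
    tw_labels f \<in> perms (length (tw_labels f)) \<and>
    (\<forall>ls\<in>set (upp_labels f). sorted_wrt (<) ls) \<and> sorted_wrt (<) (low_labels f)"

text \<open>\<open>compose_first P q p\<close> is \<open>q \<circ>\<^sub>1 p\<close>.\<close>

definition compose_first :: "('c, 'o) operad \<Rightarrow> 'o \<Rightarrow> 'o \<Rightarrow> 'o" where
  "compose_first P q p = comp P q (p # map (ident P) (tl (inp P q)))"

definition tw_target :: "('c, 'o) operad \<Rightarrow> 'o \<Rightarrow> 'o tw_mor \<Rightarrow> 'o" where
  "tw_target P p f = act P (compose_first P (low f) (comp P p (upp f))) (tw_labels f)"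

definition tw_id :: "('c, 'o) operad \<Rightarrow> 'o \<Rightarrow> 'o tw_mor" where
  "tw_id P p = \<lparr>low = ident P (out P p), low_labels = [],
    upp = map (ident P) (inp P p), upp_labels = map (\<lambda>i. [i]) [0..<arity P p]\<rparr>"

text \<open>For a list of distinct labels, \<open>ranks ls\<close> is the permutation which makes the labels
  increase: \<open>sort ls ! (ranks ls ! k) = ls ! k\<close>.\<close>

definition ranks :: "nat list \<Rightarrow> nat list" where
  "ranks ls = map (\<lambda>l. length (filter (\<lambda>l'. l' < l) ls)) ls"

definition tw_comp :: "('c, 'o) operad \<Rightarrow> 'o tw_mor \<Rightarrow> 'o tw_mor \<Rightarrow> 'o tw_mor" where
  "tw_comp P g f = (let
      new_labels = (\<lambda>ls. concat (map ((!) (upp_labels g)) ls));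
      new_upp = (\<lambda>q ls. comp P q (map ((!) (upp g)) ls));
      low_q = comp P (low f) (ident P (hd (inp P (low f))) # map ((!) (upp g)) (low_labels f));
      new_low = compose_first P (low g) low_q;
      new_low_labels = new_labels (low_labels f) @ low_labels g
    in \<lparr>low = act P new_low (0 # map Suc (ranks new_low_labels)),
        low_labels = sort new_low_labels,
        upp = map2 (\<lambda>q ls. act P (new_upp q ls) (ranks (new_labels ls))) (upp f) (upp_labels f),
        upp_labels = map (\<lambda>ls. sort (new_labels ls)) (upp_labels f)\<rparr>)"

definition Tw :: "('c, 'o) operad \<Rightarrow> ('o, 'o tw_mor) cat" where
  "Tw P = \<lparr>
    ob = Ops P,
    hom = (\<lambda>p t. {f. tw_valid P p f \<and> tw_target P p f = t}),
    idn = tw_id P,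
    cmp = (\<lambda>p t u g f. tw_comp P g f)\<rparr>"

definition is_lower :: "('c, 'o) operad \<Rightarrow> 'o \<Rightarrow> 'o tw_mor \<Rightarrow> bool" where
  "is_lower P p f \<longleftrightarrow> upp f = map (ident P) (inp P p) \<and> sorted_wrt (<) (map hd (upp_labels f))"

definition Lower :: "('c, 'o) operad \<Rightarrow> ('o, 'o tw_mor) cat" where
  "Lower P = (Tw P)\<lparr>hom := (\<lambda>p t. {f \<in> hom (Tw P) p t. is_lower P p f})\<rparr>"


section \<open>Segal presheaves\<close>

definition elementary :: "('c, 'o) operad \<Rightarrow> ('o \<Rightarrow> int) \<Rightarrow> 'o set" where
  "elementary P \<psi> = ident P ` Col P \<union> {p \<in> Ops P. \<psi> p = -1}"

definition El :: "('c, 'o) operad \<Rightarrow> ('o \<Rightarrow> int) \<Rightarrow> ('o, 'o tw_mor) cat" where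
  "El P \<psi> = full_subcategory (Lower P) (elementary P \<psi>)"

definition El_over :: "('c, 'o) operad \<Rightarrow> ('o \<Rightarrow> int) \<Rightarrow> 'o \<Rightarrow> ('o \<times> 'o tw_mor, 'o tw_mor) cat" where
  "El_over P \<psi> p = comma_over (El P \<psi>) (Lower P) p"

text \<open>The map \<open>X(p) \<rightarrow> lim X(e)\<close> sends \<open>x\<close> to the family of its restrictions along all lower
  morphisms \<open>h : e \<rightarrow> p\<close>. A morphism \<open>h : e \<rightarrow> p\<close> is a morphism \<open>p \<rightarrow> e\<close> of the opposite
  category, hence the order of the objects in \<open>fmor X p e h\<close>.\<close>

definition is_segal ::
  "('c, 'o) operad \<Rightarrow> ('o \<Rightarrow> int) \<Rightarrow> ('o, 'o tw_mor, 'u) presheaf \<Rightarrow> bool" where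
  "is_segal P \<psi> X \<longleftrightarrow> (\<forall>p\<in>Ops P.
    bij_betw (\<lambda>x. \<lambda>(e, h)\<in>ob (El_over P \<psi> p). fmor X p e h x)
      (fob X p) (set_limit (opposite (El_over P \<psi> p)) (comma_diagram X)))"

definition segal_category :: "('c, 'o) operad \<Rightarrow> ('o \<Rightarrow> int) \<Rightarrow>
    (('o, 'o tw_mor, 'u) presheaf, 'o \<Rightarrow> 'u \<Rightarrow> 'u) cat" where
  "segal_category P \<psi> = full_subcategory (presheaf_category (Tw P)) {X. is_segal P \<psi> X}"

end

theory Submission
  imports Defs
begin

text \<open>
  The nerve of a coloured operad \<open>P\<close> sends a tree \<open>T\<close> to the set of decorations of its vertices by
  operations of \<open>P\<close> with matching colours along the edges, together with the value of the
  decorated tree. A morphism \<open>p \<rightarrow> t\<close> exhibits \<open>t\<close> as the result of substituting trees into the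
  vertices of \<open>p\<close> and then \<open>p\<close> into a vertex of a lower tree; restriction evaluates the
  decorations of the substituted trees.

  The elementary objects over \<open>T\<close> are the vertices of \<open>T\<close> (corollas) and the edges of \<open>T\<close>
  (the tree without vertices). So a presheaf \<open>X\<close> is Segal iff an element of \<open>X(T)\<close> is the same as
  a family of elements of \<open>X\<close> on the vertex corollas which agree along the edges. The elements of
  \<open>X\<close> on the corollas are then the operations of an operad, composed by gluing the corollas to a
  two-level tree and restricting to the corolla into which this tree is contracted; \<open>X\<close> is
  isomorphic to the nerve of this operad. Hence the nerve is fully faithful and essentially
  surjective.
\<close>

section \<open>Substitution of trees\<close>

text \<open>The tuples of \<open>Tw\<close> number vertices and keep label lists sorted, so
  composing them needs a sorting permutation at every vertex. The proof trades a tuple for the trees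
  \<open>uppL f i\<close> and \<open>lowL f\<close>, whose vertices carry their labels directly; the
  ordering conditions make this faithful, and composition becomes plain substitution. Decorated
  trees are evaluated by relations, \<open>Ev\<close> for an operad and \<open>EvX\<close> for a
  presheaf, not by functions: the tree without vertices has no decoration from which its colour
  could be read off, while every other tree has at most one value. On both sides the key fact is
  that evaluation is compatible with substitution. It makes restriction in the nerve functorial, and
  it reduces each axiom for the operad of a Segal presheaf to exhibiting both sides as values of one
  and the same tree. An element of a nerve is a finite list of operations. To stay inside the
  universe \<open>'u\<close>, an injection of lists into \<open>'u\<close> is fixed, and this is
  what the infinity of \<open>'u\<close> is used for.\<close>

lemma perms_iff: "xs \<in> perms n \<longleftrightarrow> mset xs = mset [0..<n]"
proof
  assume "xs \<in> perms n"
  then have "set xs = set [0..<n]" "distinct xs" by (auto dest: permutations_of_setD)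
  then show "mset xs = mset [0..<n]" using set_eq_iff_mset_eq_distinct distinct_upt by blast
next
  assume a: "mset xs = mset [0..<n]"
  have "set xs = set [0..<n]" by (rule mset_eq_setD[OF a])
  moreover have "distinct xs" using mset_eq_imp_distinct_iff[OF a] by simp
  ultimately show "xs \<in> perms n" using permutations_of_setI[of xs "{..<n}"] by auto
qed

lemma perms_set: "xs \<in> perms n \<Longrightarrow> set xs = {..<n}"
  and perms_distinct: "xs \<in> perms n \<Longrightarrow> distinct xs"
  and perms_length: "xs \<in> perms n \<Longrightarrow> length xs = n"
  using permutations_of_setD[of xs "{..<n}"] distinct_card[of xs] by auto

lemma perms_self: "xs \<in> perms n \<Longrightarrow> xs \<in> perms (length xs)"
  by (simp add: perms_length)

lemma upt_perms [simp]: "[0..<n] \<in> perms n"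
  by (simp add: perms_iff)

lemma perms_nth: "xs \<in> perms n \<Longrightarrow> k < n \<Longrightarrow> xs ! k < n"
  using perms_set perms_length nth_mem by (metis lessThan_iff)

lemma perms_indexE:
  assumes "xs \<in> perms n" "j < n"
  obtains k where "k < n" "xs ! k = j"
  using assms perms_set perms_length by (metis in_set_conv_nth lessThan_iff)

abbreviation vmap :: "('v \<Rightarrow> 'w) \<Rightarrow> ('v, 'l) tree \<Rightarrow> ('w, 'l) tree" where
  "vmap f \<equiv> map_tree f (\<lambda>k. k)"

abbreviation vlabels :: "('v, 'l) tree \<Rightarrow> 'v list" where
  "vlabels T \<equiv> map fst (vertices T)"

definition cor :: "'v \<Rightarrow> nat \<Rightarrow> ('v, nat) tree" where
  "cor v n = Vertex v (map Leaf [0..<n])"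

text \<open>In contrast to \<^const>\<open>substitute\<close>, the substituted tree may depend on the arity of the
  vertex, so that corollas are units without any side condition.\<close>

primrec sub :: "('v \<Rightarrow> nat \<Rightarrow> ('w, nat) tree) \<Rightarrow> ('v, 'l) tree \<Rightarrow> ('w, 'l) tree" where
  "sub s (Leaf l) = Leaf l"
| "sub s (Vertex v ts) = graft ((!) (map (sub s) ts)) (s v (length ts))"

lemma substitute_sub: "substitute s T = sub (\<lambda>v n. s v) T"
  by (induction T) (simp_all cong: map_cong)

text \<open>Grafting looks branches up by position with \<open>!\<close>, which says nothing beyond
  the end of a list. So the leaves of a substituted tree have to name the inputs of the vertex, each
  exactly once.\<close>

definition fits :: "('v \<Rightarrow> nat \<Rightarrow> ('w, nat) tree) \<Rightarrow> ('v, 'l) tree \<Rightarrow> bool" where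
  "fits s T \<longleftrightarrow> (\<forall>(v, n) \<in> set (vertices T). leaves (s v n) \<in> perms n)"

lemma fitsD: "fits s T \<Longrightarrow> (v, n) \<in> set (vertices T) \<Longrightarrow> leaves (s v n) \<in> perms n"
  by (auto simp: fits_def)

lemma fits_Vertex: "fits s (Vertex v ts) \<longleftrightarrow>
    leaves (s v (length ts)) \<in> perms (length ts) \<and> (\<forall>t \<in> set ts. fits s t)"
  by (auto simp: fits_def)

lemma set1_tree: "set1_tree T = set (vlabels T)"
  by (induction T) (auto simp: image_Union)

lemma set2_tree: "set2_tree T = set (leaves T)"
  by (induction T) auto

lemma vertices_map_tree:
  "vertices (map_tree f g T) = map (\<lambda>(v, n). (f v, n)) (vertices T)"
  by (induction T) (simp_all add: map_concat o_def cong: map_cong)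

lemma length_vertices_map_tree [simp]: "length (vertices (map_tree f g T)) = length (vertices T)"
  by (simp add: vertices_map_tree)

lemma leaves_map_tree [simp]: "leaves (map_tree f g T) = map g (leaves T)"
  by (induction T) (simp_all add: map_concat o_def cong: map_cong)

lemma vmap_cong: "(\<And>v. v \<in> set (vlabels T) \<Longrightarrow> f v = g v) \<Longrightarrow> vmap f T = vmap g T"
  by (rule tree.map_cong0) (auto simp: set1_tree)

lemma vmap_vmap: "vmap f (vmap g T) = vmap (\<lambda>v. f (g v)) T"
  by (simp add: tree.map_comp o_def)

lemma vmap_id [simp]: "vmap (\<lambda>v. v) T = T"
  using tree.map_id[of T] by (simp add: id_def)

lemma vmap_add_0 [simp]: "vmap ((+) (0::nat)) T = T"
proof -
  have "(+) (0::nat) = (\<lambda>v. v)" by auto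
  then show ?thesis by simp
qed

lemma vmap_inj: "inj f \<Longrightarrow> vmap f T = vmap f U \<Longrightarrow> T = U"
  using tree.inj_map[of f "\<lambda>k. k"] by (auto simp: inj_def)

lemma vlabels_vmap [simp]: "vlabels (map_tree f g T) = map f (vlabels T)"
  by (simp add: vertices_map_tree case_prod_unfold)

lemma graft_cong: "(\<And>l. l \<in> set (leaves T) \<Longrightarrow> f l = g l) \<Longrightarrow> graft f T = graft g T"
  by (induction T) auto

lemma graft_graft: "graft f (graft g T) = graft (\<lambda>k. graft f (g k)) T"
  by (induction T) auto

lemma graft_Leaf_fun: "graft (\<lambda>l. Leaf (g l)) T = map_tree (\<lambda>v. v) g T"
  by (induction T) auto

lemma graft_Leaf [simp]: "graft Leaf T = T"
  using graft_Leaf_fun[of "\<lambda>l. l" T] by simp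

lemma vmap_graft: "vmap f (graft u T) = graft (\<lambda>l. vmap f (u l)) (vmap f T)"
  by (induction T) auto

lemma concat_concat_map: "concat (concat xsss) = concat (map concat xsss)"
  by (induction xsss) auto

lemma sum_list_concat: "sum_list (concat xss) = (\<Sum>xs\<leftarrow>xss. sum_list xs)"
  by (induction xss) (auto simp: add.assoc)

lemma leaves_graft: "leaves (graft f T) = concat (map (\<lambda>l. leaves (f l)) (leaves T))"
  by (induction T) (auto simp: map_concat concat_concat_map o_def cong: map_cong)

lemma mset_concat_sum: "mset (concat xss) = (\<Sum>xs\<leftarrow>xss. mset xs)"
  by (induction xss) auto

lemma vertices_graft:
  "mset (vertices (graft f T)) = mset (vertices T) + (\<Sum>l\<leftarrow>leaves T. mset (vertices (f l)))"
proof (induction T)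
  case (Vertex v ts)
  have "(\<Sum>t\<leftarrow>ts. mset (vertices (graft f t))) =
      (\<Sum>t\<leftarrow>ts. mset (vertices t) + (\<Sum>l\<leftarrow>leaves t. mset (vertices (f l))))"
    using Vertex by (intro arg_cong[where f = sum_list] map_cong) auto
  then show ?case
    by (simp add: mset_concat_sum o_def sum_list_addf map_concat sum_list_concat)
qed simp

lemma sum_list_mset_cong:
  fixes f :: "'a \<Rightarrow> 'b::comm_monoid_add"
  assumes "mset xs = mset ys" shows "(\<Sum>x\<leftarrow>xs. f x) = (\<Sum>x\<leftarrow>ys. f x)"
proof -
  have "sum_mset (mset (map f xs)) = sum_mset (mset (map f ys))"
    by (simp only: mset_map assms)
  then show ?thesis by (simp only: sum_mset_sum_list)
qed

text \<open>Only multisets can be compared: the leaves of a substituted tree may stand in any planar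
  order and thereby permute the branches above the vertex.\<close>

lemma leaves_sub: "fits s T \<Longrightarrow> mset (leaves (sub s T)) = mset (leaves T)"
proof (induction T)
  case (Vertex v ts)
  let ?n = "length ts"
  let ?g = "\<lambda>k. mset (leaves (map (sub s) ts ! k))"
  have p: "mset (leaves (s v ?n)) = mset [0..<?n]"
    using Vertex.prems by (auto simp: fits_Vertex perms_iff)
  have "mset (leaves (sub s (Vertex v ts))) = (\<Sum>k\<leftarrow>leaves (s v ?n). ?g k)"
    by (simp add: leaves_graft mset_concat_sum o_def)
  also have "\<dots> = (\<Sum>k\<leftarrow>[0..<?n]. ?g k)"
    by (rule sum_list_mset_cong[OF p])
  also have "\<dots> = (\<Sum>t\<leftarrow>ts. mset (leaves t))"
  proof (rule arg_cong[where f = sum_list], rule nth_equalityI)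
    fix i assume "i < length (map ?g [0..<?n])"
    then show "map ?g [0..<?n] ! i = map (\<lambda>t. mset (leaves t)) ts ! i"
      using Vertex by (auto simp: fits_Vertex)
  qed simp
  finally show ?case by (simp add: mset_concat_sum o_def)
qed simp

lemma vertices_sub:
  "fits s T \<Longrightarrow> mset (vertices (sub s T)) = (\<Sum>(v, n)\<leftarrow>vertices T. mset (vertices (s v n)))"
proof (induction T)
  case (Vertex v ts)
  let ?n = "length ts"
  let ?g = "\<lambda>k. mset (vertices (map (sub s) ts ! k))"
  let ?h = "\<lambda>(v, n). mset (vertices (s v n))"
  have p: "mset (leaves (s v ?n)) = mset [0..<?n]"
    using Vertex.prems by (auto simp: fits_Vertex perms_iff)
  have "mset (vertices (sub s (Vertex v ts))) =
      mset (vertices (s v ?n)) + (\<Sum>k\<leftarrow>leaves (s v ?n). ?g k)"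
    by (simp add: vertices_graft)
  also have "(\<Sum>k\<leftarrow>leaves (s v ?n). ?g k) = (\<Sum>k\<leftarrow>[0..<?n]. ?g k)"
    by (rule sum_list_mset_cong[OF p])
  also have "\<dots> = (\<Sum>t\<leftarrow>ts. \<Sum>x\<leftarrow>vertices t. ?h x)"
  proof (rule arg_cong[where f = sum_list], rule nth_equalityI)
    fix i assume "i < length (map ?g [0..<?n])"
    then show "map ?g [0..<?n] ! i = map (\<lambda>t. \<Sum>x\<leftarrow>vertices t. ?h x) ts ! i"
      using Vertex by (auto simp: fits_Vertex)
  qed simp
  finally show ?case by (simp add: map_concat sum_list_concat o_def)
qed simp

lemma set_vertices_sub:
  assumes "fits s T"
  shows "set (vertices (sub s T)) = (\<Union>(v, n) \<in> set (vertices T). set (vertices (s v n)))"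
proof -
  have "set_mset (sum_list (map f xs)) = (\<Union>x \<in> set xs. set_mset (f x))" for f xs
    by (induction xs) auto
  then show ?thesis using vertices_sub[OF assms]
    by (metis (mono_tags, lifting) SUP_cong case_prod_beta set_mset_mset)
qed

lemma sub_cong:
  "(\<And>v n. (v, n) \<in> set (vertices T) \<Longrightarrow> s v n = s' v n) \<Longrightarrow> sub s T = sub s' T"
proof (induction T)
  case (Vertex v ts)
  then have "map (sub s) ts = map (sub s') ts" by auto
  moreover have "s v (length ts) = s' v (length ts)" using Vertex.prems by simp
  ultimately show ?case by (simp only: sub.simps)
qed simp

lemma leaves_lt: "fits s (Vertex v ts) \<Longrightarrow> l \<in> set (leaves (s v (length ts))) \<Longrightarrow> l < length ts"
  by (auto simp: fits_Vertex dest: perms_set)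

lemma sub_graft: "fits s T \<Longrightarrow> sub s (graft u T) = graft (\<lambda>l. sub s (u l)) (sub s T)"
proof (induction T)
  case (Vertex v ts)
  then show ?case
    by (auto simp: graft_graft fits_Vertex intro!: graft_cong dest!: leaves_lt[OF Vertex.prems])
qed simp

text \<open>Associativity of substitution. Since \<open>s'\<close> fits every substituted tree, leaf
  numbers stay below the arity of the vertex, and branch lists are only read inside their
  range.\<close>

lemma sub_sub:
  "fits s T \<Longrightarrow> (\<And>v n. (v, n) \<in> set (vertices T) \<Longrightarrow> fits s' (s v n)) \<Longrightarrow>
    sub s' (sub s T) = sub (\<lambda>v n. sub s' (s v n)) T"
proof (induction T)
  case (Vertex v ts)
  let ?n = "length ts"
  have f: "fits s' (s v ?n)" using Vertex.prems(2) by simp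
  have "mset (leaves (sub s' (s v ?n))) = mset [0..<?n]"
    using leaves_sub[OF f] Vertex.prems(1) by (simp add: fits_Vertex perms_iff)
  then have lt: "l < ?n" if "l \<in> set (leaves (sub s' (s v ?n)))" for l
    using that mset_eq_setD by fastforce
  have IH: "sub s' (sub s t) = sub (\<lambda>v n. sub s' (s v n)) t" if "t \<in> set ts" for t
    using Vertex that by (auto simp: fits_Vertex)
  show ?case
    using f IH by (auto simp: sub_graft intro!: graft_cong dest!: lt)
qed simp

lemma sub_cor_left [simp]: "sub cor T = T"
proof (induction T)
  case (Vertex v ts)
  then have "map (sub cor) ts = ts" by (simp add: map_idI)
  then show ?case by (simp only: sub.simps) (simp add: cor_def o_def map_nth)
qed simp

text \<open>The second unit law. Grafting looks the leaves of \<open>s v n\<close> up in a list of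
  length \<open>n\<close>, whence the condition on them.\<close>

lemma sub_cor:
  assumes "leaves (s v n) \<in> perms n" shows "sub s (cor v n) = s v n"
proof -
  have "graft ((!) (map (\<lambda>l. Leaf l) [0..<n])) (s v n) = graft Leaf (s v n)"
  proof (rule graft_cong)
    fix l assume "l \<in> set (leaves (s v n))"
    then have "l < n" using perms_set[OF assms] by blast
    then show "map (\<lambda>l. Leaf l) [0..<n] ! l = Leaf l" by simp
  qed
  then show ?thesis by (simp add: cor_def o_def)
qed

lemma leaves_cor [simp]: "leaves (cor v n) = [0..<n]"
  and vertices_cor [simp]: "vertices (cor v n) = [(v, n)]"
  and vmap_cor [simp]: "vmap f (cor v n) = cor (f v) n"
  by (simp_all add: cor_def o_def)

lemma cor_neq_Leaf [simp]: "cor v n \<noteq> Leaf l" "Leaf l \<noteq> cor v n"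
  by (simp_all add: cor_def)

lemma fits_cor_left [simp]: "fits cor T"
  by (auto simp: fits_def)

lemma vmap_sub: "fits s T \<Longrightarrow> vmap f (sub s T) = sub (\<lambda>v n. vmap f (s v n)) T"
proof (induction T)
  case (Vertex v ts)
  then show ?case
    by (auto simp: vmap_graft fits_Vertex intro!: graft_cong dest!: leaves_lt[OF Vertex.prems])
qed simp

lemma sub_vmap: "sub s (vmap f T) = sub (\<lambda>v n. s (f v) n) T"
  by (induction T) (simp_all add: o_def cong: map_cong)

lemma fits_vmap_iff: "fits s (vmap f T) \<longleftrightarrow> fits (\<lambda>v n. s (f v) n) T"
  by (auto simp: fits_def vertices_map_tree)

lemma fits_vmap_range [simp]: "fits (\<lambda>v n. vmap (f v n) (s v n)) T \<longleftrightarrow> fits s T"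
  by (auto simp: fits_def)

section \<open>The operad of trees\<close>

lemma sOp_Ops: "T \<in> Ops sOp \<longleftrightarrow>
    vlabels T \<in> perms (length (vertices T)) \<and> leaves T \<in> perms (length (leaves T))"
  by (simp add: sOp_def)

lemma sOp_Ops_leaves: "T \<in> Ops sOp \<Longrightarrow> leaves T \<in> perms (length (leaves T))"
  and sOp_Ops_vlabels: "T \<in> Ops sOp \<Longrightarrow> vlabels T \<in> perms (length (vertices T))"
  by (simp_all add: sOp_Ops)

lemma sOp_simps [simp]:
  "Col sOp = UNIV" "out sOp T = length (leaves T)" "ident sOp n = cor 0 n"
  "act sOp T L = vmap ((!) L) T" "arity sOp T = length (vertices T)"
  by (simp_all add: sOp_def cor_def arity_def)

lemma cor_Ops [simp]: "cor 0 n \<in> Ops sOp"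
  by (simp add: sOp_Ops perms_iff)

lemma Leaf_Ops [simp]: "Leaf l \<in> Ops sOp \<longleftrightarrow> l = 0"
  by (auto simp: sOp_Ops perms_iff)

lemma sOp_inp_length [simp]: "length (inp sOp T) = length (vertices T)"
  by (simp add: sOp_def)

lemma sOp_inp_nth:
  assumes "T \<in> Ops sOp" "(v, n) \<in> set (vertices T)"
  shows "inp sOp T ! v = n" "v < length (vertices T)"
proof -
  have d: "vlabels T \<in> perms (length (vertices T))" using assms sOp_Ops_vlabels by blast
  have "v \<in> set (vlabels T)" using assms(2) by force
  then show v: "v < length (vertices T)" using perms_set[OF d] by auto
  have "map_of (vertices T) v = Some n"
    using perms_distinct[OF d] assms(2) by simp
  with v show "inp sOp T ! v = n" by (simp add: sOp_def)
qed

lemma sOp_vertex: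
  assumes "T \<in> Ops sOp" "v < length (vertices T)"
  shows "(v, inp sOp T ! v) \<in> set (vertices T)"
proof -
  have "v \<in> set (vlabels T)" using perms_set[OF sOp_Ops_vlabels[OF assms(1)]] assms(2) by auto
  then obtain n where "(v, n) \<in> set (vertices T)" by auto
  then show ?thesis using sOp_inp_nth[OF assms(1)] by metis
qed

lemma inp_cor [simp]: "inp sOp (cor 0 n) = [n]"
  by (simp add: sOp_def)

lemma inp_Leaf [simp]: "inp sOp (Leaf l) = []"
  by (simp add: sOp_def)

text \<open>The profile equation only counts leaves. As the leaves of an operation are numbered
  bijectively, the count already says that they match the inputs of the vertex.\<close>

lemma sOp_composable:
  "composable sOp T Ss \<longleftrightarrow> T \<in> Ops sOp \<and> length Ss = length (vertices T) \<and>
    (\<forall>j < length (vertices T). Ss ! j \<in> Ops sOp \<and> leaves (Ss ! j) \<in> perms (inp sOp T ! j))"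
  (is "?L \<longleftrightarrow> ?R")
proof
  assume ?L
  then have "length Ss = length (vertices T)"
    by (metis composable_def length_map sOp_inp_length)
  moreover have "leaves (Ss ! j) \<in> perms (inp sOp T ! j)" if "j < length Ss" for j
  proof -
    have "inp sOp T ! j = length (leaves (Ss ! j))" "Ss ! j \<in> Ops sOp"
      using \<open>?L\<close> that unfolding composable_def by (metis nth_map sOp_simps(2), auto)
    then show ?thesis using sOp_Ops_leaves by auto
  qed
  ultimately show ?R using \<open>?L\<close> by (auto simp: composable_def)
next
  assume R: ?R
  then have "map (out sOp) Ss = inp sOp T"
    by (intro nth_equalityI) (auto dest: perms_length)
  then show ?L using R by (auto simp: composable_def in_set_conv_nth)
qed

lemma sOp_fits:
  assumes "composable sOp T Ss" shows "fits (\<lambda>j n. vmap (f j) (Ss ! j)) T"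
proof -
  have "leaves (Ss ! v) \<in> perms n" if "(v, n) \<in> set (vertices T)" for v n
    using assms sOp_inp_nth[OF _ that] unfolding sOp_composable by blast
  then show ?thesis by (auto simp: fits_def)
qed

lemma sOp_comp:
  assumes "composable sOp T Ss"
  shows "comp sOp T Ss =
    sub (\<lambda>j n. vmap (\<lambda>v. block_start (map (length \<circ> vertices) Ss) j + v) (Ss ! j)) T"
  by (simp add: sOp_def substitute_sub)

lemma block_start_0 [simp]: "block_start ns 0 = 0"
  by (simp add: block_start_def)

lemma block_start_Cons_Suc [simp]: "block_start (n # ns) (Suc i) = n + block_start ns i"
  by (simp add: block_start_def)

lemma block_start_append:
  "i \<le> length ns \<Longrightarrow> block_start (ns @ ms) i = block_start ns i"
  by (simp add: block_start_def)

text \<open>The index arithmetic behind all blockwise numberings: composites in \<open>sOp\<close>,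
  block permutations and concatenated label lists.\<close>

lemma concat_nth_block:
  "i < length xss \<Longrightarrow> k < length (xss ! i) \<Longrightarrow>
    block_start (map length xss) i + k < length (concat xss) \<and>
    concat xss ! (block_start (map length xss) i + k) = xss ! i ! k"
proof (induction xss arbitrary: i)
  case (Cons xs xss)
  show ?case
  proof (cases i)
    case (Suc j)
    then show ?thesis using Cons.IH[of j] Cons.prems by (auto simp: nth_append add.assoc)
  qed (use Cons.prems in \<open>auto simp: nth_append\<close>)
qed simp

lemma block_start_replicate: "i \<le> m \<Longrightarrow> block_start (replicate m 1) i = i"
  by (simp add: block_start_def min_def sum_list_replicate)

text \<open>Lets sums over the vertices in planar order be rewritten as sums over their
  numbers.\<close>

lemma sOp_mset_vertices:
  assumes "T \<in> Ops sOp"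
  shows "mset (vertices T) = mset (map (\<lambda>v. (v, inp sOp T ! v)) [0..<length (vertices T)])"
proof -
  have d: "distinct (vertices T)"
    using perms_distinct[OF sOp_Ops_vlabels[OF assms]] by (simp add: distinct_map)
  have e: "set (vertices T) = set (map (\<lambda>v. (v, inp sOp T ! v)) [0..<length (vertices T)])"
    using sOp_inp_nth[OF assms] sOp_vertex[OF assms] by force
  have d': "distinct (map (\<lambda>v. (v, inp sOp T ! v)) [0..<length (vertices T)])"
    by (simp add: distinct_map inj_on_def)
  show ?thesis using set_eq_iff_mset_eq_distinct[OF d d'] e by blast
qed

lemma sum_list_vertices:
  fixes F :: "nat \<Rightarrow> nat \<Rightarrow> 'b::comm_monoid_add"
  assumes "T \<in> Ops sOp"
  shows "(\<Sum>(v, n)\<leftarrow>vertices T. F v n) = (\<Sum>v\<leftarrow>[0..<length (vertices T)]. F v (inp sOp T ! v))"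
  using sum_list_mset_cong[OF sOp_mset_vertices[OF assms], of "\<lambda>(v, n). F v n"]
  by (simp add: o_def)

lemma vlabels_sub:
  assumes "fits s T"
  shows "mset (vlabels (sub s T)) = (\<Sum>(v, n)\<leftarrow>vertices T. mset (vlabels (s v n)))"
proof -
  have "image_mset fst (sum_list (map f xs)) = (\<Sum>x\<leftarrow>xs. image_mset fst (f x))" for f xs
    by (induction xs) auto
  then show ?thesis
    using arg_cong[OF vertices_sub[OF assms], of "image_mset fst"]
    by (simp add: case_prod_unfold)
qed

text \<open>The shifted blocks tile an interval. This is the reason why composites in
  \<open>sOp\<close>, block sums and block permutations are numbered bijectively.\<close>

lemma concat_blocks:
  "concat (map (\<lambda>i. map ((+) (block_start ns i)) [0..<ns ! i]) [0..<length ns]) = [0..<sum_list ns]"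
proof (induction ns rule: rev_induct)
  case (snoc n ns)
  have a: "block_start (ns @ [n]) i = block_start ns i" if "i < length ns" for i
    using that by (simp add: block_start_append)
  have b: "block_start (ns @ [n]) (length ns) = sum_list ns"
    by (simp add: block_start_def)
  have c: "map (\<lambda>i. map ((+) (block_start (ns @ [n]) i)) [0..<(ns @ [n]) ! i]) [0..<length ns] =
      map (\<lambda>i. map ((+) (block_start ns i)) [0..<ns ! i]) [0..<length ns]"
    using a by (intro map_cong) (auto simp: nth_append)
  have d: "map ((+) (sum_list ns)) [0..<n] = [sum_list ns..<sum_list ns + n]"
    by (rule nth_equalityI) auto
  have "[0..<sum_list (ns @ [n])] = [0..<sum_list ns] @ [sum_list ns..<sum_list ns + n]"
    using upt_add_eq_append[of 0 "sum_list ns" n] by simp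
  then show ?case unfolding length_append_singleton upt_Suc_append[OF le0] map_append
      concat_append c snoc by (simp add: b d)
qed simp

text \<open>Counting suffices: the vertices of each substituted tree fill one block of numbers, the
  blocks tile an interval, and substitution preserves the multiset of leaves.\<close>

lemma sOp_comp_Ops:
  assumes "composable sOp T Ss"
  shows "comp sOp T Ss \<in> Ops sOp"
    and "length (vertices (comp sOp T Ss)) = sum_list (map (length \<circ> vertices) Ss)"
    and "mset (leaves (comp sOp T Ss)) = mset (leaves T)"
proof -
  let ?ns = "map (length \<circ> vertices) Ss" and ?m = "length (vertices T)"
  let ?s = "\<lambda>j n::nat. vmap (\<lambda>v. block_start ?ns j + v) (Ss ! j)"
  have T: "T \<in> Ops sOp" and l: "length Ss = ?m"
    and S: "\<And>j. j < ?m \<Longrightarrow> Ss ! j \<in> Ops sOp"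
    using assms by (auto simp: sOp_composable)
  have fits: "fits ?s T" by (rule sOp_fits[OF assms])
  have "mset (vlabels (comp sOp T Ss)) = (\<Sum>(v, n)\<leftarrow>vertices T. mset (vlabels (?s v n)))"
    unfolding sOp_comp[OF assms] by (rule vlabels_sub[OF fits])
  also have "\<dots> = (\<Sum>v\<leftarrow>[0..<?m]. mset (vlabels (?s v (inp sOp T ! v))))"
    by (rule sum_list_vertices[OF T])
  also have "\<dots> = (\<Sum>v\<leftarrow>[0..<?m]. mset (map ((+) (block_start ?ns v)) [0..<?ns ! v]))"
  proof (rule arg_cong[where f = sum_list], rule map_cong)
    fix v assume "v \<in> set [0..<?m]"
    then have v: "v < ?m" by simp
    have "mset (vlabels (Ss ! v)) = mset [0..<?ns ! v]"
      using sOp_Ops_vlabels[OF S[OF v]] v l by (simp only: perms_iff) simp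
    then have "image_mset ((+) (block_start ?ns v)) (mset (vlabels (Ss ! v))) =
        image_mset ((+) (block_start ?ns v)) (mset [0..<?ns ! v])" by simp
    then show "mset (vlabels (?s v (inp sOp T ! v))) =
        mset (map ((+) (block_start ?ns v)) [0..<?ns ! v])"
      by (simp only: vlabels_vmap mset_map)
  qed simp
  also have "\<dots> = mset (concat (map (\<lambda>v. map ((+) (block_start ?ns v)) [0..<?ns ! v]) [0..<?m]))"
    by (simp add: mset_concat_sum o_def)
  also have "\<dots> = mset [0..<sum_list ?ns]"
    using concat_blocks[of ?ns] l by simp
  finally have v: "mset (vlabels (comp sOp T Ss)) = mset [0..<sum_list ?ns]" .
  then have "vlabels (comp sOp T Ss) \<in> perms (sum_list ?ns)" by (simp only: perms_iff)
  moreover from perms_length[OF this]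
  show len: "length (vertices (comp sOp T Ss)) = sum_list ?ns" by simp
  moreover show lv: "mset (leaves (comp sOp T Ss)) = mset (leaves T)"
    unfolding sOp_comp[OF assms] by (rule leaves_sub[OF fits])
  ultimately show "comp sOp T Ss \<in> Ops sOp"
    using sOp_Ops_leaves[OF T] mset_eq_length[OF lv] unfolding sOp_Ops perms_iff by simp
qed

lemma map_nth_perm:
  assumes "L \<in> perms n" "xs \<in> perms n" shows "map ((!) L) xs \<in> perms n"
proof -
  have "mset (map ((!) L) xs) = image_mset ((!) L) (mset [0..<length L])"
    using assms(2) perms_length[OF assms(1)] by (simp add: perms_iff)
  also have "\<dots> = mset L" by (metis map_nth mset_map)
  finally show ?thesis using assms(1) by (simp add: perms_iff)
qed

lemma sOp_act_Ops:
  assumes "T \<in> Ops sOp" "L \<in> perms (length (vertices T))" shows "vmap ((!) L) T \<in> Ops sOp"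
  using assms map_nth_perm[OF assms(2) sOp_Ops_vlabels[OF assms(1)]] by (simp add: sOp_Ops)

section \<open>Sorting labels\<close>

text \<open>The function behind \<open>ranks\<close>: the position of a label in the sorted list. In
  this form it can be used to relabel the vertices of a tree.\<close>

definition rank :: "nat list \<Rightarrow> nat \<Rightarrow> nat" where
  "rank ls l = length (filter (\<lambda>l'. l' < l) ls)"

lemma ranks_rank: "ranks ls = map (rank ls) ls"
  by (simp add: ranks_def rank_def)

lemma rank_sort: "rank (sort ls) l = rank ls l"
  unfolding rank_def by (metis mset_filter mset_sort size_mset)

lemma rank_sorted:
  assumes "sorted_wrt (<) ss" "j < length ss" shows "rank ss (ss ! j) = j"
proof -
  have "filter (\<lambda>y. y < ss ! j) (take j ss) = take j ss"
    using assms sorted_wrt_nth_less[OF assms(1)] by (auto simp: filter_id_conv in_set_conv_nth)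
  moreover have "filter (\<lambda>y. y < ss ! j) (drop j ss) = []"
  proof -
    have "\<not> y < ss ! j" if "y \<in> set (drop j ss)" for y
    proof -
      from that obtain k where "k < length (drop j ss)" "y = drop j ss ! k"
        by (metis in_set_conv_nth)
      then have k: "j + k < length ss" "y = ss ! (j + k)" using assms(2) by auto
      then show ?thesis using sorted_wrt_nth_less[OF assms(1), of j "j + k"]
        by (cases k) auto
    qed
    then show ?thesis by (simp add: filter_empty_conv)
  qed
  ultimately have "filter (\<lambda>y. y < ss ! j) ss = take j ss"
    by (metis append_Nil2 append_take_drop_id filter_append)
  then show ?thesis using assms(2) by (simp add: rank_def)
qed

lemma sort_strict: "distinct ls \<Longrightarrow> sorted_wrt (<) (sort (ls :: nat list))"
  by (simp add: strict_sorted_iff)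

lemma sort_nth_rank:
  assumes "distinct ls" "l \<in> set ls"
  shows "rank ls l < length ls" "sort ls ! rank ls l = l"
proof -
  obtain j where j: "j < length (sort ls)" "sort ls ! j = l"
    using assms(2) by (metis in_set_conv_nth set_sort)
  then have "rank ls l = j"
    using rank_sorted[OF sort_strict[OF assms(1)] j(1)] by (simp add: rank_sort)
  then show "rank ls l < length ls" "sort ls ! rank ls l = l" using j by auto
qed

lemma rank_perms:
  assumes "distinct ls" shows "map (rank ls) ls \<in> perms (length ls)"
proof -
  have "inj_on (rank ls) (set ls)"
    using sort_nth_rank(2)[OF assms] by (metis inj_onI)
  then have "distinct (map (rank ls) ls)" using assms by (simp add: distinct_map)
  moreover have "set (map (rank ls) ls) = {..<length ls}"
  proof (rule card_subset_eq)
    show "set (map (rank ls) ls) \<subseteq> {..<length ls}" using sort_nth_rank(1)[OF assms] by auto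
    show "card (set (map (rank ls) ls)) = card {..<length ls}"
      using distinct_card[OF \<open>distinct (map (rank ls) ls)\<close>] by simp
  qed simp
  ultimately show ?thesis using permutations_of_setI by blast
qed

section \<open>Labelled form of the twisted arrow category\<close>

text \<open>A morphism is described by its upper trees, whose vertices carry their labels, and
  its lower tree, whose first vertex is labelled \<^const>\<open>None\<close>. The ordering conditions on labels
  say that nothing is lost, and composition becomes substitution of trees.\<close>

definition uppL :: "(nat, nat) tree tw_mor \<Rightarrow> nat \<Rightarrow> (nat, nat) tree" where
  "uppL f i = vmap ((!) (upp_labels f ! i)) (upp f ! i)"

text \<open>\<open>low_labels\<close> omits the first input of the lower operation, so vertex
  \<open>Suc k\<close> takes the label at position \<open>k\<close> and vertex 0 becomes the marked
  one.\<close>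

definition lname :: "nat list \<Rightarrow> nat \<Rightarrow> nat option" where
  "lname ls j = (case j of 0 \<Rightarrow> None | Suc k \<Rightarrow> Some (ls ! k))"

lemma lname_simps [simp]: "lname ls 0 = None" "lname ls (Suc k) = Some (ls ! k)"
  by (simp_all add: lname_def)

definition lowL :: "(nat, nat) tree tw_mor \<Rightarrow> (nat option, nat) tree" where
  "lowL f = vmap (lname (low_labels f)) (low f)"

definition plugs :: "(nat \<Rightarrow> nat \<Rightarrow> ('w, nat) tree) \<Rightarrow> ('w, nat) tree \<Rightarrow> nat option \<Rightarrow> nat \<Rightarrow> ('w, nat) tree"
  where "plugs s z a n = (case a of None \<Rightarrow> z | Some j \<Rightarrow> s j n)"

lemma plugs_simps [simp]: "plugs s z None n = z" "plugs s z (Some j) n = s j n"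
  by (simp_all add: plugs_def)

text \<open>If \<open>z\<close> is the source with the upper trees substituted into it, this is the
  target of the morphism: \<open>z\<close> fills the marked vertex, and the other vertices of the
  lower tree keep their labels.\<close>

definition plug :: "(nat, nat) tree \<Rightarrow> (nat option, 'l) tree \<Rightarrow> (nat, 'l) tree" where
  "plug z lo = sub (plugs cor z) lo"

text \<open>The part of validity that does not mention colours. It is what is needed to recover a
  tuple from its labelled trees.\<close>

definition mor_ok :: "nat \<Rightarrow> (nat, nat) tree tw_mor \<Rightarrow> bool" where
  "mor_ok m f \<longleftrightarrow> length (upp f) = m \<and> length (upp_labels f) = m \<and>
    (\<forall>i < m. upp f ! i \<in> Ops sOp \<and> length (upp_labels f ! i) = length (vertices (upp f ! i)) \<and>
      sorted_wrt (<) (upp_labels f ! i)) \<and>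
    low f \<in> Ops sOp \<and> length (vertices (low f)) = Suc (length (low_labels f)) \<and>
    sorted_wrt (<) (low_labels f)"

text \<open>The labels occurring in the tree form a set, and an increasing list is determined by its
  set of entries. With the list known, \<open>rank\<close> turns labels back into vertex
  numbers.\<close>

lemma vmap_nth_eqD:
  fixes ls ls' :: "nat list"
  assumes "T \<in> Ops sOp" "T' \<in> Ops sOp" "length ls = length (vertices T)"
    "length ls' = length (vertices T')" "sorted_wrt (<) ls" "sorted_wrt (<) ls'"
    "vmap ((!) ls) T = vmap ((!) ls') T'"
  shows "T = T' \<and> ls = ls'"
proof -
  have s: "set (map ((!) ks) (vlabels S)) = set ks"
    if "S \<in> Ops sOp" "length ks = length (vertices S)" for S ks
  proof -
    have "set (map ((!) ks) (vlabels S)) = (!) ks ` {..<length ks}"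
      unfolding set_map[of "(!) ks"] perms_set[OF sOp_Ops_vlabels[OF that(1)]] that(2) ..
    also have "\<dots> = set ks" by (auto simp: set_conv_nth)
    finally show ?thesis .
  qed
  have "map ((!) ls) (vlabels T) = map ((!) ls') (vlabels T')"
    using arg_cong[OF assms(7), of vlabels] by (simp only: vlabels_vmap)
  then have "set ls = set ls'" using s[OF assms(1,3)] s[OF assms(2,4)] by argo
  then have e: "ls = ls'" using assms(5,6) unfolding strict_sorted_iff by (intro sorted_distinct_set_unique) simp_all
  have r: "T = vmap (rank ls) (vmap ((!) ls) T)"
    if "T \<in> Ops sOp" "length ls = length (vertices T)" for T
  proof -
    have "vmap (rank ls) (vmap ((!) ls) T) = vmap (\<lambda>v. v) T"
      unfolding vmap_vmap
    proof (rule vmap_cong)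
      fix v assume "v \<in> set (vlabels T)"
      then have "v < length ls"
        unfolding perms_set[OF sOp_Ops_vlabels[OF that(1)]] that(2) by simp
      then show "rank ls (ls ! v) = v" by (rule rank_sorted[OF assms(5)])
    qed
    then show ?thesis by simp
  qed
  have "T = T'" using r[OF assms(1,3)] r[OF assms(2)] assms(4,7) e by simp
  with e show ?thesis by simp
qed

lemma mor_ext:
  assumes "mor_ok m f" "mor_ok m f'" "\<And>i. i < m \<Longrightarrow> uppL f i = uppL f' i" "lowL f = lowL f'"
  shows "f = f'"
proof -
  have "upp f ! i = upp f' ! i \<and> upp_labels f ! i = upp_labels f' ! i" if "i < m" for i
    using vmap_nth_eqD assms(1,2) assms(3)[OF that] that unfolding mor_ok_def uppL_def by metis
  then have u: "upp f = upp f'" "upp_labels f = upp_labels f'"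
    using assms(1,2) by (auto simp: mor_ok_def intro!: nth_equalityI)
  \<comment> \<open>Sending the mark to 0 and shifting all other labels by one turns the lower tree
    into a tree with an increasing list of natural labels, so that \<open>vmap_nth_eqD\<close>
    applies to it as well.\<close>
  let ?g = "\<lambda>a. case a of None \<Rightarrow> 0 | Some j \<Rightarrow> Suc j"
  have c: "vmap ?g (lowL f) = vmap ((!) (0 # map Suc (low_labels f))) (low f)" if "mor_ok m f" for f
  proof -
    have "\<And>v. v \<in> set (vlabels (low f)) \<Longrightarrow> v < Suc (length (low_labels f))"
      using that perms_set[OF sOp_Ops_vlabels, of "low f"] unfolding mor_ok_def
      by (metis lessThan_iff)
    then show ?thesis unfolding lowL_def vmap_vmap
      by (intro vmap_cong) (fastforce simp: lname_def nth_Cons split: nat.splits)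
  qed
  have "low f = low f' \<and> 0 # map Suc (low_labels f) = 0 # map Suc (low_labels f')"
    using vmap_nth_eqD[of "low f" "low f'" "0 # map Suc (low_labels f)" "0 # map Suc (low_labels f')"]
      c[OF assms(1)] c[OF assms(2)] assms(1,2,4)
    unfolding mor_ok_def by (simp add: sorted_wrt_map)
  then have "low f = low f'" "low_labels f = low_labels f'"
    by (simp_all add: inj_map_eq_map)
  with u show ?thesis by simp
qed

lemma tw_validD:
  assumes "tw_valid sOp p f"
  shows "composable sOp p (upp f)" "p \<in> Ops sOp" "length (upp f) = length (vertices p)"
    "length (upp_labels f) = length (vertices p)" "mor_ok (length (vertices p)) f"
    "(0, length (leaves p)) \<in> set (vertices (low f))" "inp sOp (low f) ! 0 = length (leaves p)"
    "distinct (concat (upp_labels f))" "distinct (low_labels f)"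
    "set (concat (upp_labels f)) \<inter> set (low_labels f) = {}"
    "\<And>i. i < length (vertices p) \<Longrightarrow> leaves (uppL f i) \<in> perms (inp sOp p ! i)"
    "set (concat (upp_labels f)) \<union> set (low_labels f) = {..<length (tw_labels f)}"
proof -
  show c: "composable sOp p (upp f)" using assms by (simp add: tw_valid_def)
  then show p: "p \<in> Ops sOp" "length (upp f) = length (vertices p)" by (simp_all add: sOp_composable)
  have ul: "map length (upp_labels f) = map (arity sOp) (upp f)"
    using assms by (simp add: tw_valid_def)
  then show ll: "length (upp_labels f) = length (vertices p)" using p by (metis length_map)
  have "length (upp_labels f ! i) = length (vertices (upp f ! i))" if "i < length (vertices p)" for i
    using arg_cong[OF ul, of "\<lambda>xs. xs ! i"] that ll p by simp
  then show "mor_ok (length (vertices p)) f"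
    using assms p ll c by (auto simp: mor_ok_def tw_valid_def sOp_composable)
  have "length (vertices (low f)) = Suc (length (low_labels f))" "low f \<in> Ops sOp"
    using assms by (simp_all add: tw_valid_def)
  moreover show i: "inp sOp (low f) ! 0 = length (leaves p)"
    using assms hd_conv_nth[of "inp sOp (low f)"] by (simp add: tw_valid_def)
  ultimately show "(0, length (leaves p)) \<in> set (vertices (low f))"
    using sOp_vertex[of "low f" 0] by simp
  have t: "tw_labels f \<in> perms (length (tw_labels f))" using assms by (simp add: tw_valid_def)
  show "distinct (concat (upp_labels f))" "distinct (low_labels f)"
    "set (concat (upp_labels f)) \<inter> set (low_labels f) = {}"
    using perms_distinct[OF t] by (auto simp: tw_labels_def)
  show "leaves (uppL f i) \<in> perms (inp sOp p ! i)" if "i < length (vertices p)" for i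
    using that c by (simp add: uppL_def sOp_composable)
  show "set (concat (upp_labels f)) \<union> set (low_labels f) = {..<length (tw_labels f)}"
    using perms_set[OF t] by (simp add: tw_labels_def)
qed

lemma fits_uppL:
  assumes "p \<in> Ops sOp" "\<And>i. i < length (vertices p) \<Longrightarrow> leaves (U i) \<in> perms (inp sOp p ! i)"
  shows "fits (\<lambda>i n. U i) p"
proof -
  have "leaves (U v) \<in> perms n" if "(v, n) \<in> set (vertices p)" for v n
    using assms(2)[of v] sOp_inp_nth[OF assms(1) that] by metis
  then show ?thesis by (auto simp: fits_def)
qed

lemma compose_first_composable:
  assumes "q \<in> Ops sOp" "C \<in> Ops sOp" "vertices q \<noteq> []" "leaves C \<in> perms (inp sOp q ! 0)"
  shows "composable sOp q (C # map (ident sOp) (tl (inp sOp q)))"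
  using assms by (auto simp: sOp_composable nth_Cons nth_tl split: nat.splits)

text \<open>The identities in the remaining inputs are blocks of size one, so vertex
  \<open>Suc k\<close> of \<open>q\<close> moves to position \<open>k\<close> behind the vertices of
  \<open>C\<close>.\<close>

lemma compose_first_sub:
  assumes "q \<in> Ops sOp" "C \<in> Ops sOp" "vertices q \<noteq> []" "leaves C \<in> perms (inp sOp q ! 0)"
  shows "compose_first sOp q C =
    sub (\<lambda>j n. case j of 0 \<Rightarrow> C | Suc k \<Rightarrow> cor (length (vertices C) + k) n) q"
proof -
  let ?Cs = "C # map (ident sOp) (tl (inp sOp q))"
  have c: "composable sOp q ?Cs" by (rule compose_first_composable[OF assms])
  have e: "map (length \<circ> vertices) (map (ident sOp) (tl (inp sOp q))) =
      replicate (length (vertices q) - 1) 1"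
    by (rule nth_equalityI) auto
  show ?thesis
    unfolding compose_first_def sOp_comp[OF c]
  proof (rule sub_cong)
    fix v n assume v: "(v, n) \<in> set (vertices q)"
    then have v': "inp sOp q ! v = n" "v < length (vertices q)"
      using sOp_inp_nth[OF assms(1)] by auto
    show "vmap ((+) (block_start (map (length \<circ> vertices) ?Cs) v)) (?Cs ! v) =
        (case v of 0 \<Rightarrow> C | Suc k \<Rightarrow> cor (length (vertices C) + k) n)"
    proof (cases v)
      case (Suc k)
      then have "block_start (replicate (length (vertices q) - 1) 1) k = k"
        using v' by (intro block_start_replicate) auto
      then show ?thesis using v' Suc e by (simp add: nth_tl del: sum_list_replicate)
    qed simp
  qed
qed

text \<open>\<open>tw_labels\<close> lists the labels of the upper trees block by block and then
  those of the lower tree. The vertices of the composite are numbered in the same order, so the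
  action puts every label on its own vertex.\<close>

lemma tw_target_plug:
  assumes "tw_valid sOp p f"
  shows "tw_target sOp p f = plug (sub (\<lambda>i n. uppL f i) p) (lowL f)"
proof -
  note v = tw_validD[OF assms]
  let ?ns = "map (length \<circ> vertices) (upp f)" and ?C = "comp sOp p (upp f)"
  let ?w = "tw_labels f"
  have ok: "i < length (vertices p) \<Longrightarrow> length (upp_labels f ! i) = length (vertices (upp f ! i))"
    "low f \<in> Ops sOp" "length (vertices (low f)) = Suc (length (low_labels f))" for i
    using v(5) by (auto simp: mor_ok_def)
  have ns: "?ns = map length (upp_labels f)"
    using v(3,4) ok(1) by (intro nth_equalityI) auto
  have len: "length (vertices ?C) = length (concat (upp_labels f))"
    using sOp_comp_Ops(2)[OF v(1)] unfolding ns by (simp add: length_concat)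
  have C: "?C \<in> Ops sOp" by (rule sOp_comp_Ops(1)[OF v(1)])
  have lC: "leaves ?C \<in> perms (inp sOp (low f) ! 0)"
    using sOp_comp_Ops(3)[OF v(1)] sOp_Ops_leaves[OF v(2)] v(7) unfolding perms_iff by simp
  have ne: "vertices (low f) \<noteq> []" using ok(3) by auto
  have lab: "vmap ((!) ?w) ?C = sub (\<lambda>i n. uppL f i) p"
    unfolding sOp_comp[OF v(1)] vmap_sub[OF sOp_fits[OF v(1)]] vmap_vmap
  proof (rule sub_cong)
    fix i n assume "(i, n) \<in> set (vertices p)"
    then have i: "i < length (vertices p)" using sOp_inp_nth[OF v(2)] by auto
    have u: "upp f ! i \<in> Ops sOp" using v(5) i by (auto simp: mor_ok_def)
    show "vmap (\<lambda>k. ?w ! (block_start ?ns i + k)) (upp f ! i) = uppL f i"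
      unfolding uppL_def
    proof (rule vmap_cong)
      fix k assume "k \<in> set (vlabels (upp f ! i))"
      then have "k < length (upp_labels f ! i)"
        using perms_set[OF sOp_Ops_vlabels[OF u]] ok(1)[OF i] by auto
      then show "?w ! (block_start ?ns i + k) = upp_labels f ! i ! k"
        using concat_nth_block[of i "upp_labels f" k] i v(4) unfolding ns tw_labels_def
        by (auto simp: nth_append)
    qed
  qed
  have fits: "fits (\<lambda>j n. case j of 0 \<Rightarrow> ?C | Suc k \<Rightarrow> cor (length (vertices ?C) + k) n) (low f)"
    using sOp_inp_nth[OF ok(2)] lC by (fastforce simp: fits_def split: nat.splits)
  have "tw_target sOp p f = vmap ((!) ?w)
      (sub (\<lambda>j n. case j of 0 \<Rightarrow> ?C | Suc k \<Rightarrow> cor (length (vertices ?C) + k) n) (low f))"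
    by (simp add: tw_target_def compose_first_sub[OF ok(2) C ne lC])
  also have "\<dots> = sub (\<lambda>j n. plugs cor (sub (\<lambda>i n. uppL f i) p) (lname (low_labels f) j) n) (low f)"
    unfolding vmap_sub[OF fits]
  proof (rule sub_cong)
    fix j n assume "(j, n) \<in> set (vertices (low f))"
    then have j: "j < Suc (length (low_labels f))" using sOp_inp_nth[OF ok(2)] ok(3) by fastforce
    show "vmap ((!) ?w) (case j of 0 \<Rightarrow> ?C | Suc k \<Rightarrow> cor (length (vertices ?C) + k) n) =
        plugs cor (sub (\<lambda>i n. uppL f i) p) (lname (low_labels f) j) n"
      using lab len by (cases j) (simp_all add: tw_labels_def nth_append)
  qed
  finally show ?thesis by (simp add: plug_def lowL_def sub_vmap)
qed

text \<open>The labels of the upper trees are left free: as \<open>t\<close> is an operation, they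
  are automatically distinct from each other and from those of \<open>lo\<close>. Distinctness in
  \<open>lo\<close> itself makes the marked vertex unique.\<close>

definition lhom :: "(nat, nat) tree \<Rightarrow> (nat, nat) tree \<Rightarrow> (nat \<Rightarrow> (nat, nat) tree) \<Rightarrow>
    (nat option, nat) tree \<Rightarrow> bool" where
  "lhom p t U lo \<longleftrightarrow> p \<in> Ops sOp \<and> t \<in> Ops sOp \<and>
    (\<forall>i < length (vertices p). leaves (U i) \<in> perms (inp sOp p ! i)) \<and>
    distinct (vlabels lo) \<and> (None, length (leaves p)) \<in> set (vertices lo) \<and>
    t = plug (sub (\<lambda>i n. U i) p) lo"

lemma distinct_vlabelsD:
  "distinct (vlabels T) \<Longrightarrow> (v, n) \<in> set (vertices T) \<Longrightarrow> (v, n') \<in> set (vertices T) \<Longrightarrow> n = n'"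
  using eq_key_imp_eq_value by fastforce

lemma lhomD:
  assumes "lhom p t U lo"
  shows "p \<in> Ops sOp" "t \<in> Ops sOp" "fits (\<lambda>i n. U i) p"
    "leaves (sub (\<lambda>i n. U i) p) \<in> perms (length (leaves p))"
    "fits (plugs cor (sub (\<lambda>i n. U i) p)) lo"
    "distinct (vlabels lo)" "(None, length (leaves p)) \<in> set (vertices lo)"
    "t = plug (sub (\<lambda>i n. U i) p) lo" "mset (leaves lo) = mset (leaves t)"
    "\<And>i. i < length (vertices p) \<Longrightarrow> leaves (U i) \<in> perms (inp sOp p ! i)"
proof -
  show p: "p \<in> Ops sOp" "t \<in> Ops sOp" and d: "distinct (vlabels lo)"
    and N: "(None, length (leaves p)) \<in> set (vertices lo)"
    and t: "t = plug (sub (\<lambda>i n. U i) p) lo"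
    and U: "\<And>i. i < length (vertices p) \<Longrightarrow> leaves (U i) \<in> perms (inp sOp p ! i)"
    using assms by (auto simp: lhom_def)
  show f: "fits (\<lambda>i n. U i) p" by (rule fits_uppL[OF p(1) U])
  show l: "leaves (sub (\<lambda>i n. U i) p) \<in> perms (length (leaves p))"
    using leaves_sub[OF f] sOp_Ops_leaves[OF p(1)] by (simp add: perms_iff)
  show f': "fits (plugs cor (sub (\<lambda>i n. U i) p)) lo"
    using l distinct_vlabelsD[OF d N] by (auto simp: fits_def plugs_def split: option.splits)
  show "mset (leaves lo) = mset (leaves t)"
    using leaves_sub[OF f'] t by (simp add: plug_def)
qed

lemma sum_list_Nones:
  assumes "distinct (vlabels lo)" "(None, k) \<in> set (vertices lo)"
  shows "(\<Sum>(a, n)\<leftarrow>vertices lo. mset (vlabels (plugs cor z a n))) =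
    mset (vlabels z) + mset (map the (filter (\<lambda>a. a \<noteq> None) (vlabels lo)))"
proof -
  have g: "(\<Sum>(a, n)\<leftarrow>xs. mset (vlabels (plugs cor z a n))) =
      (if None \<in> set (map fst xs) then mset (vlabels z) else {#}) +
      mset (map the (filter (\<lambda>a. a \<noteq> None) (map fst xs)))"
    if "distinct (map fst xs)" for xs :: "(nat option \<times> nat) list"
    using that by (induction xs) (auto simp: plugs_def image_iff split: option.splits)
  have "None \<in> set (vlabels lo)" using assms(2) by force
  then show ?thesis using g[OF assms(1)] by simp
qed

text \<open>This recovers the bijection \<lambda>. The labels of \<open>t\<close> form a
  permutation, so the labels of all upper trees and of the unmarked lower vertices are distinct and
  together exhaust an interval.\<close>

lemma lhom_labels:
  assumes "lhom p t U lo"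
  shows "mset (vlabels t) = mset (concat (map (\<lambda>i. vlabels (U i)) [0..<length (vertices p)])
    @ map the (filter (\<lambda>a. a \<noteq> None) (vlabels lo)))"
proof -
  note l = lhomD[OF assms]
  have "mset (vlabels t) = (\<Sum>(a, n)\<leftarrow>vertices lo.
      mset (vlabels (plugs cor (sub (\<lambda>i n. U i) p) a n)))"
    using vlabels_sub[OF l(5)] l(8) by (simp add: plug_def)
  also have "\<dots> = mset (vlabels (sub (\<lambda>i n. U i) p)) +
      mset (map the (filter (\<lambda>a. a \<noteq> None) (vlabels lo)))"
    by (rule sum_list_Nones[OF l(6,7)])
  also have "mset (vlabels (sub (\<lambda>i n. U i) p)) =
      (\<Sum>i\<leftarrow>[0..<length (vertices p)]. mset (vlabels (U i)))"
    using vlabels_sub[OF l(3)] sum_list_vertices[OF l(1), of "\<lambda>i n. mset (vlabels (U i))"] by simp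
  finally show ?thesis by (simp add: mset_concat_sum o_def)
qed

lemma Tw_simps [simp]: "ob (Tw sOp) = Ops sOp" "idn (Tw sOp) = tw_id sOp"
  "cmp (Tw sOp) p t u g f = tw_comp sOp g f"
  by (simp_all add: Tw_def)

lemma Tw_hom: "f \<in> hom (Tw sOp) p t \<longleftrightarrow> tw_valid sOp p f \<and> tw_target sOp p f = t"
  by (simp add: Tw_def)

lemma lhom_of_hom:
  assumes "f \<in> hom (Tw sOp) p t" "t \<in> Ops sOp"
  shows "lhom p t (uppL f) (lowL f)" "mor_ok (length (vertices p)) f"
proof -
  have f: "tw_valid sOp p f" "tw_target sOp p f = t" using assms by (simp_all add: Tw_hom)
  note v = tw_validD[OF f(1)]
  have ok: "low f \<in> Ops sOp" "length (vertices (low f)) = Suc (length (low_labels f))"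
    using v(5) by (auto simp: mor_ok_def)
  have vl: "vlabels (low f) \<in> perms (Suc (length (low_labels f)))"
    using sOp_Ops_vlabels[OF ok(1)] unfolding ok(2) .
  have inj: "inj_on (lname (low_labels f)) {..<Suc (length (low_labels f))}"
    using v(9) by (auto simp: inj_on_def lname_def nth_eq_iff_index_eq split: nat.splits)
  have "distinct (map (lname (low_labels f)) (vlabels (low f)))"
    by (rule iffD2[OF distinct_map]) (use inj perms_distinct[OF vl] perms_set[OF vl] in simp)
  moreover have "(None, length (leaves p)) \<in> set (vertices (lowL f))"
    using v(6) by (force simp: lowL_def vertices_map_tree)
  ultimately show "lhom p t (uppL f) (lowL f)"
    unfolding lhom_def using v(2,11) assms(2) tw_target_plug[OF f(1)] f(2)
    by (simp add: lowL_def)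
  show "mor_ok (length (vertices p)) f" by (rule v(5))
qed

lemma hom_eqI:
  assumes "f \<in> hom (Tw sOp) p t" "f' \<in> hom (Tw sOp) p t'"
    "\<And>i. i < length (vertices p) \<Longrightarrow> uppL f i = uppL f' i" "lowL f = lowL f'"
  shows "f = f'"
  using mor_ext assms tw_validD(5) unfolding Tw_hom by blast

lemma vmap_sort_rank:
  assumes "distinct (vlabels T)"
  shows "vmap ((!) (sort (vlabels T))) (vmap (rank (vlabels T)) T) = T"
proof -
  have "vmap (\<lambda>v. sort (vlabels T) ! rank (vlabels T) v) T = vmap (\<lambda>v. v) T"
    using sort_nth_rank(2)[OF assms] by (intro vmap_cong) auto
  then show ?thesis by (simp only: vmap_vmap vmap_id)
qed

lemma length_filter_Some:
  "distinct ys \<Longrightarrow> None \<in> set ys \<Longrightarrow> length ys = Suc (length (filter (\<lambda>a. a \<noteq> None) ys))"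
proof (induction ys)
  case (Cons b ys)
  show ?case
  proof (cases "b = None")
    case True
    then have "\<forall>a \<in> set ys. a \<noteq> None" using Cons.prems(1) by (metis distinct.simps(2))
    then have "filter (\<lambda>a. a \<noteq> None) ys = ys" by (rule filter_True)
    then show ?thesis using True by (simp del: not_None_eq)
  next
    case False
    then have "length ys = Suc (length (filter (\<lambda>a. a \<noteq> None) ys))"
      using Cons.IH Cons.prems by (metis distinct.simps(2) set_ConsD)
    then show ?thesis using False by (simp del: not_None_eq)
  qed
qed simp

text \<open>Number the vertices of each tree by the ranks of their labels and keep the sorted labels
  as label lists. Together with \<open>hom_eqI\<close>, this makes labelled trees a faithful and
  complete description of the morphisms.\<close>

lemma hom_of_lhom:
  assumes "lhom p t U lo"
  shows "\<exists>f \<in> hom (Tw sOp) p t. (\<forall>i < length (vertices p). uppL f i = U i) \<and> lowL f = lo"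
proof -
  note l = lhomD[OF assms]
  let ?m = "length (vertices p)"
  define L where "L = map the (filter (\<lambda>a. a \<noteq> None) (vlabels lo))"
  let ?ul = "\<lambda>i. sort (vlabels (U i))"
  \<comment> \<open>The marked vertex has to become the first input of the lower operation, so the
    ranks of all other labels are shifted by one.\<close>
  define R where "R = (\<lambda>a. case a of None \<Rightarrow> 0 | Some l \<Rightarrow> Suc (rank L l))"
  define f where "f = \<lparr>low = vmap R lo, low_labels = sort L,
    upp = map (\<lambda>i. vmap (rank (vlabels (U i))) (U i)) [0..<?m], upp_labels = map ?ul [0..<?m]\<rparr>"
  have vt: "vlabels t \<in> perms (length (vlabels t))" using sOp_Ops_vlabels[OF l(2)] by simp
  have ml: "mset (concat (map (\<lambda>i. vlabels (U i)) [0..<?m]) @ L) = mset [0..<length (vlabels t)]"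
    using lhom_labels[OF assms] vt unfolding perms_iff L_def by simp
  have dd: "distinct (concat (map (\<lambda>i. vlabels (U i)) [0..<?m]) @ L)"
    using ml unfolding perms_iff[symmetric] by (rule perms_distinct)
  have dU: "distinct (vlabels (U i))" if "i < ?m" for i
  proof -
    have "vlabels (U i) \<in> set (map (\<lambda>i. vlabels (U i)) [0..<?m])" using that by auto
    then show ?thesis using dd distinct_concat_iff by (metis distinct_append)
  qed
  have dL: "distinct L" using dd by simp
  have uO: "vmap (rank (vlabels (U i))) (U i) \<in> Ops sOp" if i: "i < ?m" for i
    using rank_perms[OF dU[OF i]] perms_self[OF l(10)[OF i]] by (simp add: sOp_Ops)
  have lenL: "length (vertices lo) = Suc (length L)"
  proof -
    have "None \<in> set (vlabels lo)" using l(7) by force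
    then show ?thesis
      using length_filter_Some[OF l(6)] by (simp only: L_def length_map)
  qed
  have setL: "Some ` set L = set (vlabels lo) - {None}"
  proof (rule set_eqI)
    fix a show "a \<in> Some ` set L \<longleftrightarrow> a \<in> set (vlabels lo) - {None}"
      by (cases a) (force simp: L_def)+
  qed
  have setL2: "set (vlabels lo) = insert None (Some ` set L)"
    using setL l(7) by force
  have injR: "inj_on R (set (vlabels lo))"
    unfolding setL2
  proof (rule inj_onI)
    fix a b assume a: "a \<in> insert None (Some ` set L)" and b: "b \<in> insert None (Some ` set L)"
      and e: "R a = R b"
    show "a = b"
    proof (cases a; cases b)
      fix x y assume xy: "a = Some x" "b = Some y"
      then have "rank L x = rank L y" "x \<in> set L" "y \<in> set L" using e a b by (auto simp: R_def)
      then have "x = y" using sort_nth_rank(2)[OF dL] by metis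
      then show ?thesis using xy by simp
    qed (use e in \<open>simp_all add: R_def\<close>)
  qed
  have "R ` set (vlabels lo) \<subseteq> {..<Suc (length L)}"
    unfolding setL2 using sort_nth_rank(1)[OF dL] by (auto simp: R_def)
  moreover have "card (R ` set (vlabels lo)) = Suc (length L)"
    using card_image[OF injR] distinct_card[OF l(6)] lenL by simp
  ultimately have "R ` set (vlabels lo) = {..<Suc (length L)}"
    by (intro card_subset_eq) auto
  then have "set (map R (vlabels lo)) = {..<Suc (length L)}" by (simp add: image_image)
  moreover have "distinct (map R (vlabels lo))"
    by (rule iffD2[OF distinct_map]) (use l(6) injR in simp)
  ultimately have pR: "map R (vlabels lo) \<in> perms (Suc (length L))"
    by (rule permutations_of_setI)
  have lowO: "low f \<in> Ops sOp"
  proof -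
    have "leaves lo \<in> perms (length (leaves lo))"
      using sOp_Ops_leaves[OF l(2)] unfolding perms_iff l(9)[symmetric] mset_eq_length[OF l(9)] .
    then show ?thesis using pR unfolding sOp_Ops
      by (simp only: f_def tw_mor.select_convs vlabels_vmap length_vertices_map_tree lenL
          leaves_map_tree list.map_ident)
  qed
  have upL: "uppL f i = U i" if "i < ?m" for i
    using that vmap_sort_rank[OF dU[OF that]] by (simp add: uppL_def f_def)
  have loL: "lowL f = lo"
  proof -
    have "vmap (lname (sort L)) (vmap R lo) = vmap (\<lambda>v. v) lo"
      unfolding vmap_vmap
    proof (rule vmap_cong)
      fix a assume "a \<in> set (vlabels lo)"
      then show "lname (sort L) (R a) = a"
        using sort_nth_rank(2)[OF dL] unfolding setL2 by (auto simp: R_def)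
    qed
    then show ?thesis by (simp add: lowL_def f_def)
  qed
  have zero: "(0, length (leaves p)) \<in> set (vertices (low f))"
    using l(7) by (force simp: f_def R_def vertices_map_tree)
  have "mset (tw_labels f) = mset [0..<length (vlabels t)]"
    unfolding ml[symmetric] by (simp add: tw_labels_def f_def mset_concat_sum o_def)
  then have tl: "tw_labels f \<in> perms (length (tw_labels f))"
    using perms_iff perms_self by blast
  have comp: "composable sOp p (upp f)"
    using l(1) uO l(10) by (simp add: sOp_composable f_def)
  have val: "tw_valid sOp p f"
    unfolding tw_valid_def
  proof (intro conjI)
    show "inp sOp (low f) \<noteq> []" using lenL by (auto simp: f_def simp flip: length_0_conv)
    then show "hd (inp sOp (low f)) = out sOp p"
      using sOp_inp_nth[OF lowO zero] by (simp add: hd_conv_nth)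
    show "map length (upp_labels f) = map (arity sOp) (upp f)"
      by (simp add: f_def)
    show "Suc (length (low_labels f)) = arity sOp (low f)" using lenL by (simp add: f_def)
    show "\<forall>ls \<in> set (upp_labels f). sorted_wrt (<) ls"
      using dU by (auto simp: f_def intro!: sort_strict)
    show "sorted_wrt (<) (low_labels f)" using dL by (simp add: f_def sort_strict)
  qed (use lowO comp tl in auto)
  have "tw_target sOp p f = t"
  proof -
    have "sub (\<lambda>i n. uppL f i) p = sub (\<lambda>i n. U i) p"
      using upL sOp_inp_nth[OF l(1)] by (intro sub_cong) auto
    then show ?thesis unfolding tw_target_plug[OF val] loL l(8) by simp
  qed
  with val have "f \<in> hom (Tw sOp) p t" by (simp add: Tw_hom)
  with upL loL show ?thesis by blast
qed


lemma lowL_vertices_low: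
  assumes "f \<in> hom (Tw sOp) p t"
  shows "low f \<in> Ops sOp" "length (vertices (low f)) = Suc (length (low_labels f))"
    "\<And>j n. (j, n) \<in> set (vertices (low f)) \<Longrightarrow> j < Suc (length (low_labels f))"
proof -
  have "mor_ok (length (vertices p)) f" using assms tw_validD(5) by (auto simp: Tw_hom)
  then show "low f \<in> Ops sOp" "length (vertices (low f)) = Suc (length (low_labels f))"
    by (auto simp: mor_ok_def)
  then show "(j, n) \<in> set (vertices (low f)) \<Longrightarrow> j < Suc (length (low_labels f))" for j n
    using sOp_inp_nth by fastforce
qed

text \<open>The lower tree of a composite: the upper trees of the second morphism refine the
  unmarked vertices of \<open>lf\<close>, and the result fills the marked vertex of
  \<open>lg\<close>. The mark of \<open>lf\<close> survives as the mark of the composite.\<close>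

definition lowcomp :: "(nat \<Rightarrow> (nat, nat) tree) \<Rightarrow> (nat option, nat) tree \<Rightarrow>
    (nat option, nat) tree \<Rightarrow> (nat option, nat) tree" where
  "lowcomp V lg lf = sub (plugs (\<lambda>j. cor (Some j))
    (sub (\<lambda>a n. case a of None \<Rightarrow> cor None n | Some j \<Rightarrow> vmap Some (V j)) lf)) lg"

text \<open>Transfers what is known about the vertices of the target, arities included, to the
  pieces from which it is assembled.\<close>

lemma lhom_vertices:
  assumes "lhom p t U lo"
  shows "i < length (vertices p) \<Longrightarrow> set (vertices (U i)) \<subseteq> set (vertices t)"
    "(Some j, n) \<in> set (vertices lo) \<Longrightarrow> (j, n) \<in> set (vertices t)"
    "set (vertices (sub (\<lambda>i n. U i) p)) \<subseteq> set (vertices t)"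
proof -
  note l = lhomD[OF assms]
  have t: "set (vertices t) =
      (\<Union>(a, n) \<in> set (vertices lo). set (vertices (plugs cor (sub (\<lambda>i n. U i) p) a n)))"
    using set_vertices_sub[OF l(5)] l(8) by (simp add: plug_def)
  show z: "set (vertices (sub (\<lambda>i n. U i) p)) \<subseteq> set (vertices t)"
    unfolding t using l(7) by force
  show "set (vertices (U i)) \<subseteq> set (vertices t)" if "i < length (vertices p)"
    using z sOp_vertex[OF l(1) that] unfolding set_vertices_sub[OF l(3)] by blast
  show "(j, n) \<in> set (vertices t)" if "(Some j, n) \<in> set (vertices lo)"
    unfolding t using that by force
qed

lemma count_sum_list: "count (\<Sum>x\<leftarrow>xs. f x) a = (\<Sum>x\<leftarrow>xs. count (f x) a)"
  by (induction xs) auto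

text \<open>The number of marks is left open, because this count is used to derive that a composite
  lower tree is distinctly labelled from the fact that the target is.\<close>

lemma vlabels_plug:
  assumes "fits (plugs cor z) lo"
  shows "mset (vlabels (plug z lo)) = repeat_mset (count (mset (vlabels lo)) None) (mset (vlabels z)) +
    mset (map the (filter (\<lambda>a. a \<noteq> None) (vlabels lo)))"
proof -
  have "(\<Sum>(a, n)\<leftarrow>xs. mset (vlabels (plugs cor z a n))) =
      repeat_mset (count (mset (map fst xs)) None) (mset (vlabels z)) +
      mset (map the (filter (\<lambda>a. a \<noteq> None) (map fst xs)))"
    for xs :: "(nat option \<times> nat) list"
    by (induction xs) (auto simp: plugs_def split: option.splits)
  then show ?thesis unfolding plug_def vlabels_sub[OF assms] by blast
qed

lemma distinct_of_Some:
  assumes "count (mset xs) None = 1" "distinct (map the (filter (\<lambda>a. a \<noteq> None) xs))"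
  shows "distinct xs"
proof -
  have "count (mset xs) a \<le> 1" for a
  proof (cases a)
    case (Some b)
    have "count (mset xs) (Some b) \<le> count (mset (map the (filter (\<lambda>a. a \<noteq> None) xs))) b"
      by (induction xs) auto
    also have "\<dots> \<le> 1" using assms(2) by (simp add: distinct_count_atmost_1)
    finally show ?thesis using Some by simp
  qed (use assms(1) in simp)
  then show ?thesis
    by (metis (no_types, lifting) Suc_leI count_greater_zero_iff distinct_count_atmost_1 le_antisym
        One_nat_def count_inI set_mset_mset not_gr_zero)
qed

lemma count_None_sub:
  assumes "fits s T" "distinct (vlabels T)" "(None, k) \<in> set (vertices T)"
    "\<And>j n. None \<notin> set (vlabels (s (Some j) n))"
  shows "count (mset (vlabels (sub s T))) None = count (mset (vlabels (s None k))) None"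
proof -
  have g: "(\<Sum>(a, n)\<leftarrow>xs. count (mset (vlabels (s a n))) None) =
      (if (None, k) \<in> set xs then count (mset (vlabels (s None k))) None else 0)"
    if "distinct (map fst xs)" "\<And>n. (None, n) \<in> set xs \<Longrightarrow> n = k" for xs
    using that
  proof (induction xs)
    case (Cons x xs)
    obtain a n where x: "x = (a, n)" by fastforce
    have IH: "(\<Sum>(a, n)\<leftarrow>xs. count (mset (vlabels (s a n))) None) =
      (if (None, k) \<in> set xs then count (mset (vlabels (s None k))) None else 0)"
      using Cons by auto
    show ?case
    proof (cases a)
      case None
      then have "n = k" "(None, k) \<notin> set xs" using Cons.prems x by force+
      then show ?thesis using IH x None by simp
    next
      case (Some j)
      have "count (mset (vlabels (s (Some j) n))) None = 0"
        using assms(4)[of j n] by (simp add: count_eq_zero_iff)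
      then show ?thesis using IH x Some by simp
    qed
  qed simp
  have "count (mset (vlabels (sub s T))) None =
      (\<Sum>(a, n)\<leftarrow>vertices T. count (mset (vlabels (s a n))) None)"
    unfolding vlabels_sub[OF assms(1)] count_sum_list by (simp add: case_prod_unfold)
  also have "\<dots> = count (mset (vlabels (s None k))) None"
  proof -
    have "n = k" if "(None, n) \<in> set (vertices T)" for n
      by (rule distinct_vlabelsD[OF assms(2) that assms(3)])
    from g[OF assms(2) this] show ?thesis using assms(3) by presburger
  qed
  finally show ?thesis .
qed

lemma fits_subset: "fits s T \<Longrightarrow> set (vertices T') \<subseteq> set (vertices T) \<Longrightarrow> fits s T'"
  unfolding fits_def by blast

text \<open>Both ways of assembling \<open>u\<close> agree by associativity of substitution. The
  labels of the new lower tree are distinct because those of \<open>u\<close> are and because the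
  mark occurs only once.\<close>

lemma lhom_comp:
  assumes "lhom p t U lf" "lhom t u V lg"
  shows "lhom p u (\<lambda>i. sub (\<lambda>j n. V j) (U i)) (lowcomp V lg lf)"
proof -
  note f = lhomD[OF assms(1)] and g = lhomD[OF assms(2)]
  let ?V = "\<lambda>j n::nat. V j"
  let ?Z = "sub (\<lambda>i n. U i) p"
  let ?c = "\<lambda>a n. case a of None \<Rightarrow> cor None n | Some j \<Rightarrow> vmap Some (V j)"
  define z where "z = sub (\<lambda>i n. sub ?V (U i)) p"
  define I where "I = sub ?c lf"
  have fU: "fits ?V (U i)" if "i < length (vertices p)" for i
    using fits_subset[OF g(3)] lhom_vertices(1)[OF assms(1) that] by blast
  have fU': "fits ?V (U i)" if "(i, n) \<in> set (vertices p)" for i n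
    using fU sOp_inp_nth[OF f(1) that] by blast
  have fZ: "fits ?V ?Z" using fits_subset[OF g(3)] lhom_vertices(3)[OF assms(1)] by blast
  have z: "sub ?V ?Z = z" unfolding z_def by (rule sub_sub[OF f(3) fU'])
  have lz: "leaves z \<in> perms (length (leaves p))"
    using leaves_sub[OF fZ] f(4) unfolding z perms_iff by simp
  have Vj: "leaves (V j) \<in> perms n" if "(Some j, n) \<in> set (vertices lf)" for j n
    using fitsD[OF g(3)] lhom_vertices(2)[OF assms(1) that] by blast
  have fc: "fits ?c lf"
    unfolding fits_def using Vj by (auto split: option.splits)
  have lI: "mset (leaves I) = mset (leaves t)"
    unfolding I_def using leaves_sub[OF fc] f(9) by simp
  have pI: "leaves I \<in> perms (length (leaves t))"
    using lI sOp_Ops_leaves[OF f(2)] unfolding perms_iff by simp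
  have fo: "fits (plugs (\<lambda>j. cor (Some j)) I) lg"
    using pI distinct_vlabelsD[OF g(6,7)] by (auto simp: fits_def plugs_def split: option.splits)
  have lc: "lowcomp V lg lf = sub (plugs (\<lambda>j. cor (Some j)) I) lg"
    by (simp add: lowcomp_def I_def)
  have fzn: "fits (plugs cor z) (?c a n)" if "(a, n) \<in> set (vertices lf)" for a n
    using that lz distinct_vlabelsD[OF f(6,7)]
    by (cases a) (auto simp: fits_def fits_vmap_iff vertices_map_tree)
  \<comment> \<open>The second substitution acts on \<open>t\<close> in two ways: in the marked part
    it turns the first composite into \<open>z\<close>, and at the unmarked vertices it inserts the
    trees \<open>V j\<close>.\<close>
  have Vt: "sub ?V t = sub (plugs cor z) I"
  proof -
    have "sub ?V t = sub (\<lambda>a n. sub ?V (plugs cor ?Z a n)) lf"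
      unfolding f(8) plug_def
    proof (rule sub_sub[OF f(5)])
      fix a n assume "(a, n) \<in> set (vertices lf)"
      then show "fits ?V (plugs cor ?Z a n)"
        using fZ Vj by (cases a) (auto simp: fits_def)
    qed
    also have "\<dots> = sub (\<lambda>a n. sub (plugs cor z) (?c a n)) lf"
    proof (rule sub_cong)
      fix a n assume a: "(a, n) \<in> set (vertices lf)"
      show "sub ?V (plugs cor ?Z a n) = sub (plugs cor z) (?c a n)"
      proof (cases a)
        case None
        then have "n = length (leaves p)" using a distinct_vlabelsD[OF f(6,7)] by blast
        then show ?thesis using None lz by (simp add: z sub_cor)
      next
        case (Some j)
        then show ?thesis using Vj a by (simp add: sub_cor sub_vmap)
      qed
    qed
    also have "\<dots> = sub (plugs cor z) I"
      unfolding I_def by (rule sub_sub[symmetric, OF fc fzn])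
    finally show ?thesis .
  qed
  have fzI: "fits (plugs cor z) I"
    using fzn unfolding I_def fits_def set_vertices_sub[OF fc] by fast
  have fzo: "fits (plugs cor z) (plugs (\<lambda>j. cor (Some j)) I a n)" for a n
    using fzI by (cases a) (auto simp: fits_def)
  have u: "u = plug z (lowcomp V lg lf)"
  proof -
    have "plug z (lowcomp V lg lf) =
        sub (\<lambda>a n. sub (plugs cor z) (plugs (\<lambda>j. cor (Some j)) I a n)) lg"
      unfolding plug_def lc by (rule sub_sub[OF fo fzo])
    also have "\<dots> = sub (plugs cor (sub ?V t)) lg"
    proof (rule sub_cong)
      fix a n
      show "sub (plugs cor z) (plugs (\<lambda>j. cor (Some j)) I a n) = plugs cor (sub ?V t) a n"
        by (cases a) (simp_all add: Vt sub_cor)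
    qed
    finally show ?thesis using g(8) by (simp add: plug_def)
  qed
  have N: "(None, length (leaves p)) \<in> set (vertices (lowcomp V lg lf))"
  proof -
    have "(None, length (leaves p)) \<in> set (vertices I)"
      unfolding I_def set_vertices_sub[OF fc] using f(7) by force
    then show ?thesis unfolding lc set_vertices_sub[OF fo] using g(7) by force
  qed
  have fzl: "fits (plugs cor z) (lowcomp V lg lf)"
    using fzo unfolding lc fits_def set_vertices_sub[OF fo] by fast
  \<comment> \<open>The mark of \<open>lg\<close> is used up by inserting \<open>I\<close>, and
    \<open>I\<close> contains exactly the mark of \<open>lf\<close>.\<close>
  have "count (mset (vlabels (lowcomp V lg lf))) None = count (mset (vlabels I)) None"
    unfolding lc using count_None_sub[OF fo g(6,7)] by simp
  also have "\<dots> = 1"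
    unfolding I_def by (subst count_None_sub[OF fc f(6,7)]) auto
  finally have c1: "count (mset (vlabels (lowcomp V lg lf))) None = 1" .
  have "distinct (vlabels u)" using perms_distinct[OF sOp_Ops_vlabels[OF g(2)]] .
  then have "distinct (map the (filter (\<lambda>a. a \<noteq> None) (vlabels (lowcomp V lg lf))))"
  proof -
    have "mset (vlabels u) =
        mset (vlabels z @ map the (filter (\<lambda>a. a \<noteq> None) (vlabels (lowcomp V lg lf))))"
      using vlabels_plug[OF fzl] unfolding u[symmetric] c1 by simp
    from mset_eq_imp_distinct_iff[OF this] show ?thesis
      using \<open>distinct (vlabels u)\<close> by (metis distinct_append)
  qed
  then have d: "distinct (vlabels (lowcomp V lg lf))" by (rule distinct_of_Some[OF c1])
  have "leaves (sub ?V (U i)) \<in> perms (inp sOp p ! i)" if "i < length (vertices p)" for i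
    using leaves_sub[OF fU[OF that]] f(10)[OF that] unfolding perms_iff by simp
  then show ?thesis
    unfolding lhom_def using f(1) g(2) d N u z_def by simp
qed

lemma comp_vmap:
  assumes c: "composable sOp q Ss"
    and h: "\<And>k a. k < length Ss \<Longrightarrow> a < length (vertices (Ss ! k)) \<Longrightarrow>
      h (block_start (map (length \<circ> vertices) Ss) k + a) = h' k a"
  shows "vmap h (comp sOp q Ss) = sub (\<lambda>k n. vmap (h' k) (Ss ! k)) q"
  unfolding sOp_comp[OF c] vmap_sub[OF sOp_fits[OF c]] vmap_vmap
proof (rule sub_cong)
  fix k n assume "(k, n) \<in> set (vertices q)"
  then have k: "k < length Ss" and S: "Ss ! k \<in> Ops sOp"
    using c sOp_inp_nth by (auto simp: sOp_composable)
  show "vmap (\<lambda>a. h (block_start (map (length \<circ> vertices) Ss) k + a)) (Ss ! k) = vmap (h' k) (Ss ! k)"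
  proof (rule vmap_cong)
    fix a assume "a \<in> set (vlabels (Ss ! k))"
    then have "a < length (vertices (Ss ! k))" unfolding perms_set[OF sOp_Ops_vlabels[OF S]] by simp
    then show "h (block_start (map (length \<circ> vertices) Ss) k + a) = h' k a" by (rule h[OF k])
  qed
qed

lemma distinct_concat_select:
  assumes "distinct (concat xss)" "distinct ls" "\<And>l. l \<in> set ls \<Longrightarrow> l < length xss"
  shows "distinct (concat (map ((!) xss) ls))"
proof -
  have disj: "set (xss ! a) \<inter> set (xss ! b) = {}" if "a < b" "b < length xss" for a b
  proof -
    have m1: "xss ! a \<in> set (take b xss)"
      using that by (auto simp: in_set_conv_nth)
    have m2: "xss ! b \<in> set (drop b xss)"
      using that by (metis Cons_nth_drop_Suc list.set_intros(1))
    have d: "set (concat (take b xss)) \<inter> set (concat (drop b xss)) = {}"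
      using assms(1) by (metis append_take_drop_id concat_append distinct_append)
    show ?thesis
    proof (rule equals0I)
      fix x assume "x \<in> set (xss ! a) \<inter> set (xss ! b)"
      then have "x \<in> set (concat (take b xss))" "x \<in> set (concat (drop b xss))"
        using m1 m2 unfolding set_concat by blast+
      then show False using d by blast
    qed
  qed
  have d1: "distinct (xss ! a)" if "a < length xss" for a
    using assms(1) that by (metis distinct_concat_iff nth_mem)
  from assms(2,3) show ?thesis
  proof (induction ls)
    case (Cons l ls)
    have "set (xss ! l) \<inter> set (xss ! a) = {}" if "a \<in> set ls" for a
      using disj[of l a] disj[of a l] Cons.prems that
      by (metis distinct.simps(2) inf_commute linorder_neqE_nat list.set_intros)
    then show ?case using Cons d1 by auto
  qed simp
qed

lemma sort_ranks:
  assumes "distinct ls" "k < length ls"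
  shows "ranks ls ! k < length ls" "sort ls ! (ranks ls ! k) = ls ! k"
  using sort_nth_rank[OF assms(1), of "ls ! k"] assms(2) by (simp_all add: ranks_rank)

lemma block_start_labels:
  assumes "k < length lss" "a < length (lss ! k)" "map length lss = ns"
  shows "concat lss ! (block_start ns k + a) = lss ! k ! a"
    "block_start ns k + a < length (concat lss)"
  using concat_nth_block[OF assms(1,2)] assms(3) by auto

text \<open>The permutations by \<open>ranks\<close> cancel against the sorting of the label lists,
  so the labelled trees of \<open>tw_comp\<close> are those of the composite in
  \<open>lhom_comp\<close>. This also proves indirectly that \<open>tw_comp\<close> is a
  morphism.\<close>

lemma tw_comp_hom:
  assumes f: "f \<in> hom (Tw sOp) p t" and g: "g \<in> hom (Tw sOp) t u"
    and t: "t \<in> Ops sOp" and u: "u \<in> Ops sOp"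
  shows "tw_comp sOp g f \<in> hom (Tw sOp) p u"
    and "\<And>i. i < length (vertices p) \<Longrightarrow> uppL (tw_comp sOp g f) i = sub (\<lambda>j n. uppL g j) (uppL f i)"
    and "lowL (tw_comp sOp g f) = lowcomp (uppL g) (lowL g) (lowL f)"
proof -
  let ?m = "length (vertices p)" and ?k = "length (vertices t)"
  note lf = lhom_of_hom[OF f t] and lg = lhom_of_hom[OF g u]
  have vf: "tw_valid sOp p f" and vg: "tw_valid sOp t g" using f g by (simp_all add: Tw_hom)
  note vf = tw_validD[OF vf] and vg = tw_validD[OF vg]
  have okf: "\<And>i. i < ?m \<Longrightarrow> upp f ! i \<in> Ops sOp"
    "\<And>i. i < ?m \<Longrightarrow> length (upp_labels f ! i) = length (vertices (upp f ! i))"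
    "\<And>i. i < ?m \<Longrightarrow> sorted_wrt (<) (upp_labels f ! i)"
    "low f \<in> Ops sOp" "length (vertices (low f)) = Suc (length (low_labels f))"
    using lf(2) by (auto simp: mor_ok_def)
  have okg: "\<And>i. i < ?k \<Longrightarrow> upp g ! i \<in> Ops sOp"
    "\<And>i. i < ?k \<Longrightarrow> length (upp_labels g ! i) = length (vertices (upp g ! i))"
    "\<And>i. i < ?k \<Longrightarrow> sorted_wrt (<) (upp_labels g ! i)"
    "low g \<in> Ops sOp" "length (vertices (low g)) = Suc (length (low_labels g))"
    using lg(2) by (auto simp: mor_ok_def)
  define nl where "nl = (\<lambda>ls. concat (map ((!) (upp_labels g)) ls))"
  define nu where "nu = (\<lambda>i. comp sOp (upp f ! i) (map ((!) (upp g)) (upp_labels f ! i)))"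
  define lq where "lq = comp sOp (low f) (cor 0 (length (leaves p)) # map ((!) (upp g)) (low_labels f))"
  define nlow where "nlow = compose_first sOp (low g) lq"
  define nll where "nll = nl (low_labels f) @ low_labels g"
  have hd: "hd (inp sOp (low f)) = length (leaves p)" "inp sOp (low f) \<noteq> []"
    using okf(5) vf(7) by (auto simp: hd_conv_nth simp flip: length_0_conv)
  have c: "tw_comp sOp g f = \<lparr>low = vmap ((!) (0 # map Suc (ranks nll))) nlow, low_labels = sort nll,
      upp = map2 (\<lambda>q ls. vmap ((!) (ranks (nl ls))) (comp sOp q (map ((!) (upp g)) ls)))
        (upp f) (upp_labels f),
      upp_labels = map (\<lambda>ls. sort (nl ls)) (upp_labels f)\<rparr>"
    unfolding tw_comp_def Let_def nl_def nll_def nlow_def lq_def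
    by (simp add: hd)
  have inj_lab: "(upp_labels f ! i ! k, inp sOp (upp f ! i) ! k) \<in> set (vertices t)"
    if "i < ?m" "k < length (upp_labels f ! i)" for i k
  proof -
    have "(k, inp sOp (upp f ! i) ! k) \<in> set (vertices (upp f ! i))"
      using sOp_vertex[OF okf(1)] that okf(2) by simp
    then have "(upp_labels f ! i ! k, inp sOp (upp f ! i) ! k) \<in> set (vertices (uppL f i))"
      by (force simp: uppL_def vertices_map_tree)
    then show ?thesis using lhom_vertices(1)[OF lf(1) that(1)] by blast
  qed
  have low_lab: "(low_labels f ! k, inp sOp (low f) ! Suc k) \<in> set (vertices t)"
    if "k < length (low_labels f)" for k
  proof -
    have "(Suc k, inp sOp (low f) ! Suc k) \<in> set (vertices (low f))"
      using sOp_vertex[OF okf(4)] that okf(5) by simp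
    then have "(Some (low_labels f ! k), inp sOp (low f) ! Suc k) \<in> set (vertices (lowL f))"
      by (force simp: lowL_def vertices_map_tree)
    then show ?thesis using lhom_vertices(2)[OF lf(1)] by blast
  qed
  have ug: "upp g ! l \<in> Ops sOp \<and> leaves (upp g ! l) \<in> perms n \<and> l < ?k"
    if "(l, n) \<in> set (vertices t)" for l n
    using vg(1) sOp_inp_nth[OF t that] by (auto simp: sOp_composable)
  have cu: "composable sOp (upp f ! i) (map ((!) (upp g)) (upp_labels f ! i))" if "i < ?m" for i
    unfolding sOp_composable using okf(1,2)[OF that] ug[OF inj_lab[OF that]] by simp
  have cl: "composable sOp (low f) (cor 0 (length (leaves p)) # map ((!) (upp g)) (low_labels f))"
    unfolding sOp_composable
  proof (intro conjI allI impI)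
    fix j assume j: "j < length (vertices (low f))"
    show "(cor 0 (length (leaves p)) # map ((!) (upp g)) (low_labels f)) ! j \<in> Ops sOp"
      "leaves ((cor 0 (length (leaves p)) # map ((!) (upp g)) (low_labels f)) ! j)
        \<in> perms (inp sOp (low f) ! j)"
      using j okf(5) ug[OF low_lab] vf(7) by (cases j; simp)+
  qed (use okf(4,5) in simp_all)
  have ltk: "\<And>i l. i < ?m \<Longrightarrow> l \<in> set (upp_labels f ! i) \<Longrightarrow> l < length (upp_labels g)"
    "\<And>l. l \<in> set (low_labels f) \<Longrightarrow> l < length (upp_labels g)"
    using ug[OF inj_lab] ug[OF low_lab] vg(4) by (auto simp: in_set_conv_nth)
  have dn: "distinct (nl (upp_labels f ! i))" if "i < ?m" for i
    unfolding nl_def using distinct_concat_select[OF vg(8) _ ltk(1)[OF that]] okf(3)[OF that]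
    by (simp add: strict_sorted_iff)
  have dll: "distinct nll"
    unfolding nll_def distinct_append
  proof (intro conjI)
    show "distinct (nl (low_labels f))"
      unfolding nl_def using distinct_concat_select[OF vg(8) vf(9) ltk(2)] by simp
    show "distinct (low_labels g)" by (rule vg(9))
    have "set (nl (low_labels f)) \<subseteq> set (concat (upp_labels g))"
      using ltk(2) nth_mem by (fastforce simp: nl_def)
    then show "set (nl (low_labels f)) \<inter> set (low_labels g) = {}" using vg(10) by blast
  qed
  have lens: "map length (map ((!) (upp_labels g)) ls) = map (length \<circ> vertices) (map ((!) (upp g)) ls)"
    if "\<And>l. l \<in> set ls \<Longrightarrow> l < length (upp_labels g)" for ls
    using that okg(2) vg(4) by auto
  have nu_lab: "vmap ((!) (nl (upp_labels f ! i))) (nu i) = sub (\<lambda>j n. uppL g j) (uppL f i)"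
    and nu_len: "length (vertices (nu i)) = length (nl (upp_labels f ! i))" if i: "i < ?m" for i
  proof -
    let ?ls = "upp_labels f ! i"
    note lens = lens[of ?ls, OF ltk(1)[OF i]]
    have "vmap ((!) (nl ?ls)) (nu i) =
        sub (\<lambda>k n. vmap ((!) (map ((!) (upp_labels g)) ?ls ! k)) (map ((!) (upp g)) ?ls ! k)) (upp f ! i)"
      unfolding nu_def nl_def
    proof (rule comp_vmap[OF cu[OF i]])
      fix k a assume k: "k < length (map ((!) (upp g)) ?ls)"
        "a < length (vertices (map ((!) (upp g)) ?ls ! k))"
      have "length (map ((!) (upp_labels g)) ?ls ! k) = length (vertices (map ((!) (upp g)) ?ls ! k))"
        using arg_cong[where f = "\<lambda>xs. xs ! k", OF lens] k by simp
      then show "concat (map ((!) (upp_labels g)) ?ls) !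
          (block_start (map (length \<circ> vertices) (map ((!) (upp g)) ?ls)) k + a) =
          map ((!) (upp_labels g)) ?ls ! k ! a"
        using k lens by (intro block_start_labels) simp_all
    qed
    also have "\<dots> = sub (\<lambda>k n. uppL g (?ls ! k)) (upp f ! i)"
    proof (rule sub_cong)
      fix k n assume "(k, n) \<in> set (vertices (upp f ! i))"
      then have "k < length ?ls" using sOp_inp_nth[OF okf(1)[OF i]] okf(2)[OF i] by simp
      then show "vmap ((!) (map ((!) (upp_labels g)) ?ls ! k)) (map ((!) (upp g)) ?ls ! k) = uppL g (?ls ! k)"
        by (simp add: uppL_def)
    qed
    also have "\<dots> = sub (\<lambda>j n. uppL g j) (uppL f i)"
      by (simp add: uppL_def[of f] sub_vmap)
    finally show "vmap ((!) (nl ?ls)) (nu i) = sub (\<lambda>j n. uppL g j) (uppL f i)" .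
    show "length (vertices (nu i)) = length (nl ?ls)"
      unfolding nu_def sOp_comp_Ops(2)[OF cu[OF i]] nl_def length_concat by (simp only: lens)
  qed
  have nuO: "nu i \<in> Ops sOp" if "i < ?m" for i
    unfolding nu_def by (rule sOp_comp_Ops(1)[OF cu[OF that]])
  have rank_lab: "vmap ((!) (sort ls)) (vmap ((!) (ranks ls)) T) = vmap ((!) ls) T"
    if "distinct ls" "T \<in> Ops sOp" "length (vertices T) = length ls" for ls and T :: "(nat, nat) tree"
    unfolding vmap_vmap
  proof (rule vmap_cong)
    fix v assume "v \<in> set (vlabels T)"
    then have "v < length ls" unfolding perms_set[OF sOp_Ops_vlabels[OF that(2)]] that(3) by simp
    then show "sort ls ! (ranks ls ! v) = ls ! v" by (rule sort_ranks[OF that(1)])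
  qed
  have uc: "uppL (tw_comp sOp g f) i = sub (\<lambda>j n. uppL g j) (uppL f i)" if i: "i < ?m" for i
  proof (subst uppL_def)
    show "vmap ((!) (upp_labels (tw_comp sOp g f) ! i)) (upp (tw_comp sOp g f) ! i) =
        sub (\<lambda>j n. uppL g j) (uppL f i)"
      using rank_lab[OF dn[OF i] nuO[OF i] nu_len[OF i]] nu_lab[OF i] i vf(3,4)
      by (simp add: nu_def c)
  qed
  have lqO: "lq \<in> Ops sOp" unfolding lq_def by (rule sOp_comp_Ops(1)[OF cl])
  have lenq: "length (vertices lq) = Suc (length (nl (low_labels f)))"
    using arg_cong[where f = sum_list, OF lens[of "low_labels f", OF ltk(2)]]
    unfolding lq_def sOp_comp_Ops(2)[OF cl] nl_def length_concat by simp
  have leq: "leaves lq \<in> perms (inp sOp (low g) ! 0)"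
  proof -
    have "mset (leaves lq) = mset (leaves (low f))"
      unfolding lq_def by (rule sOp_comp_Ops(3)[OF cl])
    also have "\<dots> = mset (leaves t)" using lhomD(9)[OF lf(1)] by (simp add: lowL_def)
    finally show ?thesis using sOp_Ops_leaves[OF t] vg(7) unfolding perms_iff by simp
  qed
  have neg: "vertices (low g) \<noteq> []" using okg(5) by auto
  have nlow: "nlow = sub (\<lambda>j n. case j of 0 \<Rightarrow> lq | Suc k \<Rightarrow> cor (length (vertices lq) + k) n) (low g)"
    unfolding nlow_def by (rule compose_first_sub[OF okg(4) lqO neg leq])
  have cn: "composable sOp (low g) (lq # map (ident sOp) (tl (inp sOp (low g))))"
    by (rule compose_first_composable[OF okg(4) lqO neg leq])
  have nO: "nlow \<in> Ops sOp" unfolding nlow_def compose_first_def by (rule sOp_comp_Ops(1)[OF cn])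
  have "sum_list (map (length \<circ> vertices) (map (ident sOp) xs)) = length xs" for xs
    by (induction xs) auto
  then have lenn: "length (vertices nlow) = Suc (length nll)"
    unfolding nlow_def compose_first_def sOp_comp_Ops(2)[OF cn] using lenq okg(5)
    by (simp add: nll_def)
  have "vmap (lname (sort nll)) (vmap ((!) (0 # map Suc (ranks nll))) nlow) = vmap (lname nll) nlow"
    unfolding vmap_vmap
  proof (rule vmap_cong)
    fix v assume "v \<in> set (vlabels nlow)"
    then have v: "v < Suc (length nll)" unfolding perms_set[OF sOp_Ops_vlabels[OF nO]] lenn by simp
    show "lname (sort nll) ((0 # map Suc (ranks nll)) ! v) = lname nll v"
    proof (cases v)
      case (Suc k)
      then have "k < length nll" using v by simp
      then show ?thesis using Suc sort_ranks[OF dll] by (simp add: ranks_rank)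
    qed simp
  qed
  then have "lowL (tw_comp sOp g f) = vmap (lname nll) nlow" by (simp add: lowL_def c)
  also have "\<dots> = sub (\<lambda>j n. vmap (lname nll)
      (case j of 0 \<Rightarrow> lq | Suc k \<Rightarrow> cor (length (vertices lq) + k) n)) (low g)"
    unfolding nlow
  proof (rule vmap_sub)
    show "fits (\<lambda>j n. case j of 0 \<Rightarrow> lq | Suc k \<Rightarrow> cor (length (vertices lq) + k) n) (low g)"
      unfolding fits_def
    proof (rule ballI, clarify)
      fix j n assume "(j, n) \<in> set (vertices (low g))"
      then have "inp sOp (low g) ! j = n" using sOp_inp_nth[OF okg(4)] by blast
      then show "leaves (case j of 0 \<Rightarrow> lq | Suc k \<Rightarrow> cor (length (vertices lq) + k) n) \<in> perms n"
        using leq by (cases j) simp_all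
    qed
  qed
  also have "\<dots> = sub (\<lambda>j n. plugs (\<lambda>j. cor (Some j)) (vmap (lname nll) lq) (lname (low_labels g) j) n) (low g)"
  proof (rule sub_cong)
    fix j n
    show "vmap (lname nll) (case j of 0 \<Rightarrow> lq | Suc k \<Rightarrow> cor (length (vertices lq) + k) n) =
        plugs (\<lambda>j. cor (Some j)) (vmap (lname nll) lq) (lname (low_labels g) j) n"
      by (cases j) (simp_all add: lenq nll_def nth_append)
  qed
  also have "\<dots> = sub (plugs (\<lambda>j. cor (Some j)) (vmap (lname nll) lq)) (lowL g)"
    by (simp add: lowL_def sub_vmap)
  also have "vmap (lname nll) lq =
      sub (\<lambda>a n. case a of None \<Rightarrow> cor None n | Some j \<Rightarrow> vmap Some (uppL g j)) (lowL f)"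
  proof -
    let ?Ss = "cor 0 (length (leaves p)) # map ((!) (upp g)) (low_labels f)"
    let ?h = "\<lambda>k a. case k of 0 \<Rightarrow> None | Suc k \<Rightarrow> Some (upp_labels g ! (low_labels f ! k) ! a)"
    have "vmap (lname nll) lq = sub (\<lambda>k n. vmap (?h k) (?Ss ! k)) (low f)"
      unfolding lq_def
    proof (rule comp_vmap[OF cl])
      fix k a assume k: "k < length ?Ss" "a < length (vertices (?Ss ! k))"
      show "lname nll (block_start (map (length \<circ> vertices) ?Ss) k + a) = ?h k a"
      proof (cases k)
        case 0
        then show ?thesis using k by simp
      next
        case (Suc k')
        let ?lss = "map ((!) (upp_labels g)) (low_labels f)"
        note lens = lens[of "low_labels f", OF ltk(2)]
        have k': "k' < length ?lss" using k Suc by simp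
        have "length (?lss ! k') = length (vertices (?Ss ! k))"
          using arg_cong[where f = "\<lambda>xs. xs ! k'", OF lens] k Suc by simp
        then have a: "a < length (?lss ! k')" using k by simp
        have bl: "block_start (map length ?lss) k' + a < length (concat ?lss)"
          "concat ?lss ! (block_start (map length ?lss) k' + a) = ?lss ! k' ! a"
          using concat_nth_block[OF k' a] by auto
        have "block_start (map (length \<circ> vertices) ?Ss) k + a = Suc (block_start (map length ?lss) k' + a)"
          using arg_cong[where f = "\<lambda>ns. block_start ns k'", OF lens] by (simp add: Suc)
        then show ?thesis using bl k' Suc by (simp add: nll_def nl_def nth_append)
      qed
    qed
    also have "\<dots> = sub (\<lambda>k n. case lname (low_labels f) k of None \<Rightarrow> cor None n
        | Some j \<Rightarrow> vmap Some (uppL g j)) (low f)"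
    proof (rule sub_cong)
      fix k n assume k: "(k, n) \<in> set (vertices (low f))"
      then have "inp sOp (low f) ! k = n" "k < Suc (length (low_labels f))"
        using sOp_inp_nth[OF okf(4) k] okf(5) by auto
      then show "vmap (?h k) (?Ss ! k) = (case lname (low_labels f) k of None \<Rightarrow> cor None n
        | Some j \<Rightarrow> vmap Some (uppL g j))"
        using vf(7) by (cases k) (simp_all add: uppL_def vmap_vmap)
    qed
    also have "\<dots> = sub (\<lambda>a n. case a of None \<Rightarrow> cor None n
        | Some j \<Rightarrow> vmap Some (uppL g j)) (lowL f)"
      by (simp add: lowL_def sub_vmap)
    finally show ?thesis .
  qed
  finally have lc: "lowL (tw_comp sOp g f) = lowcomp (uppL g) (lowL g) (lowL f)"
    by (simp add: lowcomp_def)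
  have "ranks nll \<in> perms (length nll)" using rank_perms[OF dll] by (simp add: ranks_rank)
  then have "0 # map Suc (ranks nll) \<in> perms (Suc (length nll))"
    unfolding perms_iff by (simp add: upt_rec[of 0] map_Suc_upt[symmetric] del: upt_Suc)
  then have lO: "vmap ((!) (0 # map Suc (ranks nll))) nlow \<in> Ops sOp"
    using sOp_act_Ops[OF nO] lenn by simp
  have uO: "vmap ((!) (ranks (nl (upp_labels f ! i)))) (nu i) \<in> Ops sOp" if "i < ?m" for i
    using sOp_act_Ops[OF nuO[OF that]] nu_len[OF that] rank_perms[OF dn[OF that]]
    by (simp add: ranks_rank)
  have okc: "mor_ok ?m (tw_comp sOp g f)"
    unfolding mor_ok_def c using lO uO nu_len dn dll lenn vf(3,4)
    by (simp add: nu_def sort_strict)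
  \<comment> \<open>A morphism with the labelled trees of the composite exists. As labelled trees
    determine the tuple, it is \<open>tw_comp sOp g f\<close>, whose validity therefore need not be
    checked by hand.\<close>
  obtain h where h: "h \<in> hom (Tw sOp) p u"
    "\<And>i. i < ?m \<Longrightarrow> uppL h i = sub (\<lambda>j n. uppL g j) (uppL f i)"
    "lowL h = lowcomp (uppL g) (lowL g) (lowL f)"
    using hom_of_lhom[OF lhom_comp[OF lf(1) lg(1)]] by blast
  have "tw_comp sOp g f = h"
    using mor_ext[OF okc lhom_of_hom(2)[OF h(1) u]] uc lc h by simp
  with h show "tw_comp sOp g f \<in> hom (Tw sOp) p u" by simp
  show "\<And>i. i < ?m \<Longrightarrow> uppL (tw_comp sOp g f) i = sub (\<lambda>j n. uppL g j) (uppL f i)" by (rule uc)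
  show "lowL (tw_comp sOp g f) = lowcomp (uppL g) (lowL g) (lowL f)" by (rule lc)
qed


section \<open>Vertices, evaluations and edges as morphisms\<close>

text \<open>The choice is unique by \<open>hom_eqI\<close> as soon as \<open>lhom p t U lo\<close>
  holds.\<close>

definition mor :: "(nat, nat) tree \<Rightarrow> (nat, nat) tree \<Rightarrow> (nat \<Rightarrow> (nat, nat) tree) \<Rightarrow>
    (nat option, nat) tree \<Rightarrow> (nat, nat) tree tw_mor" where
  "mor p t U lo = (SOME f. f \<in> hom (Tw sOp) p t \<and>
    (\<forall>i < length (vertices p). uppL f i = U i) \<and> lowL f = lo)"

lemma mor_props:
  assumes "lhom p t U lo"
  shows "mor p t U lo \<in> hom (Tw sOp) p t"
    "i < length (vertices p) \<Longrightarrow> uppL (mor p t U lo) i = U i" "lowL (mor p t U lo) = lo"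
proof -
  have "mor p t U lo \<in> hom (Tw sOp) p t \<and>
    (\<forall>i < length (vertices p). uppL (mor p t U lo) i = U i) \<and> lowL (mor p t U lo) = lo"
    unfolding mor_def using someI_ex[OF hom_of_lhom[OF assms, unfolded Bex_def]] .
  then show "mor p t U lo \<in> hom (Tw sOp) p t"
    "i < length (vertices p) \<Longrightarrow> uppL (mor p t U lo) i = U i" "lowL (mor p t U lo) = lo" by auto
qed

lemma plug_cor_None: "leaves z \<in> perms n \<Longrightarrow> plug z (cor None n) = z"
  by (simp add: plug_def sub_cor)

text \<open>An upper morphism has a corolla as its lower tree; precomposing with it does not change
  the lower tree.\<close>

lemma lowcomp_cor_right:
  assumes "distinct (vlabels lo)" "(None, n) \<in> set (vertices lo)"
  shows "lowcomp V lo (cor None n) = lo"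
proof -
  have "lowcomp V lo (cor None n) = sub (plugs (\<lambda>j. cor (Some j)) (cor None n)) lo"
    by (simp add: lowcomp_def sub_cor)
  also have "\<dots> = sub cor lo"
  proof (rule sub_cong)
    fix a k assume "(a, k) \<in> set (vertices lo)"
    then show "plugs (\<lambda>j. cor (Some j)) (cor None n) a k = cor a k"
      using distinct_vlabelsD[OF assms(1) _ assms(2)] by (cases a) auto
  qed
  finally show ?thesis by simp
qed

text \<open>Restriction along this morphism reads off the decoration of vertex \<open>i\<close>. The
  lower tree is \<open>T\<close> itself with \<open>i\<close> marked, since everything but this
  vertex lies outside the corolla.\<close>

definition vtx :: "(nat, nat) tree \<Rightarrow> nat \<Rightarrow> (nat, nat) tree tw_mor" where
  "vtx T i = mor (cor 0 (inp sOp T ! i)) T (\<lambda>_. cor i (inp sOp T ! i))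
    (vmap (\<lambda>j. if j = i then None else Some j) T)"

lemma lhom_vtx:
  assumes "T \<in> Ops sOp" "i < length (vertices T)"
  shows "lhom (cor 0 (inp sOp T ! i)) T (\<lambda>_. cor i (inp sOp T ! i))
    (vmap (\<lambda>j. if j = i then None else Some j) T)"
proof -
  let ?n = "inp sOp T ! i" and ?r = "\<lambda>j. if j = i then None else Some j"
  have "distinct (map ?r (vlabels T))"
    by (rule iffD2[OF distinct_map])
      (use perms_distinct[OF sOp_Ops_vlabels[OF assms(1)]] in \<open>auto simp: inj_on_def split: if_splits\<close>)
  moreover have "(None, ?n) \<in> set (vertices (vmap ?r T))"
    using sOp_vertex[OF assms] by (force simp: vertices_map_tree)
  moreover have "plug (cor i ?n) (vmap ?r T) = sub cor T"
    unfolding plug_def sub_vmap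
  proof (rule sub_cong)
    fix j k assume "(j, k) \<in> set (vertices T)"
    then show "plugs cor (cor i ?n) (?r j) k = cor j k"
      using sOp_inp_nth[OF assms(1)] by auto
  qed
  ultimately show ?thesis
    unfolding lhom_def using assms(1) by (simp add: sub_cor)
qed

lemma vtx_hom: "T \<in> Ops sOp \<Longrightarrow> i < length (vertices T) \<Longrightarrow>
    vtx T i \<in> hom (Tw sOp) (cor 0 (inp sOp T ! i)) T"
  and uppL_vtx: "T \<in> Ops sOp \<Longrightarrow> i < length (vertices T) \<Longrightarrow>
    uppL (vtx T i) 0 = cor i (inp sOp T ! i)"
  and lowL_vtx: "T \<in> Ops sOp \<Longrightarrow> i < length (vertices T) \<Longrightarrow>
    lowL (vtx T i) = vmap (\<lambda>j. if j = i then None else Some j) T"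
  unfolding vtx_def using mor_props[OF lhom_vtx] by simp_all

text \<open>If the upper tree is a corolla, then \<open>T\<close> is the lower tree with its mark
  renamed \<open>i\<close>, and \<open>i\<close> labels no other vertex. Marking \<open>i\<close> in
  \<open>T\<close> therefore gives the lower tree back.\<close>

lemma vtx_unique:
  assumes "h \<in> hom (Tw sOp) (cor 0 n) T" "T \<in> Ops sOp" "uppL h 0 = cor i k"
  shows "i < length (vertices T)" "n = inp sOp T ! i" "k = n" "h = vtx T i"
proof -
  note l = lhomD[OF lhom_of_hom(1)[OF assms(1,2)]]
  have "leaves (uppL h 0) \<in> perms n" using l(10)[of 0] by simp
  then have "length (leaves (uppL h 0)) = n" by (rule perms_length)
  then show k: "k = n" using assms(3) by simp
  have s: "sub (\<lambda>i n. uppL h i) (cor 0 n) = cor i n"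
    using assms(3) k by (simp add: sub_cor)
  have "(i, n) \<in> set (vertices T)"
    using lhom_vertices(3)[OF lhom_of_hom(1)[OF assms(1,2)]] unfolding s by simp
  then show i: "i < length (vertices T)" and n: "n = inp sOp T ! i"
    using sOp_inp_nth[OF assms(2)] by auto
  let ?r = "\<lambda>j. if j = i then None else Some j"
  have ne: "j \<noteq> i" if "(Some j, m) \<in> set (vertices (lowL h))" for j m
  proof
    assume "j = i"
    then have "Some i \<in> set (vlabels (lowL h))" using that by force
    then have "i \<in> set (map the (filter (\<lambda>a. a \<noteq> None) (vlabels (lowL h))))" by force
    moreover have "distinct (i # map the (filter (\<lambda>a. a \<noteq> None) (vlabels (lowL h))))"
    proof -
      have "mset (vlabels T) = mset (i # map the (filter (\<lambda>a. a \<noteq> None) (vlabels (lowL h))))"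
        using lhom_labels[OF lhom_of_hom(1)[OF assms(1,2)]] by (simp add: assms(3))
      then show ?thesis
        using perms_distinct[OF sOp_Ops_vlabels[OF assms(2)]] mset_eq_imp_distinct_iff by blast
    qed
    ultimately show False by simp
  qed
  have "vmap ?r T = sub (\<lambda>a m. vmap ?r (plugs cor (cor i n) a m)) (lowL h)"
    using l(5,8) unfolding s plug_def by (simp add: vmap_sub)
  also have "\<dots> = sub cor (lowL h)"
  proof (rule sub_cong)
    fix a m assume a: "(a, m) \<in> set (vertices (lowL h))"
    have N: "(None, n) \<in> set (vertices (lowL h))" using l(7) by simp
    show "vmap ?r (plugs cor (cor i n) a m) = cor a m"
      using a ne distinct_vlabelsD[OF l(6) _ N] by (cases a) auto
  qed
  finally have lo: "lowL h = vmap ?r T" by simp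
  show "h = vtx T i"
    using hom_eqI[OF assms(1) vtx_hom[OF assms(2) i, folded n]]
      lo lowL_vtx[OF assms(2) i] uppL_vtx[OF assms(2) i] assms(3) k n by simp
qed

text \<open>The whole of \<open>T\<close> is the upper tree and the lower tree is trivial, so
  restriction along this morphism composes a decorated tree to a single operation.\<close>

definition evm :: "(nat, nat) tree \<Rightarrow> (nat, nat) tree tw_mor" where
  "evm T = mor (cor 0 (length (leaves T))) T (\<lambda>_. T) (cor None (length (leaves T)))"

lemma lhom_upper:
  assumes "p \<in> Ops sOp" "\<And>i. i < length (vertices p) \<Longrightarrow> leaves (U i) \<in> perms (inp sOp p ! i)"
    "sub (\<lambda>i n. U i) p \<in> Ops sOp"
  shows "lhom p (sub (\<lambda>i n. U i) p) U (cor None (length (leaves p)))"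
proof -
  have "mset (leaves (sub (\<lambda>i n. U i) p)) = mset (leaves p)"
    by (rule leaves_sub[OF fits_uppL[OF assms(1,2)]])
  then have "leaves (sub (\<lambda>i n. U i) p) \<in> perms (length (leaves p))"
    using sOp_Ops_leaves[OF assms(1)] unfolding perms_iff by simp
  then show ?thesis unfolding lhom_def using assms by (simp add: plug_cor_None)
qed

lemma lhom_ev:
  assumes "T \<in> Ops sOp"
  shows "lhom (cor 0 (length (leaves T))) T (\<lambda>_. T) (cor None (length (leaves T)))"
  using lhom_upper[of "cor 0 (length (leaves T))" "\<lambda>_. T"] assms sOp_Ops_leaves[OF assms]
  by (simp add: sub_cor)

lemma evm_hom: "T \<in> Ops sOp \<Longrightarrow> evm T \<in> hom (Tw sOp) (cor 0 (length (leaves T))) T"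
  and uppL_evm: "T \<in> Ops sOp \<Longrightarrow> uppL (evm T) 0 = T"
  and lowL_evm: "T \<in> Ops sOp \<Longrightarrow> lowL (evm T) = cor None (length (leaves T))"
  unfolding evm_def using mor_props[OF lhom_ev] by simp_all

text \<open>Refining the vertices of \<open>t\<close> does not change its total composite: a corolla
  mapped to all of \<open>t\<close> is then mapped to all of \<open>u\<close>.\<close>

lemma upper_evm:
  assumes g: "g \<in> hom (Tw sOp) t u" and t: "t \<in> Ops sOp" and u: "u \<in> Ops sOp"
    and lo: "lowL g = cor None (length (leaves t))"
  shows "tw_comp sOp g (evm t) = evm u" "length (leaves u) = length (leaves t)"
proof -
  note l = lhomD[OF lhom_of_hom(1)[OF g u]]
  have ut: "u = sub (\<lambda>i n. uppL g i) t"
    using l(8) plug_cor_None[OF l(4)] lo by simp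
  show len: "length (leaves u) = length (leaves t)"
    using perms_length[OF l(4)] ut by simp
  note c = tw_comp_hom[OF evm_hom[OF t] g t u]
  show "tw_comp sOp g (evm t) = evm u"
  proof (rule hom_eqI[OF c(1) evm_hom[OF u, unfolded len]])
    fix i assume "i < length (vertices (cor 0 (length (leaves t)) :: (nat, nat) tree))"
    then show "uppL (tw_comp sOp g (evm t)) i = uppL (evm u) i"
      using c(2)[of 0] by (simp add: uppL_evm[OF t] uppL_evm[OF u] ut[symmetric])
  next
    show "lowL (tw_comp sOp g (evm t)) = lowL (evm u)"
      unfolding c(3) lo lowL_evm[OF t] lowL_evm[OF u] len
      by (rule lowcomp_cor_right) simp_all
  qed
qed

lemma tw_id_hom:
  assumes p: "p \<in> Ops sOp"
  shows "tw_id sOp p \<in> hom (Tw sOp) p p"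
    "i < length (vertices p) \<Longrightarrow> uppL (tw_id sOp p) i = cor i (inp sOp p ! i)"
    "lowL (tw_id sOp p) = cor None (length (leaves p))"
proof -
  let ?f = "tw_id sOp p"
  show u: "uppL ?f i = cor i (inp sOp p ! i)" if "i < length (vertices p)" for i
    using that by (simp add: uppL_def tw_id_def)
  show l: "lowL ?f = cor None (length (leaves p))"
    by (simp add: lowL_def tw_id_def)
  have c: "concat (map (\<lambda>i. [i]) xs) = xs" for xs :: "nat list" by (induction xs) auto
  have v: "tw_valid sOp p ?f"
    unfolding tw_valid_def
  proof (intro conjI)
    show "composable sOp p (upp ?f)"
      using p by (simp add: sOp_composable tw_id_def)
    show "map length (upp_labels ?f) = map (arity sOp) (upp ?f)"
      by (rule nth_equalityI) (simp_all add: tw_id_def)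
    show "tw_labels ?f \<in> perms (length (tw_labels ?f))"
      by (simp add: tw_labels_def tw_id_def c)
  qed (auto simp: tw_id_def)
  have "sub (\<lambda>i n. uppL ?f i) p = sub cor p"
    using u sOp_inp_nth[OF p] by (intro sub_cong) auto
  then have "tw_target sOp p ?f = p"
    unfolding tw_target_plug[OF v] l using sOp_Ops_leaves[OF p] by (simp add: plug_cor_None)
  with v show "?f \<in> hom (Tw sOp) p p" by (simp add: Tw_hom)
qed

text \<open>So over a corolla, both the decoration of the only vertex and the total composite of an
  element are the element itself.\<close>

lemma tw_id_cor:
  "vtx (cor 0 n) 0 = tw_id sOp (cor 0 n)" "evm (cor 0 n) = tw_id sOp (cor 0 n)"
proof -
  note i = tw_id_hom[of "cor 0 n"]
  show "vtx (cor 0 n) 0 = tw_id sOp (cor 0 n)"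
    using vtx_unique(4)[OF i(1), of 0 n] i(2)[of 0] by simp
  show "evm (cor 0 n) = tw_id sOp (cor 0 n)"
    using vtx_unique(4)[OF evm_hom[of "cor 0 n"], of 0 n]
      vtx_unique(4)[OF i(1), of 0 n] i(2)[of 0] by (simp add: uppL_evm)
qed

text \<open>The \<open>i\<close>-th upper tree of \<open>f\<close> as a lower morphism into the target of \<open>f\<close>.\<close>

definition ell :: "(nat, nat) tree \<Rightarrow> (nat, nat) tree \<Rightarrow> (nat, nat) tree tw_mor \<Rightarrow> nat \<Rightarrow>
    (nat, nat) tree tw_mor" where
  "ell p t f i = mor (upp f ! i) t
    (\<lambda>k. cor (upp_labels f ! i ! k) (inp sOp (upp f ! i) ! k)) (lowL (tw_comp sOp f (vtx p i)))"

text \<open>Factors \<open>f\<close> on vertex \<open>i\<close> through the upper tree: evaluate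
  that tree, then include it into \<open>t\<close>, where its vertices are vertices of
  \<open>t\<close>. Restricting to vertex \<open>i\<close> of \<open>p\<close> thus means evaluating
  a part of the decoration of \<open>t\<close>.\<close>

lemma ell:
  assumes f: "f \<in> hom (Tw sOp) p t" and p: "p \<in> Ops sOp" and t: "t \<in> Ops sOp"
    and i: "i < length (vertices p)"
  shows "ell p t f i \<in> hom (Tw sOp) (upp f ! i) t"
    "upp f ! i \<in> Ops sOp" "length (leaves (upp f ! i)) = inp sOp p ! i"
    "tw_comp sOp (ell p t f i) (evm (upp f ! i)) = tw_comp sOp f (vtx p i)"
    "k < length (vertices (upp f ! i)) \<Longrightarrow>
      tw_comp sOp (ell p t f i) (vtx (upp f ! i) k) = vtx t (upp_labels f ! i ! k)"
    "k < length (vertices (upp f ! i)) \<Longrightarrow> upp_labels f ! i ! k < length (vertices t)"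
    "k < length (vertices (upp f ! i)) \<Longrightarrow>
      inp sOp (upp f ! i) ! k = inp sOp t ! (upp_labels f ! i ! k)"
proof -
  let ?q = "upp f ! i" and ?ls = "upp_labels f ! i" and ?n = "inp sOp p ! i"
  note lf = lhom_of_hom[OF f t]
  show q: "?q \<in> Ops sOp" using lf(2) i by (auto simp: mor_ok_def)
  have lq: "leaves ?q \<in> perms ?n" using lhomD(10)[OF lf(1) i] by (simp add: uppL_def)
  then show len: "length (leaves ?q) = ?n" by (rule perms_length)
  note c = tw_comp_hom[OF vtx_hom[OF p i] f p t]
  have cu: "uppL (tw_comp sOp f (vtx p i)) 0 = uppL f i"
    using c(2)[of 0] lhomD(10)[OF lf(1) i] by (simp add: uppL_vtx p i sub_cor)
  note lc = lhomD[OF lhom_of_hom(1)[OF c(1) t]]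
  have s1: "sub (\<lambda>j n. uppL (tw_comp sOp f (vtx p i)) j) (cor 0 ?n) = uppL f i"
    using cu lhomD(10)[OF lf(1) i] by (simp add: sub_cor)
  have s2: "sub (\<lambda>k n. cor (?ls ! k) (inp sOp ?q ! k)) ?q = uppL f i"
  proof -
    have "sub (\<lambda>k n. cor (?ls ! k) (inp sOp ?q ! k)) ?q = sub (\<lambda>k n. cor (?ls ! k) n) ?q"
      using sOp_inp_nth[OF q] by (intro sub_cong) auto
    also have "\<dots> = sub cor (uppL f i)" by (simp add: uppL_def sub_vmap)
    finally show ?thesis by simp
  qed
  have lh: "lhom ?q t (\<lambda>k. cor (?ls ! k) (inp sOp ?q ! k)) (lowL (tw_comp sOp f (vtx p i)))"
    unfolding lhom_def s2 using q t lc(6,7,8) len s1 by simp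
  note m = mor_props[OF lh, folded ell_def]
  show hom: "ell p t f i \<in> hom (Tw sOp) ?q t" by (rule m(1))
  show "tw_comp sOp (ell p t f i) (evm ?q) = tw_comp sOp f (vtx p i)"
  proof -
    note e = tw_comp_hom[OF evm_hom[OF q] hom q t, unfolded len]
    show ?thesis
    proof (rule hom_eqI[OF e(1) c(1)])
      fix j assume "j < length (vertices (cor 0 ?n :: (nat, nat) tree))"
      then have j: "j = 0" by simp
      have "sub (\<lambda>j n. uppL (ell p t f i) j) ?q = sub (\<lambda>k n. cor (?ls ! k) (inp sOp ?q ! k)) ?q"
        using m(2) sOp_inp_nth[OF q] by (intro sub_cong) auto
      then show "uppL (tw_comp sOp (ell p t f i) (evm ?q)) j = uppL (tw_comp sOp f (vtx p i)) j"
        using e(2)[of 0] cu s2 by (simp add: uppL_evm q j)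
    next
      show "lowL (tw_comp sOp (ell p t f i) (evm ?q)) = lowL (tw_comp sOp f (vtx p i))"
        unfolding e(3) m(3) lowL_evm[OF q] len
        using lc(6,7) by (intro lowcomp_cor_right) simp_all
    qed
  qed
  assume k: "k < length (vertices ?q)"
  note v = tw_comp_hom[OF vtx_hom[OF q k] hom q t]
  have "uppL (tw_comp sOp (ell p t f i) (vtx ?q k)) 0 = cor (?ls ! k) (inp sOp ?q ! k)"
    using v(2)[of 0] m(2)[OF k] by (simp add: uppL_vtx q k sub_cor)
  note u = vtx_unique[OF v(1) t this]
  show "tw_comp sOp (ell p t f i) (vtx ?q k) = vtx t (?ls ! k)" by (rule u(4))
  show "?ls ! k < length (vertices t)" by (rule u(1))
  show "inp sOp ?q ! k = inp sOp t ! (?ls ! k)" by (rule u(2))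
qed

text \<open>The lower tree of \<open>f\<close> as the source of an upper morphism into the target of \<open>f\<close>.\<close>

definition wlow :: "(nat, nat) tree \<Rightarrow> (nat, nat) tree \<Rightarrow> (nat, nat) tree tw_mor \<Rightarrow>
    (nat, nat) tree tw_mor" where
  "wlow p t f = mor (low f) t (\<lambda>j. case j of 0 \<Rightarrow> sub (\<lambda>i n. uppL f i) p
    | Suc k \<Rightarrow> cor (low_labels f ! k) (inp sOp (low f) ! j)) (cor None (length (leaves t)))"

text \<open>The counterpart of \<open>ell\<close> below \<open>p\<close>: restricting along
  \<open>wlow p t f\<close> keeps the total, decorates vertex 0 of the lower tree by the total over
  \<open>p\<close>, and decorates the other vertices as in \<open>t\<close>.\<close>

lemma wlow:
  assumes f: "f \<in> hom (Tw sOp) p t" and p: "p \<in> Ops sOp" and t: "t \<in> Ops sOp"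
  shows "wlow p t f \<in> hom (Tw sOp) (low f) t" "low f \<in> Ops sOp"
    "inp sOp (low f) ! 0 = length (leaves p)" "length (vertices (low f)) = Suc (length (low_labels f))"
    "length (leaves (low f)) = length (leaves t)"
    "tw_comp sOp (wlow p t f) (evm (low f)) = evm t"
    "tw_comp sOp (wlow p t f) (vtx (low f) 0) = tw_comp sOp f (evm p)"
    "k < length (low_labels f) \<Longrightarrow>
      tw_comp sOp (wlow p t f) (vtx (low f) (Suc k)) = vtx t (low_labels f ! k)"
    "k < length (low_labels f) \<Longrightarrow> low_labels f ! k < length (vertices t)"
    "k < length (low_labels f) \<Longrightarrow> inp sOp (low f) ! Suc k = inp sOp t ! (low_labels f ! k)"
proof -
  let ?q = "low f"
  let ?W = "\<lambda>j. case j of 0 \<Rightarrow> sub (\<lambda>i n. uppL f i) p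
    | Suc k \<Rightarrow> cor (low_labels f ! k) (inp sOp ?q ! j)"
  note lf = lhom_of_hom[OF f t]
  note l = lhomD[OF lf(1)]
  note q' = lowL_vertices_low[OF f]
  show q: "?q \<in> Ops sOp" and lenq: "length (vertices ?q) = Suc (length (low_labels f))"
    by (rule q')+
  show in0: "inp sOp ?q ! 0 = length (leaves p)"
    using tw_validD(7) f by (auto simp: Tw_hom)
  have ml: "mset (leaves ?q) = mset (leaves t)" using l(9) by (simp add: lowL_def)
  then show len: "length (leaves ?q) = length (leaves t)" by (rule mset_eq_length)
  have sW: "sub (\<lambda>j n. ?W j) ?q = t"
  proof -
    have "sub (\<lambda>j n. ?W j) ?q =
        sub (\<lambda>j n. plugs cor (sub (\<lambda>i n. uppL f i) p) (lname (low_labels f) j) n) ?q"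
    proof (rule sub_cong)
      fix j n assume "(j, n) \<in> set (vertices ?q)"
      then have "inp sOp ?q ! j = n" using sOp_inp_nth[OF q] by blast
      then show "?W j = plugs cor (sub (\<lambda>i n. uppL f i) p) (lname (low_labels f) j) n"
        by (cases j) simp_all
    qed
    then show ?thesis using l(8) by (simp add: plug_def lowL_def sub_vmap)
  qed
  have lW: "leaves (?W j) \<in> perms (inp sOp ?q ! j)" for j
    using l(4) in0 by (cases j) simp_all
  have lh: "lhom ?q t ?W (cor None (length (leaves t)))"
    using lhom_upper[of ?q ?W, OF q lW] t unfolding sW len by blast
  note m = mor_props[OF lh, folded wlow_def]
  show hom: "wlow p t f \<in> hom (Tw sOp) ?q t" by (rule m(1))
  show "tw_comp sOp (wlow p t f) (evm ?q) = evm t"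
    by (rule upper_evm(1)[OF hom q t]) (simp add: m(3) len)
  have z: "0 < length (vertices ?q)" using lenq by simp
  note c = tw_comp_hom[OF vtx_hom[OF q z] hom q t]
  note c' = tw_comp_hom[OF evm_hom[OF p] f p t]
  show "tw_comp sOp (wlow p t f) (vtx ?q 0) = tw_comp sOp f (evm p)"
  proof (rule hom_eqI[OF c(1)[unfolded in0] c'(1)])
    fix i assume "i < length (vertices (cor 0 (length (leaves p)) :: (nat, nat) tree))"
    then have i: "i = 0" by simp
    show "uppL (tw_comp sOp (wlow p t f) (vtx ?q 0)) i = uppL (tw_comp sOp f (evm p)) i"
      using c(2)[of 0] c'(2)[of 0] m(2)[OF z] l(4) in0
      by (simp add: i uppL_vtx[OF q z] uppL_evm[OF p] sub_cor)
  next
    let ?r = "\<lambda>j. if j = 0 then None else Some j"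
    let ?I = "sub (\<lambda>a n. case a of None \<Rightarrow> cor None n | Some j \<Rightarrow> vmap Some (uppL (wlow p t f) j))
      (vmap ?r ?q)"
    \<comment> \<open>Marking vertex 0 and inserting the upper trees of \<open>wlow p t f\<close> at
      the others renames vertex \<open>Suc k\<close> by the label at position \<open>k\<close>,
      which is how \<open>lowL f\<close> was defined.\<close>
    have I: "?I = lowL f"
    proof -
      have "?I = sub (\<lambda>j n. cor (lname (low_labels f) j) n) ?q"
        unfolding sub_vmap
      proof (rule sub_cong)
        fix j n assume j: "(j, n) \<in> set (vertices ?q)"
        show "(case ?r j of None \<Rightarrow> cor None n | Some j \<Rightarrow> vmap Some (uppL (wlow p t f) j)) =
            cor (lname (low_labels f) j) n"
          using sOp_inp_nth[OF q j] m(2)[of j] by (cases j) simp_all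
      qed
      also have "\<dots> = sub cor (lowL f)" by (simp add: lowL_def sub_vmap)
      finally show ?thesis by simp
    qed
    have "leaves (lowL f) \<in> perms (length (leaves t))"
      using l(9) sOp_Ops_leaves[OF t] unfolding perms_iff by simp
    then have "lowL (tw_comp sOp (wlow p t f) (vtx ?q 0)) = lowL f"
      unfolding c(3) m(3) lowL_vtx[OF q z] lowcomp_def I by (simp add: sub_cor)
    moreover have "lowL (tw_comp sOp f (evm p)) = lowL f"
      unfolding c'(3) lowL_evm[OF p] using l(6,7) by (rule lowcomp_cor_right)
    ultimately show "lowL (tw_comp sOp (wlow p t f) (vtx ?q 0)) = lowL (tw_comp sOp f (evm p))"
      by simp
  qed
  assume k: "k < length (low_labels f)"
  then have k': "Suc k < length (vertices ?q)" using lenq by simp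
  note v = tw_comp_hom[OF vtx_hom[OF q k'] hom q t]
  have "uppL (tw_comp sOp (wlow p t f) (vtx ?q (Suc k))) 0 =
      cor (low_labels f ! k) (inp sOp ?q ! Suc k)"
    using v(2)[of 0] m(2)[OF k'] by (simp add: uppL_vtx q k' sub_cor)
  note u = vtx_unique[OF v(1) t this]
  show "tw_comp sOp (wlow p t f) (vtx ?q (Suc k)) = vtx t (low_labels f ! k)" by (rule u(4))
  show "low_labels f ! k < length (vertices t)" by (rule u(1))
  show "inp sOp ?q ! Suc k = inp sOp t ! (low_labels f ! k)" by (rule u(2))
qed

section \<open>Evaluation of decorated trees\<close>

text \<open>\<open>rc\<close> is the colour of the root edge and \<open>wt\<close> says that the decoration \<open>\<delta>\<close> of the vertices is
  well typed; \<open>\<gamma>\<close> gives the colours of the leaves.\<close>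

primrec rc :: "('c, 'o) operad \<Rightarrow> ('v \<Rightarrow> 'o) \<Rightarrow> ('l \<Rightarrow> 'c) \<Rightarrow> ('v, 'l) tree \<Rightarrow> 'c" where
  "rc P \<delta> \<gamma> (Leaf l) = \<gamma> l"
| "rc P \<delta> \<gamma> (Vertex v ts) = out P (\<delta> v)"

primrec wt :: "('c, 'o) operad \<Rightarrow> ('v \<Rightarrow> 'o) \<Rightarrow> ('l \<Rightarrow> 'c) \<Rightarrow> ('v, 'l) tree \<Rightarrow> bool" where
  "wt P \<delta> \<gamma> (Leaf l) \<longleftrightarrow> \<gamma> l \<in> Col P"
| "wt P \<delta> \<gamma> (Vertex v ts) \<longleftrightarrow> \<delta> v \<in> Ops P \<and> inp P (\<delta> v) = map (rc P \<delta> \<gamma>) ts \<and>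
    list_all (\<lambda>b. b) (map (wt P \<delta> \<gamma>) ts)"

text \<open>Inputs are kept in planar order. Leaf numbers only select colours here; they become
  input numbers through the symmetric group action in \<open>Ev\<close>.\<close>

primrec eval :: "('c, 'o) operad \<Rightarrow> ('v \<Rightarrow> 'o) \<Rightarrow> ('l \<Rightarrow> 'c) \<Rightarrow> ('v, 'l) tree \<Rightarrow> 'o" where
  "eval P \<delta> \<gamma> (Leaf l) = ident P (\<gamma> l)"
| "eval P \<delta> \<gamma> (Vertex v ts) = comp P (\<delta> v) (map (eval P \<delta> \<gamma>) ts)"

lemma wt_Vertex: "wt P \<delta> \<gamma> (Vertex v ts) \<longleftrightarrow> \<delta> v \<in> Ops P \<and> inp P (\<delta> v) = map (rc P \<delta> \<gamma>) ts \<and>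
    (\<forall>t \<in> set ts. wt P \<delta> \<gamma> t)"
  by (simp add: list_all_iff)

declare wt.simps(2) [simp del]

lemma vlabels_child: "t \<in> set ts \<Longrightarrow> u \<in> set (vlabels t) \<Longrightarrow> u \<in> set (vlabels (Vertex v ts))"
  and leaves_child: "t \<in> set ts \<Longrightarrow> l \<in> set (leaves t) \<Longrightarrow> l \<in> set (leaves (Vertex v ts))"
  by auto

lemma rc_cong:
  "(\<And>v. v \<in> set (vlabels T) \<Longrightarrow> \<delta> v = \<delta>' v) \<Longrightarrow> (\<And>l. l \<in> set (leaves T) \<Longrightarrow> \<gamma> l = \<gamma>' l) \<Longrightarrow>
    rc P \<delta> \<gamma> T = rc P \<delta>' \<gamma>' T"
  by (cases T) auto

lemma wt_cong:
  "(\<And>v. v \<in> set (vlabels T) \<Longrightarrow> \<delta> v = \<delta>' v) \<Longrightarrow> (\<And>l. l \<in> set (leaves T) \<Longrightarrow> \<gamma> l = \<gamma>' l) \<Longrightarrow>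
    wt P \<delta> \<gamma> T = wt P \<delta>' \<gamma>' T"
proof (induction T)
  case (Vertex v ts)
  have r: "rc P \<delta> \<gamma> t = rc P \<delta>' \<gamma>' t" "wt P \<delta> \<gamma> t = wt P \<delta>' \<gamma>' t" if "t \<in> set ts" for t
  proof -
    have 1: "\<And>u. u \<in> set (vlabels t) \<Longrightarrow> \<delta> u = \<delta>' u"
      by (rule Vertex.prems(1)[OF vlabels_child[OF that]])
    have 2: "\<And>l. l \<in> set (leaves t) \<Longrightarrow> \<gamma> l = \<gamma>' l"
      by (rule Vertex.prems(2)[OF leaves_child[OF that]])
    show "rc P \<delta> \<gamma> t = rc P \<delta>' \<gamma>' t" by (rule rc_cong[OF 1 2])
    show "wt P \<delta> \<gamma> t = wt P \<delta>' \<gamma>' t" by (rule Vertex.IH[OF that 1 2])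
  qed
  have m: "map (rc P \<delta> \<gamma>) ts = map (rc P \<delta>' \<gamma>') ts" using r by simp
  show ?case unfolding wt_Vertex m using r(2) Vertex.prems(1)[of v] by simp
qed simp

lemma eval_cong:
  "(\<And>v. v \<in> set (vlabels T) \<Longrightarrow> \<delta> v = \<delta>' v) \<Longrightarrow> (\<And>l. l \<in> set (leaves T) \<Longrightarrow> \<gamma> l = \<gamma>' l) \<Longrightarrow>
    eval P \<delta> \<gamma> T = eval P \<delta>' \<gamma>' T"
proof (induction T)
  case (Vertex v ts)
  have "eval P \<delta> \<gamma> t = eval P \<delta>' \<gamma>' t" if "t \<in> set ts" for t
    by (rule Vertex.IH[OF that Vertex.prems(1)[OF vlabels_child[OF that]]
          Vertex.prems(2)[OF leaves_child[OF that]]])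
  then show ?case using Vertex.prems(1)[of v] by (simp cong: map_cong)
qed simp

lemma rc_map_tree: "rc P \<delta> \<gamma> (map_tree f g T) = rc P (\<lambda>v. \<delta> (f v)) (\<lambda>l. \<gamma> (g l)) T"
  by (cases T) auto

lemma wt_map_tree: "wt P \<delta> \<gamma> (map_tree f g T) = wt P (\<lambda>v. \<delta> (f v)) (\<lambda>l. \<gamma> (g l)) T"
  by (induction T) (auto simp: wt_Vertex rc_map_tree)

lemma eval_map_tree: "eval P \<delta> \<gamma> (map_tree f g T) = eval P (\<lambda>v. \<delta> (f v)) (\<lambda>l. \<gamma> (g l)) T"
  by (induction T) (auto cong: map_cong)

lemma wt_vertex:
  "wt P \<delta> \<gamma> T \<Longrightarrow> (v, n) \<in> set (vertices T) \<Longrightarrow> \<delta> v \<in> Ops P \<and> arity P (\<delta> v) = n"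
  by (induction T) (auto simp: wt_Vertex arity_def)

text \<open>Every leaf is an input of some vertex, whose decoration fixes its colour, unless the
  tree is nothing but that leaf.\<close>

lemma wt_leaves_unique:
  "wt P \<delta> \<gamma> T \<Longrightarrow> wt P \<delta> \<gamma>' T \<Longrightarrow> (\<And>l. T \<noteq> Leaf l) \<Longrightarrow> l \<in> set (leaves T) \<Longrightarrow> \<gamma> l = \<gamma>' l"
proof (induction T)
  case (Vertex v ts)
  then obtain t where t: "t \<in> set ts" "l \<in> set (leaves t)" by auto
  have "map (rc P \<delta> \<gamma>) ts = map (rc P \<delta> \<gamma>') ts" using Vertex.prems by (simp add: wt_Vertex)
  then have r: "rc P \<delta> \<gamma> t = rc P \<delta> \<gamma>' t" using t(1) by simp
  show ?case
  proof (cases t)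
    case (Leaf l')
    then show ?thesis using r t(2) by simp
  next
    case (Vertex w us)
    have "wt P \<delta> \<gamma> t" "wt P \<delta> \<gamma>' t" using Vertex.prems(1,2) t(1) by (simp_all add: wt_Vertex)
    then show ?thesis by (rule Vertex.IH[OF t(1) _ _ _ t(2)]) (simp add: Vertex)
  qed
qed blast

text \<open>Colours propagate from the leaves to the root: the edges above a vertex fix the inputs
  of its decoration, these fix the decoration by assumption, and the decoration fixes the edge
  below.\<close>

lemma wt_unique:
  "wt P ys \<gamma> T \<Longrightarrow> wt P ys' \<gamma> T \<Longrightarrow>
    (\<And>v. v \<in> set (vlabels T) \<Longrightarrow> inp P (ys v) = inp P (ys' v) \<Longrightarrow> ys v = ys' v) \<Longrightarrow>
    rc P ys \<gamma> T = rc P ys' \<gamma> T \<and> (\<forall>v \<in> set (vlabels T). ys v = ys' v)"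
proof (induction T)
  case (Vertex v ts)
  have IH: "rc P ys \<gamma> t = rc P ys' \<gamma> t \<and> (\<forall>v \<in> set (vlabels t). ys v = ys' v)"
    if t: "t \<in> set ts" for t
  proof (rule Vertex.IH[OF t])
    show "wt P ys \<gamma> t" "wt P ys' \<gamma> t" using Vertex.prems(1,2) t by (simp_all add: wt_Vertex)
    fix u assume "u \<in> set (vlabels t)"
    then have "u \<in> set (vlabels (Vertex v ts))" using t by auto
    then show "inp P (ys u) = inp P (ys' u) \<Longrightarrow> ys u = ys' u" by (rule Vertex.prems(3))
  qed
  then have "map (rc P ys \<gamma>) ts = map (rc P ys' \<gamma>) ts" by simp
  then have "ys v = ys' v" using Vertex.prems by (simp add: wt_Vertex)
  then show ?case using IH by auto
qed simp

text \<open>Records the profile that a value must have without computing it. This makes sense before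
  composition is known to satisfy any axiom, which matters for the operad built from a
  presheaf.\<close>

definition Wt :: "('c, 'o) operad \<Rightarrow> ('v \<Rightarrow> 'o) \<Rightarrow> ('v, nat) tree \<Rightarrow> 'o \<Rightarrow> bool" where
  "Wt P \<delta> T x \<longleftrightarrow> x \<in> Ops P \<and> leaves T \<in> perms (arity P x) \<and>
    wt P \<delta> ((!) (inp P x)) T \<and> rc P \<delta> ((!) (inp P x)) T = out P x"

lemma Wt_inp_unique:
  assumes "Wt P \<delta> T x" "Wt P \<delta> T x'" "\<And>l. T \<noteq> Leaf l"
  shows "inp P x = inp P x'"
proof (rule nth_equalityI)
  show l: "length (inp P x) = length (inp P x')"
    using assms perms_length unfolding Wt_def arity_def by metis
  fix i assume "i < length (inp P x)"
  then have "i \<in> set (leaves T)" using assms(1) perms_set unfolding Wt_def arity_def by blast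
  then show "inp P x ! i = inp P x' ! i"
    using wt_leaves_unique[OF _ _ assms(3)] assms(1,2) unfolding Wt_def by blast
qed

text \<open>The only part of the operad structure that is available for the candidate operad of a
  presheaf before its axioms are proved.\<close>

locale typed_ops =
  fixes P :: "('c, 'o) operad"
  assumes typed_out: "p \<in> Ops P \<Longrightarrow> out P p \<in> Col P"
begin

lemma rc_Col: "wt P \<delta> \<gamma> T \<Longrightarrow> rc P \<delta> \<gamma> T \<in> Col P"
  by (cases T) (auto simp: wt_Vertex typed_out)

lemma rc_graft: "rc P \<delta> \<gamma> (graft u T) = rc P \<delta> (\<lambda>l. rc P \<delta> \<gamma> (u l)) T"
  by (cases T) auto

lemma wt_graft: "wt P \<delta> \<gamma> (graft u T) \<longleftrightarrow>
    wt P \<delta> (\<lambda>l. rc P \<delta> \<gamma> (u l)) T \<and> (\<forall>l \<in> set (leaves T). wt P \<delta> \<gamma> (u l))"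
proof (induction T)
  case (Vertex v ts)
  then show ?case by (auto simp: wt_Vertex rc_graft)
qed (auto simp: rc_Col)

lemma wt_sub:
  assumes "\<And>v n. (v, n) \<in> set (vertices T) \<Longrightarrow> Wt P \<delta> (s v n) (ys v)" "wt P ys \<gamma> T"
  shows "wt P \<delta> \<gamma> (sub s T) \<and> rc P \<delta> \<gamma> (sub s T) = rc P ys \<gamma> T"
  using assms
proof (induction T)
  case (Vertex v ts)
  let ?S = "s v (length ts)" and ?y = "ys v" and ?ts = "map (sub s) ts"
  have IH: "wt P \<delta> \<gamma> (sub s t) \<and> rc P \<delta> \<gamma> (sub s t) = rc P ys \<gamma> t" if "t \<in> set ts" for t
    using Vertex that by (auto simp: wt_Vertex)
  have S: "Wt P \<delta> ?S ?y" using Vertex.prems(1) by simp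
  have y: "inp P ?y = map (rc P ys \<gamma>) ts" using Vertex.prems(2) by (simp add: wt_Vertex)
  have L: "leaves ?S \<in> perms (length ts)" using S y by (simp add: Wt_def arity_def)
  have l: "l < length ts" if "l \<in> set (leaves ?S)" for l
    using that perms_set[OF L] by simp
  have g: "inp P ?y ! l = rc P \<delta> \<gamma> (?ts ! l)" if "l \<in> set (leaves ?S)" for l
    using IH y l[OF that] by simp
  have w: "wt P \<delta> (\<lambda>l. rc P \<delta> \<gamma> (?ts ! l)) ?S"
    using S wt_cong[of ?S \<delta> \<delta> "(!) (inp P ?y)" "\<lambda>l. rc P \<delta> \<gamma> (?ts ! l)"] g unfolding Wt_def by blast
  have r: "rc P \<delta> (\<lambda>l. rc P \<delta> \<gamma> (?ts ! l)) ?S = out P ?y"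
    using S rc_cong[of ?S \<delta> \<delta> "(!) (inp P ?y)" "\<lambda>l. rc P \<delta> \<gamma> (?ts ! l)"] g unfolding Wt_def
    by metis
  show ?case using w r IH l by (simp add: wt_graft rc_graft)
qed simp

lemma Wt_sub:
  assumes "\<And>v n. (v, n) \<in> set (vertices T) \<Longrightarrow> Wt P \<delta> (s v n) (ys v)" "Wt P ys T x"
  shows "Wt P \<delta> (sub s T) x" "fits s T"
proof -
  have w: "wt P ys ((!) (inp P x)) T" using assms(2) by (simp add: Wt_def)
  show f: "fits s T"
  proof -
    have "leaves (s v n) \<in> perms n" if a: "(v, n) \<in> set (vertices T)" for v n
    proof -
      have "leaves (s v n) \<in> perms (arity P (ys v))" using assms(1)[OF a] by (simp add: Wt_def)
      then show ?thesis using wt_vertex[OF w a] by simp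
    qed
    then show ?thesis by (auto simp: fits_def)
  qed
  show "Wt P \<delta> (sub s T) x"
    using wt_sub[OF assms(1) w] assms(2) unfolding Wt_def perms_iff leaves_sub[OF f] by simp
qed

end

sublocale coloured_operad \<subseteq> typed_ops P
  by unfold_locales (rule out_Col)

lemma concat_index:
  assumes "k < length (concat xss)"
  obtains i a where "i < length xss" "a < length (xss ! i)" "k = block_start (map length xss) i + a"
proof -
  have "\<exists>i a. i < length xss \<and> a < length (xss ! i) \<and> k = block_start (map length xss) i + a"
    using assms
  proof (induction xss arbitrary: k)
    case (Cons xs xss)
    show ?case
    proof (cases "k < length xs")
      case True
      then show ?thesis by (intro exI[of _ 0] exI[of _ k]) simp
    next
      case False
      then have "k - length xs < length (concat xss)" using Cons.prems by simp
      from Cons.IH[OF this] obtain i a where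
        "i < length xss" "a < length (xss ! i)" "k - length xs = block_start (map length xss) i + a"
        by blast
      then show ?thesis using False by (intro exI[of _ "Suc i"] exI[of _ a]) simp
    qed
  qed simp
  then show ?thesis using that by blast
qed

lemma block_sum_perms:
  assumes "map length Ls = ns" "\<And>i. i < length Ls \<Longrightarrow> Ls ! i \<in> perms (ns ! i)"
  shows "block_sum Ls \<in> perms (sum_list ns)"
proof -
  have "mset (block_sum Ls) = (\<Sum>i\<leftarrow>[0..<length Ls]. mset (map ((+) (block_start ns i)) (Ls ! i)))"
    unfolding block_sum_def assms(1) mset_concat_sum by (simp add: o_def)
  also have "\<dots> = (\<Sum>i\<leftarrow>[0..<length Ls]. mset (map ((+) (block_start ns i)) [0..<ns ! i]))"
  proof (rule arg_cong[where f = sum_list], rule map_cong)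
    fix i assume "i \<in> set [0..<length Ls]"
    then have "mset (Ls ! i) = mset [0..<ns ! i]" using assms(2)[of i] unfolding perms_iff by simp
    then show "mset (map ((+) (block_start ns i)) (Ls ! i)) =
        mset (map ((+) (block_start ns i)) [0..<ns ! i])"
      by (simp only: mset_map)
  qed simp
  also have "\<dots> = mset (concat (map (\<lambda>i. map ((+) (block_start ns i)) [0..<ns ! i]) [0..<length ns]))"
    unfolding mset_concat_sum using assms(1) by (simp add: o_def flip: assms(1))
  finally show ?thesis unfolding perms_iff concat_blocks .
qed

lemma block_sum_nth:
  assumes "map length Ls = ns" "i < length Ls" "a < length (Ls ! i)"
  shows "block_sum Ls ! (block_start ns i + a) = block_start ns i + Ls ! i ! a"
proof -
  let ?X = "map (\<lambda>i. map ((+) (block_start ns i)) (Ls ! i)) [0..<length Ls]"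
  have X: "map length ?X = ns" unfolding assms(1)[symmetric] by (rule nth_equalityI) auto
  have "concat ?X ! (block_start ns i + a) = ?X ! i ! a"
    using concat_nth_block[of i ?X a] assms(2,3) unfolding X by simp
  then show ?thesis using assms by (simp add: block_sum_def)
qed

lemma upt_shift: "[m..<m + n] = map ((+) m) [0..<n]"
  by (rule nth_equalityI) auto

lemma block_perm_perms:
  assumes "L \<in> perms (length ns)" shows "block_perm ns L \<in> perms (sum_list ns)"
proof -
  let ?f = "\<lambda>j. mset (map ((+) (block_start ns j)) [0..<ns ! j])"
  have "mset (block_perm ns L) = (\<Sum>j\<leftarrow>L. ?f j)"
    unfolding block_perm_def mset_concat_sum upt_shift by (simp add: o_def)
  also have "\<dots> = (\<Sum>j\<leftarrow>[0..<length ns]. ?f j)"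
    using assms unfolding perms_iff by (rule sum_list_mset_cong)
  also have "\<dots> = mset (concat (map (\<lambda>i. map ((+) (block_start ns i)) [0..<ns ! i]) [0..<length ns]))"
    unfolding mset_concat_sum by (simp add: o_def)
  finally show ?thesis unfolding perms_iff concat_blocks .
qed

lemma block_perm_nth:
  assumes "i < length L" "a < ns ! (L ! i)"
  shows "block_perm ns L ! (block_start (map ((!) ns) L) i + a) = block_start ns (L ! i) + a"
proof -
  let ?X = "map (\<lambda>j. [block_start ns j ..< block_start ns j + ns ! j]) L"
  have X: "map length ?X = map ((!) ns) L" by simp
  have "concat ?X ! (block_start (map ((!) ns) L) i + a) = ?X ! i ! a"
    using concat_nth_block[of i ?X a] assms unfolding X by simp
  then show ?thesis using assms by (simp add: block_perm_def)
qed

section \<open>Evaluation in an operad and its compatibility with substitution\<close>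

context coloured_operad
begin

lemma eval_props:
  assumes "wt P \<delta> \<gamma> T"
  shows "eval P \<delta> \<gamma> T \<in> Ops P" "inp P (eval P \<delta> \<gamma> T) = map \<gamma> (leaves T)"
    "out P (eval P \<delta> \<gamma> T) = rc P \<delta> \<gamma> T"
proof -
  have "eval P \<delta> \<gamma> T \<in> Ops P \<and> inp P (eval P \<delta> \<gamma> T) = map \<gamma> (leaves T) \<and>
    out P (eval P \<delta> \<gamma> T) = rc P \<delta> \<gamma> T"
    using assms
  proof (induction T)
    case (Vertex v ts)
    then have c: "composable P (\<delta> v) (map (eval P \<delta> \<gamma>) ts)"
      by (auto simp: composable_def wt_Vertex)
    have "concat (map (inp P \<circ> eval P \<delta> \<gamma>) ts) = concat (map (map \<gamma> \<circ> leaves) ts)"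
      using Vertex by (intro arg_cong[where f = concat] map_cong) (auto simp: wt_Vertex)
    then show ?case
      using comp_Ops[OF c] comp_inp[OF c] comp_out[OF c] by (simp add: map_concat)
  qed (simp add: ident_Ops ident_inp ident_out)
  then show "eval P \<delta> \<gamma> T \<in> Ops P" "inp P (eval P \<delta> \<gamma> T) = map \<gamma> (leaves T)"
    "out P (eval P \<delta> \<gamma> T) = rc P \<delta> \<gamma> T" by auto
qed

lemma eval_composable:
  assumes "wt P \<delta> \<gamma> (Vertex v ts)"
  shows "composable P (\<delta> v) (map (eval P \<delta> \<gamma>) ts)"
  using assms eval_props[of \<delta> \<gamma>] by (auto simp: composable_def wt_Vertex)

text \<open>Associativity of composition iterated along the tree, with the left unit law at the
  leaves.\<close>

lemma eval_graft:
  "wt P \<delta> \<gamma> (graft u T) \<Longrightarrow> eval P \<delta> \<gamma> (graft u T) =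
    comp P (eval P \<delta> (\<lambda>l. rc P \<delta> \<gamma> (u l)) T) (map (\<lambda>l. eval P \<delta> \<gamma> (u l)) (leaves T))"
proof (induction T)
  case (Leaf l)
  then show ?case using eval_props[of \<delta> \<gamma> "u l"] comp_ident_left[of "eval P \<delta> \<gamma> (u l)"] by simp
next
  case (Vertex v ts)
  let ?e = "eval P \<delta> (\<lambda>l. rc P \<delta> \<gamma> (u l))"
  have w: "wt P \<delta> (\<lambda>l. rc P \<delta> \<gamma> (u l)) (Vertex v ts)"
    "\<And>t l. t \<in> set ts \<Longrightarrow> l \<in> set (leaves t) \<Longrightarrow> wt P \<delta> \<gamma> (u l)"
    using Vertex.prems unfolding wt_graft by auto
  note c = eval_composable[OF w(1)]
  let ?r = "map (\<lambda>t. map (\<lambda>l. eval P \<delta> \<gamma> (u l)) (leaves t)) ts"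
  have rc: "composable P (?e t) (map (\<lambda>l. eval P \<delta> \<gamma> (u l)) (leaves t))" if "t \<in> set ts" for t
    using eval_props[of \<delta> "\<lambda>l. rc P \<delta> \<gamma> (u l)" t] w that eval_props[of \<delta> \<gamma>]
    by (auto simp: composable_def wt_Vertex)
  have "list_all2 (composable P) (map ?e ts) ?r"
    using rc by (simp add: list_all2_conv_all_nth)
  from comp_assoc[OF c this]
  have "comp P (?e (Vertex v ts)) (concat ?r) = comp P (\<delta> v) (map2 (comp P) (map ?e ts) ?r)"
    by simp
  also have "map2 (comp P) (map ?e ts) ?r = map (\<lambda>t. eval P \<delta> \<gamma> (graft u t)) ts"
    using Vertex.IH Vertex.prems by (intro nth_equalityI) (auto simp: wt_Vertex)
  finally show ?case by (simp add: map_concat o_def)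
qed

text \<open>An operation whose inputs carry names, up to a simultaneous permutation of inputs and names.\<close>

definition lsim :: "'o \<Rightarrow> 'l list \<Rightarrow> 'o \<Rightarrow> 'l list \<Rightarrow> bool" where
  "lsim p ls q ms \<longleftrightarrow> p \<in> Ops P \<and> length ls = arity P p \<and> length ms = arity P p \<and>
    (\<exists>L \<in> perms (arity P p). q = act P p L \<and> (\<forall>k < arity P p. ms ! (L ! k) = ls ! k))"

lemma lsim_refl: "p \<in> Ops P \<Longrightarrow> length ls = arity P p \<Longrightarrow> lsim p ls p ls"
  unfolding lsim_def by (intro conjI bexI[of _ "[0..<arity P p]"]) (simp_all add: act_id)

lemma lsim_trans:
  assumes "lsim p ls q ms" "lsim q ms r ns" shows "lsim p ls r ns"
proof -
  obtain L where L: "p \<in> Ops P" "length ls = arity P p" "length ms = arity P p"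
    "L \<in> perms (arity P p)" "q = act P p L" "\<And>k. k < arity P p \<Longrightarrow> ms ! (L ! k) = ls ! k"
    using assms(1) unfolding lsim_def by blast
  have aq: "arity P q = arity P p" using act_arity L by simp
  obtain M where M: "length ns = arity P p" "M \<in> perms (arity P p)" "r = act P q M"
    "\<And>k. k < arity P p \<Longrightarrow> ns ! (M ! k) = ms ! k"
    using assms(2) unfolding lsim_def aq by blast
  have "r = act P p (map ((!) M) L)" using act_act[OF L(1,4) M(2)] L(5) M(3) by simp
  moreover have "ns ! (map ((!) M) L ! k) = ls ! k" if "k < arity P p" for k
    using M(4)[OF perms_nth[OF L(4) that]] L(6)[OF that] perms_length[OF L(4)] that by simp
  ultimately show ?thesis
    unfolding lsim_def using L(1,2) M(1) map_nth_perm[OF M(2) L(4)] by blast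
qed

text \<open>The inner equivariance axiom with names: each permutation acts inside its own block, and
  \<open>block_sum\<close> moves an input together with its name.\<close>

lemma lsim_inner:
  assumes c: "composable P p qs" and len: "length qs' = length qs" "length lss = length qs" "length mss = length qs"
    and s: "\<And>i. i < length qs \<Longrightarrow> lsim (qs ! i) (lss ! i) (qs' ! i) (mss ! i)"
  shows "lsim (comp P p qs) (concat lss) (comp P p qs') (concat mss)"
proof -
  have "\<exists>L. L \<in> perms (arity P (qs ! i)) \<and> qs' ! i = act P (qs ! i) L \<and>
      (\<forall>k < arity P (qs ! i). mss ! i ! (L ! k) = lss ! i ! k)" if "i < length qs" for i
    using s[OF that] unfolding lsim_def by blast
  then obtain Lf where Lf: "\<And>i. i < length qs \<Longrightarrow> Lf i \<in> perms (arity P (qs ! i))"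
    "\<And>i. i < length qs \<Longrightarrow> qs' ! i = act P (qs ! i) (Lf i)"
    "\<And>i k. i < length qs \<Longrightarrow> k < arity P (qs ! i) \<Longrightarrow> mss ! i ! (Lf i ! k) = lss ! i ! k"
    by metis
  let ?Ls = "map Lf [0..<length qs]" and ?ns = "map (arity P) qs"
  have l2: "list_all2 (\<lambda>q L. L \<in> perms (arity P q)) qs ?Ls"
    using Lf(1) by (simp add: list_all2_conv_all_nth)
  have e: "qs' = map2 (act P) qs ?Ls" using len Lf(2) by (intro nth_equalityI) simp_all
  have ns: "map length ?Ls = ?ns"
    using perms_length[OF Lf(1)] by (intro nth_equalityI) simp_all
  have lss: "map length lss = ?ns" and mss: "map length mss = ?ns"
    using s len unfolding lsim_def by (auto intro!: nth_equalityI)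
  have ar: "arity P (comp P p qs) = sum_list ?ns"
    using comp_inp[OF c] by (simp add: arity_def[abs_def] length_concat o_def)
  have q': "comp P p qs' = act P (comp P p qs) (block_sum ?Ls)"
    unfolding e by (rule comp_act_inner[OF c l2])
  have bs: "block_sum ?Ls \<in> perms (sum_list ?ns)"
    using Lf(1) by (intro block_sum_perms[OF ns]) simp
  have "concat mss ! (block_sum ?Ls ! k) = concat lss ! k" if k: "k < sum_list ?ns" for k
  proof -
    have "k < length (concat lss)" using k lss by (simp add: length_concat)
    then obtain i a where ia: "i < length lss" "a < length (lss ! i)" "k = block_start ?ns i + a"
      using concat_index lss by metis
    have i: "i < length qs" using ia len by simp
    have la: "length (lss ! i) = arity P (qs ! i)" "length (mss ! i) = arity P (qs ! i)"
      using arg_cong[where f = "\<lambda>xs. xs ! i", OF lss] arg_cong[where f = "\<lambda>xs. xs ! i", OF mss] i len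
      by simp_all
    then have a: "a < arity P (qs ! i)" using ia by simp
    have b: "block_sum ?Ls ! k = block_start ?ns i + Lf i ! a"
      using block_sum_nth[OF ns, of i a] i a perms_length[OF Lf(1)[OF i]] ia(3) by simp
    have "Lf i ! a < length (mss ! i)" using perms_nth[OF Lf(1)[OF i] a] la by simp
    then have "concat mss ! (block_start ?ns i + Lf i ! a) = mss ! i ! (Lf i ! a)"
      using concat_nth_block[of i mss] i len unfolding mss by simp
    moreover have "concat lss ! k = lss ! i ! a"
      using concat_nth_block[OF ia(1,2)] ia(3) unfolding lss by simp
    ultimately show ?thesis using b Lf(3)[OF i a] by simp
  qed
  moreover have "length (concat lss) = sum_list ?ns" "length (concat mss) = sum_list ?ns"
    using lss mss by (simp_all add: length_concat)
  ultimately show ?thesis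
    unfolding lsim_def ar using comp_Ops[OF c] bs q' by blast
qed

text \<open>The outer equivariance axiom with names: blocks change places as a whole, and the list
  of names is rearranged by the same block permutation.\<close>

lemma lsim_outer:
  assumes p: "p \<in> Ops P" and L: "L \<in> perms (arity P p)" and c: "composable P (act P p L) qs"
    and len: "map length lss = map (arity P) qs"
  shows "composable P p (map ((!) qs) L)"
    and "lsim (comp P p (map ((!) qs) L)) (concat (map ((!) lss) L)) (comp P (act P p L) qs) (concat lss)"
proof -
  let ?ns = "map (arity P) qs"
  have lq: "length qs = arity P p"
    using c act_arity[OF p L] unfolding composable_def arity_def by (metis length_map)
  have ll: "length lss = length qs" using len by (metis length_map)
  have o: "out P (qs ! i) = inp P (act P p L) ! i" if "i < length qs" for i
    using c that unfolding composable_def by (metis nth_map)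
  have "map (out P) (map ((!) qs) L) = inp P p"
  proof (rule nth_equalityI)
    show "length (map (out P) (map ((!) qs) L)) = length (inp P p)"
      using perms_length[OF L] by (simp add: arity_def)
    fix k assume "k < length (map (out P) (map ((!) qs) L))"
    then have k: "k < arity P p" using perms_length[OF L] by simp
    then show "map (out P) (map ((!) qs) L) ! k = inp P p ! k"
      using o[of "L ! k"] perms_nth[OF L k] lq perms_length[OF L] act_inp[OF p L k] by simp
  qed
  moreover have "set (map ((!) qs) L) \<subseteq> Ops P"
    using c perms_set[OF L] lq unfolding composable_def by auto
  ultimately show c': "composable P p (map ((!) qs) L)" using p by (simp add: composable_def)
  have ns: "map (arity P) (map ((!) qs) L) = map ((!) ?ns) L"
    using perms_set[OF L] lq by simp
  have ar: "arity P (comp P p (map ((!) qs) L)) = sum_list (map ((!) ?ns) L)"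
    using comp_inp[OF c'] unfolding ns[symmetric] by (simp add: arity_def[abs_def] length_concat o_def)
  have sum: "sum_list (map ((!) ?ns) L) = sum_list ?ns"
  proof -
    have "sum_list (map ((!) ?ns) L) = sum_list (map ((!) ?ns) [0..<length ?ns])"
      using L lq unfolding perms_iff by (intro sum_list_mset_cong) simp
    then show ?thesis by (simp only: map_nth)
  qed
  have bp: "block_perm ?ns L \<in> perms (sum_list ?ns)"
    using L lq by (intro block_perm_perms) simp
  have lsl: "map length (map ((!) lss) L) = map ((!) ?ns) L"
  proof -
    have "length (lss ! j) = ?ns ! j" if "j \<in> set L" for j
      using that perms_set[OF L] lq ll arg_cong[where f = "\<lambda>xs. xs ! j", OF len] by simp
    then show ?thesis by simp
  qed
  have "concat lss ! (block_perm ?ns L ! k) = concat (map ((!) lss) L) ! k"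
    if k: "k < sum_list (map ((!) ?ns) L)" for k
  proof -
    have "k < length (concat (map ((!) lss) L))" using k by (simp only: length_concat lsl)
    then obtain i a where ia: "i < length (map ((!) lss) L)" "a < length (map ((!) lss) L ! i)"
      "k = block_start (map ((!) ?ns) L) i + a"
      using concat_index lsl by metis
    have i: "i < length L" using ia by simp
    then have Li: "L ! i < length qs" using perms_nth[OF L] perms_length[OF L] lq by simp
    have a: "a < length (lss ! (L ! i))" "length (lss ! (L ! i)) = ?ns ! (L ! i)"
      using ia i Li ll arg_cong[where f = "\<lambda>xs. xs ! (L ! i)", OF len] by simp_all
    have "block_perm ?ns L ! k = block_start ?ns (L ! i) + a"
      using block_perm_nth[OF i] a ia(3) by simp
    moreover have "concat lss ! (block_start ?ns (L ! i) + a) = lss ! (L ! i) ! a"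
      using concat_nth_block[of "L ! i" lss a] Li a ll unfolding len by simp
    moreover have "concat (map ((!) lss) L) ! k = lss ! (L ! i) ! a"
      using concat_nth_block[OF ia(1,2)] ia(3) i unfolding lsl by simp
    ultimately show ?thesis by simp
  qed
  moreover have "length (concat (map ((!) lss) L)) = sum_list (map ((!) ?ns) L)"
    by (simp only: length_concat lsl)
  moreover have "length (concat lss) = sum_list ?ns" by (simp only: length_concat len)
  moreover have "comp P (act P p L) qs = act P (comp P p (map ((!) qs) L)) (block_perm ?ns L)"
    by (rule comp_act_outer[OF p L c])
  ultimately show "lsim (comp P p (map ((!) qs) L)) (concat (map ((!) lss) L))
      (comp P (act P p L) qs) (concat lss)"
    unfolding lsim_def ar using comp_Ops[OF c'] bp by (simp only: sum) blast
qed

text \<open>Once the names are numbers, moving every input to the position that it names removes the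
  remaining ambiguity of order.\<close>

lemma lsim_act:
  assumes "lsim p ls q ms" "ls \<in> perms (arity P p)" "ms \<in> perms (arity P p)"
  shows "act P p ls = act P q ms"
proof -
  obtain L where L: "p \<in> Ops P" "L \<in> perms (arity P p)" "q = act P p L"
    "\<And>k. k < arity P p \<Longrightarrow> ms ! (L ! k) = ls ! k"
    using assms(1) unfolding lsim_def by blast
  have "map ((!) ms) L = ls"
    using L(4) perms_length[OF L(2)] perms_length[OF assms(2)] by (intro nth_equalityI) simp_all
  then show ?thesis using act_act[OF L(1,2) assms(3)] L(3) by simp
qed

text \<open>\<open>x\<close> is a value of \<open>T\<close> decorated by \<open>\<delta>\<close>:
  the planar composite with its inputs moved to the leaf numbers. The leaf colours are read off from
  \<open>x\<close>, since the decoration need not determine them.\<close>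

definition Ev :: "('v \<Rightarrow> 'o) \<Rightarrow> ('v, nat) tree \<Rightarrow> 'o \<Rightarrow> bool" where
  "Ev \<delta> T x \<longleftrightarrow> Wt P \<delta> T x \<and> x = act P (eval P \<delta> ((!) (inp P x)) T) (leaves T)"

lemma Ev_Wt: "Ev \<delta> T x \<Longrightarrow> Wt P \<delta> T x"
  by (simp add: Ev_def)

text \<open>A substituted tree permutes the branches above its vertex, so the two composites agree
  only up to a permutation of inputs; \<open>lsim\<close> carries the leaf numbers through
  it.\<close>

lemma eval_sub:
  assumes "\<And>v n. (v, n) \<in> set (vertices T) \<Longrightarrow> Ev \<delta> (s v n) (ys v)" "wt P ys \<gamma> T"
  shows "lsim (eval P \<delta> \<gamma> (sub s T)) (leaves (sub s T)) (eval P ys \<gamma> T) (leaves T)"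
  using assms
proof (induction T)
  case (Leaf l)
  then show ?case by (auto intro!: lsim_refl simp: ident_Ops arity_def ident_inp)
next
  case (Vertex v ts)
  let ?S = "s v (length ts)" and ?y = "ys v" and ?ts = "map (sub s) ts"
  let ?L = "leaves ?S" and ?g = "\<lambda>l. rc P \<delta> \<gamma> (?ts ! l)"
  have w: "wt P \<delta> \<gamma> (sub s (Vertex v ts))"
    using wt_sub[where s = s and T = "Vertex v ts", OF Ev_Wt[OF Vertex.prems(1)] Vertex.prems(2)]
    by blast
  have IH: "lsim (eval P \<delta> \<gamma> (sub s t)) (leaves (sub s t)) (eval P ys \<gamma> t) (leaves t)"
    and rt: "wt P \<delta> \<gamma> (sub s t)" "rc P \<delta> \<gamma> (sub s t) = rc P ys \<gamma> t" if "t \<in> set ts" for t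
  proof -
    have t: "wt P ys \<gamma> t" using Vertex.prems(2) that by (simp add: wt_Vertex)
    have s: "Ev \<delta> (s v n) (ys v)" if "(v, n) \<in> set (vertices t)" for v n
      using Vertex.prems(1) that \<open>t \<in> set ts\<close> by auto
    show "lsim (eval P \<delta> \<gamma> (sub s t)) (leaves (sub s t)) (eval P ys \<gamma> t) (leaves t)"
      by (rule Vertex.IH[OF that s t])
    show "wt P \<delta> \<gamma> (sub s t)" "rc P \<delta> \<gamma> (sub s t) = rc P ys \<gamma> t"
      using wt_sub[where s = s and T = t, OF Ev_Wt[OF s] t] by blast+
  qed
  have S: "Ev \<delta> ?S ?y" using Vertex.prems(1) by simp
  have y: "inp P ?y = map (rc P ys \<gamma>) ts" "?y \<in> Ops P"
    using Vertex.prems(2) by (simp_all add: wt_Vertex)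
  have L: "?L \<in> perms (length ts)" using S y unfolding Ev_def Wt_def arity_def by simp
  have g: "inp P ?y ! l = ?g l" if "l \<in> set ?L" for l
    using that perms_set[OF L] y rt(2) by simp
  have wS: "wt P \<delta> ?g ?S"
    using S wt_cong[of ?S \<delta> \<delta> "(!) (inp P ?y)" ?g] g unfolding Ev_def Wt_def by blast
  let ?e = "eval P \<delta> ?g ?S"
  have "eval P \<delta> ((!) (inp P ?y)) ?S = ?e" using g by (intro eval_cong) auto
  then have ye: "?y = act P ?e ?L" using S unfolding Ev_def by simp
  note e = eval_props[OF wS]
  have ae: "arity P ?e = length ts" using e(2) perms_length[OF L] by (simp add: arity_def)
  let ?qs = "map (eval P \<delta> \<gamma>) ?ts"
  have cy: "composable P ?y ?qs"
    using y rt eval_props[of \<delta> \<gamma>] by (auto simp: composable_def)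
  have len: "map length (map leaves ?ts) = map (arity P) ?qs"
    using rt(1) eval_props(2)[of \<delta> \<gamma>] by (simp add: arity_def)
  \<comment> \<open>The decoration \<open>?y\<close> is the planar composite \<open>?e\<close> acted
    on by the leaf numbers of the substituted tree. Moving this action outside permutes the branches
    exactly as grafting does.\<close>
  note out = lsim_outer[of ?e ?L ?qs "map leaves ?ts", unfolded ae, folded ye, OF e(1) L cy len]
  have m: "map (\<lambda>l. eval P \<delta> \<gamma> (?ts ! l)) ?L = map ((!) ?qs) ?L"
    "map (\<lambda>l. leaves (?ts ! l)) ?L = map ((!) (map leaves ?ts)) ?L"
    using perms_set[OF L] by auto
  have ev: "eval P \<delta> \<gamma> (sub s (Vertex v ts)) = comp P ?e (map ((!) ?qs) ?L)"
    "leaves (sub s (Vertex v ts)) = concat (map ((!) (map leaves ?ts)) ?L)"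
    using eval_graft[of \<delta> \<gamma> "(!) ?ts" ?S] w
    unfolding m[symmetric] by (simp_all add: leaves_graft)
  have "lsim (comp P ?y ?qs) (concat (map leaves ?ts)) (comp P ?y (map (eval P ys \<gamma>) ts))
      (concat (map leaves ts))"
    using IH by (intro lsim_inner[OF cy]) simp_all
  from lsim_trans[OF out(2) this] show ?case unfolding ev by simp
qed

text \<open>Here the names in \<open>eval_sub\<close> are the leaf numbers, so acting by them turns
  the relation \<open>lsim\<close> into an equality.\<close>

lemma Ev_sub:
  assumes "\<And>v n. (v, n) \<in> set (vertices T) \<Longrightarrow> Ev \<delta> (s v n) (ys v)" "Ev ys T x"
  shows "Ev \<delta> (sub s T) x"
proof -
  have W: "Wt P \<delta> (sub s T) x"
    using Wt_sub(1)[OF _ Ev_Wt[OF assms(2)]] assms(1) Ev_Wt by blast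
  let ?g = "(!) (inp P x)"
  have w: "wt P ys ?g T" using assms(2) by (simp add: Ev_def Wt_def)
  have l: "lsim (eval P \<delta> ?g (sub s T)) (leaves (sub s T)) (eval P ys ?g T) (leaves T)"
    by (rule eval_sub[OF assms(1) w])
  have "wt P \<delta> ?g (sub s T)" using W by (simp add: Wt_def)
  then have "arity P (eval P \<delta> ?g (sub s T)) = arity P x"
    using eval_props(2)[of \<delta> ?g] W perms_length unfolding Wt_def arity_def by (metis length_map)
  then have "act P (eval P \<delta> ?g (sub s T)) (leaves (sub s T)) = act P (eval P ys ?g T) (leaves T)"
    using lsim_act[OF l] W assms(2) unfolding Ev_def Wt_def by simp
  then show ?thesis using W assms(2) by (simp add: Ev_def)
qed

text \<open>Existence of values: any consistent colouring yields one, and the colouring gives its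
  inputs.\<close>

lemma Ev_of_wt:
  assumes w: "wt P \<delta> \<gamma> T" and L: "leaves T \<in> perms n"
  shows "Ev \<delta> T (act P (eval P \<delta> \<gamma> T) (leaves T))"
    and "arity P (act P (eval P \<delta> \<gamma> T) (leaves T)) = n"
    and "\<And>l. l < n \<Longrightarrow> inp P (act P (eval P \<delta> \<gamma> T) (leaves T)) ! l = \<gamma> l"
    and "out P (act P (eval P \<delta> \<gamma> T) (leaves T)) = rc P \<delta> \<gamma> T"
proof -
  let ?e = "eval P \<delta> \<gamma> T" and ?L = "leaves T"
  let ?x = "act P ?e ?L"
  note e = eval_props[OF w]
  have ae: "arity P ?e = n" using e(2) perms_length[OF L] by (simp add: arity_def)
  note a = act_Ops[OF e(1)] act_arity[OF e(1)] act_inp[OF e(1)] act_out[OF e(1)]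
  show ar: "arity P ?x = n" using a(2) L ae by simp
  show i: "inp P ?x ! l = \<gamma> l" if l: "l < n" for l
  proof -
    obtain k where k: "k < n" "?L ! k = l" using perms_indexE[OF L l] by blast
    then show ?thesis using a(3)[of ?L k] L ae e(2) perms_length[OF L] by simp
  qed
  show o: "out P ?x = rc P \<delta> \<gamma> T" using a(4) L ae e(3) by simp
  have g: "inp P ?x ! l = \<gamma> l" if "l \<in> set ?L" for l using that perms_set[OF L] i by simp
  have "wt P \<delta> ((!) (inp P ?x)) T = wt P \<delta> \<gamma> T" "rc P \<delta> ((!) (inp P ?x)) T = rc P \<delta> \<gamma> T"
    "eval P \<delta> ((!) (inp P ?x)) T = ?e"
    using g by (intro wt_cong rc_cong eval_cong; simp)+
  then show "Ev \<delta> T ?x"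
    unfolding Ev_def Wt_def using a(1)[of ?L] L ae w ar o by simp
qed

text \<open>A converse to the typing half of substitution: each vertex of \<open>T\<close> is
  decorated by the value of the tree substituted there. Distinct labels make this a function of the
  label.\<close>

lemma Ev_decomp_wt:
  "fits s T \<Longrightarrow> distinct (vlabels T) \<Longrightarrow> wt P \<delta> \<gamma> (sub s T) \<Longrightarrow>
    \<exists>ys. wt P ys \<gamma> T \<and> (\<forall>(v, n) \<in> set (vertices T). Ev \<delta> (s v n) (ys v))"
proof (induction T)
  case (Vertex v ts)
  let ?S = "s v (length ts)" and ?ts = "map (sub s) ts"
  let ?L = "leaves ?S" and ?g = "\<lambda>l. rc P \<delta> \<gamma> (?ts ! l)"
  have L: "?L \<in> perms (length ts)" using Vertex.prems(1) by (simp add: fits_Vertex)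
  have wS: "wt P \<delta> ?g ?S" and wts: "\<And>l. l \<in> set ?L \<Longrightarrow> wt P \<delta> \<gamma> (?ts ! l)"
    using Vertex.prems(3) by (auto simp: wt_graft)
  have d: "v \<notin> set (concat (map vlabels ts))" "distinct (concat (map vlabels ts))"
    using Vertex.prems(2) by (simp_all add: map_concat o_def)
  have "\<exists>ys. wt P ys \<gamma> (ts ! k) \<and> (\<forall>(v, n) \<in> set (vertices (ts ! k)). Ev \<delta> (s v n) (ys v))"
    if k: "k < length ts" for k
  proof (rule Vertex.IH)
    show "fits s (ts ! k)" using Vertex.prems(1) k by (simp add: fits_Vertex)
    show "distinct (vlabels (ts ! k))"
    proof -
      have "vlabels (ts ! k) \<in> set (map vlabels ts)" using k by simp
      then show ?thesis using d(2) unfolding distinct_concat_iff by blast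
    qed
    show "wt P \<delta> \<gamma> (sub s (ts ! k))" using wts[of k] perms_set[OF L] k by simp
  qed (use k in simp)
  then obtain Y where Y: "\<And>k. k < length ts \<Longrightarrow> wt P (Y k) \<gamma> (ts ! k)"
    "\<And>k v n. k < length ts \<Longrightarrow> (v, n) \<in> set (vertices (ts ! k)) \<Longrightarrow> Ev \<delta> (s v n) (Y k v)"
    by (metis (mono_tags, lifting) case_prodD)
  have uk: "k = k'" if "k < length ts" "k' < length ts" "u \<in> set (vlabels (ts ! k))"
    "u \<in> set (vlabels (ts ! k'))" for k k' u
  proof (rule ccontr)
    assume ne: "k \<noteq> k'"
    have disj: "set (vlabels (ts ! a)) \<inter> set (vlabels (ts ! b)) = {}" if "a < b" "b < length ts" for a b
    proof -
      let ?X = "map vlabels ts"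
      have m1: "vlabels (ts ! a) \<in> set (take b ?X)" using that by (force simp: in_set_conv_nth)
      have m2: "vlabels (ts ! b) \<in> set (drop b ?X)"
        using that by (metis Cons_nth_drop_Suc length_map list.set_intros(1) nth_map)
      have "set (concat (take b ?X)) \<inter> set (concat (drop b ?X)) = {}"
        using d(2) by (metis append_take_drop_id concat_append distinct_append)
      then show ?thesis using m1 m2 unfolding set_concat by blast
    qed
    then show False using that ne by (metis disjoint_iff linorder_neqE_nat)
  qed
  let ?y = "act P (eval P \<delta> ?g ?S) ?L"
  \<comment> \<open>A label other than \<open>v\<close> occurs in exactly one branch, and the
    decoration found for that branch is used.\<close>
  define ys where "ys = (\<lambda>u. if u = v then ?y else Y (THE k. k < length ts \<and> u \<in> set (vlabels (ts ! k))) u)"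
  have ysk: "ys u = Y k u" if "k < length ts" "u \<in> set (vlabels (ts ! k))" for k u
  proof -
    have "vlabels (ts ! k) \<in> set (map vlabels ts)" using that(1) by simp
    then have "u \<in> set (concat (map vlabels ts))" using that(2) unfolding set_concat by blast
    then have "u \<noteq> v" using d(1) by blast
    moreover have "(THE k. k < length ts \<and> u \<in> set (vlabels (ts ! k))) = k"
      using uk that by (intro the_equality) blast+
    ultimately show ?thesis by (simp add: ys_def)
  qed
  note E = Ev_of_wt[OF wS L]
  have wk: "wt P ys \<gamma> (ts ! k)" "rc P ys \<gamma> (ts ! k) = ?g k" if k: "k < length ts" for k
  proof -
    show w: "wt P ys \<gamma> (ts ! k)"
      using Y(1)[OF k] ysk[OF k] wt_cong[of "ts ! k" ys "Y k" \<gamma> \<gamma>] by blast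
    have "Wt P \<delta> (s u n) (ys u)" if u: "(u, n) \<in> set (vertices (ts ! k))" for u n
    proof -
      have "u \<in> set (vlabels (ts ! k))" using u by force
      then show ?thesis using Y(2)[OF k u] ysk[OF k] Ev_Wt by metis
    qed
    from wt_sub[OF this w] show "rc P ys \<gamma> (ts ! k) = ?g k" using k by simp
  qed
  have "inp P ?y = map (rc P ys \<gamma>) ts"
  proof (rule nth_equalityI)
    show "length (inp P ?y) = length (map (rc P ys \<gamma>) ts)" using E(2) by (simp add: arity_def)
    fix k assume "k < length (inp P ?y)"
    then have "k < length ts" using E(2) by (simp add: arity_def)
    then show "inp P ?y ! k = map (rc P ys \<gamma>) ts ! k" using E(3) wk by simp
  qed
  moreover have "ys v = ?y" by (simp add: ys_def)
  moreover have "?y \<in> Ops P" using E(1) by (simp add: Ev_def Wt_def)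
  ultimately have "wt P ys \<gamma> (Vertex v ts)"
    using wk(1) by (auto simp: wt_Vertex in_set_conv_nth)
  moreover have "Ev \<delta> (s u n) (ys u)" if un: "(u, n) \<in> set (vertices (Vertex v ts))" for u n
  proof (cases "(u, n) = (v, length ts)")
    case True
    then show ?thesis using E(1) \<open>ys v = ?y\<close> by simp
  next
    case False
    then obtain t where "t \<in> set ts" "(u, n) \<in> set (vertices t)" using un by auto
    then obtain k where k: "k < length ts" "(u, n) \<in> set (vertices (ts ! k))"
      by (metis in_set_conv_nth)
    then have "u \<in> set (vlabels (ts ! k))" by force
    then show ?thesis using Y(2)[OF k] ysk[OF k(1)] by simp
  qed
  ultimately show ?case by blast
qed auto

lemma Ev_decomp:
  assumes "fits s T" "distinct (vlabels T)" "Ev \<delta> (sub s T) x"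
  obtains ys where "Ev ys T x" "\<And>v n. (v, n) \<in> set (vertices T) \<Longrightarrow> Ev \<delta> (s v n) (ys v)"
proof -
  let ?g = "(!) (inp P x)"
  have x: "Wt P \<delta> (sub s T) x" using assms(3) by (rule Ev_Wt)
  then obtain ys where ys: "wt P ys ?g T" "\<And>v n. (v, n) \<in> set (vertices T) \<Longrightarrow> Ev \<delta> (s v n) (ys v)"
    using Ev_decomp_wt[OF assms(1,2), of \<delta> ?g] unfolding Wt_def by blast
  have L: "leaves T \<in> perms (arity P x)"
    using x leaves_sub[OF assms(1)] unfolding Wt_def perms_iff by simp
  have r: "rc P ys ?g T = out P x"
    using wt_sub[OF _ ys(1), of \<delta> s] ys(2) Ev_Wt x unfolding Wt_def by metis
  have l: "lsim (eval P \<delta> ?g (sub s T)) (leaves (sub s T)) (eval P ys ?g T) (leaves T)"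
    by (rule eval_sub[OF ys(2,1)])
  have "wt P \<delta> ?g (sub s T)" using x by (simp add: Wt_def)
  then have "arity P (eval P \<delta> ?g (sub s T)) = arity P x"
    using eval_props(2)[of \<delta> ?g] x perms_length unfolding Wt_def arity_def by (metis length_map)
  then have "act P (eval P \<delta> ?g (sub s T)) (leaves (sub s T)) = act P (eval P ys ?g T) (leaves T)"
    using lsim_act[OF l] x L unfolding Wt_def by simp
  then have "Ev ys T x"
    using x ys(1) L r assms(3) unfolding Ev_def Wt_def by simp
  then show ?thesis using that ys(2) by blast
qed

lemma Ev_cor: "Ev \<delta> (cor v n) x \<longleftrightarrow> x = \<delta> v \<and> x \<in> Ops P \<and> arity P x = n"
proof
  assume E: "Ev \<delta> (cor v n) x"
  then have W: "x \<in> Ops P" "leaves (cor v n) \<in> perms (arity P x)" "wt P \<delta> ((!) (inp P x)) (cor v n)"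
    by (simp_all add: Ev_def Wt_def)
  have n: "arity P x = n" using perms_length[OF W(2)] by simp
  then have i: "map ((!) (inp P x)) [0..<n] = inp P x" by (simp add: arity_def map_nth flip: n)
  have d: "\<delta> v \<in> Ops P" "inp P (\<delta> v) = inp P x"
    using W(3) i by (simp_all add: cor_def wt_Vertex o_def)
  have "eval P \<delta> ((!) (inp P x)) (cor v n) = comp P (\<delta> v) (map (ident P) (map ((!) (inp P x)) [0..<n]))"
    by (simp add: cor_def o_def)
  also have "\<dots> = \<delta> v" using comp_ident_right[OF d(1)] i d(2) by simp
  finally have "x = act P (\<delta> v) [0..<arity P (\<delta> v)]"
    using E n d(2) unfolding Ev_def by (simp add: arity_def)
  then show "x = \<delta> v \<and> x \<in> Ops P \<and> arity P x = n" using act_id[OF d(1)] W(1) n by simp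
next
  assume x: "x = \<delta> v \<and> x \<in> Ops P \<and> arity P x = n"
  then have i: "map ((!) (inp P x)) [0..<n] = inp P x" by (auto simp: arity_def map_nth)
  have "\<forall>c \<in> set (map ((!) (inp P x)) [0..<n]). c \<in> Col P" unfolding i using inp_Col x by blast
  then have "wt P \<delta> ((!) (inp P x)) (cor v n)"
    using x i by (auto simp: cor_def wt_Vertex o_def)
  moreover have "eval P \<delta> ((!) (inp P x)) (cor v n) = comp P (\<delta> v) (map (ident P) (map ((!) (inp P x)) [0..<n]))"
    by (simp add: cor_def o_def)
  then have "eval P \<delta> ((!) (inp P x)) (cor v n) = x" unfolding i using comp_ident_right[of x] x by metis
  ultimately show "Ev \<delta> (cor v n) x"
    unfolding Ev_def Wt_def using x act_id[of x] by (auto simp: cor_def o_def)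
qed

text \<open>The decoration is empty here, so nothing fixes the colour. This is what makes
  \<open>Ev\<close> a relation and excludes leaves from \<open>Ev_unique\<close>.\<close>

lemma Ev_Leaf: "Ev \<delta> (Leaf 0) x \<longleftrightarrow> (\<exists>c \<in> Col P. x = ident P c)"
proof
  assume E: "Ev \<delta> (Leaf 0) x"
  let ?c = "inp P x ! 0"
  have c: "?c \<in> Col P" "x = act P (ident P ?c) [0]" using E unfolding Ev_def Wt_def wt.simps(1) eval.simps(1) leaves.simps(1) by blast+
  moreover have "act P (ident P ?c) [0] = ident P ?c"
    using act_id[OF ident_Ops[OF c(1)]] ident_inp[OF c(1)] by (simp add: arity_def)
  ultimately show "\<exists>c \<in> Col P. x = ident P c" by metis
next
  assume "\<exists>c \<in> Col P. x = ident P c"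
  then obtain c where c: "c \<in> Col P" "x = ident P c" by blast
  have "act P x [0] = x"
    using act_id[OF ident_Ops[OF c(1)]] ident_inp[OF c(1)] c(2) by (simp add: arity_def)
  then show "Ev \<delta> (Leaf 0) x"
    using c ident_Ops ident_inp ident_out by (simp add: Ev_def Wt_def arity_def perms_iff)
qed

lemma Ev_unique:
  assumes "Ev \<delta> T x" "Ev \<delta> T x'" "\<And>l. T \<noteq> Leaf l"
  shows "x = x'"
  using Wt_inp_unique[OF Ev_Wt[OF assms(1)] Ev_Wt[OF assms(2)] assms(3)] assms(1,2)
  unfolding Ev_def by simp

lemma Ev_cong:
  assumes "\<And>v. v \<in> set (vlabels T) \<Longrightarrow> \<delta> v = \<delta>' v" shows "Ev \<delta> T x \<longleftrightarrow> Ev \<delta>' T x"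
proof -
  have "wt P \<delta> \<gamma> T = wt P \<delta>' \<gamma> T" "rc P \<delta> \<gamma> T = rc P \<delta>' \<gamma> T" "eval P \<delta> \<gamma> T = eval P \<delta>' \<gamma> T" for \<gamma>
    by (rule wt_cong[OF assms refl] rc_cong[OF assms refl] eval_cong[OF assms refl]; assumption)+
  then show ?thesis by (simp add: Ev_def Wt_def)
qed

lemma Ev_vmap: "Ev \<delta> (vmap f T) x \<longleftrightarrow> Ev (\<lambda>v. \<delta> (f v)) T x"
  by (simp add: Ev_def Wt_def wt_map_tree rc_map_tree eval_map_tree)

lemma Ev_decomp_unique:
  assumes "Ev ys T x" "Ev ys' T x"
    "\<And>v. v \<in> set (vlabels T) \<Longrightarrow> inp P (ys v) = inp P (ys' v) \<Longrightarrow> ys v = ys' v"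
  shows "\<forall>v \<in> set (vlabels T). ys v = ys' v"
  using wt_unique[of P ys _ T ys'] assms unfolding Ev_def Wt_def by blast

lemma Ev_fits:
  assumes "\<And>v n. (v, n) \<in> set (vertices T) \<Longrightarrow> Ev \<delta> (s v n) (ys v)" "Ev ys T x"
  shows "fits s T"
  by (rule Wt_sub(2)[OF Ev_Wt[OF assms(1)] Ev_Wt[OF assms(2)]])

end

section \<open>The nerve of an operad\<close>

context coloured_operad
begin

lemma Ev_vertex: "Ev \<delta> T x \<Longrightarrow> (v, n) \<in> set (vertices T) \<Longrightarrow> \<delta> v \<in> Ops P \<and> arity P (\<delta> v) = n"
  unfolding Ev_def Wt_def using wt_vertex[of P \<delta> "(!) (inp P x)" T v n] by blast

lemma Ev_cor_vertex:
  "Ev \<delta> T x \<Longrightarrow> (v, n) \<in> set (vertices T) \<Longrightarrow> \<delta>' w = \<delta> v \<Longrightarrow> Ev \<delta>' (cor w n) (\<delta> v)"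
  using Ev_vertex Ev_cor by metis

text \<open>The value is stored along with the decoration because over the tree without vertices it
  is the only datum: the identity of a colour.\<close>

definition elem :: "(nat, nat) tree \<Rightarrow> 'o list \<Rightarrow> 'o \<Rightarrow> bool" where
  "elem T \<delta> x \<longleftrightarrow> length \<delta> = length (vertices T) \<and> Ev ((!) \<delta>) T x"

text \<open>The restriction of a decoration \<open>(\<delta>, x)\<close> of the target of \<open>f\<close> to its source \<open>p\<close>.\<close>

definition restr :: "(nat, nat) tree tw_mor \<Rightarrow> (nat, nat) tree \<Rightarrow> 'o list \<Rightarrow> 'o \<Rightarrow> 'o list \<Rightarrow> 'o \<Rightarrow> bool"
  where "restr f p \<delta> x ys z \<longleftrightarrow> elem p ys z \<and>
    (\<forall>i < length (vertices p). Ev ((!) \<delta>) (uppL f i) (ys ! i)) \<and>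
    Ev (case_option z ((!) \<delta>)) (lowL f) x"

text \<open>Decompose twice: along the lower tree, which yields the value \<open>z\<close> of the
  marked part, and then along \<open>p\<close>, which yields the decoration of its vertices.\<close>

lemma restr_exists:
  assumes f: "f \<in> hom (Tw sOp) p t" and t: "t \<in> Ops sOp" and e: "elem t \<delta> x"
  obtains ys z where "restr f p \<delta> x ys z"
proof -
  note l = lhomD[OF lhom_of_hom(1)[OF f t]]
  let ?Z = "sub (\<lambda>i n. uppL f i) p"
  have "Ev ((!) \<delta>) (sub (plugs cor ?Z) (lowL f)) x"
    using e l(8) by (simp add: elem_def plug_def)
  from Ev_decomp[OF l(5,6) this] obtain y where
    y: "Ev y (lowL f) x" "\<And>a n. (a, n) \<in> set (vertices (lowL f)) \<Longrightarrow> Ev ((!) \<delta>) (plugs cor ?Z a n) (y a)"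
    by blast
  have yS: "y (Some j) = \<delta> ! j" if "(Some j, n) \<in> set (vertices (lowL f))" for j n
    using y(2)[OF that] by (simp add: Ev_cor)
  have "Ev ((!) \<delta>) ?Z (y None)" using y(2)[OF l(7)] by simp
  from Ev_decomp[OF l(3) perms_distinct[OF sOp_Ops_vlabels[OF l(1)]] this] obtain Y where
    Y: "Ev Y p (y None)" "\<And>i n. (i, n) \<in> set (vertices p) \<Longrightarrow> Ev ((!) \<delta>) (uppL f i) (Y i)"
    by blast
  let ?ys = "map Y [0..<length (vertices p)]"
  have pv: "i < length (vertices p)" if "i \<in> set (vlabels p)" for i
    using that perms_set[OF sOp_Ops_vlabels[OF l(1)]] by simp
  have "Ev ((!) ?ys) p (y None)"
    using Y(1) Ev_cong[of p Y "(!) ?ys"] pv by simp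
  moreover have "Ev ((!) \<delta>) (uppL f i) (?ys ! i)" if "i < length (vertices p)" for i
    using Y(2)[OF sOp_vertex[OF l(1) that]] that by simp
  moreover have "Ev (case_option (y None) ((!) \<delta>)) (lowL f) x"
  proof -
    have "y a = case_option (y None) ((!) \<delta>) a" if "a \<in> set (vlabels (lowL f))" for a
    proof (cases a)
      case (Some j)
      then obtain n where "(Some j, n) \<in> set (vertices (lowL f))" using \<open>a \<in> _\<close> by auto
      then show ?thesis using yS Some by simp
    qed simp
    then show ?thesis using y(1) Ev_cong[of "lowL f" y] by blast
  qed
  ultimately have "restr f p \<delta> x ?ys (y None)" by (simp add: restr_def elem_def)
  then show ?thesis by (rule that)
qed

text \<open>In contrast to \<open>Ev_unique\<close>, this also covers the tree without vertices,
  where the inputs carry the missing colour.\<close>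

lemma Ev_same_inp:
  assumes "Ev \<delta> T y" "Ev \<delta> T y'" "inp P y = inp P y'" shows "y = y'"
  using assms by (simp add: Ev_def)

text \<open>An upper tree may have no vertices, and then its value is not determined by the
  decoration of \<open>t\<close>. Its colour is fixed by its neighbours instead: colours are
  propagated from the leaves through \<open>p\<close> placed inside the lower tree.\<close>

lemma restr_unique:
  assumes f: "f \<in> hom (Tw sOp) p t" and t: "t \<in> Ops sOp"
    and r: "restr f p \<delta> x ys z" and r': "restr f p \<delta> x ys' z'"
  shows "ys = ys' \<and> z = z'"
proof -
  note l = lhomD[OF lhom_of_hom(1)[OF f t]]
  \<comment> \<open>The sum type keeps the vertices of \<open>p\<close> apart from the other
    vertices of the lower tree.\<close>
  let ?s = "plugs (\<lambda>j. cor (Inr j)) (vmap Inl p) :: nat option \<Rightarrow> nat \<Rightarrow> (nat + nat, nat) tree"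
  define T1 where "T1 = sub ?s (lowL f)"
  have E: "Ev (case_sum ((!) us) ((!) \<delta>)) (?s a n) (case_option w ((!) \<delta>) a)"
    if "restr f p \<delta> x us w" "(a, n) \<in> set (vertices (lowL f))" for us w a n
  proof (cases a)
    case None
    then show ?thesis using that by (simp add: restr_def elem_def Ev_vmap)
  next
    case (Some j)
    have "Ev (case_option w ((!) \<delta>)) (lowL f) x" using that(1) by (simp add: restr_def)
    from Ev_cor_vertex[OF this that(2), of "case_sum ((!) us) ((!) \<delta>)" "Inr j"] show ?thesis
      using Some by simp
  qed
  have T1: "Ev (case_sum ((!) us) ((!) \<delta>)) T1 x" if "restr f p \<delta> x us w" for us w
    unfolding T1_def using Ev_sub[where s = ?s and T = "lowL f", OF E[OF that]] that
    by (simp add: restr_def)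
  have fits: "fits ?s (lowL f)"
    using Ev_fits[where s = ?s and T = "lowL f", OF E[OF r]] r unfolding restr_def by blast
  have same: "ys ! i = ys' ! i" if "i < length (vertices p)" "inp P (ys ! i) = inp P (ys' ! i)" for i
    using Ev_same_inp that r r' unfolding restr_def by blast
  have "\<forall>v \<in> set (vlabels T1). case_sum ((!) ys) ((!) \<delta>) v = case_sum ((!) ys') ((!) \<delta>) v"
  proof (rule Ev_decomp_unique[OF T1[OF r] T1[OF r']])
    fix v assume v: "v \<in> set (vlabels T1)"
      and i: "inp P (case_sum ((!) ys) ((!) \<delta>) v) = inp P (case_sum ((!) ys') ((!) \<delta>) v)"
    show "case_sum ((!) ys) ((!) \<delta>) v = case_sum ((!) ys') ((!) \<delta>) v"
    proof (cases v)
      case (Inl i')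
      obtain n a m where "(a, m) \<in> set (vertices (lowL f))" "(Inl i', n) \<in> set (vertices (?s a m))"
        using v Inl unfolding T1_def set_map set_vertices_sub[OF fits] by force
      then have "(i', n) \<in> set (vertices p)"
        by (cases a) (auto simp: vertices_map_tree)
      then have "i' < length (vertices p)" using sOp_inp_nth[OF l(1)] by blast
      then show ?thesis using same i Inl by simp
    qed simp
  qed
  moreover have "Inl i \<in> set (vlabels T1)" if "i < length (vertices p)" for i
  proof -
    have "(Inl i, inp sOp p ! i) \<in> set (vertices (?s None (length (leaves p))))"
      using sOp_vertex[OF l(1) that] by (force simp: vertices_map_tree)
    then have "(Inl i, inp sOp p ! i) \<in> set (vertices T1)"
      unfolding T1_def set_vertices_sub[OF fits] using l(7) by blast
    then show ?thesis by force
  qed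
  ultimately have "ys ! i = ys' ! i" if "i < length (vertices p)" for i
    using that by fastforce
  moreover have "length ys = length (vertices p)" "length ys' = length (vertices p)"
    using r r' by (simp_all add: restr_def elem_def)
  ultimately have ys: "ys = ys'" by (intro nth_equalityI) auto
  have "\<forall>a \<in> set (vlabels (lowL f)). case_option z ((!) \<delta>) a = case_option z' ((!) \<delta>) a"
  proof (rule Ev_decomp_unique)
    show "Ev (case_option z ((!) \<delta>)) (lowL f) x" "Ev (case_option z' ((!) \<delta>)) (lowL f) x"
      using r r' by (simp_all add: restr_def)
    fix a assume "inp P (case_option z ((!) \<delta>) a) = inp P (case_option z' ((!) \<delta>) a)"
    then show "case_option z ((!) \<delta>) a = case_option z' ((!) \<delta>) a"
      using Ev_same_inp r r' ys unfolding restr_def elem_def by (cases a) auto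
  qed
  moreover have "None \<in> set (vlabels (lowL f))" using l(7) by force
  ultimately have "z = z'" by fastforce
  with ys show ?thesis by simp
qed

lemma restr_id:
  assumes p: "p \<in> Ops sOp" and e: "elem p \<delta> x" shows "restr (tw_id sOp p) p \<delta> x \<delta> x"
proof -
  have E: "Ev ((!) \<delta>) p x" using e by (simp add: elem_def)
  have ar: "arity P x = length (leaves p)"
    using E perms_length unfolding Ev_def Wt_def by metis
  have "Ev ((!) \<delta>) (uppL (tw_id sOp p) i) (\<delta> ! i)" if "i < length (vertices p)" for i
    using Ev_cor_vertex[OF E sOp_vertex[OF p that], of "(!) \<delta>" i] tw_id_hom(2)[OF p that] by simp
  moreover have "Ev (case_option x ((!) \<delta>)) (lowL (tw_id sOp p)) x"
    unfolding tw_id_hom(3)[OF p] Ev_cor using E ar by (simp add: Ev_def Wt_def)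
  ultimately show ?thesis using e by (simp add: restr_def)
qed

text \<open>The labelled trees of a composite are obtained by substitution, so each condition is an
  instance of \<open>Ev_sub\<close>.\<close>

lemma restr_comp:
  assumes f: "f \<in> hom (Tw sOp) p t" and g: "g \<in> hom (Tw sOp) t u"
    and t: "t \<in> Ops sOp" and u: "u \<in> Ops sOp"
    and rg: "restr g t \<delta> x \<delta>' x'" and rf: "restr f p \<delta>' x' ys z"
  shows "restr (tw_comp sOp g f) p \<delta> x ys z"
proof -
  note c = tw_comp_hom[OF f g t u]
  note lv = lhom_vertices[OF lhom_of_hom(1)[OF f t]]
  have g': "Ev ((!) \<delta>) (uppL g j) (\<delta>' ! j)" if "(j, n) \<in> set (vertices t)" for j n
    using rg sOp_inp_nth(2)[OF t that] by (simp add: restr_def)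
  have "Ev ((!) \<delta>) (uppL (tw_comp sOp g f) i) (ys ! i)" if i: "i < length (vertices p)" for i
    unfolding c(2)[OF i]
  proof (rule Ev_sub)
    show "Ev ((!) \<delta>') (uppL f i) (ys ! i)" using rf i by (simp add: restr_def)
    fix j n assume "(j, n) \<in> set (vertices (uppL f i))"
    then show "Ev ((!) \<delta>) (uppL g j) (\<delta>' ! j)" using lv(1)[OF i] g' by blast
  qed
  moreover have "Ev (case_option z ((!) \<delta>)) (lowL (tw_comp sOp g f)) x"
    unfolding c(3) lowcomp_def
  proof (rule Ev_sub)
    show x: "Ev (case_option x' ((!) \<delta>)) (lowL g) x" using rg by (simp add: restr_def)
    have f': "Ev (case_option z ((!) \<delta>')) (lowL f) x'" using rf by (simp add: restr_def)
    let ?I = "sub (\<lambda>a n. case a of None \<Rightarrow> cor None n | Some j \<Rightarrow> vmap Some (uppL g j)) (lowL f)"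
    have I: "Ev (case_option z ((!) \<delta>)) ?I x'"
    proof (rule Ev_sub[OF _ f'])
      fix a n assume a: "(a, n) \<in> set (vertices (lowL f))"
      show "Ev (case_option z ((!) \<delta>)) (case a of None \<Rightarrow> cor None n | Some j \<Rightarrow> vmap Some (uppL g j))
          (case_option z ((!) \<delta>') a)"
      proof (cases a)
        case None
        then show ?thesis
          using Ev_cor_vertex[OF f' a, of "case_option z ((!) \<delta>)" None] by simp
      next
        case (Some j)
        then have "Ev ((!) \<delta>) (uppL g j) (\<delta>' ! j)" using a by (intro g'[OF lv(2)]) simp
        then show ?thesis using Some by (simp add: Ev_vmap)
      qed
    qed
    fix a n assume a: "(a, n) \<in> set (vertices (lowL g))"
    show "Ev (case_option z ((!) \<delta>)) (plugs (\<lambda>j. cor (Some j)) ?I a n) (case_option x' ((!) \<delta>) a)"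
    proof (cases a)
      case None
      then show ?thesis using I by simp
    next
      case (Some j)
      then show ?thesis
        using Ev_cor_vertex[OF x a, of "case_option z ((!) \<delta>)" "Some j"] by simp
    qed
  qed
  ultimately show ?thesis using rf by (simp add: restr_def)
qed

lemma restr_vtx:
  assumes T: "T \<in> Ops sOp" and e: "elem T \<delta> x" and i: "i < length (vertices T)"
  shows "restr (vtx T i) (cor 0 (inp sOp T ! i)) \<delta> x [\<delta> ! i] (\<delta> ! i)"
proof -
  have E: "Ev ((!) \<delta>) T x" using e by (simp add: elem_def)
  note v = sOp_vertex[OF T i]
  have "Ev (\<lambda>v. case_option (\<delta> ! i) ((!) \<delta>) (if v = i then None else Some v)) T x"
    using E Ev_cong[of T "(!) \<delta>" "\<lambda>v. case_option (\<delta> ! i) ((!) \<delta>) (if v = i then None else Some v)"]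
    by simp
  then show ?thesis
    using Ev_cor_vertex[OF E v, of "(!) [\<delta> ! i]" 0] Ev_cor_vertex[OF E v, of "(!) \<delta>" i]
    by (simp add: restr_def elem_def uppL_vtx[OF T i] lowL_vtx[OF T i] Ev_vmap)
qed

lemma restr_evm:
  assumes T: "T \<in> Ops sOp" and e: "elem T \<delta> x"
  shows "restr (evm T) (cor 0 (length (leaves T))) \<delta> x [x] x"
proof -
  have E: "Ev ((!) \<delta>) T x" using e by (simp add: elem_def)
  have "x \<in> Ops P" "arity P x = length (leaves T)"
    using E perms_length unfolding Ev_def Wt_def by metis+
  then show ?thesis using E
    by (simp add: restr_def elem_def uppL_evm[OF T] lowL_evm[OF T] Ev_cor)
qed

end

section \<open>Two-level trees\<close>

text \<open>The tree whose value is the composite \<open>p(q\<^sub>1,\<dots>,q\<^sub>n)\<close>;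
  leaves are numbered in planar order, as the inputs of a composite are.\<close>

definition two_level :: "'v \<Rightarrow> (nat \<Rightarrow> 'v) \<Rightarrow> nat list \<Rightarrow> ('v, nat) tree" where
  "two_level r f ks = Vertex r
    (map (\<lambda>i. Vertex (f i) (map Leaf [block_start ks i..<block_start ks i + ks ! i])) [0..<length ks])"

lemma concat_map_Nil: "concat (map (\<lambda>x. []) xs) = []"
  by (induction xs) auto

lemma vertices_two_level: "vertices (two_level r f ks) =
    (r, length ks) # map (\<lambda>i. (f i, ks ! i)) [0..<length ks]"
  by (simp add: two_level_def o_def concat_map_singleton concat_map_Nil)

lemma leaves_two_level: "leaves (two_level r f ks) = [0..<sum_list ks]"
proof -
  have "leaves (two_level r f ks) =
      concat (map (\<lambda>i. map ((+) (block_start ks i)) [0..<ks ! i]) [0..<length ks])"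
    by (simp add: two_level_def o_def upt_shift concat_map_singleton)
  then show ?thesis using concat_blocks by simp
qed

lemma two_level_Ops: "two_level 0 Suc ks \<in> Ops sOp"
proof -
  have "vlabels (two_level 0 Suc ks) = [0..<Suc (length ks)]"
    by (simp add: vertices_two_level o_def upt_rec[of 0] map_Suc_upt[symmetric] del: upt_Suc)
  moreover have "length (vertices (two_level 0 Suc ks)) = Suc (length ks)"
    by (simp add: vertices_two_level)
  ultimately show ?thesis unfolding sOp_Ops leaves_two_level by (simp only: upt_perms) simp
qed

lemma two_level_neq_Leaf [simp]: "two_level r f ks \<noteq> Leaf l"
  by (simp add: two_level_def)

lemma nth_concat_slice:
  assumes "i < length xss"
  shows "map ((!) (concat xss)) [block_start (map length xss) i..<block_start (map length xss) i + length (xss ! i)]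
    = xss ! i"
  using concat_nth_block[OF assms] by (intro nth_equalityI) auto

lemma wt_two_level:
  assumes "length qs = length ks"
  shows "wt P \<delta> \<gamma> (two_level r f ks) \<longleftrightarrow> \<delta> r \<in> Ops P \<and>
    inp P (\<delta> r) = map (\<lambda>i. out P (\<delta> (f i))) [0..<length ks] \<and>
    (\<forall>i < length ks. \<delta> (f i) \<in> Ops P \<and>
      inp P (\<delta> (f i)) = map \<gamma> [block_start ks i..<block_start ks i + ks ! i] \<and>
      (\<forall>l \<in> {block_start ks i..<block_start ks i + ks ! i}. \<gamma> l \<in> Col P))"
  unfolding two_level_def by (auto simp: wt_Vertex o_def)

context coloured_operad
begin

lemma Ev_two_level:
  assumes c: "composable P p qs" and "\<delta> r = p" "\<And>i. i < length qs \<Longrightarrow> \<delta> (f i) = qs ! i"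
  shows "Ev \<delta> (two_level r f (map (arity P) qs)) (comp P p qs)"
proof -
  let ?x = "comp P p qs" and ?ks = "map (arity P) qs"
  have ks: "?ks = map length (map (inp P) qs)" by (simp add: arity_def)
  have i: "inp P ?x = concat (map (inp P) qs)" by (rule comp_inp[OF c])
  have p: "p \<in> Ops P" "\<And>i. i < length qs \<Longrightarrow> qs ! i \<in> Ops P" "inp P p = map (out P) qs"
    using c by (auto simp: composable_def)
  have sl: "map ((!) (inp P ?x)) [block_start ?ks i..<block_start ?ks i + ?ks ! i] = inp P (qs ! i)"
    if "i < length qs" for i
    using nth_concat_slice[of i "map (inp P) qs"] that unfolding ks i by simp
  have col: "inp P ?x ! l \<in> Col P" if "i < length qs" "l \<in> {block_start ?ks i..<block_start ?ks i + ?ks ! i}" for i l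
  proof -
    have "inp P ?x ! l \<in> set (inp P (qs ! i))" unfolding sl[OF that(1), symmetric] using that(2) by auto
    then show ?thesis using inp_Col p(2) that(1) by blast
  qed
  have "map (out P) qs = map (\<lambda>i. out P (\<delta> (f i))) [0..<length ?ks]"
    using assms(3) by (intro nth_equalityI) auto
  then have w: "wt P \<delta> ((!) (inp P ?x)) (two_level r f ?ks)"
    using p sl col assms(2,3) by (subst wt_two_level[where qs = qs]) simp_all
  have "eval P \<delta> ((!) (inp P ?x)) (two_level r f ?ks) = comp P p (map (\<lambda>i. comp P (qs ! i)
      (map (ident P) (map ((!) (inp P ?x)) [block_start ?ks i..<block_start ?ks i + ?ks ! i]))) [0..<length qs])"
    unfolding two_level_def eval.simps map_map assms(2)
    using assms(3) by (intro arg_cong[where f = "comp P p"] map_cong) (simp_all add: o_def)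
  also have "\<dots> = comp P p (map ((!) qs) [0..<length qs])"
    using sl comp_ident_right p(2) by (intro arg_cong[where f = "comp P p"] map_cong) simp_all
  finally have ev: "eval P \<delta> ((!) (inp P ?x)) (two_level r f ?ks) = ?x" by (simp add: map_nth)
  have ar: "arity P ?x = sum_list ?ks"
    unfolding arity_def i length_concat by (simp add: arity_def[abs_def] o_def)
  show ?thesis
    unfolding Ev_def Wt_def ev leaves_two_level ar[symmetric]
    using comp_Ops[OF c] w act_id[OF comp_Ops[OF c]] comp_out[OF c] assms(2)
    by (simp add: two_level_def)
qed

text \<open>Together with \<open>Ev_two_level\<close> and \<open>Ev_Leaf\<close>, this expresses
  every structure map of an operad as the evaluation of a tree.\<close>

lemma Ev_act:
  assumes p: "p \<in> Ops P" and L: "L \<in> perms (arity P p)" and "\<delta> r = p"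
  shows "Ev \<delta> (Vertex r (map Leaf L)) (act P p L)"
proof -
  let ?x = "act P p L"
  have i: "map ((!) (inp P ?x)) L = inp P p"
    using act_inp[OF p L] perms_length[OF L] by (intro nth_equalityI) (simp_all add: arity_def)
  have "\<forall>c \<in> set (map ((!) (inp P ?x)) L). c \<in> Col P" unfolding i using inp_Col[OF p] by blast
  then have w: "wt P \<delta> ((!) (inp P ?x)) (Vertex r (map Leaf L))"
    using p i assms(3) by (simp add: wt_Vertex o_def) (metis image_eqI list.set_map)
  have "eval P \<delta> ((!) (inp P ?x)) (Vertex r (map Leaf L)) = comp P p (map (ident P) (map ((!) (inp P ?x)) L))"
    using assms(3) by (simp add: o_def)
  also have "\<dots> = p" unfolding i by (rule comp_ident_right[OF p])
  finally have ev: "eval P \<delta> ((!) (inp P ?x)) (Vertex r (map Leaf L)) = p" .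
  show ?thesis
    unfolding Ev_def Wt_def ev using act_Ops[OF p L] w L act_arity[OF p L] act_out[OF p L] assms(3)
    by (simp add: o_def concat_map_singleton)
qed

end

section \<open>Morphisms of operads preserve values of trees\<close>

lemma operad_homD:
  assumes "(f, g) \<in> operad_hom P Q"
  shows "f \<in> Col P \<rightarrow>\<^sub>E Col Q" "g \<in> Ops P \<rightarrow>\<^sub>E Ops Q"
    "\<And>p. p \<in> Ops P \<Longrightarrow> inp Q (g p) = map f (inp P p)" "\<And>p. p \<in> Ops P \<Longrightarrow> out Q (g p) = f (out P p)"
    "\<And>c. c \<in> Col P \<Longrightarrow> g (ident P c) = ident Q (f c)"
    "\<And>p qs. composable P p qs \<Longrightarrow> g (comp P p qs) = comp Q (g p) (map g qs)"
    "\<And>p L. p \<in> Ops P \<Longrightarrow> L \<in> perms (arity P p) \<Longrightarrow> g (act P p L) = act Q (g p) L"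
  using assms unfolding operad_hom_def by auto

text \<open>Values are built from identities, composition and the action alone, and a morphism
  preserves all three.\<close>

lemma operad_hom_Ev:
  assumes P: "coloured_operad P" and Q: "coloured_operad Q" and h: "(f, g) \<in> operad_hom P Q"
    and E: "coloured_operad.Ev P \<delta> T x"
  shows "coloured_operad.Ev Q (\<lambda>v. g (\<delta> v)) T (g x)"
proof -
  interpret P: coloured_operad P by fact
  interpret Q: coloured_operad Q by fact
  note h = operad_homD[OF h]
  have rc: "rc Q (\<lambda>v. g (\<delta> v)) (\<lambda>l. f (\<gamma> l)) T = f (rc P \<delta> \<gamma> T)" if "wt P \<delta> \<gamma> T" for \<gamma> and T :: "('e, 'f) tree" and \<delta>
    using that by (cases T) (simp_all add: wt_Vertex h(4))
  have main: "wt Q (\<lambda>v. g (\<delta> v)) (\<lambda>l. f (\<gamma> l)) T \<and> eval Q (\<lambda>v. g (\<delta> v)) (\<lambda>l. f (\<gamma> l)) T = g (eval P \<delta> \<gamma> T)"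
    if "wt P \<delta> \<gamma> T" for \<gamma> and T :: "('e, 'f) tree" and \<delta>
    using that
  proof (induction T)
    case (Leaf l)
    then show ?case using h(1,5) by auto
  next
    case (Vertex v ts)
    note c = P.eval_composable[OF Vertex.prems]
    have v: "\<delta> v \<in> Ops P" "inp P (\<delta> v) = map (rc P \<delta> \<gamma>) ts" "\<And>t. t \<in> set ts \<Longrightarrow> wt P \<delta> \<gamma> t"
      using Vertex.prems by (simp_all add: wt_Vertex)
    have "map (eval Q (\<lambda>v. g (\<delta> v)) (\<lambda>l. f (\<gamma> l))) ts = map g (map (eval P \<delta> \<gamma>) ts)"
      using Vertex.IH v(3) by simp
    then have ev: "eval Q (\<lambda>v. g (\<delta> v)) (\<lambda>l. f (\<gamma> l)) (Vertex v ts) = g (eval P \<delta> \<gamma> (Vertex v ts))"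
      unfolding eval.simps h(6)[OF c] by (rule arg_cong)
    have "f (rc P \<delta> \<gamma> t) = rc Q (\<lambda>v. g (\<delta> v)) (\<lambda>l. f (\<gamma> l)) t" if "t \<in> set ts" for t
      using rc[OF v(3)[OF that]] by simp
    then have "inp Q (g (\<delta> v)) = map (rc Q (\<lambda>v. g (\<delta> v)) (\<lambda>l. f (\<gamma> l))) ts"
      using h(3)[OF v(1)] v(2) by simp
    moreover have "g (\<delta> v) \<in> Ops Q" using h(2) v(1) by auto
    ultimately show ?case using Vertex.IH v(3) ev by (simp add: wt_Vertex del: eval.simps)
  qed
  let ?\<gamma> = "(!) (inp P x)"
  have x: "x \<in> Ops P" "leaves T \<in> perms (arity P x)" "wt P \<delta> ?\<gamma> T" "rc P \<delta> ?\<gamma> T = out P x"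
    "x = act P (eval P \<delta> ?\<gamma> T) (leaves T)"
    using E by (simp_all add: P.Ev_def Wt_def)
  have ax: "arity Q (g x) = arity P x" using h(3)[OF x(1)] by (simp add: arity_def)
  have \<gamma>: "inp Q (g x) ! l = f (?\<gamma> l)" if "l \<in> set (leaves T)" for l
    using that perms_set[OF x(2)] h(3)[OF x(1)] by (simp add: arity_def)
  have cong: "wt Q (\<lambda>v. g (\<delta> v)) ((!) (inp Q (g x))) T = wt Q (\<lambda>v. g (\<delta> v)) (\<lambda>l. f (?\<gamma> l)) T"
    "rc Q (\<lambda>v. g (\<delta> v)) ((!) (inp Q (g x))) T = rc Q (\<lambda>v. g (\<delta> v)) (\<lambda>l. f (?\<gamma> l)) T"
    "eval Q (\<lambda>v. g (\<delta> v)) ((!) (inp Q (g x))) T = eval Q (\<lambda>v. g (\<delta> v)) (\<lambda>l. f (?\<gamma> l)) T"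
    using \<gamma> by (intro wt_cong rc_cong eval_cong; simp)+
  note e = P.eval_props[OF x(3)]
  have ae: "leaves T \<in> perms (arity P (eval P \<delta> ?\<gamma> T))"
    using x(2) perms_length[OF x(2)] e(2) by (simp add: arity_def)
  have "g x = act Q (g (eval P \<delta> ?\<gamma> T)) (leaves T)"
    using h(7)[OF e(1) ae] x(5) by simp
  moreover have "g x \<in> Ops Q" using h(2) x(1) by auto
  ultimately show ?thesis
    unfolding Q.Ev_def Wt_def cong ax using main[OF x(3)] rc[OF x(3)] x(2,4) h(4)[OF x(1)] by simp
qed

section \<open>The nerve functor\<close>

lemma opposite_simps [simp]: "ob (opposite C) = ob C" "hom (opposite C) a b = hom C b a"
  "idn (opposite C) = idn C" "cmp (opposite C) a b c g f = cmp C c b a f g"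
  by (simp_all add: opposite_def)

lemma set_category_simps [simp]: "ob set_category = UNIV" "hom set_category A B = A \<rightarrow>\<^sub>E B"
  "idn set_category A = (\<lambda>x\<in>A. x)" "cmp set_category A B D g f = compose A g f"
  by (simp_all add: set_category_def)

text \<open>An element of a nerve is a list of operations; the injection brings it back into the
  universe \<open>'u\<close>.\<close>

locale coding =
  fixes enc :: "'u list \<Rightarrow> 'u"
  assumes enc_inj: "inj enc"
begin

definition dec :: "'u \<Rightarrow> 'u list" where "dec = inv enc"

lemma dec_enc [simp]: "dec (enc xs) = xs"
  by (simp add: dec_def enc_inj)

lemma enc_eq [simp]: "enc xs = enc ys \<longleftrightarrow> xs = ys"
  using enc_inj by (auto simp: inj_def)

definition nerve_ob :: "('u, 'u) operad \<Rightarrow> (nat, nat) tree \<Rightarrow> 'u set" where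
  "nerve_ob P T = {enc (x # \<delta>) | x \<delta>. coloured_operad.elem P T \<delta> x}"

text \<open>The choice is determined by \<open>restr_exists\<close> and \<open>restr_unique\<close>.
  In the coded list the head is the value and the tail is the decoration.\<close>

definition nerve :: "('u, 'u) operad \<Rightarrow> ((nat, nat) tree, (nat, nat) tree tw_mor, 'u) presheaf" where
  "nerve P = \<lparr>fob = nerve_ob P, fmor = (\<lambda>t p f. \<lambda>d\<in>nerve_ob P t.
    SOME d'. \<exists>ys z. d' = enc (z # ys) \<and>
      coloured_operad.restr P f p (tl (dec d)) (hd (dec d)) ys z)\<rparr>"

lemma nerve_obE:
  assumes "d \<in> nerve_ob P T" obtains x \<delta> where "d = enc (x # \<delta>)" "coloured_operad.elem P T \<delta> x"
  using assms unfolding nerve_ob_def by blast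

lemma nerve_obI: "coloured_operad.elem P T \<delta> x \<Longrightarrow> enc (x # \<delta>) \<in> nerve_ob P T"
  unfolding nerve_ob_def by blast

lemma fob_nerve [simp]: "fob (nerve P) = nerve_ob P"
  by (simp add: nerve_def)

lemma fmor_nerve:
  assumes P: "coloured_operad P" and f: "f \<in> hom (Tw sOp) p t" and t: "t \<in> Ops sOp"
    and e: "coloured_operad.elem P t \<delta> x" and r: "coloured_operad.restr P f p \<delta> x ys z"
  shows "fmor (nerve P) t p f (enc (x # \<delta>)) = enc (z # ys)"
proof -
  interpret coloured_operad P by fact
  have "(SOME d'. \<exists>ys z. d' = enc (z # ys) \<and> restr f p \<delta> x ys z) = enc (z # ys)"
  proof (rule some_equality)
    show "\<exists>ys' z'. enc (z # ys) = enc (z' # ys') \<and> restr f p \<delta> x ys' z'" using r by blast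
    show "d' = enc (z # ys)" if "\<exists>ys z. d' = enc (z # ys) \<and> restr f p \<delta> x ys z" for d'
      using that restr_unique[OF f t r] by blast
  qed
  then show ?thesis using nerve_obI[OF e] by (simp add: nerve_def)
qed

lemma fmor_nerve_ext:
  assumes P: "coloured_operad P" and f: "f \<in> hom (Tw sOp) p t" and t: "t \<in> Ops sOp"
  shows "fmor (nerve P) t p f \<in> nerve_ob P t \<rightarrow>\<^sub>E nerve_ob P p"
proof (rule PiE_I)
  interpret coloured_operad P by fact
  fix d assume "d \<in> nerve_ob P t"
  then obtain x \<delta> where d: "d = enc (x # \<delta>)" "elem t \<delta> x" by (rule nerve_obE)
  obtain ys z where r: "restr f p \<delta> x ys z" using restr_exists[OF f t d(2)] by blast
  then have "elem p ys z" by (simp add: restr_def)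
  then show "fmor (nerve P) t p f d \<in> nerve_ob P p"
    using fmor_nerve[OF P f t d(2) r] d(1) nerve_obI by simp
qed (simp add: nerve_def)

lemma nerve_functor:
  assumes P: "coloured_operad P"
  shows "is_functor (opposite (Tw sOp)) set_category (nerve P)"
proof -
  interpret coloured_operad P by fact
  show ?thesis
    unfolding is_functor_def
  proof (intro conjI ballI; simp)
    fix t p f assume "t \<in> Ops sOp" "p \<in> Ops sOp" "f \<in> hom (Tw sOp) p t"
    then show "fmor (nerve P) t p f \<in> nerve_ob P t \<rightarrow>\<^sub>E nerve_ob P p"
      using fmor_nerve_ext[OF P] by blast
  next
    fix p :: "(nat, nat) tree" assume p: "p \<in> Ops sOp"
    show "fmor (nerve P) p p (tw_id sOp p) = (\<lambda>x\<in>nerve_ob P p. x)"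
    proof (rule PiE_ext[OF fmor_nerve_ext[OF P tw_id_hom(1)[OF p] p]])
      fix d assume "d \<in> nerve_ob P p"
      then obtain x \<delta> where d: "d = enc (x # \<delta>)" "elem p \<delta> x" by (rule nerve_obE)
      show "fmor (nerve P) p p (tw_id sOp p) d = (\<lambda>x\<in>nerve_ob P p. x) d"
        using fmor_nerve[OF P tw_id_hom(1)[OF p] p d(2) restr_id[OF p d(2)]] \<open>d \<in> _\<close> d(1) by simp
    qed auto
  next
    fix u t p g f
    assume u: "u \<in> Ops sOp" and t: "t \<in> Ops sOp" and p: "p \<in> Ops sOp"
      and g: "g \<in> hom (Tw sOp) t u" and f: "f \<in> hom (Tw sOp) p t"
    note c = tw_comp_hom(1)[OF f g t u]
    show "fmor (nerve P) u p (tw_comp sOp g f) =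
        compose (nerve_ob P u) (fmor (nerve P) t p f) (fmor (nerve P) u t g)"
    proof (rule PiE_ext[OF fmor_nerve_ext[OF P c u]])
      show "compose (nerve_ob P u) (fmor (nerve P) t p f) (fmor (nerve P) u t g)
          \<in> nerve_ob P u \<rightarrow>\<^sub>E nerve_ob P p"
        using fmor_nerve_ext[OF P f t] fmor_nerve_ext[OF P g u] by (auto simp: compose_def)
      fix d assume "d \<in> nerve_ob P u"
      then obtain x \<delta> where d: "d = enc (x # \<delta>)" "elem u \<delta> x" by (rule nerve_obE)
      obtain \<delta>' x' where r: "restr g t \<delta> x \<delta>' x'" using restr_exists[OF g u d(2)] by blast
      then have e': "elem t \<delta>' x'" by (simp add: restr_def)
      obtain ys z where r': "restr f p \<delta>' x' ys z" using restr_exists[OF f t e'] by blast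
      show "fmor (nerve P) u p (tw_comp sOp g f) d =
          compose (nerve_ob P u) (fmor (nerve P) t p f) (fmor (nerve P) u t g) d"
        using fmor_nerve[OF P c u d(2) restr_comp[OF f g t u r r']] fmor_nerve[OF P g u d(2) r]
          fmor_nerve[OF P f t e' r'] \<open>d \<in> _\<close> d(1) by (simp add: compose_def)
    qed
  qed
qed

lemma fmor_vtx:
  assumes "coloured_operad P" "T \<in> Ops sOp" "coloured_operad.elem P T \<delta> x" "i < length (vertices T)"
  shows "fmor (nerve P) T (cor 0 (inp sOp T ! i)) (vtx T i) (enc (x # \<delta>)) = enc [\<delta> ! i, \<delta> ! i]"
  using fmor_nerve[OF assms(1) vtx_hom[OF assms(2,4)] assms(2,3)]
    coloured_operad.restr_vtx[OF assms(1-4)] by blast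

lemma fmor_evm:
  assumes "coloured_operad P" "T \<in> Ops sOp" "coloured_operad.elem P T \<delta> x"
  shows "fmor (nerve P) T (cor 0 (length (leaves T))) (evm T) (enc (x # \<delta>)) = enc [x, x]"
  using fmor_nerve[OF assms(1) evm_hom[OF assms(2)] assms(2,3)]
    coloured_operad.restr_evm[OF assms(1-3)] by blast

section \<open>Full faithfulness of the nerve\<close>

definition nerve_mor :: "('u, 'u) operad \<Rightarrow> ('u \<Rightarrow> 'u) \<times> ('u \<Rightarrow> 'u) \<Rightarrow> (nat, nat) tree \<Rightarrow> 'u \<Rightarrow> 'u" where
  "nerve_mor P h = (\<lambda>T\<in>Ops sOp. \<lambda>d\<in>nerve_ob P T. enc (map (snd h) (dec d)))"

lemma elem_hom:
  assumes "coloured_operad P" "coloured_operad Q" "(f, g) \<in> operad_hom P Q"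
    "T \<in> Ops sOp" "coloured_operad.elem P T \<delta> x"
  shows "coloured_operad.elem Q T (map g \<delta>) (g x)"
proof -
  interpret P: coloured_operad P by fact
  interpret Q: coloured_operad Q by fact
  have E: "length \<delta> = length (vertices T)" "P.Ev ((!) \<delta>) T x" using assms(5) by (simp_all add: P.elem_def)
  have "Q.Ev (\<lambda>v. g (\<delta> ! v)) T (g x)" by (rule operad_hom_Ev[OF assms(1-3) E(2)])
  then have "Q.Ev ((!) (map g \<delta>)) T (g x)"
    using Q.Ev_cong[of T "\<lambda>v. g (\<delta> ! v)" "(!) (map g \<delta>)"] E(1)
      perms_set[OF sOp_Ops_vlabels[OF assms(4)]] by simp
  then show ?thesis using E(1) by (simp add: Q.elem_def)
qed

text \<open>A morphism of operads preserves the values of the upper trees and of the lower tree, so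
  it carries restrictions to restrictions.\<close>

lemma nerve_mor_nat:
  assumes P: "coloured_operad P" and Q: "coloured_operad Q" and h: "h \<in> operad_hom P Q"
  shows "nerve_mor P h \<in> nat_trans (opposite (Tw sOp)) set_category (nerve P) (nerve Q)"
proof -
  interpret P: coloured_operad P by fact
  interpret Q: coloured_operad Q by fact
  obtain fc g where fg: "h = (fc, g)" by fastforce
  note h = h[unfolded fg]
  have m: "nerve_mor P h T (enc (x # \<delta>)) = enc (g x # map g \<delta>)" if "T \<in> Ops sOp" "P.elem T \<delta> x" for T x \<delta>
    using that nerve_obI[of P] by (simp add: nerve_mor_def fg)
  have e: "nerve_mor P h T \<in> nerve_ob P T \<rightarrow>\<^sub>E nerve_ob Q T" if T: "T \<in> Ops sOp" for T
  proof (rule PiE_I)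
    fix d assume "d \<in> nerve_ob P T"
    then obtain x \<delta> where d: "d = enc (x # \<delta>)" "P.elem T \<delta> x" by (rule nerve_obE)
    then show "nerve_mor P h T d \<in> nerve_ob Q T"
      using m[OF T d(2)] nerve_obI[OF elem_hom[OF P Q h T d(2)]] by simp
  qed (simp add: nerve_mor_def T)
  show ?thesis
    unfolding nat_trans_def
  proof (intro CollectI conjI ballI; simp)
    show "nerve_mor P h \<in> extensional (Ops sOp)" by (simp add: nerve_mor_def)
    show "nerve_mor P h T \<in> nerve_ob P T \<rightarrow>\<^sub>E nerve_ob Q T" if "T \<in> Ops sOp" for T by (rule e[OF that])
    fix t p f assume t: "t \<in> Ops sOp" and p: "p \<in> Ops sOp" and f: "f \<in> hom (Tw sOp) p t"
    note fP = fmor_nerve_ext[OF P f t] and fQ = fmor_nerve_ext[OF Q f t]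
    show "compose (nerve_ob P t) (nerve_mor P h p) (fmor (nerve P) t p f) =
        compose (nerve_ob P t) (fmor (nerve Q) t p f) (nerve_mor P h t)"
    proof (rule extensionalityI)
      fix d assume d0: "d \<in> nerve_ob P t"
      then obtain x \<delta> where d: "d = enc (x # \<delta>)" "P.elem t \<delta> x" by (rule nerve_obE)
      obtain ys z where r: "P.restr f p \<delta> x ys z" using P.restr_exists[OF f t d(2)] by blast
      then have e': "P.elem p ys z" by (simp add: P.restr_def)
      note l = lhom_of_hom(1)[OF f t]
      have len: "length \<delta> = length (vertices t)" using d(2) by (simp add: P.elem_def)
      have "Q.restr f p (map g \<delta>) (g x) (map g ys) (g z)"
        unfolding Q.restr_def
      proof (intro conjI allI impI)
        show "Q.elem p (map g ys) (g z)" by (rule elem_hom[OF P Q h p e'])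
        fix i assume i: "i < length (vertices p)"
        have "P.Ev ((!) \<delta>) (uppL f i) (ys ! i)" using r i by (simp add: P.restr_def)
        from operad_hom_Ev[OF P Q h this]
        have "Q.Ev (\<lambda>v. g (\<delta> ! v)) (uppL f i) (map g ys ! i)"
          using e' i by (simp add: P.elem_def)
        moreover have "g (\<delta> ! v) = map g \<delta> ! v" if "v \<in> set (vlabels (uppL f i))" for v
        proof -
          from that obtain n where "(v, n) \<in> set (vertices (uppL f i))" by auto
          then have "v < length \<delta>"
            using lhom_vertices(1)[OF l i] sOp_inp_nth(2)[OF t] len by auto
          then show ?thesis by simp
        qed
        ultimately show "Q.Ev ((!) (map g \<delta>)) (uppL f i) (map g ys ! i)"
          using Q.Ev_cong[of "uppL f i" "\<lambda>v. g (\<delta> ! v)"] by blast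
      next
        have "P.Ev (case_option z ((!) \<delta>)) (lowL f) x" using r by (simp add: P.restr_def)
        from operad_hom_Ev[OF P Q h this]
        have "Q.Ev (\<lambda>v. g (case_option z ((!) \<delta>) v)) (lowL f) (g x)" .
        moreover have "g (case_option z ((!) \<delta>) v) = case_option (g z) ((!) (map g \<delta>)) v"
          if "v \<in> set (vlabels (lowL f))" for v
        proof (cases v)
          case (Some j)
          then obtain n where "(Some j, n) \<in> set (vertices (lowL f))" using \<open>v \<in> _\<close> by auto
          then have "j < length \<delta>" using lhom_vertices(2)[OF l] sOp_inp_nth(2)[OF t] len by auto
          then show ?thesis using Some by simp
        qed simp
        ultimately show "Q.Ev (case_option (g z) ((!) (map g \<delta>))) (lowL f) (g x)"
          using Q.Ev_cong[of "lowL f" "\<lambda>v. g (case_option z ((!) \<delta>) v)"] by blast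
      qed
      from fmor_nerve[OF Q f t elem_hom[OF P Q h t d(2)] this]
      show "compose (nerve_ob P t) (nerve_mor P h p) (fmor (nerve P) t p f) d =
          compose (nerve_ob P t) (fmor (nerve Q) t p f) (nerve_mor P h t) d"
        using fmor_nerve[OF P f t d(2) r] m[OF t d(2)] m[OF p e'] d0 d(1) by (simp add: compose_def)
    qed simp_all
  qed
qed

lemma elem_cor:
  assumes "coloured_operad P" "p \<in> Ops P"
  shows "coloured_operad.elem P (cor 0 (arity P p)) [p] p"
proof -
  interpret coloured_operad P by fact
  show ?thesis using assms(2) by (simp add: elem_def Ev_cor)
qed

text \<open>Operations are visible over corollas, and colours are recovered from their
  identities.\<close>

lemma nerve_mor_faithful:
  assumes P: "coloured_operad P" and Q: "coloured_operad Q" and h: "h \<in> operad_hom P Q" and h': "h' \<in> operad_hom P Q"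
    and e: "nerve_mor P h = nerve_mor P h'"
  shows "h = h'"
proof -
  interpret P: coloured_operad P by fact
  interpret Q: coloured_operad Q by fact
  obtain f g f' g' where fg: "h = (f, g)" "h' = (f', g')" by fastforce
  note h = operad_homD[OF h[unfolded fg]] and h' = operad_homD[OF h'[unfolded fg]]
  have g: "g p = g' p" if p: "p \<in> Ops P" for p
  proof -
    have "nerve_mor P (f, g) (cor 0 (arity P p)) (enc [p, p]) = nerve_mor P (f', g') (cor 0 (arity P p)) (enc [p, p])"
      using e fg by simp
    then show ?thesis using nerve_obI[OF elem_cor[OF P p]] by (simp add: nerve_mor_def)
  qed
  then have "g = g'" using PiE_ext[OF h(2) h'(2)] by blast
  moreover have "f c = f' c" if c: "c \<in> Col P" for c
  proof -
    have "f c \<in> Col Q" "f' c \<in> Col Q" using h(1) h'(1) c by auto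
    then show ?thesis
      using h(5)[OF c] h'(5)[OF c] g[OF P.ident_Ops[OF c]] Q.ident_out by metis
  qed
  then have "f = f'" using PiE_ext[OF h(1) h'(1)] by blast
  ultimately show ?thesis using fg by simp
qed

text \<open>The components over corollas define a map on operations. Naturality along
  \<open>vtx\<close> and \<open>evm\<close> forces \<open>\<alpha>\<close> to apply it entrywise
  over every tree. Applied to the trees that express the structure maps, this shows that the map is
  a morphism of operads.\<close>

lemma nerve_mor_full:
  assumes P: "coloured_operad P" and Q: "coloured_operad Q"
    and \<alpha>: "\<alpha> \<in> nat_trans (opposite (Tw sOp)) set_category (nerve P) (nerve Q)"
  shows "\<exists>h \<in> operad_hom P Q. \<alpha> = nerve_mor P h"
proof -
  interpret P: coloured_operad P by fact
  interpret Q: coloured_operad Q by fact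
  have ext: "\<alpha> \<in> extensional (Ops sOp)"
    and e: "\<And>T. T \<in> Ops sOp \<Longrightarrow> \<alpha> T \<in> nerve_ob P T \<rightarrow>\<^sub>E nerve_ob Q T"
    and nat: "\<And>t p f. t \<in> Ops sOp \<Longrightarrow> p \<in> Ops sOp \<Longrightarrow> f \<in> hom (Tw sOp) p t \<Longrightarrow>
      compose (nerve_ob P t) (\<alpha> p) (fmor (nerve P) t p f) =
      compose (nerve_ob P t) (fmor (nerve Q) t p f) (\<alpha> t)"
    using \<alpha> by (auto simp: nat_trans_def)
  have nat': "\<alpha> p (fmor (nerve P) t p f d) = fmor (nerve Q) t p f (\<alpha> t d)"
    if "t \<in> Ops sOp" "p \<in> Ops sOp" "f \<in> hom (Tw sOp) p t" "d \<in> nerve_ob P t" for t p f d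
    using fun_cong[OF nat[OF that(1-3)], of d] that(4) by (simp add: compose_def)
  \<comment> \<open>Over a corolla an operation is stored twice, as the value and as the
    decoration.\<close>
  define g where "g = (\<lambda>p\<in>Ops P. hd (dec (\<alpha> (cor 0 (arity P p)) (enc [p, p]))))"
  \<comment> \<open>The presheaf does not see colours directly; a colour is recovered as the output
    of its identity.\<close>
  define f where "f = (\<lambda>c\<in>Col P. out Q (g (ident P c)))"
  have \<alpha>g: "\<alpha> T (enc (x # \<delta>)) = enc (g x # map g \<delta>)" and elQ: "Q.elem T (map g \<delta>) (g x)"
    if T: "T \<in> Ops sOp" and el: "P.elem T \<delta> x" for T x \<delta>
  proof -
    have d: "enc (x # \<delta>) \<in> nerve_ob P T" by (rule nerve_obI[OF el])
    then have "\<alpha> T (enc (x # \<delta>)) \<in> nerve_ob Q T" using e[OF T] by auto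
    then obtain x' \<delta>' where d': "\<alpha> T (enc (x # \<delta>)) = enc (x' # \<delta>')" "Q.elem T \<delta>' x'" by (rule nerve_obE)
    have len: "length \<delta> = length (vertices T)" "length \<delta>' = length (vertices T)"
      using el d'(2) by (simp_all add: P.elem_def Q.elem_def)
    have E: "P.Ev ((!) \<delta>) T x" using el by (simp add: P.elem_def)
    have "x \<in> Ops P" "arity P x = length (leaves T)"
      using E perms_length unfolding P.Ev_def Wt_def by metis+
    then have "g x = x'"
      using nat'[OF T _ evm_hom[OF T] d] fmor_evm[OF P T el] fmor_evm[OF Q T d'(2)] d'(1)
      by (simp add: g_def)
    moreover have "g (\<delta> ! i) = \<delta>' ! i" if i: "i < length (vertices T)" for i
    proof -
      have "\<delta> ! i \<in> Ops P \<and> arity P (\<delta> ! i) = inp sOp T ! i"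
        using P.Ev_vertex[OF E sOp_vertex[OF T i]] .
      then show ?thesis
        using nat'[OF T _ vtx_hom[OF T i] d] fmor_vtx[OF P T el i] fmor_vtx[OF Q T d'(2) i] d'(1)
        by (simp add: g_def)
    qed
    then have "map g \<delta> = \<delta>'" using len by (intro nth_equalityI) auto
    ultimately show "\<alpha> T (enc (x # \<delta>)) = enc (g x # map g \<delta>)" "Q.elem T (map g \<delta>) (g x)"
      using d' by auto
  qed
  have gO: "g p \<in> Ops Q" "arity Q (g p) = arity P p" if p: "p \<in> Ops P" for p
    using elQ[OF _ elem_cor[OF P p]] by (auto simp: Q.elem_def Q.Ev_cor)
  \<comment> \<open>Identities are the values of the tree without vertices, so naturality over this
    tree preserves them.\<close>
  have id: "\<exists>c' \<in> Col Q. g (ident P c) = ident Q c'" if c: "c \<in> Col P" for c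
  proof -
    have "P.elem (Leaf 0) [] (ident P c)" using c by (auto simp: P.elem_def P.Ev_Leaf)
    from elQ[OF _ this] show ?thesis by (simp add: Q.elem_def Q.Ev_Leaf)
  qed
  have fid: "f c \<in> Col Q" "g (ident P c) = ident Q (f c)" if c: "c \<in> Col P" for c
    using id[OF c] c Q.ident_out by (auto simp: f_def)
  have two: "Q.Ev ((!) (map g (p # qs))) (two_level 0 Suc (map (arity P) qs)) (g (comp P p qs))"
    if c: "composable P p qs" for p qs
  proof -
    have "P.elem (two_level 0 Suc (map (arity P) qs)) (p # qs) (comp P p qs)"
      unfolding P.elem_def using P.Ev_two_level[OF c, of "(!) (p # qs)" 0 Suc]
      by (simp add: vertices_two_level)
    from elQ[OF two_level_Ops this] show ?thesis by (simp add: Q.elem_def)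
  qed
  have twoD: "inp Q (g p) = map (\<lambda>q. out Q (g q)) qs" if c: "composable P p qs" for p qs
  proof -
    have "wt Q ((!) (map g (p # qs))) ((!) (inp Q (g (comp P p qs)))) (two_level 0 Suc (map (arity P) qs))"
      using two[OF c] unfolding Q.Ev_def Wt_def by blast
    then have "inp Q (g p) = map (\<lambda>i. out Q (map g qs ! i)) [0..<length qs]"
      by (subst (asm) wt_two_level[where qs = qs]) simp_all
    also have "\<dots> = map (\<lambda>q. out Q (g q)) qs" by (intro nth_equalityI) simp_all
    finally show ?thesis .
  qed
  have inp: "inp Q (g p) = map f (inp P p)" if p: "p \<in> Ops P" for p
  proof -
    have col: "c \<in> Col P" if "c \<in> set (inp P p)" for c using P.inp_Col[OF p] that by blast
    \<comment> \<open>With identities above \<open>p\<close>, the outputs in \<open>twoD\<close>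
      become the images of the input colours of \<open>p\<close>.\<close>
    have "composable P p (map (ident P) (inp P p))"
      using p col P.ident_Ops P.ident_out by (auto simp: composable_def intro!: nth_equalityI)
    from twoD[OF this] show ?thesis using col by (simp add: f_def)
  qed
  have out: "out Q (g p) = f (out P p)" if p: "p \<in> Ops P" for p
  proof -
    note c = P.out_Col[OF p]
    \<comment> \<open>Placing \<open>p\<close> above an identity turns its output colour into an
      input colour, to which \<open>twoD\<close> applies.\<close>
    have "composable P (ident P (out P p)) [p]"
      using p c P.ident_Ops P.ident_inp by (auto simp: composable_def)
    from twoD[OF this] show ?thesis using fid[OF c] Q.ident_inp by simp
  qed
  have "(f, g) \<in> operad_hom P Q"
    unfolding operad_hom_def
  proof (intro CollectI case_prodI conjI ballI allI impI)
    show "f \<in> Col P \<rightarrow>\<^sub>E Col Q" 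
      using fid(1) by (intro PiE_I) (blast, simp add: f_def)
    show "g \<in> Ops P \<rightarrow>\<^sub>E Ops Q" 
      using gO(1) by (intro PiE_I) (blast, simp add: g_def)
    fix p qs assume c: "composable P p qs"
    then have p: "p \<in> Ops P" "\<And>q. q \<in> set qs \<Longrightarrow> q \<in> Ops P" "map (out P) qs = inp P p"
      by (auto simp: composable_def)
    have "map (out Q) (map g qs) = inp Q (g p)"
      using inp[OF p(1)] out p(2) by (simp flip: p(3))
    then have cQ: "composable Q (g p) (map g qs)" using gO p by (auto simp: composable_def)
    have "map (arity Q) (map g qs) = map (arity P) qs" using gO(2) p(2) by simp
    then have "Q.Ev ((!) (map g (p # qs))) (two_level 0 Suc (map (arity P) qs)) (comp Q (g p) (map g qs))"
      using Q.Ev_two_level[OF cQ, of "(!) (map g (p # qs))" 0 Suc] by (simp del: map_map)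
    from Q.Ev_unique[OF two[OF c] this] show "g (comp P p qs) = comp Q (g p) (map g qs)" by simp
  next
    fix p L assume p: "p \<in> Ops P" and L: "L \<in> perms (arity P p)"
    let ?T = "Vertex 0 (map Leaf L)"
    have lT: "leaves ?T = L" by (simp add: o_def concat_map_singleton)
    have "vlabels ?T \<in> perms (length (vertices ?T))" by (simp add: o_def perms_iff)
    then have T: "?T \<in> Ops sOp" unfolding sOp_Ops lT using perms_self[OF L] by blast
    have "P.elem ?T [p] (act P p L)"
      unfolding P.elem_def using P.Ev_act[OF p L, of "(!) [p]" 0] by (simp add: o_def)
    from elQ[OF T this] have 1: "Q.Ev ((!) (map g [p])) ?T (g (act P p L))" by (simp add: Q.elem_def)
    have 2: "Q.Ev ((!) (map g [p])) ?T (act Q (g p) L)"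
      using Q.Ev_act[of "g p" L "(!) (map g [p])" 0] gO[OF p] L by simp
    from Q.Ev_unique[OF 1 2] show "g (act P p L) = act Q (g p) L" by simp
  qed (use inp out fid in auto)
  moreover have "\<alpha> = nerve_mor P (f, g)"
  proof (rule extensionalityI[OF ext])
    show "nerve_mor P (f, g) \<in> extensional (Ops sOp)" by (simp add: nerve_mor_def)
    fix T :: "(nat, nat) tree" assume T: "T \<in> Ops sOp"
    show "\<alpha> T = nerve_mor P (f, g) T"
    proof (rule extensionalityI)
      show "\<alpha> T \<in> extensional (nerve_ob P T)" using e[OF T] by (auto simp: PiE_def)
      show "nerve_mor P (f, g) T \<in> extensional (nerve_ob P T)" using T by (simp add: nerve_mor_def)
      fix d assume "d \<in> nerve_ob P T"
      then obtain x \<delta> where d: "d = enc (x # \<delta>)" "P.elem T \<delta> x" by (rule nerve_obE)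
      then show "\<alpha> T d = nerve_mor P (f, g) T d"
        using \<alpha>g[OF T d(2)] \<open>d \<in> _\<close> T by (simp add: nerve_mor_def)
    qed
  qed
  ultimately show ?thesis by blast
qed

end

section \<open>Edges\<close>

primrec subtrees :: "('v, 'l) tree \<Rightarrow> ('v, 'l) tree set" where
  "subtrees (Leaf l) = {Leaf l}"
| "subtrees (Vertex v ts) = insert (Vertex v ts) (\<Union>(set (map subtrees ts)))"

text \<open>An edge of \<open>T\<close> is given by the subtree \<open>S\<close> above it; a unary vertex labelled \<^const>\<open>None\<close> is
  inserted on this edge.\<close>

primrec mark :: "('v, 'l) tree \<Rightarrow> ('v, 'l) tree \<Rightarrow> ('v option, 'l) tree" where
  "mark S (Leaf l) = (if S = Leaf l then Vertex None [Leaf l] else Leaf l)"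
| "mark S (Vertex v ts) = (if S = Vertex v ts then Vertex None [vmap Some (Vertex v ts)]
    else Vertex (Some v) (map (mark S) ts))"

text \<open>Finds what lies above a marked vertex. It recovers the subtree from
  \<open>mark S T\<close> and thus separates different edges.\<close>

primrec marked :: "('v option, 'l) tree \<Rightarrow> ('v option, 'l) tree set" where
  "marked (Leaf l) = {}"
| "marked (Vertex a ts) = (if a = None then set ts else \<Union>(set (map marked ts)))"

text \<open>Under this condition different edges have different subtrees above them, so a subtree
  identifies an edge.\<close>

definition labels_distinct :: "('v, 'l) tree \<Rightarrow> bool" where
  "labels_distinct T \<longleftrightarrow> distinct (vlabels T) \<and> distinct (leaves T)"

lemma subtrees_self [simp]: "T \<in> subtrees T"
  by (cases T) auto

lemma subtrees_trans: "R \<in> subtrees S \<Longrightarrow> S \<in> subtrees T \<Longrightarrow> R \<in> subtrees T"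
  by (induction T) auto

lemma subtrees_child: "k < length us \<Longrightarrow> Vertex i us \<in> subtrees T \<Longrightarrow> us ! k \<in> subtrees T"
  by (rule subtrees_trans[of _ "Vertex i us"]) (force intro: nth_mem)+

lemma subtrees_labels: "S \<in> subtrees T \<Longrightarrow>
    set (vertices S) \<subseteq> set (vertices T) \<and> set (leaves S) \<subseteq> set (leaves T)"
  by (induction T) auto

lemma subtrees_length: "S \<in> subtrees T \<Longrightarrow> length (vertices S) \<le> length (vertices T)"
proof (induction T)
  case (Vertex v ts)
  show ?case
  proof (cases "S = Vertex v ts")
    case False
    then obtain t where t: "t \<in> set ts" "S \<in> subtrees t" using Vertex.prems by auto
    have "length (vertices t) \<le> sum_list (map (length \<circ> vertices) ts)"
      by (rule member_le_sum_list) (use t(1) in simp_all)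
    then show ?thesis using Vertex.IH[OF t] by (simp add: length_concat o_def)
  qed simp
qed auto

lemma subtrees_proper: "t \<in> set ts \<Longrightarrow> Vertex v ts \<notin> subtrees t"
proof
  assume t: "t \<in> set ts" and "Vertex v ts \<in> subtrees t"
  from subtrees_length[OF this(2)] have "length (vertices (Vertex v ts)) \<le> length (vertices t)" .
  moreover have "length (vertices t) \<le> sum_list (map (length \<circ> vertices) ts)"
    by (rule member_le_sum_list) (use t in simp_all)
  ultimately show False by (simp add: length_concat o_def)
qed

lemma has_label: "set (vertices S) \<noteq> {} \<or> set (leaves S) \<noteq> {}"
  by (cases S) auto

lemma labels_distinct_Vertex:
  "labels_distinct (Vertex v ts) \<Longrightarrow> t \<in> set ts \<Longrightarrow> labels_distinct t"
  "labels_distinct (Vertex v ts) \<Longrightarrow> t \<in> set ts \<Longrightarrow> v \<notin> set (vlabels t)"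
  unfolding labels_distinct_def by (auto simp: map_concat o_def distinct_concat_iff)

lemma distinct_concat_disjoint:
  assumes "distinct (concat (map f ts))" "k < length ts" "j < length ts" "k \<noteq> j"
  shows "set (f (ts ! k)) \<inter> set (f (ts ! j)) = {}"
  using assms
proof (induction ts arbitrary: k j)
  case (Cons t ts)
  have *: "set (f t) \<inter> set (f (ts ! i)) = {}" if "i < length ts" for i
  proof -
    have "set (f t) \<inter> (\<Union>a\<in>set ts. set (f a)) = {}" using Cons.prems(1) by simp
    then show ?thesis using nth_mem[OF that] by blast
  qed
  show ?case
    using Cons.IH[of "k - 1" "j - 1"] Cons.prems *[of "k - 1"] *[of "j - 1"]
    by (cases k; cases j) auto
qed simp

text \<open>Every subtree contains the label of a vertex or of a leaf, and no label occurs in two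
  branches.\<close>

lemma subtrees_disjoint:
  assumes "labels_distinct (Vertex v ts)" "k < length ts" "j < length ts" "k \<noteq> j"
    "S \<in> subtrees (ts ! k)"
  shows "S \<notin> subtrees (ts ! j)"
proof
  assume "S \<in> subtrees (ts ! j)"
  then have s: "set (vlabels S) \<subseteq> set (vlabels (ts ! k)) \<inter> set (vlabels (ts ! j))"
    "set (leaves S) \<subseteq> set (leaves (ts ! k)) \<inter> set (leaves (ts ! j))"
    using subtrees_labels[OF assms(5)] subtrees_labels[of S "ts ! j"] by auto
  have "distinct (concat (map vlabels ts))" "distinct (concat (map leaves ts))"
    using assms(1) unfolding labels_distinct_def by (simp_all add: map_concat o_def)
  from distinct_concat_disjoint[OF this(1) assms(2-4)] distinct_concat_disjoint[OF this(2) assms(2-4)]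
  show False using s has_label[of S] by auto
qed

lemma mark_other: "S \<notin> subtrees T \<Longrightarrow> mark S T = vmap Some T"
  by (induction T) auto

lemma mark_self: "mark T T = Vertex None [vmap Some T]"
  by (cases T) auto

lemma vlabels_mark: "filter (\<lambda>a. a \<noteq> None) (vlabels (mark S T)) = map Some (vlabels T)"
proof (induction T)
  case (Vertex v ts)
  have "filter (\<lambda>a. a \<noteq> None) (vlabels (vmap Some (Vertex v ts))) = map Some (vlabels (Vertex v ts))"
    unfolding vlabels_vmap by (intro filter_True) auto
  moreover have "filter (\<lambda>a. a \<noteq> None) (concat (map vlabels (map (mark S) ts))) =
      concat (map (\<lambda>t. map Some (vlabels t)) ts)"
    using Vertex.IH by (simp add: filter_concat o_def cong: map_cong)
  ultimately show ?case by (simp add: map_concat o_def)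
qed simp

lemma count_mark:
  "labels_distinct T \<Longrightarrow> count (mset (vlabels (mark S T))) None = (if S \<in> subtrees T then 1 else 0)"
proof (induction T)
  case (Vertex v ts)
  have nS: "count (mset (vlabels (vmap Some t))) None = 0" for t :: "('a, 'b) tree"
    unfolding vlabels_vmap by (auto simp: count_eq_zero_iff)
  show ?case
  proof (cases "S = Vertex v ts")
    case True
    then show ?thesis using nS[of "Vertex v ts"] by (simp add: o_def)
  next
    case False
    let ?c = "\<lambda>t. count (mset (vlabels (mark S t))) None"
    have e: "count (mset (vlabels (mark S (Vertex v ts)))) None = (\<Sum>t\<leftarrow>ts. ?c t)"
      using False by (simp add: map_concat mset_concat_sum count_sum_list o_def)
    have c: "?c t = (if S \<in> subtrees t then 1 else 0)" if "t \<in> set ts" for t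
      using Vertex.IH[OF that labels_distinct_Vertex(1)[OF Vertex.prems that]] .
    show ?thesis
    proof (cases "\<exists>k < length ts. S \<in> subtrees (ts ! k)")
      case True
      then obtain k where k: "k < length ts" "S \<in> subtrees (ts ! k)" by blast
      have "(\<Sum>t\<leftarrow>ts. ?c t) = (\<Sum>j = 0..<length ts. ?c (ts ! j))"
        by (simp add: sum_list_sum_nth)
      also have "\<dots> = (\<Sum>j = 0..<length ts. if j = k then 1 else 0)"
      proof (rule sum.cong)
        fix j assume "j \<in> {0..<length ts}"
        then have j: "j < length ts" by simp
        show "?c (ts ! j) = (if j = k then 1 else 0)"
          using c[OF nth_mem[OF j]] subtrees_disjoint[OF Vertex.prems k(1) j _ k(2)] k(2)
          by (cases "j = k") simp_all
      qed simp
      also have "\<dots> = 1" using k(1) by simp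
      finally have "(\<Sum>t\<leftarrow>ts. ?c t) = 1" .
      moreover have "S \<in> subtrees (Vertex v ts)" using k nth_mem[OF k(1)] by auto
      ultimately show ?thesis unfolding e by simp
    next
      case False
      then have n: "S \<notin> subtrees t" if "t \<in> set ts" for t using that by (auto simp: in_set_conv_nth)
      have "map ?c ts = map (\<lambda>t. 0) ts" using c n by (intro map_cong) auto
      then have "(\<Sum>t\<leftarrow>ts. ?c t) = 0" by (simp only: sum_list_0)
      moreover have "S \<notin> subtrees (Vertex v ts)" using n \<open>S \<noteq> _\<close> by auto
      ultimately show ?thesis unfolding e by simp
    qed
  qed
qed simp

lemma distinct_mark:
  assumes "labels_distinct T" "S \<in> subtrees T" shows "distinct (vlabels (mark S T))"
proof (rule distinct_of_Some)
  show "count (mset (vlabels (mark S T))) None = 1" using count_mark[OF assms(1)] assms(2) by simp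
  show "distinct (map the (filter (\<lambda>a. a \<noteq> None) (vlabels (mark S T))))"
    unfolding vlabels_mark using assms(1) by (simp add: labels_distinct_def o_def)
qed

lemma None_mark: "S \<in> subtrees T \<Longrightarrow> (None, 1) \<in> set (vertices (mark S T))"
  by (induction T) auto

lemma plug_vmap_Some: "plug z (vmap Some T) = T"
  by (simp add: plug_def sub_vmap)

lemma graft_nth_cor: "length xs = n \<Longrightarrow> graft ((!) xs) (cor v n) = Vertex v xs"
  using map_nth[of xs] by (simp add: cor_def o_def)

lemma plug_Vertex_Some: "plug z (Vertex (Some v) ts) = Vertex v (map (plug z) ts)"
  by (simp add: plug_def graft_nth_cor)

text \<open>Substituting the tree without vertices erases a unary vertex, here the one that
  \<open>mark\<close> inserted.\<close>

lemma plug_mark: "plug (Leaf 0) (mark S T) = T"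
proof (induction T)
  case (Leaf l)
  then show ?case by (simp add: plug_def)
next
  case (Vertex v ts)
  have "plug (Leaf 0) (Vertex None [t]) = plug (Leaf 0) t" for t :: "(nat option, 'a) tree"
    by (simp add: plug_def)
  moreover have "map (plug (Leaf 0) \<circ> mark S) ts = ts" using Vertex by (simp add: map_idI)
  ultimately show ?case using plug_vmap_Some[of "Leaf 0" "Vertex v ts"]
    by (simp add: plug_Vertex_Some del: tree.map)
qed

lemma marked_mark: "marked (mark S T) \<subseteq> {vmap Some S}"
  "S \<in> subtrees T \<Longrightarrow> vmap Some S \<in> marked (mark S T)"
  by (induction T) auto

lemma mark_inj: "S \<in> subtrees T \<Longrightarrow> mark S T = mark S' T \<Longrightarrow> S = S'"
  using marked_mark(2)[of S T] marked_mark(1)[of S' T] vmap_inj[of Some S S'] by auto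

lemma vmap_plug: "None \<notin> set (vlabels lo) \<Longrightarrow> vmap Some (plug z lo) = lo"
proof (induction lo)
  case (Leaf l)
  then show ?case by (simp add: plug_def)
next
  case (Vertex a ts)
  then obtain v where a: "a = Some v" by (cases a) auto
  have "map (\<lambda>t. vmap Some (plug z t)) ts = ts"
    using Vertex.IH Vertex.prems by (intro map_idI) fastforce
  then show ?case by (simp add: a plug_Vertex_Some o_def)
qed

text \<open>Erasing the unary marked vertex only forgets on which edge it sat, and the subtree above
  that edge remembers it. Distinct labels ensure that no other branch contains the same
  subtree.\<close>

lemma lo_mark:
  "distinct (vlabels lo) \<Longrightarrow> (None, 1) \<in> set (vertices lo) \<Longrightarrow>
    labels_distinct (plug (Leaf 0) lo) \<Longrightarrow>
    \<exists>S \<in> subtrees (plug (Leaf 0) lo). lo = mark S (plug (Leaf 0) lo)"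
proof (induction lo)
  case (Vertex a ts)
  let ?p = "plug (Leaf 0)"
  show ?case
  proof (cases a)
    case None
    have "length ts = 1"
      using distinct_vlabelsD[OF Vertex.prems(1) _ Vertex.prems(2)] None by simp
    then obtain t where ts: "ts = [t]" by (cases ts) auto
    have p: "?p (Vertex a ts) = ?p t" by (simp add: None ts plug_def)
    have "None \<notin> set (vlabels t)" using Vertex.prems(1) None ts by simp
    then have "Vertex a ts = mark (?p t) (?p t)"
      using vmap_plug[of t "Leaf 0"] by (simp add: mark_self None ts)
    then show ?thesis using p by auto
  next
    case (Some v)
    have p: "?p (Vertex a ts) = Vertex v (map ?p ts)" by (simp add: Some plug_Vertex_Some)
    note ld = Vertex.prems(3)[unfolded p]
    obtain t where "t \<in> set ts" "(None, 1) \<in> set (vertices t)"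
      using Vertex.prems(2) Some by auto
    then obtain k where k: "k < length ts" "(None, 1) \<in> set (vertices (ts ! k))"
      by (metis in_set_conv_nth)
    have dts: "distinct (concat (map vlabels ts))"
      using Vertex.prems(1) by (simp add: map_concat o_def)
    have "distinct (vlabels (ts ! k))"
      using dts k(1) unfolding distinct_concat_iff by simp
    moreover have "labels_distinct (?p (ts ! k))"
      using labels_distinct_Vertex(1)[OF ld, of "?p (ts ! k)"] k(1) by simp
    ultimately obtain S where S: "S \<in> subtrees (?p (ts ! k))" "ts ! k = mark S (?p (ts ! k))"
      using Vertex.IH[OF nth_mem[OF k(1)] _ k(2)] by blast
    have "None \<in> set (vlabels (ts ! k))" using k(2) by force
    then have other: "None \<notin> set (vlabels (ts ! j))" if "j < length ts" "j \<noteq> k" for j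
      using distinct_concat_disjoint[OF dts that(1) k(1) that(2)] by blast
    have "mark S (?p (ts ! j)) = ts ! j" if j: "j < length ts" for j
    proof (cases "j = k")
      case False
      have "S \<notin> subtrees (map ?p ts ! j)"
        using subtrees_disjoint[OF ld, of k j S] k(1) j False S(1) by simp
      then show ?thesis using mark_other[of S "?p (ts ! j)"] vmap_plug[OF other[OF j False]] j by simp
    qed (use S in simp)
    then have "map (\<lambda>t. mark S (?p t)) ts = ts" by (intro nth_equalityI) auto
    moreover have "S \<noteq> Vertex v (map ?p ts)"
      using subtrees_proper[of "?p (ts ! k)" "map ?p ts" v] S(1) k(1) by auto
    moreover have "S \<in> subtrees (Vertex v (map ?p ts))" using S(1) k(1) by auto
    ultimately show ?thesis unfolding p by (intro bexI[of _ S]) (simp_all add: Some o_def)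
  qed
qed simp

lemma Ops_labels_distinct: "T \<in> Ops sOp \<Longrightarrow> labels_distinct T"
  unfolding labels_distinct_def using sOp_Ops_vlabels sOp_Ops_leaves perms_distinct by blast

text \<open>The source has no vertices, so the upper trees are a dummy and the lower tree alone
  describes the morphism.\<close>

definition edge :: "(nat, nat) tree \<Rightarrow> (nat, nat) tree \<Rightarrow> (nat, nat) tree tw_mor" where
  "edge T S = mor (Leaf 0) T (\<lambda>_. Leaf 0) (mark S T)"

lemma lhom_edge:
  assumes "T \<in> Ops sOp" "S \<in> subtrees T"
  shows "lhom (Leaf 0) T (\<lambda>_. Leaf 0) (mark S T)"
  unfolding lhom_def using assms distinct_mark[OF Ops_labels_distinct[OF assms(1)] assms(2)]
    None_mark[OF assms(2)] by (simp add: plug_mark)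

lemma edge_hom: "T \<in> Ops sOp \<Longrightarrow> S \<in> subtrees T \<Longrightarrow> edge T S \<in> hom (Tw sOp) (Leaf 0) T"
  and lowL_edge: "T \<in> Ops sOp \<Longrightarrow> S \<in> subtrees T \<Longrightarrow> lowL (edge T S) = mark S T"
  unfolding edge_def using mor_props[OF lhom_edge] by simp_all

lemma edge_eqI:
  assumes "h \<in> hom (Tw sOp) (Leaf 0) T" "T \<in> Ops sOp" "S \<in> subtrees T" "lowL h = mark S T"
  shows "h = edge T S"
  using hom_eqI[OF assms(1) edge_hom[OF assms(2,3)]] lowL_edge[OF assms(2,3)] assms(4) by simp

text \<open>The marked vertex of the lower tree is unary because the source has one leaf, so
  \<open>lo_mark\<close> finds its edge.\<close>

lemma edge_cases:
  assumes "h \<in> hom (Tw sOp) (Leaf 0) T" "T \<in> Ops sOp"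
  obtains S where "S \<in> subtrees T" "h = edge T S"
proof -
  note l = lhomD[OF lhom_of_hom(1)[OF assms]]
  have T: "T = plug (Leaf 0) (lowL h)" using l(8) by simp
  have "(None, 1) \<in> set (vertices (lowL h))" using l(7) by simp
  from lo_mark[OF l(6) this] obtain S where "S \<in> subtrees T" "lowL h = mark S T"
    using Ops_labels_distinct[OF assms(2)] T by metis
  then show ?thesis using that edge_eqI[OF assms] by blast
qed

lemma edge_inj: "T \<in> Ops sOp \<Longrightarrow> S \<in> subtrees T \<Longrightarrow> S' \<in> subtrees T \<Longrightarrow> edge T S = edge T S' \<Longrightarrow> S = S'"
  using lowL_edge[of T S] lowL_edge[of T S'] mark_inj[of S T S'] by simp

lemma vtx_inj:
  assumes "T \<in> Ops sOp" "i < length (vertices T)" "j < length (vertices T)" "vtx T i = vtx T j"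
  shows "i = j"
proof -
  have "cor i (inp sOp T ! i) = cor j (inp sOp T ! j)"
    using uppL_vtx[OF assms(1,2)] uppL_vtx[OF assms(1,3)] unfolding assms(4) by (rule trans[OF sym])
  then show ?thesis by (simp add: cor_def)
qed

lemma tw_comp_id_right:
  assumes f: "f \<in> hom (Tw sOp) p t" and p: "p \<in> Ops sOp" and t: "t \<in> Ops sOp"
  shows "tw_comp sOp f (tw_id sOp p) = f"
proof -
  note c = tw_comp_hom[OF tw_id_hom(1)[OF p] f p t]
  note l = lhomD[OF lhom_of_hom(1)[OF f t]]
  show ?thesis
  proof (rule hom_eqI[OF c(1) f])
    show "uppL (tw_comp sOp f (tw_id sOp p)) i = uppL f i" if "i < length (vertices p)" for i
      unfolding c(2)[OF that] tw_id_hom(2)[OF p that] by (rule sub_cor) (rule l(10)[OF that])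
    show "lowL (tw_comp sOp f (tw_id sOp p)) = lowL f"
      unfolding c(3) tw_id_hom(3)[OF p] by (rule lowcomp_cor_right[OF l(6,7)])
  qed
qed

section \<open>Edges next to a vertex and outer edges of a tree\<close>

lemma sub_other:
  assumes "i \<notin> set (vlabels t)"
  shows "sub (\<lambda>j m. if j = i then s m else cor (Some j) m) t = vmap Some t"
proof -
  have "sub (\<lambda>j m. if j = i then s m else cor (Some j) m) t = sub (\<lambda>j m. cor (Some j) m) t"
    using assms by (intro sub_cong) force
  also have "\<dots> = sub cor (vmap Some t)" by (simp only: sub_vmap)
  finally show ?thesis by simp
qed

lemma sub_Vertex_cor: "sub s (Vertex v ts) = Vertex w (map (sub s) ts)" if "s v (length ts) = cor w (length ts)"
  using that by (simp add: graft_nth_cor)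

text \<open>Computes the lower tree for \<open>vtx_edge_root\<close>: a unary vertex placed under a
  corolla, which then replaces vertex \<open>i\<close>, comes to sit on the output edge of
  \<open>i\<close>.\<close>

lemma mark_root:
  "labels_distinct T \<Longrightarrow> Vertex i us \<in> subtrees T \<Longrightarrow>
    sub (\<lambda>j m. if j = i then Vertex None [cor (Some i) m] else cor (Some j) m) T = mark (Vertex i us) T"
proof (induction T)
  case (Vertex v ts)
  let ?s = "\<lambda>j m. if j = i then Vertex None [cor (Some i) m] else cor (Some j) m :: (_, nat) tree"
  show ?case
  proof (cases "v = i")
    case True
    have n: "i \<notin> set (vlabels t)" if "t \<in> set ts" for t
      using labels_distinct_Vertex(2)[OF Vertex.prems(1) that] True by simp
    have "Vertex i us \<notin> subtrees t" if "t \<in> set ts" for t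
      using subtrees_labels[of "Vertex i us" t] n[OF that] by force
    then have e: "Vertex v ts = Vertex i us" using Vertex.prems(2) by auto
    have s: "map (sub ?s) ts = map (vmap Some) ts" using sub_other[OF n] by simp
    have "sub ?s (Vertex v ts) = Vertex None [graft ((!) (map (sub ?s) ts)) (cor (Some i) (length ts))]"
      using True by simp
    also have "graft ((!) (map (sub ?s) ts)) (cor (Some i) (length ts)) = Vertex (Some i) (map (sub ?s) ts)"
      by (simp add: graft_nth_cor)
    finally show ?thesis unfolding s e[symmetric] mark_self using True by simp
  next
    case False
    then have "Vertex i us \<noteq> Vertex v ts" by simp
    moreover have "sub ?s t = mark (Vertex i us) t" if t: "t \<in> set ts" for t
    proof (cases "Vertex i us \<in> subtrees t")
      case True
      then show ?thesis using Vertex.IH[OF t labels_distinct_Vertex(1)[OF Vertex.prems(1) t]] by blast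
    next
      case nt: False
      then obtain t' where t': "t' \<in> set ts" "Vertex i us \<in> subtrees t'"
        using Vertex.prems(2) False by auto
      have "i \<notin> set (vlabels t)"
      proof -
        obtain k j where kj: "k < length ts" "j < length ts" "t' = ts ! k" "t = ts ! j"
          using t t'(1) by (metis in_set_conv_nth)
        then have "k \<noteq> j" using nt t'(2) by auto
        moreover have "distinct (concat (map vlabels ts))"
          using Vertex.prems(1) unfolding labels_distinct_def by (simp add: map_concat o_def)
        moreover have "i \<in> set (vlabels t')" using subtrees_labels[OF t'(2)] by force
        ultimately show ?thesis using distinct_concat_disjoint[of vlabels ts k j] kj by blast
      qed
      then show ?thesis unfolding mark_other[OF nt] by (rule sub_other)
    qed
    ultimately show ?thesis using False by (subst sub_Vertex_cor[where w = "Some v"]) simp_all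
  qed
qed simp

text \<open>Computes the lower tree for \<open>vtx_edge_Leaf\<close>: here the unary vertex comes to
  sit on input \<open>k\<close> of vertex \<open>i\<close>.\<close>

lemma mark_child:
  "labels_distinct T \<Longrightarrow> Vertex i us \<in> subtrees T \<Longrightarrow> k < length us \<Longrightarrow>
    sub (\<lambda>j m. if j = i then Vertex (Some i) (map (\<lambda>l. if l = k then Vertex None [Leaf l] else Leaf l) [0..<m])
      else cor (Some j) m) T = mark (us ! k) T"
proof (induction T)
  case (Vertex v ts)
  let ?s = "\<lambda>j m. if j = i then Vertex (Some i) (map (\<lambda>l. if l = k then Vertex None [Leaf l] else Leaf l) [0..<m])
      else cor (Some j) m :: (_, nat) tree"
  show ?case
  proof (cases "v = i")
    case True
    have n: "i \<notin> set (vlabels t)" if "t \<in> set ts" for t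
      using labels_distinct_Vertex(2)[OF Vertex.prems(1) that] True by simp
    have "Vertex i us \<notin> subtrees t" if "t \<in> set ts" for t
      using subtrees_labels[of "Vertex i us" t] n[OF that] by force
    then have e: "us = ts" using Vertex.prems(2) by auto
    have s: "map (sub ?s) ts = map (vmap Some) ts" using sub_other[OF n] by simp
    have "sub ?s (Vertex v ts) = Vertex (Some i) (map (\<lambda>l. if l = k then Vertex None [map (sub ?s) ts ! l]
        else map (sub ?s) ts ! l) [0..<length ts])"
      using True by (simp add: o_def if_distrib cong: if_cong)
    also have "map (\<lambda>l. if l = k then Vertex None [map (sub ?s) ts ! l]
        else map (sub ?s) ts ! l) [0..<length ts] = map (mark (ts ! k)) ts"
    proof (rule nth_equalityI)
      fix l assume "l < length (map (\<lambda>l. if l = k then Vertex None [map (sub ?s) ts ! l]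
        else map (sub ?s) ts ! l) [0..<length ts])"
      then have l: "l < length ts" by simp
      have "ts ! k \<notin> subtrees (ts ! l)" if "l \<noteq> k"
        using subtrees_disjoint[OF Vertex.prems(1), of k l "ts ! k"] Vertex.prems(3) l that e by simp
      then show "map (\<lambda>l. if l = k then Vertex None [map (sub ?s) ts ! l]
        else map (sub ?s) ts ! l) [0..<length ts] ! l = map (mark (ts ! k)) ts ! l"
        using l unfolding s by (simp add: mark_self mark_other)
    qed simp
    finally show ?thesis
      using subtrees_proper[of "ts ! k" ts v] Vertex.prems(3) e True by auto
  next
    case False
    then have ne: "Vertex i us \<noteq> Vertex v ts" by simp
    then obtain t' where t': "t' \<in> set ts" "Vertex i us \<in> subtrees t'"
      using Vertex.prems(2) by auto
    have ck: "us ! k \<in> subtrees t'" by (rule subtrees_child[OF Vertex.prems(3) t'(2)])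
    have "sub ?s t = mark (us ! k) t" if t: "t \<in> set ts" for t
    proof (cases "Vertex i us \<in> subtrees t")
      case True
      then show ?thesis
        using Vertex.IH[OF t labels_distinct_Vertex(1)[OF Vertex.prems(1) t]] Vertex.prems(3) by blast
    next
      case nt: False
      obtain a b where kj: "a < length ts" "b < length ts" "t' = ts ! a" "t = ts ! b"
        using t t'(1) by (metis in_set_conv_nth)
      then have ab: "a \<noteq> b" using nt t'(2) by auto
      have "i \<notin> set (vlabels t)"
      proof -
        have "distinct (concat (map vlabels ts))"
          using Vertex.prems(1) unfolding labels_distinct_def by (simp add: map_concat o_def)
        moreover have "i \<in> set (vlabels t')" using subtrees_labels[OF t'(2)] by force
        ultimately show ?thesis using distinct_concat_disjoint[of vlabels ts a b] kj ab by blast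
      qed
      then have s: "sub ?s t = vmap Some t" by (rule sub_other)
      have "us ! k \<notin> subtrees t"
        using subtrees_disjoint[OF Vertex.prems(1) kj(1,2) ab, of "us ! k"] ck kj by simp
      then show ?thesis unfolding s by (rule mark_other[symmetric])
    qed
    moreover have "us ! k \<noteq> Vertex v ts" using ck subtrees_proper[OF t'(1)] by metis
    ultimately show ?thesis using False by (subst sub_Vertex_cor[where w = "Some v"]) simp_all
  qed
qed simp

lemma mark_Leaf: "graft (\<lambda>l. if l = k then Vertex None [Leaf l] else Leaf l) (vmap Some T) = mark (Leaf k) T"
  by (induction T) auto

lemma subtrees_cor: "subtrees (cor v n) = insert (cor v n) (Leaf ` {..<n})"
  by (auto simp: cor_def)

lemma mark_cor_root: "mark (cor 0 n) (cor 0 n) = Vertex None [cor (Some 0) n]"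
  by (simp add: mark_self)

lemma mark_cor_Leaf: "mark (Leaf k) (cor 0 n) =
    Vertex (Some 0) (map (\<lambda>l. if l = k then Vertex None [Leaf l] else Leaf l) [0..<n])"
  by (auto simp: cor_def)

lemma lowcomp_root:
  assumes "leaves q \<in> perms n" "V 0 = q"
  shows "lowcomp V lo (mark (cor 0 n) (cor 0 n)) = sub (plugs (\<lambda>j. cor (Some j)) (Vertex None [vmap Some q])) lo"
proof -
  let ?c = "\<lambda>a n. case a of None \<Rightarrow> cor None n | Some j \<Rightarrow> vmap Some (V j)"
  have "sub ?c (cor (Some 0) n) = vmap Some q" using assms by (subst sub_cor) simp_all
  then have "sub ?c (mark (cor 0 n) (cor 0 n)) = Vertex None [vmap Some q]"
    unfolding mark_cor_root by (simp add: cor_def[of None])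
  then show ?thesis unfolding lowcomp_def by simp
qed

lemma lowcomp_Leaf:
  assumes "leaves q \<in> perms n" "V 0 = q"
  shows "lowcomp V lo (mark (Leaf k) (cor 0 n)) =
    sub (plugs (\<lambda>j. cor (Some j)) (graft (\<lambda>l. if l = k then Vertex None [Leaf l] else Leaf l) (vmap Some q))) lo"
proof -
  let ?c = "\<lambda>a n. case a of None \<Rightarrow> cor None n | Some j \<Rightarrow> vmap Some (V j)"
  have u: "sub ?c (Vertex None [Leaf l]) = Vertex None [Leaf l]" for l
    by (simp add: cor_def)
  have "sub ?c (mark (Leaf k) (cor 0 n)) = graft ((!) (map (\<lambda>l. if l = k then Vertex None [Leaf l] else Leaf l) [0..<n])) (vmap Some q)"
  proof -
    have m: "map (sub ?c) (map (\<lambda>l. if l = k then Vertex None [Leaf l] else Leaf l) [0..<n]) =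
        map (\<lambda>l. if l = k then Vertex None [Leaf l] else Leaf l) [0..<n]"
      by (rule nth_equalityI) (simp_all add: u del: sub.simps(2))
    show ?thesis unfolding mark_cor_Leaf sub.simps m by (simp add: assms(2))
  qed
  also have "\<dots> = graft (\<lambda>l. if l = k then Vertex None [Leaf l] else Leaf l) (vmap Some q)"
    using perms_set[OF assms(1)] by (intro graft_cong) simp
  finally show ?thesis unfolding lowcomp_def by simp
qed

lemma sOp_subtree_arity:
  assumes "T \<in> Ops sOp" "Vertex i us \<in> subtrees T"
  shows "i < length (vertices T)" "inp sOp T ! i = length us"
proof -
  have "(i, length us) \<in> set (vertices T)" using subtrees_labels[OF assms(2)] by auto
  then show "i < length (vertices T)" "inp sOp T ! i = length us" using sOp_inp_nth[OF assms(1)] by auto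
qed

lemma subtree_at:
  assumes "T \<in> Ops sOp" "i < length (vertices T)"
  obtains us where "Vertex i us \<in> subtrees T"
proof -
  have "(v, n) \<in> set (vertices S) \<Longrightarrow> \<exists>us. Vertex v us \<in> subtrees S" for v n and S :: "(nat, nat) tree"
    by (induction S) (auto, blast)
  then show ?thesis using sOp_vertex[OF assms] that by blast
qed

text \<open>With \<open>vtx_edge_Leaf\<close>, which treats the inputs, this says how restriction to
  a vertex and restriction to an adjacent edge fit together: colours of a decoration are the colours
  of edges of \<open>T\<close>.\<close>

lemma vtx_edge_root:
  assumes T: "T \<in> Ops sOp" and s: "Vertex i us \<in> subtrees T"
  shows "tw_comp sOp (vtx T i) (edge (cor 0 (length us)) (cor 0 (length us))) = edge T (Vertex i us)"
proof -
  let ?n = "length us"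
  note i = sOp_subtree_arity[OF T s]
  note c = tw_comp_hom[OF edge_hom[of "cor 0 ?n" "cor 0 ?n"] vtx_hom[OF T i(1), unfolded i(2)] _ T]
  have lv: "sub (plugs (\<lambda>j. cor (Some j)) (Vertex None [cor (Some i) ?n])) (lowL (vtx T i)) = mark (Vertex i us) T"
    unfolding lowL_vtx[OF T i(1)] sub_vmap mark_root[OF Ops_labels_distinct[OF T] s, symmetric]
  proof (rule sub_cong)
    fix j m assume "(j, m) \<in> set (vertices T)"
    then have "inp sOp T ! j = m" using sOp_inp_nth[OF T] by blast
    then show "plugs (\<lambda>j. cor (Some j)) (Vertex None [cor (Some i) ?n]) (if j = i then None else Some j) m =
        (if j = i then Vertex None [cor (Some i) m] else cor (Some j) m)"
      using i(2) by auto
  qed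
  show ?thesis
    using c lowL_edge[of "cor 0 ?n" "cor 0 ?n"] lowcomp_root[of "cor i ?n" ?n "uppL (vtx T i)"] lv
      uppL_vtx[OF T i(1)] i(2) by (intro edge_eqI[OF _ T s]) simp_all
qed

lemma vtx_edge_Leaf:
  assumes T: "T \<in> Ops sOp" and s: "Vertex i us \<in> subtrees T" and k: "k < length us"
  shows "tw_comp sOp (vtx T i) (edge (cor 0 (length us)) (Leaf k)) = edge T (us ! k)"
proof -
  let ?n = "length us"
  note i = sOp_subtree_arity[OF T s]
  have kc: "Leaf k \<in> subtrees (cor 0 ?n)" using k by (simp add: subtrees_cor)
  note c = tw_comp_hom[OF edge_hom[of "cor 0 ?n" "Leaf k"] vtx_hom[OF T i(1), unfolded i(2)] _ T]
  let ?f = "\<lambda>l. if l = k then Vertex None [Leaf l] else Leaf l"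
  have lv: "sub (plugs (\<lambda>j. cor (Some j)) (graft ?f (cor (Some i) ?n))) (lowL (vtx T i)) = mark (us ! k) T"
    unfolding lowL_vtx[OF T i(1)] sub_vmap mark_child[OF Ops_labels_distinct[OF T] s k, symmetric]
  proof (rule sub_cong)
    fix j m assume "(j, m) \<in> set (vertices T)"
    then have "inp sOp T ! j = m" using sOp_inp_nth[OF T] by blast
    then show "plugs (\<lambda>j. cor (Some j)) (graft ?f (cor (Some i) ?n)) (if j = i then None else Some j) m =
        (if j = i then Vertex (Some i) (map ?f [0..<m]) else cor (Some j) m)"
      using i(2) by (auto simp: cor_def)
  qed
  show ?thesis
    using c kc lowL_edge[of "cor 0 ?n" "Leaf k"] lowcomp_Leaf[of "cor i ?n" ?n "uppL (vtx T i)"] lv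
      uppL_vtx[OF T i(1)] i(2) by (intro edge_eqI[OF _ T subtrees_child[OF k s]]) simp_all
qed

text \<open>The outer edges of \<open>T\<close> are those of the corolla into which it is
  contracted. With \<open>evm_edge_Leaf\<close> for the leaves, this gives the profile of a total
  composite.\<close>

lemma evm_edge_root:
  assumes T: "T \<in> Ops sOp"
  shows "tw_comp sOp (evm T) (edge (cor 0 (length (leaves T))) (cor 0 (length (leaves T)))) = edge T T"
proof -
  let ?n = "length (leaves T)"
  note c = tw_comp_hom[OF edge_hom[of "cor 0 ?n" "cor 0 ?n"] evm_hom[OF T] _ T]
  have p: "leaves T \<in> perms ?n" using T sOp_Ops_leaves by blast
  have "sub (plugs (\<lambda>j. cor (Some j)) (Vertex None [vmap Some T])) (cor None ?n) = mark T T"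
    unfolding mark_self using p by (subst sub_cor) simp_all
  then show ?thesis
    using c lowL_edge[of "cor 0 ?n" "cor 0 ?n"] lowcomp_root[OF p, of "uppL (evm T)"]
      uppL_evm[OF T] lowL_evm[OF T] by (intro edge_eqI[OF _ T]) simp_all
qed

lemma Leaf_subtree: "k \<in> set (leaves T) \<Longrightarrow> Leaf k \<in> subtrees T"
  by (induction T) auto

lemma evm_edge_Leaf:
  assumes T: "T \<in> Ops sOp" and k: "k < length (leaves T)"
  shows "tw_comp sOp (evm T) (edge (cor 0 (length (leaves T))) (Leaf k)) = edge T (Leaf k)"
proof -
  let ?n = "length (leaves T)"
  have kc: "Leaf k \<in> subtrees (cor 0 ?n)" using k by (simp add: subtrees_cor)
  note c = tw_comp_hom[OF edge_hom[of "cor 0 ?n" "Leaf k"] evm_hom[OF T] _ T]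
  have p: "leaves T \<in> perms ?n" using T sOp_Ops_leaves by blast
  have "k \<in> set (leaves T)" using perms_set[OF p] k by simp
  then have kT: "Leaf k \<in> subtrees T" by (rule Leaf_subtree)
  let ?f = "\<lambda>l. if l = k then Vertex None [Leaf l] else Leaf l"
  have fl: "map (\<lambda>l. leaves (?f l)) xs = map (\<lambda>l. [l]) xs" for xs :: "nat list"
    by simp
  have "leaves (graft ?f (vmap Some T)) \<in> perms ?n"
    unfolding leaves_graft fl concat_map_singleton using p by simp
  then have "sub (plugs (\<lambda>j. cor (Some j)) (graft ?f (vmap Some T))) (cor None ?n) = mark (Leaf k) T"
    by (subst sub_cor) (simp_all add: mark_Leaf)
  then show ?thesis
    using c kc lowL_edge[of "cor 0 ?n" "Leaf k"] lowcomp_Leaf[OF p, of "uppL (evm T)"]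
      uppL_evm[OF T] lowL_evm[OF T] by (intro edge_eqI[OF _ T kT]) simp_all
qed

section \<open>The Segal condition in terms of decorations\<close>

lemma sOp_Ops_no_vertices: "T \<in> Ops sOp \<Longrightarrow> vertices T = [] \<longleftrightarrow> T = Leaf 0"
  by (cases T) auto

text \<open>The upper tree of a lower morphism is an identity; with its label it is a corolla, and
  \<open>vtx_unique\<close> applies.\<close>

lemma lower_cor:
  assumes T: "T \<in> Ops sOp" and h: "h \<in> hom (Tw sOp) (cor 0 n) T"
  shows "is_lower sOp (cor 0 n) h \<longleftrightarrow> (\<exists>i < length (vertices T). n = inp sOp T ! i \<and> h = vtx T i)"
proof
  assume "is_lower sOp (cor 0 n) h"
  then have "uppL h 0 = cor (upp_labels h ! 0 ! 0) n"
    by (simp add: is_lower_def uppL_def)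
  from vtx_unique[OF h T this] show "\<exists>i < length (vertices T). n = inp sOp T ! i \<and> h = vtx T i" by blast
next
  assume "\<exists>i < length (vertices T). n = inp sOp T ! i \<and> h = vtx T i"
  then obtain i where i: "i < length (vertices T)" "n = inp sOp T ! i" "h = vtx T i" by blast
  have "mor_ok 1 h" using lhom_of_hom(2)[OF h T] by simp
  then have ok: "length (upp h) = 1" "length (upp_labels h) = 1" "upp h ! 0 \<in> Ops sOp"
    "length (upp_labels h ! 0) = length (vertices (upp h ! 0))" "sorted_wrt (<) (upp_labels h ! 0)"
    by (auto simp: mor_ok_def)
  have "vmap ((!) (upp_labels h ! 0)) (upp h ! 0) = vmap ((!) [i]) (cor 0 n)"
    using uppL_vtx[OF T i(1)] i by (simp add: uppL_def)
  from vmap_nth_eqD[OF ok(3) _ ok(4) _ ok(5) _ this]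
  have u: "upp h ! 0 = cor 0 n" by simp
  have "upp h = [upp h ! 0]" "upp_labels h = [upp_labels h ! 0]"
    using ok(1,2) by (auto simp: length_Suc_conv)
  then show "is_lower sOp (cor 0 n) h"
    using u unfolding is_lower_def by (metis inp_cor list.simps(8,9) sOp_simps(3) sorted_wrt1)
qed

lemma lower_Leaf:
  assumes "T \<in> Ops sOp" "h \<in> hom (Tw sOp) (Leaf 0) T" shows "is_lower sOp (Leaf 0) h"
  using lhom_of_hom(2)[OF assms(2,1)] by (simp add: is_lower_def mor_ok_def)

lemma elementary_sOp: "elementary sOp sOp_grading = range (cor 0) \<union> {Leaf 0}"
proof -
  have "{p \<in> Ops sOp. sOp_grading p = -1} = {Leaf 0}"
    using sOp_Ops_no_vertices by (auto simp: sOp_grading_def)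
  then show ?thesis by (auto simp: elementary_def)
qed

lemma El_ob: "e \<in> ob (El sOp sOp_grading) \<longleftrightarrow> (\<exists>n. e = cor 0 n) \<or> e = Leaf 0"
  by (auto simp: El_def full_subcategory_def elementary_sOp Lower_def)

lemma El_hom: "u \<in> hom (El sOp sOp_grading) e e' \<longleftrightarrow> u \<in> hom (Tw sOp) e e' \<and> is_lower sOp e u"
  by (simp add: El_def full_subcategory_def Lower_def)

lemma El_over_ob:
  assumes T: "T \<in> Ops sOp"
  shows "(e, h) \<in> ob (El_over sOp sOp_grading T) \<longleftrightarrow>
    (\<exists>i < length (vertices T). e = cor 0 (inp sOp T ! i) \<and> h = vtx T i) \<or>
    (\<exists>S \<in> subtrees T. e = Leaf 0 \<and> h = edge T S)" (is "?L \<longleftrightarrow> ?R")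
proof -
  have o: "?L \<longleftrightarrow> ((\<exists>n. e = cor 0 n) \<or> e = Leaf 0) \<and> h \<in> hom (Tw sOp) e T \<and> is_lower sOp e h"
    by (simp add: El_over_def comma_over_def El_ob Lower_def)
  show ?thesis
  proof
    assume ?L
    then have h: "h \<in> hom (Tw sOp) e T" "is_lower sOp e h" and e: "(\<exists>n. e = cor 0 n) \<or> e = Leaf 0"
      using o by auto
    from e show ?R
    proof
      assume "\<exists>n. e = cor 0 n"
      then obtain n where "e = cor 0 n" by blast
      then show ?R using lower_cor[OF T, of h n] h by blast
    next
      assume "e = Leaf 0"
      then show ?R using edge_cases[OF _ T, of h] h by metis
    qed
  next
    assume ?R
    then show ?L
    proof (elim disjE exE bexE conjE)
      fix i assume i: "i < length (vertices T)" "e = cor 0 (inp sOp T ! i)" "h = vtx T i"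
      then show ?L using o vtx_hom[OF T i(1)] lower_cor[OF T, of h "inp sOp T ! i"] by blast
    next
      fix S assume S: "S \<in> subtrees T" "e = Leaf 0" "h = edge T S"
      then show ?L using o edge_hom[OF T S(1)] lower_Leaf[OF T] by blast
    qed
  qed
qed

lemma El_over_hom: "u \<in> hom (El_over sOp sOp_grading T) (e, h) (e', h') \<longleftrightarrow>
    u \<in> hom (Tw sOp) e e' \<and> is_lower sOp e u \<and> tw_comp sOp h' u = h"
  by (simp add: El_over_def comma_over_def El_hom) (simp add: Lower_def)

section \<open>The candidate operad of a presheaf\<close>

locale presheaf_coding = coding enc for enc :: "'u list \<Rightarrow> 'u" +
  fixes X :: "((nat, nat) tree, (nat, nat) tree tw_mor, 'u) presheaf"
  assumes presheaf: "is_functor (opposite (Tw sOp)) set_category X"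
begin

lemma pb_in:
  assumes "f \<in> hom (Tw sOp) p t" "p \<in> Ops sOp" "t \<in> Ops sOp" "\<xi> \<in> fob X t"
  shows "fmor X t p f \<xi> \<in> fob X p"
  using presheaf assms unfolding is_functor_def by auto

lemma pb_id:
  assumes "p \<in> Ops sOp" "\<xi> \<in> fob X p" shows "fmor X p p (tw_id sOp p) \<xi> = \<xi>"
proof -
  have "fmor X p p (tw_id sOp p) = (\<lambda>x\<in>fob X p. x)"
    using presheaf assms(1) unfolding is_functor_def by auto
  then show ?thesis using assms(2) by simp
qed

lemma pb_comp:
  assumes "f \<in> hom (Tw sOp) p t" "g \<in> hom (Tw sOp) t u"
    "p \<in> Ops sOp" "t \<in> Ops sOp" "u \<in> Ops sOp" "\<xi> \<in> fob X u"
  shows "fmor X u p (tw_comp sOp g f) \<xi> = fmor X t p f (fmor X u t g \<xi>)"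
proof -
  have "fmor X u p (tw_comp sOp g f) = compose (fob X u) (fmor X t p f) (fmor X u t g)"
    using presheaf assms(1-5) unfolding is_functor_def by auto
  then show ?thesis using assms(6) by (simp add: compose_def)
qed

text \<open>The sets \<open>X(cor 0 n)\<close> for different \<open>n\<close> need not be disjoint, so operations carry their arity.\<close>

definition code :: "nat \<Rightarrow> 'u \<Rightarrow> 'u" where "code n y = enc (replicate (Suc n) y)"

lemma code_inject [simp]: "code n y = code m z \<longleftrightarrow> n = m \<and> y = z"
  unfolding code_def enc_eq by (auto dest: arg_cong[where f = length])

definition opn :: "'u \<Rightarrow> nat" where "opn a = length (dec a) - 1"
definition el :: "'u \<Rightarrow> 'u" where "el a = hd (dec a)"

lemma opn_code [simp]: "opn (code n y) = n" and el_code [simp]: "el (code n y) = y"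
  by (simp_all add: opn_def el_def code_def)

definition vt :: "(nat, nat) tree \<Rightarrow> 'u \<Rightarrow> nat \<Rightarrow> 'u" where
  "vt T \<xi> i = fmor X T (cor 0 (inp sOp T ! i)) (vtx T i) \<xi>"

definition ed :: "(nat, nat) tree \<Rightarrow> (nat, nat) tree \<Rightarrow> 'u \<Rightarrow> 'u" where
  "ed T S \<xi> = fmor X T (Leaf 0) (edge T S) \<xi>"

definition deco :: "(nat, nat) tree \<Rightarrow> 'u \<Rightarrow> nat \<Rightarrow> 'u" where
  "deco T \<xi> i = code (inp sOp T ! i) (vt T \<xi> i)"

text \<open>The analogue of the value stored in a nerve. Over \<open>Leaf 0\<close> it sends a
  colour to its identity, and this is how \<open>FX\<close> defines identities.\<close>

definition tot :: "(nat, nat) tree \<Rightarrow> 'u \<Rightarrow> 'u" where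
  "tot T \<xi> = code (length (leaves T)) (fmor X T (cor 0 (length (leaves T))) (evm T) \<xi>)"

text \<open>The numbering of the vertices of \<open>T\<close> is irrelevant, so any labelled tree may be evaluated.\<close>

definition EvX :: "('v \<Rightarrow> 'u) \<Rightarrow> ('v, nat) tree \<Rightarrow> 'u \<Rightarrow> bool" where
  "EvX \<delta> T x \<longleftrightarrow> (\<exists>T0 ls \<xi>. T0 \<in> Ops sOp \<and> \<xi> \<in> fob X T0 \<and> length ls = length (vertices T0) \<and>
    T = vmap ((!) ls) T0 \<and> x = tot T0 \<xi> \<and> (\<forall>i < length (vertices T0). \<delta> (ls ! i) = deco T0 \<xi> i))"

text \<open>The profile of an operation is its restriction to the outer edges of its corolla.
  Composition and action are values of the trees found in \<open>Ev_two_level\<close> and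
  \<open>Ev_act\<close>; only for Segal presheaves does gluing show that the chosen values exist and
  are unique.\<close>

definition FX :: "('u, 'u) operad" where
  "FX = \<lparr>Col = fob X (Leaf 0), Ops = {code n y | n y. y \<in> fob X (cor 0 n)},
    inp = (\<lambda>a. map (\<lambda>k. ed (cor 0 (opn a)) (Leaf k) (el a)) [0..<opn a]),
    out = (\<lambda>a. ed (cor 0 (opn a)) (cor 0 (opn a)) (el a)),
    ident = tot (Leaf 0),
    comp = (\<lambda>p qs. SOME x. EvX (case_option p ((!) qs)) (two_level None Some (map opn qs)) x),
    act = (\<lambda>p L. SOME x. EvX (\<lambda>_. p) (Vertex () (map Leaf L)) x)\<rparr>"

lemma FX_Col [simp]: "Col FX = fob X (Leaf 0)" and FX_ident [simp]: "ident FX = tot (Leaf 0)"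
  by (simp_all add: FX_def)

lemma FX_Ops: "a \<in> Ops FX \<longleftrightarrow> a = code (opn a) (el a) \<and> el a \<in> fob X (cor 0 (opn a))"
  by (auto simp: FX_def)

lemma FX_code [simp]: "code n y \<in> Ops FX \<longleftrightarrow> y \<in> fob X (cor 0 n)"
  by (simp add: FX_Ops)

lemma FX_inp: "inp FX (code n y) = map (\<lambda>k. ed (cor 0 n) (Leaf k) y) [0..<n]"
  and FX_out: "out FX (code n y) = ed (cor 0 n) (cor 0 n) y"
  and FX_arity: "arity FX a = opn a"
  by (simp_all add: FX_def arity_def)

lemma ed_in: "T \<in> Ops sOp \<Longrightarrow> S \<in> subtrees T \<Longrightarrow> \<xi> \<in> fob X T \<Longrightarrow> ed T S \<xi> \<in> fob X (Leaf 0)"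
  unfolding ed_def using pb_in[OF edge_hom] by simp

lemma vt_in: "T \<in> Ops sOp \<Longrightarrow> i < length (vertices T) \<Longrightarrow> \<xi> \<in> fob X T \<Longrightarrow>
    vt T \<xi> i \<in> fob X (cor 0 (inp sOp T ! i))"
  unfolding vt_def using pb_in[OF vtx_hom] by simp

lemma tot_Ops: "T \<in> Ops sOp \<Longrightarrow> \<xi> \<in> fob X T \<Longrightarrow> tot T \<xi> \<in> Ops FX"
  unfolding tot_def using pb_in[OF evm_hom] by simp

sublocale FX: typed_ops FX
proof
  fix p assume "p \<in> Ops FX"
  then obtain n y where "p = code n y" "y \<in> fob X (cor 0 n)" by (auto simp: FX_Ops)
  then show "out FX p \<in> Col FX" using ed_in[of "cor 0 n" "cor 0 n"] by (simp add: FX_out)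
qed

lemma ed_vt:
  assumes T: "T \<in> Ops sOp" and \<xi>: "\<xi> \<in> fob X T" and s: "Vertex i us \<in> subtrees T"
  shows "ed (cor 0 (length us)) (cor 0 (length us)) (vt T \<xi> i) = ed T (Vertex i us) \<xi>"
    "k < length us \<Longrightarrow> ed (cor 0 (length us)) (Leaf k) (vt T \<xi> i) = ed T (us ! k) \<xi>"
proof -
  let ?n = "length us"
  note i = sOp_subtree_arity[OF T s]
  note v = vtx_hom[OF T i(1), unfolded i(2)]
  show "ed (cor 0 ?n) (cor 0 ?n) (vt T \<xi> i) = ed T (Vertex i us) \<xi>"
    using pb_comp[OF edge_hom[of "cor 0 ?n" "cor 0 ?n"] v _ _ T \<xi>] vtx_edge_root[OF T s]
    by (simp add: ed_def vt_def i)
  assume k: "k < ?n"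
  then have kc: "Leaf k \<in> subtrees (cor 0 ?n)" by (simp add: subtrees_cor)
  show "ed (cor 0 ?n) (Leaf k) (vt T \<xi> i) = ed T (us ! k) \<xi>"
    using pb_comp[OF edge_hom[OF cor_Ops kc] v _ _ T \<xi>] vtx_edge_Leaf[OF T s k]
    by (simp add: ed_def vt_def i)
qed

lemma ed_tot:
  assumes T: "T \<in> Ops sOp" and \<xi>: "\<xi> \<in> fob X T"
  shows "out FX (tot T \<xi>) = ed T T \<xi>" "k < length (leaves T) \<Longrightarrow> inp FX (tot T \<xi>) ! k = ed T (Leaf k) \<xi>"
proof -
  let ?n = "length (leaves T)"
  show "out FX (tot T \<xi>) = ed T T \<xi>"
    using pb_comp[OF edge_hom[of "cor 0 ?n" "cor 0 ?n"] evm_hom[OF T] _ _ T \<xi>] evm_edge_root[OF T]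
    by (simp add: ed_def tot_def FX_out)
  assume k: "k < ?n"
  then have kc: "Leaf k \<in> subtrees (cor 0 ?n)" by (simp add: subtrees_cor)
  show "inp FX (tot T \<xi>) ! k = ed T (Leaf k) \<xi>"
    using pb_comp[OF edge_hom[OF cor_Ops kc] evm_hom[OF T] _ _ T \<xi>] evm_edge_Leaf[OF T k] k
    by (simp add: ed_def tot_def FX_inp)
qed

text \<open>Agreement at every vertex is all that typing requires. The abstract form serves twice:
  \<open>C\<close> is either the edge part of an element over \<open>T\<close> or that of a
  compatible family.\<close>

lemma wt_compatible:
  assumes T: "T \<in> Ops sOp" and y: "\<And>i. i < length (vertices T) \<Longrightarrow> y i \<in> fob X (cor 0 (inp sOp T ! i))"
    and C: "\<And>S. S \<in> subtrees T \<Longrightarrow> C S \<in> fob X (Leaf 0)"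
    and root: "\<And>i us. Vertex i us \<in> subtrees T \<Longrightarrow>
      ed (cor 0 (length us)) (cor 0 (length us)) (y i) = C (Vertex i us)"
    and child: "\<And>i us k. Vertex i us \<in> subtrees T \<Longrightarrow> k < length us \<Longrightarrow>
      ed (cor 0 (length us)) (Leaf k) (y i) = C (us ! k)"
  shows "S \<in> subtrees T \<Longrightarrow> wt FX (\<lambda>i. code (inp sOp T ! i) (y i)) (\<lambda>l. C (Leaf l)) S \<and>
    rc FX (\<lambda>i. code (inp sOp T ! i) (y i)) (\<lambda>l. C (Leaf l)) S = C S"
proof (induction S)
  case (Leaf l)
  then show ?case using C by simp
next
  case (Vertex i us)
  note i = sOp_subtree_arity[OF T Vertex.prems]
  have IH: "wt FX (\<lambda>i. code (inp sOp T ! i) (y i)) (\<lambda>l. C (Leaf l)) (us ! k) \<and>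
    rc FX (\<lambda>i. code (inp sOp T ! i) (y i)) (\<lambda>l. C (Leaf l)) (us ! k) = C (us ! k)"
    if "k < length us" for k
    using Vertex.IH[OF nth_mem[OF that] subtrees_child[OF that Vertex.prems]] .
  have "inp FX (code (inp sOp T ! i) (y i)) =
      map (rc FX (\<lambda>i. code (inp sOp T ! i) (y i)) (\<lambda>l. C (Leaf l))) us"
    using IH child[OF Vertex.prems] i(2) by (intro nth_equalityI) (simp_all add: FX_inp)
  moreover have "\<forall>t \<in> set us. wt FX (\<lambda>i. code (inp sOp T ! i) (y i)) (\<lambda>l. C (Leaf l)) t"
    using IH by (auto simp: in_set_conv_nth)
  ultimately show ?case using y[OF i(1)] root[OF Vertex.prems] i(2) by (simp add: wt_Vertex FX_out)
qed

lemma deco_wt: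
  assumes T: "T \<in> Ops sOp" and \<xi>: "\<xi> \<in> fob X T" and S: "S \<in> subtrees T"
  shows "wt FX (deco T \<xi>) (\<lambda>l. ed T (Leaf l) \<xi>) S" "rc FX (deco T \<xi>) (\<lambda>l. ed T (Leaf l) \<xi>) S = ed T S \<xi>"
proof -
  have "deco T \<xi> = (\<lambda>i. code (inp sOp T ! i) (vt T \<xi> i))" by (simp add: deco_def fun_eq_iff)
  then show "wt FX (deco T \<xi>) (\<lambda>l. ed T (Leaf l) \<xi>) S" "rc FX (deco T \<xi>) (\<lambda>l. ed T (Leaf l) \<xi>) S = ed T S \<xi>"
    using wt_compatible[OF T vt_in[OF T _ \<xi>] ed_in[OF T _ \<xi>] ed_vt[OF T \<xi>] S] by simp_all
qed

lemma tot_Wt: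
  assumes T: "T \<in> Ops sOp" and \<xi>: "\<xi> \<in> fob X T"
  shows "Wt FX (deco T \<xi>) T (tot T \<xi>)"
proof -
  note p = sOp_Ops_leaves[OF T]
  have g: "inp FX (tot T \<xi>) ! l = ed T (Leaf l) \<xi>" if "l \<in> set (leaves T)" for l
    using that perms_set[OF p] ed_tot(2)[OF T \<xi>] by simp
  have "wt FX (deco T \<xi>) ((!) (inp FX (tot T \<xi>))) T = wt FX (deco T \<xi>) (\<lambda>l. ed T (Leaf l) \<xi>) T"
    "rc FX (deco T \<xi>) ((!) (inp FX (tot T \<xi>))) T = rc FX (deco T \<xi>) (\<lambda>l. ed T (Leaf l) \<xi>) T"
    using g by (intro wt_cong rc_cong; simp)+
  moreover have "arity FX (tot T \<xi>) = length (leaves T)" by (simp add: FX_arity tot_def)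
  ultimately show ?thesis
    unfolding Wt_def using deco_wt[OF T \<xi> subtrees_self] tot_Ops[OF T \<xi>] ed_tot(1)[OF T \<xi>] p by simp
qed

text \<open>The Segal condition at one tree with the edges eliminated: as soon as a tree has a
  vertex, its decorations determine the colours of all edges. The tree without vertices has to be
  treated apart.\<close>

definition glues :: "(nat, nat) tree \<Rightarrow> bool" where
  "glues T \<longleftrightarrow> (\<forall>y \<gamma>. (\<forall>i < length (vertices T). y i \<in> fob X (cor 0 (inp sOp T ! i))) \<longrightarrow>
    wt FX (\<lambda>i. code (inp sOp T ! i) (y i)) \<gamma> T \<longrightarrow>
    (\<exists>!\<xi>. \<xi> \<in> fob X T \<and> (\<forall>i < length (vertices T). vt T \<xi> i = y i)))"

abbreviation El_T :: "(nat, nat) tree \<Rightarrow> ((nat, nat) tree \<times> (nat, nat) tree tw_mor) set" where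
  "El_T T \<equiv> ob (El_over sOp sOp_grading T)"

abbreviation lim :: "(nat, nat) tree \<Rightarrow> ((nat, nat) tree \<times> (nat, nat) tree tw_mor \<Rightarrow> 'u) set" where
  "lim T \<equiv> set_limit (opposite (El_over sOp sOp_grading T)) (comma_diagram X)"

definition family :: "(nat, nat) tree \<Rightarrow> 'u \<Rightarrow> (nat, nat) tree \<times> (nat, nat) tree tw_mor \<Rightarrow> 'u" where
  "family T = (\<lambda>x. \<lambda>(e, h)\<in>El_T T. fmor X T e h x)"

lemma family_apply [simp]: "(e, h) \<in> El_T T \<Longrightarrow> family T \<xi> (e, h) = fmor X T e h \<xi>"
  and family_extensional [simp]: "family T \<xi> \<in> extensional (El_T T)"
  by (simp_all add: family_def)

lemma lim_iff: "x \<in> lim T \<longleftrightarrow> x \<in> extensional (El_T T) \<and>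
    (\<forall>(e, h) \<in> El_T T. x (e, h) \<in> fob X e) \<and>
    (\<forall>(e, h) \<in> El_T T. \<forall>(e', h') \<in> El_T T. \<forall>u. u \<in> hom (Tw sOp) e' e \<longrightarrow> is_lower sOp e' u \<longrightarrow>
      tw_comp sOp h u = h' \<longrightarrow> fmor X e e' u (x (e, h)) = x (e', h'))"
proof -
  have "x \<in> lim T \<longleftrightarrow> x \<in> (\<Pi>\<^sub>E j\<in>El_T T. fob (comma_diagram X) j) \<and>
    (\<forall>i \<in> El_T T. \<forall>j \<in> El_T T. \<forall>u. u \<in> hom (El_over sOp sOp_grading T) j i \<longrightarrow>
      fmor (comma_diagram X) i j u (x i) = x j)"
    by (simp add: set_limit_def) blast
  also have "x \<in> (\<Pi>\<^sub>E j\<in>El_T T. fob (comma_diagram X) j) \<longleftrightarrow> x \<in> extensional (El_T T) \<and>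
      (\<forall>(e, h) \<in> El_T T. x (e, h) \<in> fob X e)"
    by (auto simp: PiE_iff comma_diagram_def)
  also have "(\<forall>i \<in> El_T T. \<forall>j \<in> El_T T. \<forall>u. u \<in> hom (El_over sOp sOp_grading T) j i \<longrightarrow>
      fmor (comma_diagram X) i j u (x i) = x j) \<longleftrightarrow>
    (\<forall>(e, h) \<in> El_T T. \<forall>(e', h') \<in> El_T T. \<forall>u. u \<in> hom (Tw sOp) e' e \<longrightarrow> is_lower sOp e' u \<longrightarrow>
      tw_comp sOp h u = h' \<longrightarrow> fmor X e e' u (x (e, h)) = x (e', h'))" (is "?A \<longleftrightarrow> ?B")
  proof
    assume A: ?A
    have "fmor X e e' u (x (e, h)) = x (e', h')"
      if "(e, h) \<in> El_T T" "(e', h') \<in> El_T T" "u \<in> hom (Tw sOp) e' e" "is_lower sOp e' u"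
        "tw_comp sOp h u = h'" for e h e' h' u
      using A[rule_format, OF that(1,2), of u] that by (simp add: El_over_hom comma_diagram_def)
    then show ?B by blast
  next
    assume B: ?B
    have "fmor (comma_diagram X) (e, h) (e', h') u (x (e, h)) = x (e', h')"
      if "(e, h) \<in> El_T T" "(e', h') \<in> El_T T" "u \<in> hom (El_over sOp sOp_grading T) (e', h') (e, h)"
      for e h e' h' u
      using B that by (fastforce simp: El_over_hom comma_diagram_def)
    then show ?A by (metis surj_pair)
  qed
  finally show ?thesis by (simp only: conj_assoc)
qed

lemma El_TE:
  assumes T: "T \<in> Ops sOp" and "(e, h) \<in> El_T T"
  obtains i where "i < length (vertices T)" "e = cor 0 (inp sOp T ! i)" "h = vtx T i"
    | S where "S \<in> subtrees T" "e = Leaf 0" "h = edge T S"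
  using assms(2) unfolding El_over_ob[OF T] by blast

lemma El_T_hom:
  assumes T: "T \<in> Ops sOp" and "(e, h) \<in> El_T T" shows "e \<in> Ops sOp" "h \<in> hom (Tw sOp) e T"
  using El_TE[OF assms] vtx_hom[OF T] edge_hom[OF T] cor_Ops Leaf_Ops by metis+

lemma family_lim:
  assumes T: "T \<in> Ops sOp" and \<xi>: "\<xi> \<in> fob X T" shows "family T \<xi> \<in> lim T"
  unfolding lim_iff
proof (intro conjI ballI allI impI; clarify?)
  show "family T \<xi> \<in> extensional (El_T T)" by simp
next
  fix e h assume "(e, h) \<in> El_T T"
  then show "family T \<xi> (e, h) \<in> fob X e" using El_T_hom[OF T] pb_in T \<xi> by simp
next
  fix e h e' h' u
  assume eh: "(e, h) \<in> El_T T" and eh': "(e', tw_comp sOp h u) \<in> El_T T" and u: "u \<in> hom (Tw sOp) e' e"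
  then show "fmor X e e' u (family T \<xi> (e, h)) = family T \<xi> (e', tw_comp sOp h u)"
    using pb_comp[OF u El_T_hom(2)[OF T eh] El_T_hom(1)[OF T eh'] El_T_hom(1)[OF T eh] T \<xi>] by simp
qed

lemma lim_wt:
  assumes T: "T \<in> Ops sOp" and x: "x \<in> lim T" and S: "S \<in> subtrees T"
  defines "y \<equiv> \<lambda>i. x (cor 0 (inp sOp T ! i), vtx T i)" and "C \<equiv> \<lambda>S. x (Leaf 0, edge T S)"
  shows "i < length (vertices T) \<Longrightarrow> y i \<in> fob X (cor 0 (inp sOp T ! i))"
    "wt FX (\<lambda>i. code (inp sOp T ! i) (y i)) (\<lambda>l. C (Leaf l)) S"
    "rc FX (\<lambda>i. code (inp sOp T ! i) (y i)) (\<lambda>l. C (Leaf l)) S = C S"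
proof -
  have v: "(cor 0 (inp sOp T ! i), vtx T i) \<in> El_T T" if "i < length (vertices T)" for i
    using that unfolding El_over_ob[OF T] by blast
  have ed: "(Leaf 0, edge T S) \<in> El_T T" if "S \<in> subtrees T" for S
    using that unfolding El_over_ob[OF T] by blast
  have xin: "x (e, h) \<in> fob X e" if "(e, h) \<in> El_T T" for e h
    using x that unfolding lim_iff by auto
  have comp: "fmor X e e' u (x (e, h)) = x (e', h')"
    if "(e, h) \<in> El_T T" "(e', h') \<in> El_T T" "u \<in> hom (Tw sOp) e' e" "is_lower sOp e' u"
      "tw_comp sOp h u = h'" for e h e' h' u
    using x that unfolding lim_iff by blast
  show y: "i < length (vertices T) \<Longrightarrow> y i \<in> fob X (cor 0 (inp sOp T ! i))" for i
  proof -
    assume "i < length (vertices T)"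
    then show "y i \<in> fob X (cor 0 (inp sOp T ! i))" using xin[OF v] by (simp add: y_def)
  qed
  have C: "C S \<in> fob X (Leaf 0)" if "S \<in> subtrees T" for S
    using xin[OF ed[OF that]] by (simp add: C_def)
  have root: "ed (cor 0 (length us)) (cor 0 (length us)) (y i) = C (Vertex i us)"
    if s: "Vertex i us \<in> subtrees T" for i us
  proof -
    note i = sOp_subtree_arity[OF T s]
    have e: "edge (cor 0 (length us)) (cor 0 (length us)) \<in> hom (Tw sOp) (Leaf 0) (cor 0 (length us))"
      by (rule edge_hom) simp_all
    show ?thesis
      using comp[OF v[OF i(1)] ed[OF s], unfolded i(2), OF e lower_Leaf[OF _ e] vtx_edge_root[OF T s]]
      by (simp add: ed_def y_def C_def i(2))
  qed
  have child: "ed (cor 0 (length us)) (Leaf k) (y i) = C (us ! k)"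
    if s: "Vertex i us \<in> subtrees T" and k: "k < length us" for i us k
  proof -
    note i = sOp_subtree_arity[OF T s]
    have e: "edge (cor 0 (length us)) (Leaf k) \<in> hom (Tw sOp) (Leaf 0) (cor 0 (length us))"
      using k by (intro edge_hom) (simp_all add: subtrees_cor)
    show ?thesis
      using comp[OF v[OF i(1)] ed[OF subtrees_child[OF k s]], unfolded i(2), OF e lower_Leaf[OF _ e]
          vtx_edge_Leaf[OF T s k]]
      by (simp add: ed_def y_def C_def i(2))
  qed
  show "wt FX (\<lambda>i. code (inp sOp T ! i) (y i)) (\<lambda>l. C (Leaf l)) S"
    "rc FX (\<lambda>i. code (inp sOp T ! i) (y i)) (\<lambda>l. C (Leaf l)) S = C S"
    using wt_compatible[OF T y C root child S] by simp_all
qed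

lemma wt_subtree: "wt P \<delta> \<gamma> T \<Longrightarrow> S \<in> subtrees T \<Longrightarrow> wt P \<delta> \<gamma> S"
  by (induction T) (auto simp: wt_Vertex)

lemma edge_Leaf: "edge (Leaf 0) (Leaf 0) = tw_id sOp (Leaf 0)"
proof -
  have L: "Leaf 0 \<in> Ops sOp" by simp
  obtain S where "S \<in> subtrees (Leaf 0)" "tw_id sOp (Leaf 0) = edge (Leaf 0) S"
    using edge_cases[OF tw_id_hom(1)[OF L] L] .
  then show ?thesis by simp
qed

text \<open>An edge receives the root colour of the subtree above it. Besides identities, the only
  maps between elementary objects over \<open>T\<close> include an edge into a corolla, and for
  these compatibility is the typing of the vertex.\<close>

lemma extend_family:
  assumes T: "T \<in> Ops sOp" and y: "\<And>i. i < length (vertices T) \<Longrightarrow> y i \<in> fob X (cor 0 (inp sOp T ! i))"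
    and w: "wt FX (\<lambda>i. code (inp sOp T ! i) (y i)) \<gamma> T"
  obtains x where "x \<in> lim T" "\<And>i. i < length (vertices T) \<Longrightarrow> x (cor 0 (inp sOp T ! i), vtx T i) = y i"
    "\<And>S. S \<in> subtrees T \<Longrightarrow> x (Leaf 0, edge T S) = rc FX (\<lambda>i. code (inp sOp T ! i) (y i)) \<gamma> S"
proof -
  let ?\<delta> = "\<lambda>i. code (inp sOp T ! i) (y i)"
  \<comment> \<open>The descriptions are well defined because different vertices and different edges
    give different morphisms.\<close>
  define x where "x = (\<lambda>(e, h)\<in>El_T T. if e = Leaf 0
    then rc FX ?\<delta> \<gamma> (THE S. S \<in> subtrees T \<and> h = edge T S)
    else y (THE i. i < length (vertices T) \<and> h = vtx T i))"
  have v: "(cor 0 (inp sOp T ! i), vtx T i) \<in> El_T T" if "i < length (vertices T)" for i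
    using that unfolding El_over_ob[OF T] by blast
  have ed: "(Leaf 0, edge T S) \<in> El_T T" if "S \<in> subtrees T" for S
    using that unfolding El_over_ob[OF T] by blast
  have xv: "x (cor 0 (inp sOp T ! i), vtx T i) = y i" if i: "i < length (vertices T)" for i
  proof -
    have "(THE j. j < length (vertices T) \<and> vtx T i = vtx T j) = i"
      using i vtx_inj[OF T] by (intro the_equality) auto
    then show ?thesis using v[OF i] by (simp add: x_def)
  qed
  have xe: "x (Leaf 0, edge T S) = rc FX ?\<delta> \<gamma> S" if S: "S \<in> subtrees T" for S
  proof -
    have "(THE S'. S' \<in> subtrees T \<and> edge T S = edge T S') = S"
      using S edge_inj[OF T] by (intro the_equality) blast+
    then show ?thesis using ed[OF S] by (simp add: x_def)
  qed
  note ws = wt_subtree[OF w]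
  have "x \<in> lim T"
    unfolding lim_iff
  proof (intro conjI ballI allI impI; clarify?)
    show "x \<in> extensional (El_T T)" by (simp add: x_def)
  next
    fix e h assume "(e, h) \<in> El_T T"
    from El_TE[OF T this] show "x (e, h) \<in> fob X e"
    proof cases
      case (1 i) then show ?thesis using xv y by simp
    next
      case (2 S) then show ?thesis using xe FX.rc_Col[OF ws] by simp
    qed
  next
    fix e h e' u
    assume eh: "(e, h) \<in> El_T T" and eh': "(e', tw_comp sOp h u) \<in> El_T T"
      and u: "u \<in> hom (Tw sOp) e' e" and l: "is_lower sOp e' u"
    from El_TE[OF T eh] show "fmor X e e' u (x (e, h)) = x (e', tw_comp sOp h u)"
    proof cases
      case (1 i)
      let ?n = "inp sOp T ! i"
      obtain us where us: "Vertex i us \<in> subtrees T" using subtree_at[OF T 1(1)] .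
      have n: "?n = length us" by (rule sOp_subtree_arity(2)[OF T us])
      have wi: "inp FX (code ?n (y i)) = map (rc FX ?\<delta> \<gamma>) us"
        using ws[OF us] by (simp add: wt_Vertex)
      from El_TE[OF T eh'] show ?thesis
      proof cases
        case (1 j)
        have "is_lower sOp (cor 0 (inp sOp T ! j)) u" "u \<in> hom (Tw sOp) (cor 0 (inp sOp T ! j)) (cor 0 ?n)"
          using l u 1 \<open>e = _\<close> by simp_all
        from lower_cor[OF _ this(2)] this(1) have "inp sOp T ! j = ?n" "u = vtx (cor 0 ?n) 0" by auto
        then have u': "u = tw_id sOp (cor 0 ?n)" "e' = e" using tw_id_cor 1 \<open>e = _\<close> by auto
        have "tw_comp sOp h u = h"
          using tw_comp_id_right[OF El_T_hom(2)[OF T eh] El_T_hom(1)[OF T eh] T] u' \<open>e = _\<close> by simp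
        moreover have "x (e, h) \<in> fob X e" using xv[of i] y[of i] \<open>i < _\<close> \<open>e = _\<close> \<open>h = _\<close> by simp
        ultimately show ?thesis using pb_id[of e] u' \<open>e = _\<close> by simp
      next
        case (2 S)
        have e: "e = cor 0 (length us)" using \<open>e = _\<close> n by simp
        have "u \<in> hom (Tw sOp) (Leaf 0) (cor 0 (length us))" using u 2 e by simp
        then obtain U where U: "U \<in> subtrees (cor 0 (length us))" "u = edge (cor 0 (length us)) U"
          by (rule edge_cases) simp_all
        then consider "U = cor 0 (length us)" | k where "k < length us" "U = Leaf k"
          by (auto simp: subtrees_cor)
        then show ?thesis
        proof cases
          case 1
          then show ?thesis
            using vtx_edge_root[OF T us] xe[OF us] xv[OF \<open>i < _\<close>] U e \<open>e' = _\<close> \<open>h = _\<close> n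
            by (simp add: FX_out ed_def)
        next
          case (2 k)
          have "ed (cor 0 (length us)) (Leaf k) (y i) = rc FX ?\<delta> \<gamma> (us ! k)"
            using arg_cong[where f = "\<lambda>xs. xs ! k", OF wi] 2 n by (simp add: FX_inp)
          then show ?thesis
            using vtx_edge_Leaf[OF T us 2(1)] xe[OF subtrees_child[OF 2(1) us]] xv[OF \<open>i < _\<close>]
              U 2 e \<open>e' = _\<close> \<open>h = _\<close> n by (simp add: ed_def)
        qed
      qed
    next
      case (2 S)
      from El_TE[OF T eh'] show ?thesis
      proof cases
        case (1 j)
        have "is_lower sOp (cor 0 (inp sOp T ! j)) u" "u \<in> hom (Tw sOp) (cor 0 (inp sOp T ! j)) (Leaf 0)"
          using l u 1 2 by simp_all
        from lower_cor[OF _ this(2)] this(1) show ?thesis by simp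
      next
        case (2 S')
        have "u \<in> hom (Tw sOp) (Leaf 0) (Leaf 0)" using u 2 \<open>e = _\<close> by simp
        then have u': "u = tw_id sOp (Leaf 0)"
          by (rule edge_cases) (simp_all add: edge_Leaf)
        have "tw_comp sOp h u = h"
          using tw_comp_id_right[OF El_T_hom(2)[OF T eh] El_T_hom(1)[OF T eh] T] u' \<open>e = _\<close> by simp
        moreover have "x (e, h) \<in> fob X e"
          using xe FX.rc_Col[OF ws] \<open>S \<in> _\<close> \<open>e = _\<close> \<open>h = _\<close> by simp
        ultimately show ?thesis using pb_id[of "Leaf 0"] u' \<open>e = _\<close> \<open>e' = _\<close> by simp
      qed
    qed
  qed
  then show ?thesis using that xv xe by blast
qed

text \<open>Agreement at the vertices forces agreement at the edges: as \<open>T\<close> has a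
  vertex, the decoration determines the leaf colours, and every other edge lies under a
  vertex.\<close>

lemma family_eqI:
  assumes T: "T \<in> Ops sOp" and x: "x \<in> lim T" and \<xi>: "\<xi> \<in> fob X T" and ne: "T \<noteq> Leaf 0"
    and v: "\<And>i. i < length (vertices T) \<Longrightarrow> vt T \<xi> i = x (cor 0 (inp sOp T ! i), vtx T i)"
  shows "family T \<xi> = x"
proof (rule extensionalityI[of _ "El_T T"])
  show "family T \<xi> \<in> extensional (El_T T)" by simp
  show "x \<in> extensional (El_T T)" using x by (simp add: lim_iff)
  let ?\<delta> = "\<lambda>i. code (inp sOp T ! i) (x (cor 0 (inp sOp T ! i), vtx T i))"
  have nl: "T \<noteq> Leaf l" for l using ne T by (cases "T = Leaf l") auto
  fix eh assume eh: "eh \<in> El_T T"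
  obtain e h where p: "eh = (e, h)" by fastforce
  from El_TE[OF T eh[unfolded p]] show "family T \<xi> eh = x eh"
  proof cases
    case (1 i)
    then show ?thesis using eh v[OF 1(1)] by (simp add: p vt_def)
  next
    case (2 S)
    have dv: "deco T \<xi> i = ?\<delta> i" if "i \<in> set (vlabels T)" for i
      using v perms_set[OF sOp_Ops_vlabels[OF T]] that by (simp add: deco_def)
    have w1: "wt FX ?\<delta> (\<lambda>l. ed T (Leaf l) \<xi>) T"
      using deco_wt(1)[OF T \<xi> subtrees_self]
        wt_cong[where T = T and \<delta> = "deco T \<xi>" and \<delta>' = ?\<delta>, OF dv refl] by blast
    have g: "ed T (Leaf l) \<xi> = x (Leaf 0, edge T (Leaf l))" if "l \<in> set (leaves T)" for l
      using wt_leaves_unique[OF w1 lim_wt(2)[OF T x subtrees_self] nl that] .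
    have "rc FX (deco T \<xi>) (\<lambda>l. ed T (Leaf l) \<xi>) S = rc FX ?\<delta> (\<lambda>l. x (Leaf 0, edge T (Leaf l))) S"
      using subtrees_labels[OF 2(1)] g dv by (intro rc_cong) (auto simp: image_iff) 
    then have "ed T S \<xi> = x (Leaf 0, edge T S)"
      using deco_wt(2)[OF T \<xi> 2(1)] lim_wt(3)[OF T x 2(1)] by simp
    then show ?thesis using eh 2 by (simp add: p ed_def)
  qed
qed

text \<open>The comma category over the tree without vertices has the identity as its only object,
  so the Segal condition is automatic there.\<close>

lemma family_Leaf: "bij_betw (family (Leaf 0)) (fob X (Leaf 0)) (lim (Leaf 0))"
proof -
  let ?T = "Leaf 0 :: (nat, nat) tree"
  let ?o = "(?T, tw_id sOp ?T)"
  have o: "El_T ?T = {?o}"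
  proof (rule set_eqI, clarify)
    fix e h show "(e, h) \<in> El_T ?T \<longleftrightarrow> (e, h) \<in> {?o}"
      by (auto simp: El_over_ob edge_Leaf)
  qed
  have f: "family ?T \<xi> ?o = \<xi>" if "\<xi> \<in> fob X ?T" for \<xi>
    using pb_id[of ?T \<xi>] that by (simp add: o)
  show ?thesis
  proof (rule bij_betwI')
    fix x y assume "x \<in> fob X ?T" "y \<in> fob X ?T"
    then show "family ?T x = family ?T y \<longleftrightarrow> x = y" using f by metis
  next
    fix x assume "x \<in> fob X ?T"
    then show "family ?T x \<in> lim ?T" using family_lim[of ?T] by simp
  next
    fix x assume x: "x \<in> lim ?T"
    then have "x ?o \<in> fob X ?T" "x \<in> extensional {?o}" unfolding lim_iff o by auto
    have "x = family ?T (x ?o)"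
    proof (rule extensionalityI[of _ "El_T ?T"])
      show "x \<in> extensional (El_T ?T)" using x by (simp add: lim_iff)
      show "x eh = family ?T (x ?o) eh" if "eh \<in> El_T ?T" for eh
        using that f[OF \<open>x ?o \<in> _\<close>] unfolding o by simp
    qed simp
    then show "\<exists>\<xi> \<in> fob X ?T. x = family ?T \<xi>" using \<open>x ?o \<in> _\<close> by blast
  qed
qed

lemma segal_iff: "is_segal sOp sOp_grading X \<longleftrightarrow> (\<forall>T \<in> Ops sOp. T \<noteq> Leaf 0 \<longrightarrow> glues T)"
proof -
  have v: "(cor 0 (inp sOp T ! i), vtx T i) \<in> El_T T" if "T \<in> Ops sOp" "i < length (vertices T)" for T i
    using that unfolding El_over_ob[OF that(1)] by blast
  have fv: "family T \<xi> (cor 0 (inp sOp T ! i), vtx T i) = vt T \<xi> i"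
    if "T \<in> Ops sOp" "i < length (vertices T)" for T i \<xi>
    using v[OF that] by (simp add: vt_def)
  have *: "bij_betw (family T) (fob X T) (lim T) \<longleftrightarrow> glues T" if T: "T \<in> Ops sOp" and ne: "T \<noteq> Leaf 0" for T
  proof
    assume b: "bij_betw (family T) (fob X T) (lim T)"
    show "glues T"
      unfolding glues_def
    proof (intro allI impI)
      fix y \<gamma> assume y: "\<forall>i < length (vertices T). y i \<in> fob X (cor 0 (inp sOp T ! i))"
        and w: "wt FX (\<lambda>i. code (inp sOp T ! i) (y i)) \<gamma> T"
      obtain x where x: "x \<in> lim T" "\<And>i. i < length (vertices T) \<Longrightarrow> x (cor 0 (inp sOp T ! i), vtx T i) = y i"
        using extend_family[of T y \<gamma>, OF T y[rule_format] w] by metis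
      then have "x \<in> family T ` fob X T" using bij_betw_imp_surj_on[OF b] by blast
      then obtain \<xi> where \<xi>: "\<xi> \<in> fob X T" "family T \<xi> = x" by blast
      show "\<exists>!\<xi>. \<xi> \<in> fob X T \<and> (\<forall>i < length (vertices T). vt T \<xi> i = y i)"
      proof (rule ex1I[of _ \<xi>])
        show "\<xi> \<in> fob X T \<and> (\<forall>i < length (vertices T). vt T \<xi> i = y i)"
          using \<xi> x(2) fv[OF T, of _ \<xi>] by simp
        fix \<xi>' assume "\<xi>' \<in> fob X T \<and> (\<forall>i < length (vertices T). vt T \<xi>' i = y i)"
        then have "\<xi>' \<in> fob X T" "family T \<xi>' = x"
          using family_eqI[OF T x(1) _ ne] x(2) by auto
        then show "\<xi>' = \<xi>" using inj_onD[OF bij_betw_imp_inj_on[OF b]] \<xi> by simp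
      qed
    qed
  next
    assume g: "glues T"
    show "bij_betw (family T) (fob X T) (lim T)"
    proof (rule bij_betwI')
      fix \<xi> \<xi>' assume \<xi>: "\<xi> \<in> fob X T" and \<xi>': "\<xi>' \<in> fob X T"
      show "family T \<xi> = family T \<xi>' \<longleftrightarrow> \<xi> = \<xi>'"
      proof
        assume "family T \<xi> = family T \<xi>'"
        then have e: "\<forall>i < length (vertices T). vt T \<xi>' i = vt T \<xi> i" using fv[OF T] by metis
        have "wt FX (\<lambda>i. code (inp sOp T ! i) (vt T \<xi> i)) (\<lambda>l. ed T (Leaf l) \<xi>) T"
          using deco_wt(1)[OF T \<xi> subtrees_self] unfolding deco_def[abs_def] .
        then have "\<exists>!\<zeta>. \<zeta> \<in> fob X T \<and> (\<forall>i < length (vertices T). vt T \<zeta> i = vt T \<xi> i)"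
          using g vt_in[OF T _ \<xi>] unfolding glues_def by blast
        then show "\<xi> = \<xi>'" using \<xi> \<xi>' e by blast
      qed simp
    next
      fix \<xi> assume "\<xi> \<in> fob X T" then show "family T \<xi> \<in> lim T" by (rule family_lim[OF T])
    next
      fix x assume x: "x \<in> lim T"
      have "\<exists>!\<xi>. \<xi> \<in> fob X T \<and>
          (\<forall>i < length (vertices T). vt T \<xi> i = x (cor 0 (inp sOp T ! i), vtx T i))"
        using g[unfolded glues_def, rule_format, OF lim_wt(1,2)[OF T x subtrees_self]] .
      then obtain \<xi> where \<xi>: "\<xi> \<in> fob X T"
        "\<forall>i < length (vertices T). vt T \<xi> i = x (cor 0 (inp sOp T ! i), vtx T i)" by blast
      then have "family T \<xi> = x" using family_eqI[OF T x \<xi>(1) ne] by blast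
      then show "\<exists>\<xi> \<in> fob X T. x = family T \<xi>" using \<xi>(1) by blast
    qed
  qed
  have "bij_betw (family T) (fob X T) (lim T) \<longleftrightarrow> (T \<noteq> Leaf 0 \<longrightarrow> glues T)" if "T \<in> Ops sOp" for T
  proof (cases "T = Leaf 0")
    case True
    show ?thesis unfolding True using family_Leaf by blast
  next
    case False
    then show ?thesis using * that by blast
  qed
  then show ?thesis unfolding is_segal_def family_def by (rule ball_cong[OF refl])
qed

end

section \<open>The operad of a Segal presheaf\<close>

lemma vlabels_vertex: "v \<in> set (vlabels T) \<Longrightarrow> \<exists>n. (v, n) \<in> set (vertices T)"
  by auto

text \<open>A common relabelling forces equal shapes and equal leaves, so matching the vertex labels
  in planar order is enough.\<close>

lemma vmap_eq_relabel:
  "vmap f T = vmap f' T' \<Longrightarrow> map \<sigma> (vlabels T) = vlabels T' \<Longrightarrow> vmap \<sigma> T = T'"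
proof (induction T arbitrary: T')
  case (Leaf l)
  then show ?case by (cases T') auto
next
  case (Vertex v ts)
  then obtain w us where T': "T' = Vertex w us" by (cases T') auto
  have m: "map (vmap f) ts = map (vmap f') us" using Vertex.prems(1) T' by simp
  then have len: "length ts = length us" by (metis length_map)
  have e: "vmap f (ts ! i) = vmap f' (us ! i)" if "i < length ts" for i
    using arg_cong[where f = "\<lambda>xs. xs ! i", OF m] that len by simp
  have c: "concat (map (\<lambda>t. map \<sigma> (vlabels t)) ts) = concat (map vlabels us)" "\<sigma> v = w"
    using Vertex.prems(2) T' by (simp_all add: map_concat o_def)
  have "length (vertices (ts ! i)) = length (vertices (us ! i))" if "i < length ts" for i
    using arg_cong[OF e[OF that], of "\<lambda>t. length (vertices t)"] by simp
  then have "map (\<lambda>t. map \<sigma> (vlabels t)) ts = map vlabels us"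
    using c(1) len by (subst (asm) concat_eq_concat_iff) (auto simp: set_zip)
  then have "map \<sigma> (vlabels (ts ! i)) = vlabels (us ! i)" if "i < length ts" for i
    using that len by (metis nth_map)
  then have "map (vmap \<sigma>) ts = us"
    using Vertex.IH[OF nth_mem e] len by (intro nth_equalityI) auto
  then show ?case using c(2) T' by simp
qed

text \<open>Compares two numberings of one labelled tree, as they arise from two witnesses for
  \<open>EvX\<close>.\<close>

lemma relabelling:
  assumes "vmap f T = vmap f' T'" "distinct (vlabels T)"
  obtains \<sigma> where "T' = vmap \<sigma> T" "\<And>v. v \<in> set (vlabels T) \<Longrightarrow> f v = f' (\<sigma> v)"
proof -
  let ?a = "vlabels T" and ?b = "vlabels T'"
  have m: "map f ?a = map f' ?b" using arg_cong[OF assms(1), of vlabels] by (simp only: vlabels_vmap)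
  then have len: "length ?a = length ?b" by (metis length_map)
  define \<sigma> where "\<sigma> = (\<lambda>v. the (map_of (zip ?a ?b) v))"
  have s: "\<sigma> (?a ! i) = ?b ! i" if "i < length ?a" for i
    using map_of_zip_nth[OF len assms(2), of i] that len by (simp add: \<sigma>_def)
  have "map \<sigma> ?a = ?b"
  proof (rule nth_equalityI)
    show "length (map \<sigma> ?a) = length ?b" using len by simp
    fix i assume "i < length (map \<sigma> ?a)"
    then have "i < length ?a" by simp
    then show "map \<sigma> ?a ! i = ?b ! i" using s[of i] nth_map[of i ?a \<sigma>] by argo
  qed
  then have T': "T' = vmap \<sigma> T" using vmap_eq_relabel[OF assms(1)] by metis
  have "f v = f' (\<sigma> v)" if "v \<in> set ?a" for v
  proof -
    obtain i where i: "i < length ?a" "?a ! i = v" using \<open>v \<in> _\<close> by (metis in_set_conv_nth)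
    have "f (?a ! i) = f' (?b ! i)"
      using arg_cong[where f = "\<lambda>xs. xs ! i", OF m] i(1) len nth_map[of i ?a f] nth_map[of i ?b f'] by simp
    then show ?thesis using s[OF i(1)] i(2) by simp
  qed
  then show ?thesis using that T' by blast
qed

section \<open>Values of trees decorated by a presheaf\<close>

context presheaf_coding
begin

lemma FX_OpsE:
  assumes "a \<in> Ops FX" obtains n y where "a = code n y" "y \<in> fob X (cor 0 n)"
  using assms by (auto simp: FX_Ops)

lemma EvXI:
  assumes "T0 \<in> Ops sOp" "\<xi> \<in> fob X T0" "T = vmap g T0"
    "\<And>i. i < length (vertices T0) \<Longrightarrow> \<delta> (g i) = deco T0 \<xi> i"
  shows "EvX \<delta> T (tot T0 \<xi>)"
proof -
  let ?ls = "map g [0..<length (vertices T0)]"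
  have "vmap g T0 = vmap ((!) ?ls) T0"
    using perms_set[OF sOp_Ops_vlabels[OF assms(1)]] by (intro vmap_cong) simp
  then show ?thesis
    unfolding EvX_def using assms by (intro exI[of _ T0] exI[of _ ?ls] exI[of _ \<xi>]) simp
qed

lemma EvXE:
  assumes "EvX \<delta> T x"
  obtains T0 g \<xi> where "T0 \<in> Ops sOp" "\<xi> \<in> fob X T0" "T = vmap g T0" "x = tot T0 \<xi>"
    "\<And>i. i < length (vertices T0) \<Longrightarrow> \<delta> (g i) = deco T0 \<xi> i"
  using assms unfolding EvX_def by blast

lemma EvX_cong:
  assumes "EvX \<delta> T x" "\<And>v. v \<in> set (vlabels T) \<Longrightarrow> \<delta> v = \<delta>' v" shows "EvX \<delta>' T x"
proof -
  obtain T0 g \<xi> where e: "T0 \<in> Ops sOp" "\<xi> \<in> fob X T0" "T = vmap g T0" "x = tot T0 \<xi>"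
    "\<And>i. i < length (vertices T0) \<Longrightarrow> \<delta> (g i) = deco T0 \<xi> i"
    by (rule EvXE[OF assms(1)]) blast
  have "\<delta>' (g i) = deco T0 \<xi> i" if i: "i < length (vertices T0)" for i
  proof -
    have "i \<in> set (vlabels T0)" using perms_set[OF sOp_Ops_vlabels[OF e(1)]] i by simp
    then have "g i \<in> set (vlabels T)" unfolding e(3) vlabels_vmap set_map[of g] by blast
    then show ?thesis using assms(2) e(5)[OF i] by simp
  qed
  then show ?thesis unfolding e(4) by (rule EvXI[OF e(1-3)])
qed

lemma EvX_vmap:
  assumes "EvX (\<lambda>v. \<delta> (f v)) T x" shows "EvX \<delta> (vmap f T) x"
proof -
  obtain T0 g \<xi> where e: "T0 \<in> Ops sOp" "\<xi> \<in> fob X T0" "T = vmap g T0" "x = tot T0 \<xi>"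
    "\<And>i. i < length (vertices T0) \<Longrightarrow> \<delta> (f (g i)) = deco T0 \<xi> i"
    by (rule EvXE[OF assms]) blast
  show ?thesis unfolding e(4) by (rule EvXI[OF e(1,2), of _ "\<lambda>v. f (g v)"]) (simp_all add: e(3,5) vmap_vmap)
qed

lemma EvX_Wt:
  assumes "EvX \<delta> T x" shows "Wt FX \<delta> T x"
proof -
  obtain T0 g \<xi> where e: "T0 \<in> Ops sOp" "\<xi> \<in> fob X T0" "T = vmap g T0" "x = tot T0 \<xi>"
    "\<And>i. i < length (vertices T0) \<Longrightarrow> \<delta> (g i) = deco T0 \<xi> i"
    by (rule EvXE[OF assms]) blast
  have d: "\<delta> (g v) = deco T0 \<xi> v" if "v \<in> set (vlabels T0)" for v
    using that perms_set[OF sOp_Ops_vlabels[OF e(1)]] e(5) by simp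
  have "wt FX (\<lambda>v. \<delta> (g v)) \<gamma> T0 = wt FX (deco T0 \<xi>) \<gamma> T0"
    "rc FX (\<lambda>v. \<delta> (g v)) \<gamma> T0 = rc FX (deco T0 \<xi>) \<gamma> T0" for \<gamma> :: "nat \<Rightarrow> 'u"
    by (rule wt_cong[OF d refl] rc_cong[OF d refl]; assumption)+
  then show ?thesis
    using tot_Wt[OF e(1,2)] unfolding Wt_def e(3,4) by (simp add: wt_map_tree rc_map_tree)
qed

lemma tot_Leaf: 
  assumes "c \<in> fob X (Leaf 0)"
  shows "tot (Leaf 0) c \<in> Ops FX" "inp FX (tot (Leaf 0) c) = [c]" "out FX (tot (Leaf 0) c) = c"
proof -
  have id: "ed (Leaf 0) (Leaf 0) c = c" using pb_id[OF _ assms] by (simp add: ed_def edge_Leaf)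
  show "tot (Leaf 0) c \<in> Ops FX" using tot_Ops[of "Leaf 0"] assms by simp
  show "out FX (tot (Leaf 0) c) = c" using ed_tot(1)[of "Leaf 0"] assms id by simp
  have "length (inp FX (tot (Leaf 0) c)) = 1" using FX_arity[of "tot (Leaf 0) c"] by (simp add: arity_def tot_def)
  then show "inp FX (tot (Leaf 0) c) = [c]"
    using ed_tot(2)[of "Leaf 0" c 0] assms id by (cases "inp FX (tot (Leaf 0) c)") auto
qed

lemma EvX_Leaf: "EvX \<delta> (Leaf 0) x \<longleftrightarrow> (\<exists>c \<in> fob X (Leaf 0). x = tot (Leaf 0) c)"
proof
  assume a: "EvX \<delta> (Leaf 0) x"
  obtain T0 g \<xi> where "T0 \<in> Ops sOp" and e: "\<xi> \<in> fob X T0" "Leaf 0 = vmap g T0" "x = tot T0 \<xi>"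
    and "\<And>i. i < length (vertices T0) \<Longrightarrow> \<delta> (g i) = deco T0 \<xi> i"
    by (rule EvXE[OF a]) blast
  then have "T0 = Leaf 0" by (cases T0) auto
  then show "\<exists>c \<in> fob X (Leaf 0). x = tot (Leaf 0) c" using e by blast
next
  assume "\<exists>c \<in> fob X (Leaf 0). x = tot (Leaf 0) c"
  then show "EvX \<delta> (Leaf 0) x" using EvXI[of "Leaf 0"] by auto
qed

lemma tot_cor:
  assumes "y \<in> fob X (cor 0 n)" shows "tot (cor 0 n) y = code n y" "deco (cor 0 n) y 0 = code n y"
  using pb_id[OF _ assms] tw_id_cor[of n] by (simp_all add: tot_def deco_def vt_def)

lemma EvX_cor:
  assumes "\<delta> v \<in> Ops FX" "opn (\<delta> v) = n" shows "EvX \<delta> (cor v n) (\<delta> v)"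
proof -
  obtain y where y: "\<delta> v = code n y" "y \<in> fob X (cor 0 n)"
    using assms by (auto elim!: FX_OpsE)
  show ?thesis
    using EvXI[OF cor_Ops y(2), of "cor v n" "\<lambda>_. v" \<delta>] tot_cor[OF y(2)] y(1) by simp
qed

lemma EvX_deco:
  assumes "T \<in> Ops sOp" "\<xi> \<in> fob X T" shows "EvX (deco T \<xi>) T (tot T \<xi>)"
  by (rule EvXI[OF assms, of _ "\<lambda>v. v"]) simp_all

text \<open>By the factorisation in \<open>ell\<close>, the decoration of vertex \<open>i\<close> of
  the restricted element is the total of the restriction of \<open>\<xi>\<close> to the upper
  tree.\<close>

lemma EvX_upp:
  assumes f: "f \<in> hom (Tw sOp) p t" and p: "p \<in> Ops sOp" and t: "t \<in> Ops sOp"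
    and \<xi>: "\<xi> \<in> fob X t" and i: "i < length (vertices p)"
  shows "EvX (deco t \<xi>) (uppL f i) (deco p (fmor X t p f \<xi>) i)"
proof -
  note l = ell[OF f p t i]
  let ?q = "upp f ! i" and ?\<zeta> = "fmor X t (upp f ! i) (ell p t f i) \<xi>"
  have \<zeta>: "?\<zeta> \<in> fob X ?q" by (rule pb_in[OF l(1,2) t \<xi>])
  have "tot ?q ?\<zeta> = deco p (fmor X t p f \<xi>) i"
    using pb_comp[OF evm_hom[OF l(2)] l(1) _ l(2) t \<xi>] pb_comp[OF vtx_hom[OF p i] f _ p t \<xi>] l(3,4)
    by (simp add: tot_def deco_def vt_def)
  moreover have "deco t \<xi> (upp_labels f ! i ! k) = deco ?q ?\<zeta> k" if k: "k < length (vertices ?q)" for k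
    using pb_comp[OF vtx_hom[OF l(2) k] l(1) _ l(2) t \<xi>] l(5,7)[OF k] by (simp add: deco_def vt_def)
  ultimately show ?thesis
    using EvXI[OF l(2) \<zeta>, of "uppL f i" "(!) (upp_labels f ! i)" "deco t \<xi>"] by (simp add: uppL_def)
qed

text \<open>By \<open>wlow\<close>, restricting \<open>\<xi>\<close> to the lower tree leaves its
  total unchanged and decorates the marked vertex by the total over \<open>p\<close>.\<close>

lemma EvX_low:
  assumes f: "f \<in> hom (Tw sOp) p t" and p: "p \<in> Ops sOp" and t: "t \<in> Ops sOp"
    and \<xi>: "\<xi> \<in> fob X t"
  shows "EvX (case_option (tot p (fmor X t p f \<xi>)) (deco t \<xi>)) (lowL f) (tot t \<xi>)"
proof -
  note w = wlow[OF f p t]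
  let ?q = "low f" and ?\<zeta> = "fmor X t (low f) (wlow p t f) \<xi>"
  have \<zeta>: "?\<zeta> \<in> fob X ?q" by (rule pb_in[OF w(1,2) t \<xi>])
  have z: "0 < length (vertices ?q)" using w(4) by simp
  have "tot ?q ?\<zeta> = tot t \<xi>"
    using pb_comp[OF evm_hom[OF w(2)] w(1) _ w(2) t \<xi>] w(5,6) by (simp add: tot_def)
  moreover have "case_option (tot p (fmor X t p f \<xi>)) (deco t \<xi>) (lname (low_labels f) j) = deco ?q ?\<zeta> j"
    if j: "j < length (vertices ?q)" for j
  proof (cases j)
    case 0
    then show ?thesis
      using pb_comp[OF vtx_hom[OF w(2) z] w(1) _ w(2) t \<xi>] pb_comp[OF evm_hom[OF p] f _ p t \<xi>] w(3,7)
      by (simp add: tot_def deco_def vt_def)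
  next
    case (Suc k)
    then have k: "k < length (low_labels f)" using j w(4) by simp
    then show ?thesis
      using pb_comp[OF vtx_hom[OF w(2) j] w(1) _ w(2) t \<xi>] w(8,10)[OF k] Suc
      by (simp add: deco_def vt_def)
  qed
  ultimately show ?thesis
    using EvXI[OF w(2) \<zeta>, of "lowL f" "lname (low_labels f)"
        "case_option (tot p (fmor X t p f \<xi>)) (deco t \<xi>)"] by (simp add: lowL_def)
qed

lemma tot_upper:
  assumes g: "g \<in> hom (Tw sOp) p t" and p: "p \<in> Ops sOp" and t: "t \<in> Ops sOp"
    and lo: "lowL g = cor None (length (leaves p))" and \<xi>: "\<xi> \<in> fob X t"
  shows "tot p (fmor X t p g \<xi>) = tot t \<xi>"
  using pb_comp[OF evm_hom[OF p] g _ p t \<xi>] upper_evm[OF g p t lo] by (simp add: tot_def)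

end

section \<open>Values over a Segal presheaf: uniqueness and substitution\<close>

locale segal_coding = presheaf_coding +
  assumes segal: "is_segal sOp sOp_grading X"
begin

lemma glue_unique:
  assumes T: "T \<in> Ops sOp" and ne: "T \<noteq> Leaf 0" and \<xi>: "\<xi> \<in> fob X T" "\<xi>' \<in> fob X T"
    and d: "\<And>i. i < length (vertices T) \<Longrightarrow> deco T \<xi> i = deco T \<xi>' i"
  shows "\<xi> = \<xi>'"
proof -
  have g: "glues T" using segal T ne by (simp add: segal_iff)
  have "wt FX (\<lambda>i. code (inp sOp T ! i) (vt T \<xi> i)) (\<lambda>l. ed T (Leaf l) \<xi>) T"
    using deco_wt(1)[OF T \<xi>(1) subtrees_self] unfolding deco_def[abs_def] .
  from g[unfolded glues_def, rule_format, OF vt_in[OF T _ \<xi>(1)] this]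
  have "\<exists>!\<zeta>. \<zeta> \<in> fob X T \<and> (\<forall>i < length (vertices T). vt T \<zeta> i = vt T \<xi> i)" .
  moreover have "\<forall>i < length (vertices T). vt T \<xi>' i = vt T \<xi> i"
    using d by (simp add: deco_def)
  ultimately show ?thesis using \<xi> by blast
qed

lemma glue_exists:
  assumes T: "T \<in> Ops sOp" and ne: "T \<noteq> Leaf 0" and w: "wt FX \<delta> \<gamma> T"
  obtains \<xi> where "\<xi> \<in> fob X T" "\<And>i. i < length (vertices T) \<Longrightarrow> deco T \<xi> i = \<delta> i"
proof -
  have g: "glues T" using segal T ne by (simp add: segal_iff)
  let ?y = "\<lambda>i. el (\<delta> i)"
  have d: "\<delta> i = code (inp sOp T ! i) (?y i)" "?y i \<in> fob X (cor 0 (inp sOp T ! i))"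
    if "i < length (vertices T)" for i
  proof -
    have "\<delta> i \<in> Ops FX \<and> arity FX (\<delta> i) = inp sOp T ! i"
      using wt_vertex[OF w sOp_vertex[OF T that]] .
    then show "\<delta> i = code (inp sOp T ! i) (?y i)" "?y i \<in> fob X (cor 0 (inp sOp T ! i))"
      unfolding FX_arity by (auto elim!: FX_OpsE)
  qed
  have "\<delta> v = code (inp sOp T ! v) (?y v)" if "v \<in> set (vlabels T)" for v
    using d that perms_set[OF sOp_Ops_vlabels[OF T]] by simp
  then have "wt FX (\<lambda>i. code (inp sOp T ! i) (?y i)) \<gamma> T"
    using wt_cong[where T = T and \<delta> = \<delta> and \<delta>' = "\<lambda>i. code (inp sOp T ! i) (?y i)", OF _ refl] w by blast
  from g[unfolded glues_def, rule_format, OF d(2) this]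
  have "\<exists>!\<xi>. \<xi> \<in> fob X T \<and> (\<forall>i < length (vertices T). vt T \<xi> i = ?y i)" .
  then obtain \<xi> where \<xi>: "\<xi> \<in> fob X T" "\<forall>i < length (vertices T). vt T \<xi> i = ?y i" by blast
  then have "deco T \<xi> i = \<delta> i" if "i < length (vertices T)" for i
    using d(1)[OF that] that by (simp add: deco_def)
  then show ?thesis using that \<xi>(1) by blast
qed

lemma upper_morphism:
  assumes p: "p \<in> Ops sOp" and U: "\<And>i. i < length (vertices p) \<Longrightarrow> leaves (U i) \<in> perms (inp sOp p ! i)"
    and t: "t \<in> Ops sOp" "t = sub (\<lambda>i n. U i) p"
  obtains g where "g \<in> hom (Tw sOp) p t" "lowL g = cor None (length (leaves p))"
    "\<And>i. i < length (vertices p) \<Longrightarrow> uppL g i = U i"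
  using mor_props[OF lhom_upper[OF p U]] t that by metis

text \<open>Two witnesses number the same labelled tree in two ways. The renumbering is an upper
  morphism whose upper trees are corollas; restricting one element along it and comparing vertices
  reduces the claim to uniqueness of gluing.\<close>

lemma EvX_unique:
  assumes a: "EvX \<delta> T x" and b: "EvX \<delta> T x'" and ne: "\<And>l. T \<noteq> Leaf l"
  shows "x = x'"
proof -
  obtain T0 g \<xi> where e: "T0 \<in> Ops sOp" "\<xi> \<in> fob X T0" "T = vmap g T0" "x = tot T0 \<xi>"
    "\<And>i. i < length (vertices T0) \<Longrightarrow> \<delta> (g i) = deco T0 \<xi> i"
    by (rule EvXE[OF a]) blast
  obtain T0' g' \<xi>' where e': "T0' \<in> Ops sOp" "\<xi>' \<in> fob X T0'" "T = vmap g' T0'" "x' = tot T0' \<xi>'"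
    "\<And>i. i < length (vertices T0') \<Longrightarrow> \<delta> (g' i) = deco T0' \<xi>' i"
    by (rule EvXE[OF b]) blast
  obtain \<sigma> where \<sigma>: "T0' = vmap \<sigma> T0" "\<And>v. v \<in> set (vlabels T0) \<Longrightarrow> g v = g' (\<sigma> v)"
    using relabelling[of g T0 g' T0'] e(1,3) e'(3) perms_distinct[OF sOp_Ops_vlabels] by metis
  let ?U = "\<lambda>i. cor (\<sigma> i) (inp sOp T0 ! i)"
  have "sub (\<lambda>i n. ?U i) T0 = sub (\<lambda>i n. cor (\<sigma> i) n) T0"
    using sOp_inp_nth[OF e(1)] by (intro sub_cong) auto
  also have "\<dots> = T0'" unfolding \<sigma>(1) by (metis sub_cor_left sub_vmap)
  finally have s: "T0' = sub (\<lambda>i n. ?U i) T0" ..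
  obtain h where h: "h \<in> hom (Tw sOp) T0 T0'" "lowL h = cor None (length (leaves T0))"
    "\<And>i. i < length (vertices T0) \<Longrightarrow> uppL h i = ?U i"
    using upper_morphism[OF e(1) _ e'(1) s] by (metis leaves_cor upt_perms)
  let ?\<zeta> = "fmor X T0' T0 h \<xi>'"
  have \<zeta>: "?\<zeta> \<in> fob X T0" by (rule pb_in[OF h(1) e(1) e'(1,2)])
  have T0: "T0 \<noteq> Leaf 0" using ne[of 0] e(3) by auto
  have "deco T0 \<xi> i = deco T0 ?\<zeta> i" if i: "i < length (vertices T0)" for i
  proof -
    note c = tw_comp_hom[OF vtx_hom[OF e(1) i] h(1) e(1) e'(1)]
    have "uppL (tw_comp sOp h (vtx T0 i)) 0 = cor (\<sigma> i) (inp sOp T0 ! i)"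
      using c(2)[of 0] h(3)[OF i] by (simp add: uppL_vtx[OF e(1) i] sub_cor)
    note u = vtx_unique[OF c(1) e'(1) this]
    have "deco T0 ?\<zeta> i = deco T0' \<xi>' (\<sigma> i)"
      using pb_comp[OF vtx_hom[OF e(1) i] h(1) _ e(1) e'(1,2)] u(2,4) by (simp add: deco_def vt_def)
    also have "\<dots> = \<delta> (g' (\<sigma> i))" using e'(5)[OF u(1)] ..
    also have "g' (\<sigma> i) = g i"
      using \<sigma>(2)[of i] perms_set[OF sOp_Ops_vlabels[OF e(1)]] i by simp
    also have "\<delta> (g i) = deco T0 \<xi> i" by (rule e(5)[OF i])
    finally show ?thesis ..
  qed
  then have "\<xi> = ?\<zeta>" by (rule glue_unique[OF e(1) T0 e(2) \<zeta>])
  then show ?thesis using tot_upper[OF h(1) e(1) e'(1) h(2) e'(2)] e(4) e'(4) by simp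
qed

text \<open>Over the tree without vertices a value is the identity of a colour, and this colour is
  its only input.\<close>

lemma EvX_same_inp:
  assumes a: "EvX \<delta> T x" and b: "EvX \<delta> T x'" and i: "inp FX x = inp FX x'"
  shows "x = x'"
proof (cases T)
  case (Leaf l)
  have "leaves T \<in> perms (arity FX x)" using EvX_Wt[OF a] unfolding Wt_def by blast
  then have "mset [l] = mset [0..<arity FX x]" unfolding perms_iff Leaf by simp
  then have "l \<in> set [0..<arity FX x]" "arity FX x = 1"
    by (metis list.set_intros(1) mset_eq_setD, metis One_nat_def length_Cons length_upt list.size(3) minus_nat.diff_0 mset_eq_length)
  then have "T = Leaf 0" using Leaf by simp
  then show ?thesis using a b i tot_Leaf(2) by (auto simp: EvX_Leaf)
qed (use EvX_unique[OF a b] in simp)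

text \<open>The witnesses for the substituted trees are composed in \<open>sOp\<close> to one tree
  \<open>T'\<close>, over which the decorations glue to \<open>\<omega>\<close>. Restricted along
  the upper morphism from \<open>T0\<close>, this has the decoration of \<open>\<xi>\<close>, so it
  is \<open>\<xi>\<close>; and restriction along an upper morphism keeps the total.\<close>

lemma EvX_sub:
  assumes s: "\<And>v n. (v, n) \<in> set (vertices T) \<Longrightarrow> EvX \<delta> (s v n) (ys v)" and T: "EvX ys T x"
  shows "EvX \<delta> (sub s T) x"
proof -
  obtain T0 g \<xi> where e: "T0 \<in> Ops sOp" "\<xi> \<in> fob X T0" "T = vmap g T0" "x = tot T0 \<xi>"
    "\<And>i. i < length (vertices T0) \<Longrightarrow> ys (g i) = deco T0 \<xi> i"
    by (rule EvXE[OF T]) blast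
  have W: "Wt FX \<delta> (sub s T) x" "fits s T"
    using FX.Wt_sub[where s = s and T = T, OF EvX_Wt[OF s] EvX_Wt[OF T]] by blast+
  let ?m = "length (vertices T0)" and ?n = "\<lambda>i. inp sOp T0 ! i"
  have gv: "(g i, ?n i) \<in> set (vertices T)" if "i < ?m" for i
    using sOp_vertex[OF e(1) that] unfolding e(3) vertices_map_tree by force
  have "\<exists>S h \<zeta>. S \<in> Ops sOp \<and> \<zeta> \<in> fob X S \<and> s (g i) (?n i) = vmap h S \<and> deco T0 \<xi> i = tot S \<zeta> \<and>
      (\<forall>j < length (vertices S). \<delta> (h j) = deco S \<zeta> j)" if i: "i < ?m" for i
    using EvXE[OF s[OF gv[OF i]]] e(5)[OF i] by metis
  then obtain S h \<zeta> where S: "\<And>i. i < ?m \<Longrightarrow> S i \<in> Ops sOp" "\<And>i. i < ?m \<Longrightarrow> \<zeta> i \<in> fob X (S i)"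
    "\<And>i. i < ?m \<Longrightarrow> s (g i) (?n i) = vmap (h i) (S i)"
    "\<And>i. i < ?m \<Longrightarrow> deco T0 \<xi> i = tot (S i) (\<zeta> i)"
    "\<And>i j. i < ?m \<Longrightarrow> j < length (vertices (S i)) \<Longrightarrow> \<delta> (h i j) = deco (S i) (\<zeta> i) j"
    by metis
  have lS: "leaves (S i) \<in> perms (?n i)" if "i < ?m" for i
    using fitsD[OF W(2) gv[OF that]] S(3)[OF that] by simp
  let ?Ss = "map S [0..<?m]"
  have c: "composable sOp T0 ?Ss" using e(1) S(1) lS by (simp add: sOp_composable)
  define T' where "T' = comp sOp T0 ?Ss"
  have T': "T' \<in> Ops sOp" unfolding T'_def by (rule sOp_comp_Ops(1)[OF c])
  let ?bs = "block_start (map (length \<circ> vertices) ?Ss)"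
  let ?U = "\<lambda>i. vmap (\<lambda>a. ?bs i + a) (S i)"
  let ?kss = "map (\<lambda>i. map (h i) [0..<length (vertices (S i))]) [0..<?m]"
  \<comment> \<open>Vertices of \<open>T'\<close> are numbered in blocks, so their labels are the
    concatenated label lists of the substituted trees.\<close>
  define k where "k = (!) (concat ?kss)"
  have kb: "k (?bs i + a) = h i a" if "i < ?m" "a < length (vertices (S i))" for i a
  proof -
    have lens: "map length ?kss = map (length \<circ> vertices) ?Ss" by (intro nth_equalityI) simp_all
    show ?thesis using concat_nth_block[of i ?kss a] that unfolding k_def lens by simp
  qed
  have T'U: "T' = sub (\<lambda>i n. ?U i) T0"
    unfolding T'_def sOp_comp[OF c] using sOp_inp_nth[OF e(1)] by (intro sub_cong) auto
  have sT: "sub s T = vmap k T'"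
  proof -
    have "vmap k T' = sub (\<lambda>i n. vmap (h i) (?Ss ! i)) T0"
      unfolding T'_def by (rule comp_vmap[OF c]) (use kb in simp)
    also have "\<dots> = sub (\<lambda>i n. s (g i) n) T0"
    proof (rule sub_cong)
      fix i n assume "(i, n) \<in> set (vertices T0)"
      then show "vmap (h i) (?Ss ! i) = s (g i) n" using sOp_inp_nth[OF e(1)] S(3) by fastforce
    qed
    finally show ?thesis by (simp add: e(3) sub_vmap)
  qed
  have hU: "vmap k (?U i) = s (g i) (?n i)" if i: "i < ?m" for i
    unfolding vmap_vmap S(3)[OF i] using kb[OF i] perms_set[OF sOp_Ops_vlabels[OF S(1)[OF i]]]
    by (intro vmap_cong) simp
  obtain f where f: "f \<in> hom (Tw sOp) T0 T'" "lowL f = cor None (length (leaves T0))"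
    "\<And>i. i < ?m \<Longrightarrow> uppL f i = ?U i"
    using upper_morphism[OF e(1) _ T' T'U] lS by (metis leaves_map_tree list.map_ident)
  show ?thesis
  proof (cases "T0 = Leaf 0")
    case True
    then have "x = tot (Leaf 0) \<xi>" "\<xi> \<in> fob X (Leaf 0)" "sub s T = Leaf 0" using e by simp_all
    then show ?thesis using EvX_Leaf by metis
  next
    case ne: False
    have wT': "wt FX (\<lambda>v. \<delta> (k v)) ((!) (inp FX x)) T'"
      using W(1) unfolding Wt_def sT wt_map_tree by simp
    obtain \<omega> where \<omega>: "\<omega> \<in> fob X T'" "\<And>i. i < length (vertices T') \<Longrightarrow> deco T' \<omega> i = \<delta> (k i)"
      "inp FX (tot T' \<omega>) = inp FX x"
    proof (cases "T' = Leaf 0")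
      case True
      \<comment> \<open>All vertices have been erased. There is nothing to glue, and the element
        over \<open>T'\<close> is the colour that \<open>x\<close> has as its input.\<close>
      let ?c = "inp FX x ! 0"
      have c: "?c \<in> fob X (Leaf 0)" using wT' True by simp
      have "leaves (sub s T) \<in> perms (arity FX x)" using W(1) unfolding Wt_def by blast
      then have "length (inp FX x) = 1" using perms_length True sT unfolding arity_def by fastforce
      then have "inp FX x = [?c]" by (cases "inp FX x") auto
      then show ?thesis using that[of ?c] tot_Leaf(2)[OF c] c True by simp
    next
      case False
      obtain \<omega> where \<omega>: "\<omega> \<in> fob X T'" "\<And>i. i < length (vertices T') \<Longrightarrow> deco T' \<omega> i = \<delta> (k i)"
        using glue_exists[OF T' False wT'] by blast
      have "Wt FX (\<lambda>v. \<delta> (k v)) T' (tot T' \<omega>)"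
      proof (rule EvX_Wt, rule EvXI[OF T' \<omega>(1), of _ "\<lambda>v. v"])
        show "\<delta> (k i) = deco T' \<omega> i" if "i < length (vertices T')" for i using \<omega>(2)[OF that] ..
      qed simp
      moreover have "Wt FX (\<lambda>v. \<delta> (k v)) T' x"
        using W(1) unfolding Wt_def sT wt_map_tree rc_map_tree by simp
      moreover have "T' \<noteq> Leaf l" for l using False T' by auto
      ultimately have "inp FX (tot T' \<omega>) = inp FX x" by (rule Wt_inp_unique)
      then show ?thesis using that[of \<omega>] \<omega> by blast
    qed
    let ?\<xi>' = "fmor X T' T0 f \<omega>"
    have \<xi>': "?\<xi>' \<in> fob X T0" by (rule pb_in[OF f(1) e(1) T' \<omega>(1)])
    have tot: "tot T0 ?\<xi>' = tot T' \<omega>" by (rule tot_upper[OF f(1) e(1) T' f(2) \<omega>(1)])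
    have each: "EvX \<delta> (s (g i) (?n i)) (deco T0 ?\<xi>' i)" if i: "i < ?m" for i
    proof -
      have "EvX (deco T' \<omega>) (?U i) (deco T0 ?\<xi>' i)"
        using EvX_upp[OF f(1) e(1) T' \<omega>(1) i] f(3)[OF i] by simp
      then have "EvX (\<lambda>v. \<delta> (k v)) (?U i) (deco T0 ?\<xi>' i)"
      proof (rule EvX_cong)
        fix v assume "v \<in> set (vlabels (?U i))"
        from vlabels_vertex[OF this] obtain n where n: "(v, n) \<in> set (vertices (?U i))" ..
        have "set (vertices (uppL f i)) \<subseteq> set (vertices T')"
          by (rule lhom_vertices(1)[OF lhom_of_hom(1)[OF f(1) T'] i])
        then have "v < length (vertices T')" using n f(3)[OF i] sOp_inp_nth(2)[OF T'] by auto
        then show "deco T' \<omega> v = \<delta> (k v)" by (rule \<omega>(2))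
      qed
      then show ?thesis using EvX_vmap[of \<delta> k] hU[OF i] by metis
    qed
    have ddx: "Wt FX (deco T0 \<xi>) T0 x" unfolding e(4) by (rule tot_Wt[OF e(1,2)])
    have ddx': "Wt FX (deco T0 ?\<xi>') T0 (tot T0 ?\<xi>')" by (rule tot_Wt[OF e(1) \<xi>'])
    have "wt FX (deco T0 \<xi>) ((!) (inp FX x)) T0" "wt FX (deco T0 ?\<xi>') ((!) (inp FX x)) T0"
      using ddx ddx' tot \<omega>(3) unfolding Wt_def by simp_all
    \<comment> \<open>A substituted tree without vertices has no unique value. Its colour is fixed
      by the surrounding tree, so decorations are compared from the leaves downwards, where equal
      inputs are already known.\<close>
    then have same: "\<forall>v \<in> set (vlabels T0). deco T0 \<xi> v = deco T0 ?\<xi>' v"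
    proof (rule wt_unique[THEN conjunct2])
      fix v assume "v \<in> set (vlabels T0)" and i: "inp FX (deco T0 \<xi> v) = inp FX (deco T0 ?\<xi>' v)"
      then have v: "v < ?m" using perms_set[OF sOp_Ops_vlabels[OF e(1)]] by simp
      show "deco T0 \<xi> v = deco T0 ?\<xi>' v"
        using EvX_same_inp[OF _ each[OF v] i] s[OF gv[OF v]] e(5)[OF v] by simp
    qed
    have "\<xi> = ?\<xi>'"
    proof (rule glue_unique[OF e(1) ne e(2) \<xi>'])
      fix i assume "i < ?m"
      then have "i \<in> set (vlabels T0)" using perms_set[OF sOp_Ops_vlabels[OF e(1)]] by simp
      then show "deco T0 \<xi> i = deco T0 ?\<xi>' i" by (rule same[rule_format])
    qed
    then have "x = tot T' \<omega>" using tot e(4) by simp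
    then show ?thesis
      using EvXI[OF T' \<omega>(1) sT] \<omega>(2) by simp
  qed
qed

lemma FX_comp: "comp FX p qs = (SOME x. EvX (case_option p ((!) qs)) (two_level None Some (map opn qs)) x)"
  and FX_act: "act FX p L = (SOME x. EvX (\<lambda>_. p) (Vertex () (map Leaf L)) x)"
  by (simp_all add: FX_def)

lemma EvX_exists:
  assumes T: "T \<in> Ops sOp" "T \<noteq> Leaf 0" and w: "wt FX (\<lambda>v. \<delta> (g v)) \<gamma> T"
  shows "\<exists>x. EvX \<delta> (vmap g T) x"
proof -
  obtain \<xi> where \<xi>: "\<xi> \<in> fob X T" "\<And>i. i < length (vertices T) \<Longrightarrow> deco T \<xi> i = \<delta> (g i)"
    using glue_exists[OF T w] by blast
  then have "EvX \<delta> (vmap g T) (tot T \<xi>)" by (intro EvXI[OF T(1)]) simp_all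
  then show ?thesis by blast
qed

lemma FX_inp_Col: "p \<in> Ops FX \<Longrightarrow> set (inp FX p) \<subseteq> Col FX"
  by (auto elim!: FX_OpsE simp: FX_inp subtrees_cor intro!: ed_in)

lemma vmap_two_level: "vmap h (two_level r f ks) = two_level (h r) (\<lambda>i. h (f i)) ks"
  by (simp add: two_level_def o_def)

text \<open>The inputs of the \<open>qs\<close>, concatenated, colour the leaves of the two-level
  tree consistently. Gluing then provides a value, so the choice in \<open>FX\<close> is a genuine
  value.\<close>

lemma EvX_comp:
  assumes c: "composable FX p qs" and d: "\<delta> r = p" "\<And>i. i < length qs \<Longrightarrow> \<delta> (f i) = qs ! i"
  shows "EvX \<delta> (two_level r f (map opn qs)) (comp FX p qs)"
proof -
  let ?ks = "map opn qs" and ?\<delta> = "case_option p ((!) qs)"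
  have ks: "?ks = map length (map (inp FX) qs)" using FX_arity by (simp add: arity_def)
  have p: "p \<in> Ops FX" "\<And>i. i < length qs \<Longrightarrow> qs ! i \<in> Ops FX" "inp FX p = map (out FX) qs"
    using c by (auto simp: composable_def)
  let ?g = "\<lambda>v::nat. case v of 0 \<Rightarrow> None | Suc i \<Rightarrow> Some i"
  let ?\<gamma> = "(!) (concat (map (inp FX) qs))"
  have sl: "map ?\<gamma> [block_start ?ks i..<block_start ?ks i + ?ks ! i] = inp FX (qs ! i)"
    if "i < length qs" for i
    using nth_concat_slice[of i "map (inp FX) qs"] that unfolding ks by simp
  have col: "?\<gamma> l \<in> Col FX" if "i < length qs" "l \<in> {block_start ?ks i..<block_start ?ks i + ?ks ! i}" for i l
  proof -
    have "?\<gamma> l \<in> set (inp FX (qs ! i))" unfolding sl[OF that(1), symmetric] using that(2) by auto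
    then show ?thesis using FX_inp_Col p(2) that(1) by blast
  qed
  have "map (out FX) qs = map (\<lambda>i. out FX (qs ! i)) [0..<length ?ks]"
    by (intro nth_equalityI) auto
  then have "wt FX (\<lambda>v. ?\<delta> (?g v)) ?\<gamma> (two_level 0 Suc ?ks)"
    using p sl col by (subst wt_two_level[where qs = qs]) simp_all
  from EvX_exists[where g = ?g and \<delta> = ?\<delta>, OF two_level_Ops _ this]
  have "\<exists>x. EvX ?\<delta> (two_level None Some ?ks) x" by (simp add: vmap_two_level)
  then have "EvX ?\<delta> (two_level None Some ?ks) (comp FX p qs)"
    unfolding FX_comp by (rule someI_ex)
  then have "EvX (\<lambda>v. \<delta> (case_option r f v)) (two_level None Some ?ks) (comp FX p qs)"
  proof (rule EvX_cong)
    fix v assume "v \<in> set (vlabels (two_level None Some ?ks))"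
    then have "v = None \<or> (\<exists>i < length qs. v = Some i)" by (auto simp: vertices_two_level)
    then show "?\<delta> v = \<delta> (case_option r f v)" using d by auto
  qed
  from EvX_vmap[where f = "case_option r f", OF this] show ?thesis by (simp add: vmap_two_level)
qed

lemma EvX_act:
  assumes p: "\<delta> r \<in> Ops FX" and L: "L \<in> perms (opn (\<delta> r))"
  shows "EvX \<delta> (Vertex r (map Leaf L)) (act FX (\<delta> r) L)"
proof -
  let ?p = "\<delta> r" and ?T = "Vertex 0 (map Leaf L) :: (nat, nat) tree"
  have lT: "leaves ?T = L" by (simp add: o_def concat_map_singleton)
  have "vlabels ?T \<in> perms (length (vertices ?T))" by (simp add: o_def perms_iff concat_map_Nil)
  then have T: "?T \<in> Ops sOp" unfolding sOp_Ops lT using perms_self[OF L] by blast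
  \<comment> \<open>The leaf at position \<open>k\<close> has number \<open>L ! k\<close>, so its
    colour is found by inverting \<open>L\<close>.\<close>
  let ?\<gamma> = "\<lambda>l. inp FX ?p ! (THE k. k < opn ?p \<and> L ! k = l)"
  have len: "length L = opn ?p" "length (inp FX ?p) = opn ?p"
    using perms_length[OF L] FX_arity by (simp_all add: arity_def)
  have g: "?\<gamma> (L ! k) = inp FX ?p ! k" if k: "k < opn ?p" for k
  proof -
    have "(THE k'. k' < opn ?p \<and> L ! k' = L ! k) = k"
      using perms_distinct[OF L] k len(1) by (intro the_equality) (auto simp: nth_eq_iff_index_eq)
    then show ?thesis by simp
  qed
  have m: "map ?\<gamma> L = inp FX ?p" using g len by (intro nth_equalityI) simp_all
  have "\<forall>c \<in> set (map ?\<gamma> L). c \<in> Col FX" unfolding m using FX_inp_Col[OF p] by blast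
  then have "\<forall>l \<in> set L. ?\<gamma> l \<in> Col FX" by simp
  moreover have "map (rc FX (\<lambda>_. ?p) ?\<gamma>) (map Leaf L) = inp FX ?p"
    by (rule trans[OF _ m]) simp
  ultimately have "wt FX (\<lambda>_. ?p) ?\<gamma> ?T"
    unfolding wt_Vertex by (intro conjI p) (rule sym, simp_all)
  from EvX_exists[where g = "\<lambda>_. ()" and \<delta> = "\<lambda>_. ?p", OF T _ this]
  have "\<exists>x. EvX (\<lambda>_. ?p) (Vertex () (map Leaf L)) x" by (simp add: o_def)
  then have "EvX (\<lambda>_. ?p) (Vertex () (map Leaf L)) (act FX ?p L)"
    unfolding FX_act by (rule someI_ex)
  from EvX_vmap[of \<delta> "\<lambda>_. r", OF this] show ?thesis by (simp add: o_def)
qed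

lemma EvX_ident: "c \<in> fob X (Leaf 0) \<Longrightarrow> EvX \<delta> (Leaf 0) (ident FX c)"
  using EvX_Leaf by auto

lemma EvX_eqI:
  assumes "EvX \<delta> T x" "EvX \<delta> T' x'" "T = T'" "\<And>l. T \<noteq> Leaf l" shows "x = x'"
  using EvX_unique assms by metis

lemma FX_comp_profile:
  assumes c: "composable FX p qs"
  shows "comp FX p qs \<in> Ops FX" "inp FX (comp FX p qs) = concat (map (inp FX) qs)"
    "out FX (comp FX p qs) = out FX p"
proof -
  let ?ks = "map opn qs" and ?x = "comp FX p qs"
  have ks: "?ks = map length (map (inp FX) qs)" using FX_arity by (simp add: arity_def)
  have W: "Wt FX (case_option p ((!) qs)) (two_level None Some ?ks) ?x"
    by (rule EvX_Wt[OF EvX_comp[OF c]]) simp_all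
  then show "?x \<in> Ops FX" "out FX ?x = out FX p"
    unfolding Wt_def by (simp_all add: two_level_def)
  have len: "length (inp FX ?x) = sum_list ?ks"
    using W perms_length unfolding Wt_def leaves_two_level arity_def by fastforce
  have sl: "inp FX (qs ! i) = map ((!) (inp FX ?x)) [block_start ?ks i..<block_start ?ks i + ?ks ! i]"
    if "i < length qs" for i
    using W that unfolding Wt_def by (simp add: wt_two_level[where qs = qs])
  show "inp FX ?x = concat (map (inp FX) qs)"
  proof (rule nth_equalityI)
    show l: "length (inp FX ?x) = length (concat (map (inp FX) qs))"
      unfolding length_concat ks[symmetric] by (rule len)
    fix k assume "k < length (inp FX ?x)"
    then obtain i a where ia: "i < length (map (inp FX) qs)" "a < length (map (inp FX) qs ! i)"
      "k = block_start (map length (map (inp FX) qs)) i + a"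
      using concat_index[of k "map (inp FX) qs"] l by metis
    have "concat (map (inp FX) qs) ! k = inp FX (qs ! i) ! a"
      using concat_nth_block[OF ia(1,2)] ia by simp
    also have "\<dots> = map ((!) (inp FX ?x)) [block_start ?ks i..<block_start ?ks i + ?ks ! i] ! a"
      using sl[of i] ia(1) by simp
    also have "\<dots> = inp FX ?x ! k"
    proof -
      have "a < ?ks ! i" using ia(1,2) ks by (metis length_map nth_map)
      then show ?thesis using ia(3) unfolding ks[symmetric] by simp
    qed
    finally show "inp FX ?x ! k = concat (map (inp FX) qs) ! k" ..
  qed
qed

lemma FX_act_profile:
  assumes p: "p \<in> Ops FX" and L: "L \<in> perms (arity FX p)"
  shows "act FX p L \<in> Ops FX" "arity FX (act FX p L) = arity FX p"
    "k < arity FX p \<Longrightarrow> inp FX (act FX p L) ! (L ! k) = inp FX p ! k"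
    "out FX (act FX p L) = out FX p"
proof -
  have "Wt FX (\<lambda>_. p) (Vertex () (map Leaf L)) (act FX p L)"
    using EvX_Wt[OF EvX_act[of "\<lambda>_. p"]] p L by (simp add: FX_arity)
  then have W: "act FX p L \<in> Ops FX" "L \<in> perms (arity FX (act FX p L))"
    "inp FX p = map ((!) (inp FX (act FX p L))) L" "out FX (act FX p L) = out FX p"
    unfolding Wt_def by (simp_all add: wt_Vertex o_def concat_map_singleton)
  show "act FX p L \<in> Ops FX" "out FX (act FX p L) = out FX p" by (rule W)+
  show "arity FX (act FX p L) = arity FX p" using perms_length[OF L] perms_length[OF W(2)] by simp
  show "k < arity FX p \<Longrightarrow> inp FX (act FX p L) ! (L ! k) = inp FX p ! k"
    unfolding W(3) using perms_length[OF L] by simp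
qed

end

section \<open>The operad axioms for a Segal presheaf, each from one tree\<close>

abbreviation lmap :: "('l \<Rightarrow> 'm) \<Rightarrow> ('v, 'l) tree \<Rightarrow> ('v, 'm) tree" where
  "lmap g \<equiv> map_tree (\<lambda>v. v) g"

lemma sub_leaf_vertex:
  assumes "leaves (s r (length L)) \<in> perms (length L)"
  shows "sub s (Vertex r (map Leaf L)) = lmap ((!) L) (s r (length L))"
proof -
  have "sub s (Vertex r (map Leaf L)) = graft ((!) (map Leaf L)) (s r (length L))"
    by (simp add: o_def)
  also have "\<dots> = graft (\<lambda>k. Leaf (L ! k)) (s r (length L))"
    using perms_set[OF assms] by (intro graft_cong) simp
  finally show ?thesis by (simp add: graft_Leaf_fun)
qed

lemma sub_two_level:
  assumes r: "leaves (s r (length ks)) \<in> perms (length ks)"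
    and f: "\<And>i. i < length ks \<Longrightarrow> leaves (s (f i) (ks ! i)) \<in> perms (ks ! i)"
  shows "sub s (two_level r f ks) =
    graft (\<lambda>i. lmap (\<lambda>a. block_start ks i + a) (s (f i) (ks ! i))) (s r (length ks))"
proof -
  let ?c = "\<lambda>i. Vertex (f i) (map Leaf [block_start ks i..<block_start ks i + ks ! i])"
  have c: "sub s (?c i) = lmap (\<lambda>a. block_start ks i + a) (s (f i) (ks ! i))" if i: "i < length ks" for i
  proof -
    have "sub s (?c i) = lmap ((!) [block_start ks i..<block_start ks i + ks ! i]) (s (f i) (ks ! i))"
      using sub_leaf_vertex[of s "f i" "[block_start ks i..<block_start ks i + ks ! i]"] f[OF i] by simp
    also have "\<dots> = lmap (\<lambda>a. block_start ks i + a) (s (f i) (ks ! i))"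
      using perms_set[OF f[OF i]] by (intro tree.map_cong0) (simp_all add: set2_tree)
    finally show ?thesis .
  qed
  have "sub s (two_level r f ks) = graft ((!) (map (sub s) (map ?c [0..<length ks]))) (s r (length ks))"
    by (simp add: two_level_def)
  also have "\<dots> = graft (\<lambda>i. lmap (\<lambda>a. block_start ks i + a) (s (f i) (ks ! i))) (s r (length ks))"
  proof (rule graft_cong)
    fix i assume "i \<in> set (leaves (s r (length ks)))"
    then have "i < length ks" using perms_set[OF r] by simp
    then show "map (sub s) (map ?c [0..<length ks]) ! i = lmap (\<lambda>a. block_start ks i + a) (s (f i) (ks ! i))"
      using c by simp
  qed
  finally show ?thesis .
qed

lemma lmap_cor: "lmap h (cor v n) = Vertex v (map (\<lambda>a. Leaf (h a)) [0..<n])"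
  by (simp add: cor_def)

lemma graft_cor: "graft u (cor v n) = Vertex v (map u [0..<n])"
  by (simp add: cor_def)

lemma lmap_two_level: "lmap h (two_level r f ks) = Vertex r (map (\<lambda>i. Vertex (f i)
    (map (\<lambda>l. Leaf (h l)) [block_start ks i..<block_start ks i + ks ! i])) [0..<length ks])"
  by (simp add: two_level_def o_def)

text \<open>Offsets for blocks nested two deep, as needed for the leaves of a three-level
  tree.\<close>

lemma block_start_concat:
  "i < length xss \<Longrightarrow> j \<le> length (xss ! i) \<Longrightarrow>
    block_start (concat xss) (block_start (map length xss) i + j) =
    block_start (map sum_list xss) i + block_start (xss ! i) j"
proof (induction xss arbitrary: i)
  case (Cons xs xss)
  show ?case
  proof (cases i)
    case 0
    then show ?thesis using Cons.prems by (simp add: block_start_append)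
  next
    case (Suc i')
    have "block_start (xs @ ys) (length xs + m) = sum_list xs + block_start ys m" for ys m
      by (simp add: block_start_def)
    then show ?thesis using Cons.IH[of i'] Cons.prems Suc by (simp add: add.assoc)
  qed
qed simp

context segal_coding
begin

lemma len_inp: "length (inp FX p) = opn p"
  using FX_arity[of p] by (simp add: arity_def)

lemma opn_ident: "c \<in> fob X (Leaf 0) \<Longrightarrow> opn (tot (Leaf 0) c) = 1"
  by (simp add: tot_def)

text \<open>The tree without vertices, substituted at the root of the two-level tree, leaves the
  corolla of \<open>p\<close>.\<close>

lemma FX_comp_ident_left:
  assumes p: "p \<in> Ops FX" shows "comp FX (ident FX (out FX p)) [p] = p"
proof -
  let ?c = "out FX p"
  have c: "?c \<in> fob X (Leaf 0)" using FX.typed_out[OF p] by simp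
  have cm: "composable FX (ident FX ?c) [p]"
    using p tot_Leaf[OF c] by (simp add: composable_def)
  let ?\<delta> = "case_option (ident FX ?c) ((!) [p])"
  let ?s = "\<lambda>v n. case v of None \<Rightarrow> Leaf 0 | Some i \<Rightarrow> cor () n"
  have E: "EvX ?\<delta> (two_level None Some [opn p]) (comp FX (ident FX ?c) [p])"
    using EvX_comp[OF cm, of ?\<delta> None Some] by simp
  have "EvX (\<lambda>_. p) (sub ?s (two_level None Some [opn p])) (comp FX (ident FX ?c) [p])"
  proof (rule EvX_sub[OF _ E])
    fix v n assume "(v, n) \<in> set (vertices (two_level None Some [opn p]))"
    then consider "v = None" | "v = Some 0" "n = opn p" by (auto simp: vertices_two_level)
    then show "EvX (\<lambda>_. p) (?s v n) (?\<delta> v)"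
      using EvX_ident[OF c] EvX_cor[of "\<lambda>_. p" "()"] p by cases auto
  qed
  moreover have "sub ?s (two_level None Some [opn p]) = cor () (opn p)"
  proof -
    have "sub ?s (two_level None Some [opn p]) =
        graft (\<lambda>i. lmap (\<lambda>a. block_start [opn p] i + a) (cor () ([opn p] ! i))) (Leaf 0)"
      by (subst sub_two_level) (simp_all add: perms_iff)
    then show ?thesis by (simp add: lmap_cor) (simp add: cor_def block_start_def)
  qed
  ultimately have "EvX (\<lambda>_. p) (cor () (opn p)) (comp FX (ident FX ?c) [p])" by simp
  from EvX_unique[OF this EvX_cor[of "\<lambda>_. p" "()"]] show ?thesis using p by simp
qed

text \<open>The tree without vertices, substituted at every branch, removes the upper level.\<close>

lemma FX_comp_ident_right:
  assumes p: "p \<in> Ops FX" shows "comp FX p (map (ident FX) (inp FX p)) = p"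
proof -
  let ?qs = "map (ident FX) (inp FX p)" and ?n = "opn p"
  have c: "c \<in> fob X (Leaf 0)" if "c \<in> set (inp FX p)" for c using FX_inp_Col[OF p] that by auto
  have len: "length (inp FX p) = ?n" using FX_arity by (simp add: arity_def)
  have cm: "composable FX p ?qs"
    using p c tot_Leaf by (auto simp: composable_def intro!: nth_equalityI)
  let ?\<delta> = "case_option p ((!) ?qs)"
  let ?s = "\<lambda>v n. case v of None \<Rightarrow> cor () n | Some i \<Rightarrow> Leaf 0"
  have ks: "map opn ?qs = replicate ?n 1"
    using c opn_ident len by (intro nth_equalityI) simp_all
  have E: "EvX ?\<delta> (two_level None Some (replicate ?n 1)) (comp FX p ?qs)"
    using EvX_comp[OF cm, of ?\<delta> None Some] unfolding ks by simp
  have "EvX (\<lambda>_. p) (sub ?s (two_level None Some (replicate ?n 1))) (comp FX p ?qs)"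
  proof (rule EvX_sub[OF _ E])
    fix v n assume "(v, n) \<in> set (vertices (two_level None Some (replicate ?n 1)))"
    then consider "v = None" "n = ?n" | i where "v = Some i" "i < ?n"
      by (auto simp: vertices_two_level)
    then show "EvX (\<lambda>_. p) (?s v n) (?\<delta> v)"
    proof cases
      case 1
      then show ?thesis using EvX_cor[of "\<lambda>_. p" "()"] p by auto
    next
      case (2 i)
      then have "inp FX p ! i \<in> fob X (Leaf 0)" using c len by simp
      from EvX_ident[OF this] show ?thesis using 2 len by simp
    qed
  qed
  moreover have "sub ?s (two_level None Some (replicate ?n 1)) = cor () ?n"
  proof -
    have "sub ?s (two_level None Some (replicate ?n 1)) =
        graft (\<lambda>i. Leaf (block_start (replicate ?n 1) i)) (cor () ?n)"
      by (subst sub_two_level) (simp_all add: perms_iff)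
    also have "\<dots> = cor () ?n"
      unfolding graft_cor unfolding cor_def using block_start_replicate by simp
    finally show ?thesis .
  qed
  ultimately have "EvX (\<lambda>_. p) (cor () ?n) (comp FX p ?qs)" by simp
  from EvX_unique[OF this EvX_cor[of "\<lambda>_. p" "()"]] show ?thesis using p by simp
qed

lemma FX_act_id:
  assumes p: "p \<in> Ops FX" shows "act FX p [0..<arity FX p] = p"
proof -
  have "EvX (\<lambda>_. p) (Vertex () (map Leaf [0..<arity FX p])) (act FX p [0..<arity FX p])"
    using EvX_act[of "\<lambda>_. p" "()", OF p, of "[0..<arity FX p]"] by (simp add: FX_arity)
  then have "EvX (\<lambda>_. p) (cor () (opn p)) (act FX p [0..<arity FX p])"
    by (simp add: cor_def FX_arity)
  from EvX_unique[OF this EvX_cor[of "\<lambda>_. p" "()"]] show ?thesis using p by simp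
qed

text \<open>A corolla numbered by \<open>L\<close>, substituted into one numbered by
  \<open>M\<close>, is the corolla numbered by the composite permutation.\<close>

lemma FX_act_act:
  assumes p: "p \<in> Ops FX" and L: "L \<in> perms (arity FX p)" and M: "M \<in> perms (arity FX p)"
  shows "act FX (act FX p L) M = act FX p (map ((!) M) L)"
proof -
  let ?q = "act FX p L"
  note a = FX_act_profile[OF p L]
  have lM: "length M = opn p" "length L = opn p" using perms_length M L FX_arity by metis+
  have E: "EvX (\<lambda>_. ?q) (Vertex () (map Leaf M)) (act FX ?q M)"
    using EvX_act[of "\<lambda>_. ?q" "()" M] a(1,2) M FX_arity by metis
  let ?s = "\<lambda>v n. Vertex v (map Leaf L)"
  have "EvX (\<lambda>_. p) (sub ?s (Vertex () (map Leaf M))) (act FX ?q M)"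
  proof (rule EvX_sub[OF _ E])
    show "EvX (\<lambda>_. p) (?s v n) ?q" for v :: unit and n
      using EvX_act[of "\<lambda>_. p" v L] p L FX_arity by metis
  qed
  moreover have "sub ?s (Vertex () (map Leaf M)) = Vertex () (map Leaf (map ((!) M) L))"
    using L lM FX_arity by (subst sub_leaf_vertex) (simp_all add: o_def concat_map_singleton)
  moreover have "map ((!) M) L \<in> perms (opn p)" using map_nth_perm[OF M L] FX_arity by simp
  from EvX_act[of "\<lambda>_. p" "()", OF p this]
  have "EvX (\<lambda>_. p) (Vertex () (map Leaf (map ((!) M) L))) (act FX p (map ((!) M) L))" .
  ultimately show ?thesis using EvX_eqI by (metis tree.distinct(1))
qed

lemma composable_opn:
  assumes "composable FX p qs" shows "length qs = opn p"
  using assms FX_arity unfolding composable_def arity_def by (metis length_map)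

text \<open>Acting on the branches renumbers the leaves inside each block of the two-level tree.
  Renumbering all its leaves by the block sum gives the same tree.\<close>

lemma FX_comp_act_inner:
  assumes c: "composable FX p qs" and L: "list_all2 (\<lambda>q L. L \<in> perms (arity FX q)) qs Ls"
  shows "comp FX p (map2 (act FX) qs Ls) = act FX (comp FX p qs) (block_sum Ls)"
proof -
  let ?qs = "map2 (act FX) qs Ls" and ?ks = "map opn qs" and ?x = "comp FX p qs"
  have len: "length Ls = length qs" and Li: "\<And>i. i < length qs \<Longrightarrow> Ls ! i \<in> perms (opn (qs ! i))"
    using L FX_arity by (auto simp: list_all2_conv_all_nth)
  have p: "p \<in> Ops FX" "\<And>i. i < length qs \<Longrightarrow> qs ! i \<in> Ops FX" "inp FX p = map (out FX) qs"
    using c by (auto simp: composable_def)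
  note a = FX_act_profile[OF p(2), of _ "Ls ! _"]
  have a': "act FX (qs ! i) (Ls ! i) \<in> Ops FX" "opn (act FX (qs ! i) (Ls ! i)) = opn (qs ! i)"
    "out FX (act FX (qs ! i) (Ls ! i)) = out FX (qs ! i)" if "i < length qs" for i
    using FX_act_profile[OF p(2)[OF that], of "Ls ! i"] Li[OF that] FX_arity by simp_all
  have "map (out FX) ?qs = map (out FX) qs" using a'(3) len by (intro nth_equalityI) simp_all
  moreover have "q \<in> Ops FX" if "q \<in> set ?qs" for q
  proof -
    from that obtain i where "i < length ?qs" "q = ?qs ! i" by (metis in_set_conv_nth)
    then show ?thesis using a'(1) len by simp
  qed
  ultimately have c': "composable FX p ?qs" using p by (auto simp: composable_def)
  have ks': "map opn ?qs = ?ks" using a'(2) len by (intro nth_equalityI) simp_all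
  let ?\<delta> = "case_option p ((!) ?qs)" and ?\<delta>' = "case_option p ((!) qs)"
  have E: "EvX ?\<delta> (two_level None Some ?ks) (comp FX p ?qs)"
    using EvX_comp[OF c', of ?\<delta> None Some] unfolding ks' by simp
  let ?s = "\<lambda>v n. case v of None \<Rightarrow> cor None n | Some i \<Rightarrow> Vertex (Some i) (map Leaf (Ls ! i))"
  have lL: "length (Ls ! i) = opn (qs ! i)" if "i < length qs" for i
    using perms_length[OF Li[OF that]] .
  have 1: "EvX ?\<delta>' (sub ?s (two_level None Some ?ks)) (comp FX p ?qs)"
  proof (rule EvX_sub[OF _ E])
    fix v n assume "(v, n) \<in> set (vertices (two_level None Some ?ks))"
    then consider "v = None" "n = opn p" | i where "v = Some i" "i < length qs"
      using composable_opn[OF c] by (auto simp: vertices_two_level)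
    then show "EvX ?\<delta>' (?s v n) (?\<delta> v)"
    proof cases
      case 1
      then show ?thesis using EvX_cor[of ?\<delta>' None] p(1) by simp
    next
      case (2 i)
      then show ?thesis using EvX_act[of ?\<delta>' "Some i" "Ls ! i"] p(2)[of i] Li[of i] len by simp
    qed
  qed
  have Ls_ns: "map length Ls = ?ks" using lL len by (intro nth_equalityI) simp_all
  have t1: "sub ?s (two_level None Some ?ks) = Vertex None (map (\<lambda>i. Vertex (Some i)
      (map (\<lambda>a. Leaf (block_start ?ks i + a)) (Ls ! i))) [0..<length qs])"
    using Li by (subst sub_two_level) (simp_all add: o_def concat_map_singleton graft_cor)
  have bs: "block_sum Ls \<in> perms (sum_list ?ks)"
    by (rule block_sum_perms[OF Ls_ns]) (use Li len in simp)
  note xp = FX_comp_profile[OF c]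
  have ox: "opn ?x = sum_list ?ks"
  proof -
    have "arity FX ?x = sum_list ?ks"
      unfolding arity_def xp(2) length_concat by (simp add: o_def len_inp)
    then show ?thesis by (simp add: FX_arity)
  qed
  have E2: "EvX (\<lambda>_. ?x) (Vertex () (map Leaf (block_sum Ls))) (act FX ?x (block_sum Ls))"
    by (rule EvX_act) (use xp bs ox in simp_all)
  have lb: "length (block_sum Ls) = sum_list ?ks" by (rule perms_length[OF bs])
  have 2: "EvX ?\<delta>' (sub (\<lambda>_ _. two_level None Some ?ks) (Vertex () (map Leaf (block_sum Ls))))
      (act FX ?x (block_sum Ls))"
  proof (rule EvX_sub[OF _ E2])
    show "EvX ?\<delta>' (two_level None Some ?ks) ?x" for v :: unit and n :: nat
      using EvX_comp[OF c, of ?\<delta>' None Some] by simp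
  qed
  have t2: "sub (\<lambda>_ _. two_level None Some ?ks) (Vertex () (map Leaf (block_sum Ls))) =
      lmap ((!) (block_sum Ls)) (two_level None Some ?ks)"
    by (subst sub_leaf_vertex) (simp_all add: leaves_two_level lb)
  have t: "sub ?s (two_level None Some ?ks) =
      sub (\<lambda>_ _. two_level None Some ?ks) (Vertex () (map Leaf (block_sum Ls)))"
    unfolding t1 t2 lmap_two_level tree.inject length_map
  proof (intro conjI refl map_cong)
    fix i assume "i \<in> set [0..<length qs]"
    then have i: "i < length qs" by simp
    have "map (\<lambda>a. block_start ?ks i + a) (Ls ! i) =
        map ((!) (block_sum Ls)) [block_start ?ks i..<block_start ?ks i + opn (qs ! i)]"
      using block_sum_nth[OF Ls_ns, of i] i len lL[OF i] by (intro nth_equalityI) simp_all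
    from arg_cong[OF this, of "map Leaf"]
    show "Vertex (Some i) (map (\<lambda>a. Leaf (block_start ?ks i + a)) (Ls ! i)) = Vertex (Some i)
        (map (\<lambda>l. Leaf (block_sum Ls ! l)) [block_start ?ks i..<block_start ?ks i + ?ks ! i])"
      using i by (simp add: o_def)
  qed
  show ?thesis by (rule EvX_eqI[OF 1 2 t]) (simp add: t1)
qed

text \<open>Both sides are values of the two-level tree whose branches stand in the order
  \<open>L\<close>, while the leaf numbers stay attached to their branches.\<close>

lemma FX_comp_act_outer:
  assumes p: "p \<in> Ops FX" and L: "L \<in> perms (arity FX p)" and c: "composable FX (act FX p L) qs"
  shows "comp FX (act FX p L) qs =
    act FX (comp FX p (map ((!) qs) L)) (block_perm (map (arity FX) qs) L)"
proof -
  let ?q = "act FX p L" and ?ks = "map opn qs" and ?rs = "map ((!) qs) L"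
  note a = FX_act_profile[OF p L]
  have ar: "map (arity FX) qs = ?ks" using FX_arity by simp
  have lq: "length qs = opn p" using composable_opn[OF c] a(2) FX_arity by simp
  have L': "L \<in> perms (opn p)" using L FX_arity by simp
  have lL: "length L = opn p" by (rule perms_length[OF L'])
  have qs: "\<And>i. i < length qs \<Longrightarrow> qs ! i \<in> Ops FX" "map (out FX) qs = inp FX ?q"
    using c by (auto simp: composable_def)
  have Lk: "L ! i < length qs" if "i < opn p" for i using perms_nth[OF L' that] lq by simp
  have "map (out FX) ?rs = inp FX p"
  proof (rule nth_equalityI)
    show "length (map (out FX) ?rs) = length (inp FX p)" using lL FX_arity by (simp add: arity_def)
    fix k assume "k < length (map (out FX) ?rs)"
    then have k: "k < opn p" using lL by simp
    have "out FX (qs ! (L ! k)) = map (out FX) qs ! (L ! k)" using Lk[OF k] by simp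
    also have "\<dots> = inp FX p ! k" unfolding qs(2) using a(3)[of k] k FX_arity by simp
    finally show "map (out FX) ?rs ! k = inp FX p ! k" using k lL by simp
  qed
  moreover have "set ?rs \<subseteq> Ops FX" using perms_set[OF L'] qs(1) lq by auto
  ultimately have cr: "composable FX p ?rs" using p by (simp add: composable_def)
  let ?\<delta> = "case_option ?q ((!) qs)" and ?\<delta>' = "case_option p ((!) qs)"
  have E: "EvX ?\<delta> (two_level None Some ?ks) (comp FX ?q qs)"
    using EvX_comp[OF c, of ?\<delta> None Some] by simp
  let ?s = "\<lambda>v n. case v of None \<Rightarrow> Vertex None (map Leaf L) | Some i \<Rightarrow> cor (Some i) n"
  have 1: "EvX ?\<delta>' (sub ?s (two_level None Some ?ks)) (comp FX ?q qs)"
  proof (rule EvX_sub[OF _ E])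
    fix v n assume "(v, n) \<in> set (vertices (two_level None Some ?ks))"
    then consider "v = None" | i where "v = Some i" "i < length qs" "n = opn (qs ! i)"
      by (auto simp: vertices_two_level)
    then show "EvX ?\<delta>' (?s v n) (?\<delta> v)"
    proof cases
      case 1
      then show ?thesis using EvX_act[of ?\<delta>' None L] p L' by simp
    next
      case (2 i)
      then show ?thesis using EvX_cor[of ?\<delta>' "Some i"] qs(1)[of i] by simp
    qed
  qed
  have t1: "sub ?s (two_level None Some ?ks) = Vertex None (map (\<lambda>j. Vertex (Some j)
      (map (\<lambda>a. Leaf (block_start ?ks j + a)) [0..<?ks ! j])) L)"
  proof -
    have "sub ?s (two_level None Some ?ks) =
        graft (\<lambda>i. lmap (\<lambda>a. block_start ?ks i + a) (cor (Some i) (?ks ! i))) (Vertex None (map Leaf L))"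
      using L' lq by (subst sub_two_level) (simp_all add: o_def concat_map_singleton)
    then show ?thesis by (simp add: lmap_cor o_def)
  qed
  let ?x = "comp FX p ?rs" and ?bp = "block_perm ?ks L"
  have rks: "map opn ?rs = map ((!) ?ks) L" using perms_set[OF L'] lq by simp
  note xp = FX_comp_profile[OF cr]
  have sum: "sum_list (map ((!) ?ks) L) = sum_list ?ks"
  proof -
    have "sum_list (map ((!) ?ks) L) = sum_list (map ((!) ?ks) [0..<length ?ks])"
      using L' lq unfolding perms_iff by (intro sum_list_mset_cong) simp
    then show ?thesis by (simp only: map_nth)
  qed
  have ox: "opn ?x = sum_list ?ks"
  proof -
    have "arity FX ?x = sum_list (map opn ?rs)"
      unfolding arity_def xp(2) length_concat by (simp add: o_def len_inp)
    then show ?thesis unfolding rks sum FX_arity .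
  qed
  have bp: "?bp \<in> perms (sum_list ?ks)" using L' lq by (intro block_perm_perms) simp
  have E2: "EvX (\<lambda>_. ?x) (Vertex () (map Leaf ?bp)) (act FX ?x ?bp)"
    by (rule EvX_act) (use xp bp ox in simp_all)
  let ?T = "two_level None (\<lambda>i. Some (L ! i)) (map ((!) ?ks) L)"
  have 2: "EvX ?\<delta>' (sub (\<lambda>_ _. ?T) (Vertex () (map Leaf ?bp))) (act FX ?x ?bp)"
  proof (rule EvX_sub[OF _ E2])
    show "EvX ?\<delta>' ?T ?x" for v :: unit and n :: nat
      using EvX_comp[OF cr, of ?\<delta>' None "\<lambda>i. Some (L ! i)"] unfolding rks by simp
  qed
  have lb: "length ?bp = sum_list ?ks" by (rule perms_length[OF bp])
  have t2: "sub (\<lambda>_ _. ?T) (Vertex () (map Leaf ?bp)) = lmap ((!) ?bp) ?T"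
    by (subst sub_leaf_vertex) (simp_all add: leaves_two_level lb sum)
  have t: "sub ?s (two_level None Some ?ks) = sub (\<lambda>_ _. ?T) (Vertex () (map Leaf ?bp))"
  proof -
    have e: "map (\<lambda>a. Leaf (block_start ?ks (L ! i) + a)) [0..<?ks ! (L ! i)] =
        map (\<lambda>l. Leaf (?bp ! l)) [block_start (map ((!) ?ks) L) i..<block_start (map ((!) ?ks) L) i + map ((!) ?ks) L ! i]"
      if i: "i < length L" for i
      using block_perm_nth[OF i, of _ ?ks] i by (intro nth_equalityI) simp_all
    have "map (\<lambda>j. Vertex (Some j) (map (\<lambda>a. Leaf (block_start ?ks j + a)) [0..<?ks ! j])) L =
        map (\<lambda>i. Vertex (Some (L ! i)) (map (\<lambda>l. Leaf (?bp ! l))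
          [block_start (map ((!) ?ks) L) i..<block_start (map ((!) ?ks) L) i + map ((!) ?ks) L ! i])) [0..<length L]"
      (is "?A = ?B")
    proof (rule nth_equalityI)
      fix i assume "i < length ?A"
      then have i: "i < length L" by simp
      have "?A ! i = Vertex (Some (L ! i)) (map (\<lambda>a. Leaf (block_start ?ks (L ! i) + a)) [0..<?ks ! (L ! i)])"
        using i by simp
      also have "\<dots> = ?B ! i" unfolding e[OF i] using i by simp
      finally show "?A ! i = ?B ! i" .
    qed simp
    then show ?thesis unfolding t1 t2 lmap_two_level by simp
  qed
  show ?thesis unfolding ar by (rule EvX_eqI[OF 1 2 t]) (simp add: t1)
qed

text \<open>The left side puts the two-level tree of \<open>p\<close> and \<open>qs\<close> at the
  root of one with branches \<open>concat rss\<close>; the right side puts two-level trees at the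
  branches of one with root \<open>p\<close>. Both substitutions yield \<open>?T3\<close>.\<close>

lemma FX_comp_assoc:
  assumes c: "composable FX p qs" and cs: "list_all2 (composable FX) qs rss"
  shows "comp FX (comp FX p qs) (concat rss) = comp FX p (map2 (comp FX) qs rss)"
proof -
  have len: "length rss = length qs" and ci: "\<And>i. i < length qs \<Longrightarrow> composable FX (qs ! i) (rss ! i)"
    using cs by (auto simp: list_all2_conv_all_nth)
  have p: "p \<in> Ops FX" "\<And>i. i < length qs \<Longrightarrow> qs ! i \<in> Ops FX" "inp FX p = map (out FX) qs"
    using c by (auto simp: composable_def)
  have r: "rss ! i ! j \<in> Ops FX" if "i < length qs" "j < length (rss ! i)" for i j
    using ci[OF that(1)] that(2) by (auto simp: composable_def)
  have lr: "length (rss ! i) = opn (qs ! i)" if "i < length qs" for i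
    using composable_opn[OF ci[OF that]] .
  have lens: "map length rss = map opn qs" using lr len by (intro nth_equalityI) simp_all
  note cp = FX_comp_profile[OF ci]
  let ?m = "length qs" and ?x = "comp FX p qs" and ?ys = "map2 (comp FX) qs rss"
  have oc: "opn (comp FX p' qs') = sum_list (map opn qs')" if "composable FX p' qs'" for p' qs'
  proof -
    have "arity FX (comp FX p' qs') = sum_list (map opn qs')"
      unfolding arity_def FX_comp_profile(2)[OF that] length_concat
      by (simp add: o_def len_inp)
    then show ?thesis by (simp add: FX_arity)
  qed
  \<comment> \<open>Vertices of the three-level tree: \<open>None\<close> is \<open>p\<close>, \<open>Some (i, None)\<close> is \<open>qs ! i\<close> and
    \<open>Some (i, Some j)\<close> is \<open>rss ! i ! j\<close>.\<close>
  let ?\<delta> = "\<lambda>v. case v of None \<Rightarrow> p | Some (i, w) \<Rightarrow> case w of None \<Rightarrow> qs ! i | Some j \<Rightarrow> rss ! i ! j"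
  let ?kss = "map (map opn) rss"
  let ?ks = "map sum_list ?kss"
  let ?T3 = "Vertex None (map (\<lambda>i. Vertex (Some (i, None)) (map (\<lambda>j. Vertex (Some (i, Some j))
    (map (\<lambda>a. Leaf (block_start ?ks i + block_start (?kss ! i) j + a)) [0..<?kss ! i ! j]))
      [0..<length (rss ! i)])) [0..<?m])"
  have cy: "composable FX p ?ys"
  proof -
    have "map (out FX) ?ys = map (out FX) qs" using cp(3) len by (intro nth_equalityI) simp_all
    moreover have "q \<in> Ops FX" if "q \<in> set ?ys" for q
    proof -
      from that obtain i where "i < length ?ys" "q = ?ys ! i" by (metis in_set_conv_nth)
      then show ?thesis using cp(1) len by simp
    qed
    ultimately show ?thesis using p by (auto simp: composable_def)
  qed
  have oy: "map opn ?ys = ?ks" using oc[OF ci] len by (intro nth_equalityI) simp_all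
  let ?\<epsilon> = "case_option p ((!) ?ys)"
  let ?s = "\<lambda>v n. case v of None \<Rightarrow> cor None n
    | Some i \<Rightarrow> two_level (Some (i, None)) (\<lambda>j. Some (i, Some j)) (?kss ! i)"
  have E1: "EvX ?\<epsilon> (two_level None Some ?ks) (comp FX p ?ys)"
    using EvX_comp[OF cy, of ?\<epsilon> None Some] unfolding oy by simp
  have 1: "EvX ?\<delta> (sub ?s (two_level None Some ?ks)) (comp FX p ?ys)"
  proof (rule EvX_sub[OF _ E1])
    fix v n assume "(v, n) \<in> set (vertices (two_level None Some ?ks))"
    then consider "v = None" "n = opn p" | i where "v = Some i" "i < ?m"
      using len composable_opn[OF c] by (auto simp: vertices_two_level)
    then show "EvX ?\<delta> (?s v n) (?\<epsilon> v)"
    proof cases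
      case 1
      then show ?thesis using EvX_cor[of ?\<delta> None] p(1) by simp
    next
      case (2 i)
      then show ?thesis
        using EvX_comp[OF ci[OF 2(2)], of ?\<delta> "Some (i, None)" "\<lambda>j. Some (i, Some j)"] len by simp
    qed
  qed
  have sh: "map (\<lambda>l. Leaf (m + l)) [b..<b + n] = map (\<lambda>a. Leaf (m + b + a)) [0..<n]" for m b n :: nat
    by (intro nth_equalityI) simp_all
  have t1: "sub ?s (two_level None Some ?ks) = ?T3"
  proof -
    have "sub ?s (two_level None Some ?ks) = graft (\<lambda>i. lmap (\<lambda>a. block_start ?ks i + a)
        (two_level (Some (i, None)) (\<lambda>j. Some (i, Some j)) (?kss ! i))) (cor None ?m)"
      using len by (subst sub_two_level) (simp_all add: leaves_two_level)
    also have "\<dots> = ?T3"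
      unfolding graft_cor lmap_two_level sh tree.inject
    proof (intro conjI refl map_cong)
      fix i assume "i \<in> set [0..<?m]"
      then have "length (?kss ! i) = length (rss ! i)" using len by simp
      then show "Vertex (Some (i, None)) (map (\<lambda>ia. Vertex (Some (i, Some ia))
          (map (\<lambda>a. Leaf (block_start ?ks i + block_start (?kss ! i) ia + a)) [0..<?kss ! i ! ia]))
            [0..<length (?kss ! i)]) =
        Vertex (Some (i, None)) (map (\<lambda>j. Vertex (Some (i, Some j))
          (map (\<lambda>a. Leaf (block_start ?ks i + block_start (?kss ! i) j + a)) [0..<?kss ! i ! j]))
            [0..<length (rss ! i)])" by simp
    qed
    finally show ?thesis .
  qed
  note xp = FX_comp_profile[OF c]
  have cx: "composable FX ?x (concat rss)"
  proof -
    have "concat (map (map (out FX)) rss) = concat (map (inp FX) qs)"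
      using ci len by (intro arg_cong[where f = concat] nth_equalityI) (simp_all add: composable_def)
    moreover have "set (concat rss) \<subseteq> Ops FX"
      using r len by (auto simp: in_set_conv_nth)
    ultimately show ?thesis using xp by (simp add: composable_def map_concat)
  qed
  \<comment> \<open>The inverse of the block enumeration: a position in \<open>concat rss\<close> is
    turned back into its block and the index inside it.\<close>
  let ?loc = "\<lambda>l. SOME ij. fst ij < ?m \<and> snd ij < length (rss ! fst ij) \<and>
    l = block_start (map length rss) (fst ij) + snd ij"
  let ?\<epsilon>' = "case_option ?x ((!) (concat rss))"
  let ?lab = "\<lambda>l. Some (fst (?loc l), Some (snd (?loc l)))"
  have loc: "concat rss ! l = rss ! fst (?loc l) ! snd (?loc l)" "fst (?loc l) < ?m"
    "snd (?loc l) < length (rss ! fst (?loc l))" "l = block_start (map length rss) (fst (?loc l)) + snd (?loc l)"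
    if l: "l < length (concat rss)" for l
  proof -
    obtain i j where "i < length rss" "j < length (rss ! i)" "l = block_start (map length rss) i + j"
      using concat_index[OF l] .
    then have ex: "\<exists>ij. fst ij < ?m \<and> snd ij < length (rss ! fst ij) \<and>
        l = block_start (map length rss) (fst ij) + snd ij"
      using len by (intro exI[of _ "(i, j)"]) simp
    note sm = someI_ex[OF ex]
    then show "fst (?loc l) < ?m" "snd (?loc l) < length (rss ! fst (?loc l))"
      "l = block_start (map length rss) (fst (?loc l)) + snd (?loc l)" by blast+
    then show "concat rss ! l = rss ! fst (?loc l) ! snd (?loc l)"
      using concat_nth_block[of "fst (?loc l)" rss "snd (?loc l)"] len by simp
  qed
  have loc_eq: "?loc (block_start (map length rss) i + j) = (i, j)" if i: "i < ?m" and j: "j < length (rss ! i)" for i j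
  proof -
    let ?l = "block_start (map length rss) i + j"
    have "?l < length (concat rss)" using concat_nth_block[of i rss j] i j len by simp
    note L = loc[OF this]
    \<comment> \<open>Blocks are disjoint: compare positions in the concatenation of the index pairs.\<close>
    let ?P = "map (\<lambda>i. map (Pair i) [0..<length (rss ! i)]) [0..<length rss]"
    have lP: "map length ?P = map length rss" by (intro nth_equalityI) simp_all
    have blk: "concat ?P ! (block_start (map length rss) a + b) = (a, b)" if "a < ?m" "b < length (rss ! a)" for a b
      using concat_nth_block[of a ?P b] that len unfolding lP by simp
    have "(i, j) = concat ?P ! ?l" using blk[OF i j] by (rule sym)
    also have "\<dots> = (fst (?loc ?l), snd (?loc ?l))"
      using blk[OF L(2,3)] unfolding L(4)[symmetric] .
    finally show ?thesis unfolding prod.collapse by (rule sym)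
  qed
  have E2: "EvX ?\<epsilon>' (two_level None Some (map opn (concat rss))) (comp FX ?x (concat rss))"
    using EvX_comp[OF cx, of ?\<epsilon>' None Some] by simp
  let ?s' = "\<lambda>v n. case v of None \<Rightarrow> two_level None (\<lambda>i. Some (i, None)) (map opn qs) | Some l \<Rightarrow> cor (?lab l) n"
  have 2: "EvX ?\<delta> (sub ?s' (two_level None Some (map opn (concat rss)))) (comp FX ?x (concat rss))"
  proof (rule EvX_sub[OF _ E2])
    fix v n assume "(v, n) \<in> set (vertices (two_level None Some (map opn (concat rss))))"
    then consider "v = None" | l where "v = Some l" "l < length (concat rss)" "n = opn (concat rss ! l)"
      by (auto simp: vertices_two_level)
    then show "EvX ?\<delta> (?s' v n) (?\<epsilon>' v)"
    proof cases
      case 1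
      then show ?thesis using EvX_comp[OF c, of ?\<delta> None "\<lambda>i. Some (i, None)"] by simp
    next
      case (2 l)
      then show ?thesis using EvX_cor[of ?\<delta> "?lab l" n] loc[OF 2(2)] r[of "fst (?loc l)" "snd (?loc l)"] by simp
    qed
  qed
  have lc: "length (concat rss) = sum_list (map opn qs)" unfolding length_concat lens ..
  have t2: "sub ?s' (two_level None Some (map opn (concat rss))) = ?T3"
  proof -
    let ?N = "map opn (concat rss)"
    have "sub ?s' (two_level None Some ?N) = graft (\<lambda>l. lmap (\<lambda>a. block_start ?N l + a) (cor (?lab l) (?N ! l)))
        (two_level None (\<lambda>i. Some (i, None)) (map opn qs))"
      using lc by (subst sub_two_level) (simp_all add: leaves_two_level)
    also have "\<dots> = Vertex None (map (\<lambda>i. Vertex (Some (i, None)) (map (\<lambda>l. lmap (\<lambda>a. block_start ?N l + a)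
        (cor (?lab l) (?N ! l))) [block_start (map opn qs) i..<block_start (map opn qs) i + opn (qs ! i)])) [0..<?m])"
      by (simp add: two_level_def o_def)
    also have "\<dots> = ?T3"
      unfolding tree.inject
    proof (intro conjI refl map_cong)
      fix i assume "i \<in> set [0..<?m]"
      then have i: "i < ?m" by simp
      have shift: "[block_start (map opn qs) i..<block_start (map opn qs) i + opn (qs ! i)] =
          map (\<lambda>j. block_start (map length rss) i + j) [0..<length (rss ! i)]"
        unfolding lens lr[OF i] upt_shift ..
      have "lmap (\<lambda>a. block_start ?N l + a) (cor (?lab l) (?N ! l)) = Vertex (Some (i, Some j))
          (map (\<lambda>a. Leaf (block_start ?ks i + block_start (?kss ! i) j + a)) [0..<?kss ! i ! j])"
        if j: "j < length (rss ! i)" and l: "l = block_start (map length rss) i + j" for j l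
      proof -
        have N: "?N = concat ?kss" by (simp add: map_concat)
        have ml: "map length ?kss = map length rss" by (intro nth_equalityI) simp_all
        have b: "block_start ?N l = block_start ?ks i + block_start (?kss ! i) j"
          unfolding N l ml[symmetric] by (rule block_start_concat) (use i j len in simp_all)
        have n: "?N ! l = ?kss ! i ! j"
          using concat_nth_block[of i ?kss j] i j len unfolding N l ml by simp
        show ?thesis unfolding lmap_cor b n using loc_eq[OF i j] l by simp
      qed
      then have "map (\<lambda>l. lmap (\<lambda>a. block_start ?N l + a) (cor (?lab l) (?N ! l)))
          [block_start (map opn qs) i..<block_start (map opn qs) i + opn (qs ! i)] =
        map (\<lambda>j. Vertex (Some (i, Some j)) (map (\<lambda>a. Leaf (block_start ?ks i + block_start (?kss ! i) j + a))
          [0..<?kss ! i ! j])) [0..<length (rss ! i)]"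
        unfolding shift by (intro nth_equalityI) simp_all
      then show "Vertex (Some (i, None)) (map (\<lambda>l. lmap (\<lambda>a. block_start ?N l + a) (cor (?lab l) (?N ! l)))
          [block_start (map opn qs) i..<block_start (map opn qs) i + opn (qs ! i)]) =
        Vertex (Some (i, None)) (map (\<lambda>j. Vertex (Some (i, Some j))
          (map (\<lambda>a. Leaf (block_start ?ks i + block_start (?kss ! i) j + a)) [0..<?kss ! i ! j]))
            [0..<length (rss ! i)])" by (rule arg_cong)
    qed
    finally show ?thesis .
  qed
  show ?thesis by (rule EvX_eqI[OF 2 1 trans[OF t2 t1[symmetric]]]) (unfold t2, rule tree.distinct(2))
qed

theorem FX_operad: "coloured_operad FX"
proof
  fix p assume p: "p \<in> Ops FX"
  show "set (inp FX p) \<subseteq> Col FX" by (rule FX_inp_Col[OF p])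
  show "out FX p \<in> Col FX" by (rule FX.typed_out[OF p])
  show "comp FX (ident FX (out FX p)) [p] = p" by (rule FX_comp_ident_left[OF p])
  show "comp FX p (map (ident FX) (inp FX p)) = p" by (rule FX_comp_ident_right[OF p])
  show "act FX p [0..<arity FX p] = p" by (rule FX_act_id[OF p])
next
  fix c assume "c \<in> Col FX"
  then have c: "c \<in> fob X (Leaf 0)" by simp
  show "ident FX c \<in> Ops FX" "inp FX (ident FX c) = [c]" "out FX (ident FX c) = c"
    using tot_Leaf[OF c] by simp_all
qed (rule FX_comp_profile FX_act_profile FX_comp_assoc FX_act_act FX_comp_act_inner FX_comp_act_outer; assumption)+

end

text \<open>Changes operations and colours at once. It is used to read a typing over the operad of a
  nerve as a typing over the original operad.\<close>

lemma wt_transfer: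
  assumes \<delta>: "\<And>v. v \<in> set (vlabels T) \<Longrightarrow> \<delta> v \<in> Ops Q \<Longrightarrow> \<delta>' v \<in> Ops P \<and>
      inp P (\<delta>' v) = map \<kappa> (inp Q (\<delta> v)) \<and> out P (\<delta>' v) = \<kappa> (out Q (\<delta> v))"
    and \<kappa>: "\<And>c. c \<in> Col Q \<Longrightarrow> \<kappa> c \<in> Col P"
  shows "wt Q \<delta> \<gamma> T \<Longrightarrow> wt P \<delta>' (\<lambda>l. \<kappa> (\<gamma> l)) T \<and> rc P \<delta>' (\<lambda>l. \<kappa> (\<gamma> l)) T = \<kappa> (rc Q \<delta> \<gamma> T)"
  using \<delta>
proof (induction T)
  case (Leaf l)
  then show ?case using \<kappa> by simp
next
  case (Vertex v ts)
  have v: "\<delta> v \<in> Ops Q" "inp Q (\<delta> v) = map (rc Q \<delta> \<gamma>) ts" "\<And>t. t \<in> set ts \<Longrightarrow> wt Q \<delta> \<gamma> t"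
    using Vertex.prems(1) unfolding wt_Vertex by blast+
  have IH: "wt P \<delta>' (\<lambda>l. \<kappa> (\<gamma> l)) t \<and> rc P \<delta>' (\<lambda>l. \<kappa> (\<gamma> l)) t = \<kappa> (rc Q \<delta> \<gamma> t)" if t: "t \<in> set ts" for t
    by (rule Vertex.IH[OF t v(3)[OF t]]) (rule Vertex.prems(2)[OF vlabels_child[OF t]])
  note d = Vertex.prems(2)[OF _ v(1)]
  have "map (rc P \<delta>' (\<lambda>l. \<kappa> (\<gamma> l))) ts = map \<kappa> (map (rc Q \<delta> \<gamma>) ts)" using IH by simp
  then show ?case using d v(2) IH unfolding wt_Vertex by simp
qed

section \<open>The nerve satisfies the Segal condition\<close>

context coding
begin

lemma nerve_ob_cor:
  assumes P: "coloured_operad P"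
  shows "d \<in> nerve_ob P (cor 0 n) \<longleftrightarrow> (\<exists>q \<in> Ops P. arity P q = n \<and> d = enc [q, q])"
proof
  interpret coloured_operad P by (rule P)
  assume "d \<in> nerve_ob P (cor 0 n)"
  then obtain x \<delta> where d: "d = enc (x # \<delta>)" "elem (cor 0 n) \<delta> x" by (rule nerve_obE)
  have e: "length \<delta> = 1" "x = \<delta> ! 0" "x \<in> Ops P" "arity P x = n"
    using d(2) unfolding elem_def Ev_cor vertices_cor by auto
  have "\<delta> = [x]" using e(1) unfolding e(2) by (intro nth_equalityI) simp_all
  then show "\<exists>q \<in> Ops P. arity P q = n \<and> d = enc [q, q]" using d(1) e(3,4) by blast
next
  assume "\<exists>q \<in> Ops P. arity P q = n \<and> d = enc [q, q]"
  then show "d \<in> nerve_ob P (cor 0 n)" using elem_cor[OF P] nerve_obI by blast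
qed

text \<open>An element over the tree without vertices is the identity of a colour. In the
  restriction this identity decorates the unary vertex inserted on the edge, and typing of the
  marked corolla determines its colour.\<close>

lemma nerve_edge:
  assumes P: "coloured_operad P" and q: "q \<in> Ops P" and n: "arity P q = n"
  shows "fmor (nerve P) (cor 0 n) (Leaf 0) (edge (cor 0 n) (cor 0 n)) (enc [q, q]) = enc [ident P (out P q)]"
    and "k < n \<Longrightarrow>
      fmor (nerve P) (cor 0 n) (Leaf 0) (edge (cor 0 n) (Leaf k)) (enc [q, q]) = enc [ident P (inp P q ! k)]"
proof -
  interpret coloured_operad P by (rule P)
  have C: "cor 0 n \<in> Ops sOp" by simp
  have e: "elem (cor 0 n) [q] q" using elem_cor[OF P q] n by simp
  have main: "\<exists>c \<in> Col P. fmor (nerve P) (cor 0 n) (Leaf 0) (edge (cor 0 n) S) (enc [q, q]) = enc [ident P c] \<and>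
      Ev (case_option (ident P c) ((!) [q])) (mark S (cor 0 n)) q" if S: "S \<in> subtrees (cor 0 n)" for S
  proof -
    note h = edge_hom[OF C S]
    obtain ys z where r: "restr (edge (cor 0 n) S) (Leaf 0) [q] q ys z"
      by (rule restr_exists[OF h C e])
    then have "ys = []" and "Ev ((!) ys) (Leaf 0) z"
      and E: "Ev (case_option z ((!) [q])) (mark S (cor 0 n)) q"
      unfolding restr_def elem_def lowL_edge[OF C S] by auto
    then obtain c where "c \<in> Col P" "z = ident P c" unfolding Ev_Leaf by blast
    then show ?thesis using fmor_nerve[OF P h C e r] \<open>ys = []\<close> E by blast
  qed
  obtain c where c: "c \<in> Col P"
    "fmor (nerve P) (cor 0 n) (Leaf 0) (edge (cor 0 n) (cor 0 n)) (enc [q, q]) = enc [ident P c]"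
    "Ev (case_option (ident P c) ((!) [q])) (mark (cor 0 n) (cor 0 n)) q"
    using main[of "cor 0 n"] by auto
  from Ev_Wt[OF c(3)] have "inp P (ident P c) = [out P q]"
    unfolding mark_cor_root Wt_def wt_Vertex by (simp add: cor_def)
  then show "fmor (nerve P) (cor 0 n) (Leaf 0) (edge (cor 0 n) (cor 0 n)) (enc [q, q]) = enc [ident P (out P q)]"
    using c ident_inp by simp
  assume k: "k < n"
  then obtain c where c: "c \<in> Col P"
    "fmor (nerve P) (cor 0 n) (Leaf 0) (edge (cor 0 n) (Leaf k)) (enc [q, q]) = enc [ident P c]"
    "Ev (case_option (ident P c) ((!) [q])) (mark (Leaf k) (cor 0 n)) q"
    using main[of "Leaf k"] unfolding subtrees_cor by auto
  let ?d = "case_option (ident P c) ((!) [q])"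
  from Ev_Wt[OF c(3)] have "inp P q = map (rc P ?d ((!) (inp P q)))
      (map (\<lambda>l. if l = k then Vertex None [Leaf l] else Leaf l) [0..<n])"
    unfolding mark_cor_Leaf Wt_def wt_Vertex by simp
  from arg_cong[OF this, of "\<lambda>xs. xs ! k"] have "inp P q ! k = out P (ident P c)" using k by simp
  then show "fmor (nerve P) (cor 0 n) (Leaf 0) (edge (cor 0 n) (Leaf k)) (enc [q, q]) = enc [ident P (inp P q ! k)]"
    using c ident_out by simp
qed

text \<open>A typing over the operad of the nerve becomes a typing over \<open>P\<close> when coded
  colours are decoded, and then it has a value. Decoration and value form the element; the value is
  unique because \<open>T\<close> has a vertex.\<close>

theorem nerve_segal:
  assumes P: "coloured_operad P" shows "is_segal sOp sOp_grading (nerve P)"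
proof -
  interpret coloured_operad P by (rule P)
  interpret N: presheaf_coding enc "nerve P" by unfold_locales (rule nerve_functor[OF P])
  \<comment> \<open>A colour of the operad of the nerve is the code of an identity, and its output
    is the original colour.\<close>
  define \<kappa> where "\<kappa> d = out P (hd (dec d))" for d
  have \<kappa>: "\<kappa> (enc [ident P c]) = c" if "c \<in> Col P" for c using ident_out[OF that] by (simp add: \<kappa>_def)
  have FX_inp: "map \<kappa> (inp N.FX (N.code n (enc [q, q]))) = inp P q"
    and FX_out: "\<kappa> (out N.FX (N.code n (enc [q, q]))) = out P q"
    if q: "q \<in> Ops P" "arity P q = n" for q n
  proof -
    have c: "inp P q ! k \<in> Col P" if "k < n" for k
      using inp_Col[OF q(1)] that q(2) nth_mem unfolding arity_def by blast
    then show "map \<kappa> (inp N.FX (N.code n (enc [q, q]))) = inp P q"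
      unfolding N.FX_inp N.ed_def using nerve_edge(2)[OF P q] \<kappa> q(2)
      by (intro nth_equalityI) (simp_all add: arity_def)
    show "\<kappa> (out N.FX (N.code n (enc [q, q]))) = out P q"
      unfolding N.FX_out N.ed_def nerve_edge(1)[OF P q] using \<kappa> out_Col[OF q(1)] by simp
  qed
  have "N.glues T" if T: "T \<in> Ops sOp" and ne: "T \<noteq> Leaf 0" for T
    unfolding N.glues_def
  proof (intro allI impI)
    fix y \<gamma>
    let ?m = "length (vertices T)"
    assume y: "\<forall>i < ?m. y i \<in> fob (nerve P) (cor 0 (inp sOp T ! i))"
      and w: "wt N.FX (\<lambda>i. N.code (inp sOp T ! i) (y i)) \<gamma> T"
    define q where "q i = hd (dec (y i))" for i
    have q: "q i \<in> Ops P" "arity P (q i) = inp sOp T ! i" "y i = enc [q i, q i]" if "i < ?m" for i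
      using y[rule_format, OF that] unfolding fob_nerve nerve_ob_cor[OF P] q_def by auto
    have lt: "i < ?m" if "i \<in> set (vlabels T)" for i
      using that perms_set[OF sOp_Ops_vlabels[OF T]] by simp
    have no_Leaf: "T \<noteq> Leaf l" for l using sOp_Ops_no_vertices[OF T] ne by auto
    have "wt P q (\<lambda>l. \<kappa> (\<gamma> l)) T \<and> rc P q (\<lambda>l. \<kappa> (\<gamma> l)) T =
        \<kappa> (rc N.FX (\<lambda>i. N.code (inp sOp T ! i) (y i)) \<gamma> T)"
    proof (rule wt_transfer[OF _ _ w])
      fix i assume "i \<in> set (vlabels T)"
      note i = lt[OF this]
      show "q i \<in> Ops P \<and> inp P (q i) = map \<kappa> (inp N.FX (N.code (inp sOp T ! i) (y i))) \<and>
          out P (q i) = \<kappa> (out N.FX (N.code (inp sOp T ! i) (y i)))"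
        unfolding q(3)[OF i] using FX_inp[OF q(1,2)[OF i]] FX_out[OF q(1,2)[OF i]] q(1)[OF i] by simp
    next
      fix c assume "c \<in> Col N.FX"
      then have "c \<in> nerve_ob P (Leaf 0)" by simp
      then obtain x \<delta> where "c = enc (x # \<delta>)" "elem (Leaf 0) \<delta> x" by (rule nerve_obE)
      then show "\<kappa> c \<in> Col P" using \<kappa> unfolding elem_def Ev_Leaf by (auto simp: \<kappa>_def ident_out)
    qed
    then have "wt P q (\<lambda>l. \<kappa> (\<gamma> l)) T" by blast
    from Ev_of_wt(1)[OF this sOp_Ops_leaves[OF T]] obtain x where x: "Ev q T x" by blast
    let ?\<delta> = "map q [0..<?m]"
    have e: "elem T ?\<delta> x" unfolding elem_def
    proof
      show "Ev ((!) ?\<delta>) T x" using x by (rule Ev_cong[THEN iffD1, rotated]) (use lt in simp)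
    qed simp
    show "\<exists>!\<xi>. \<xi> \<in> fob (nerve P) T \<and> (\<forall>i < ?m. N.vt T \<xi> i = y i)"
    proof (rule ex1I[of _ "enc (x # ?\<delta>)"])
      show "enc (x # ?\<delta>) \<in> fob (nerve P) T \<and> (\<forall>i < ?m. N.vt T (enc (x # ?\<delta>)) i = y i)"
        using nerve_obI[OF e] fmor_vtx[OF P T e] q(3) by (simp add: N.vt_def)
    next
      fix \<xi>' assume \<xi>': "\<xi>' \<in> fob (nerve P) T \<and> (\<forall>i < ?m. N.vt T \<xi>' i = y i)"
      then obtain x' \<delta>' where d: "\<xi>' = enc (x' # \<delta>')" "elem T \<delta>' x'" using nerve_obE by (metis fob_nerve)
      have "\<delta>' ! i = q i" if "i < ?m" for i
        using \<xi>' fmor_vtx[OF P T d(2) that] q(3)[OF that] that d(1) by (simp add: N.vt_def)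
      then have "\<delta>' = ?\<delta>" using d(2) unfolding elem_def by (intro nth_equalityI) simp_all
      moreover have "x' = x"
        using Ev_unique[OF _ _ no_Leaf] d(2) e unfolding elem_def \<open>\<delta>' = ?\<delta>\<close> by blast
      ultimately show "\<xi>' = enc (x # ?\<delta>)" using d(1) by simp
    qed
  qed
  then show ?thesis unfolding N.segal_iff by blast
qed

end

section \<open>A Segal presheaf is the nerve of its operad\<close>

context segal_coding
begin

sublocale F: coloured_operad FX by (rule FX_operad)

text \<open>The operadic composite keeps planar order, so it is the value of \<open>T\<close> with
  its leaves renumbered from left to right; the original numbers are restored by the action in
  \<open>EvX_of_wt\<close>.\<close>

lemma EvX_eval: "wt FX \<delta> \<gamma> T \<Longrightarrow> \<exists>T1. leaves T1 = [0..<length (leaves T)] \<and>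
    lmap ((!) (leaves T)) T1 = T \<and> EvX \<delta> T1 (eval FX \<delta> \<gamma> T)"
proof (induction T)
  case (Leaf l)
  then show ?case using EvX_ident[of "\<gamma> l" \<delta>] by (intro exI[of _ "Leaf 0"]) simp
next
  case (Vertex v ts)
  let ?n = "length ts" and ?qs = "map (eval FX \<delta> \<gamma>) ts" and ?L = "leaves (Vertex v ts)"
  let ?ks = "map length (map leaves ts)"
  have w: "wt FX \<delta> \<gamma> t" if "t \<in> set ts" for t using Vertex.prems that unfolding wt_Vertex by blast
  have "\<exists>U. \<forall>i < ?n. leaves (U i) = [0..<length (leaves (ts ! i))] \<and>
      lmap ((!) (leaves (ts ! i))) (U i) = ts ! i \<and> EvX \<delta> (U i) (eval FX \<delta> \<gamma> (ts ! i))"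
    using Vertex.IH w nth_mem by (intro choice) blast
  then obtain U where U: "\<And>i. i < ?n \<Longrightarrow> leaves (U i) = [0..<length (leaves (ts ! i))]"
    "\<And>i. i < ?n \<Longrightarrow> lmap ((!) (leaves (ts ! i))) (U i) = ts ! i"
    "\<And>i. i < ?n \<Longrightarrow> EvX \<delta> (U i) (eval FX \<delta> \<gamma> (ts ! i))" by blast
  have c: "composable FX (\<delta> v) ?qs" by (rule F.eval_composable[OF Vertex.prems])
  have ks: "map opn ?qs = ?ks"
  proof (rule nth_equalityI)
    fix i assume "i < length (map opn ?qs)"
    then have "ts ! i \<in> set ts" and i: "i < ?n" by simp_all
    then show "map opn ?qs ! i = ?ks ! i"
      using F.eval_props(2)[OF w] len_inp[of "eval FX \<delta> \<gamma> (ts ! i)"] by simp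
  qed simp
  let ?\<epsilon> = "case_option (\<delta> v) ((!) ?qs)"
  let ?s = "\<lambda>w n. case w of None \<Rightarrow> cor v n | Some i \<Rightarrow> U i"
  have E: "EvX ?\<epsilon> (two_level None Some ?ks) (comp FX (\<delta> v) ?qs)"
    using EvX_comp[OF c, of ?\<epsilon> None Some] unfolding ks by simp
  have v: "\<delta> v \<in> Ops FX" "opn (\<delta> v) = ?n"
    using Vertex.prems composable_opn[OF c] unfolding wt_Vertex by simp_all
  define T1 where "T1 = Vertex v (map (\<lambda>i. lmap (\<lambda>a. block_start ?ks i + a) (U i)) [0..<?n])"
  have "EvX \<delta> (sub ?s (two_level None Some ?ks)) (comp FX (\<delta> v) ?qs)"
  proof (rule EvX_sub[OF _ E])
    fix w n assume "(w, n) \<in> set (vertices (two_level None Some ?ks))"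
    then consider "w = None" "n = ?n" | i where "w = Some i" "i < ?n"
      by (auto simp: vertices_two_level)
    then show "EvX \<delta> (?s w n) (?\<epsilon> w)"
      using EvX_cor[of \<delta> v, OF v] U(3) by cases simp_all
  qed
  moreover have "sub ?s (two_level None Some ?ks) = T1"
    unfolding T1_def using U(1) by (subst sub_two_level) (simp_all add: graft_cor)
  ultimately have E1: "EvX \<delta> T1 (eval FX \<delta> \<gamma> (Vertex v ts))" by simp
  have "leaves T1 = leaves (two_level () (\<lambda>_. ()) ?ks)"
  proof -
    have "map leaves (map (\<lambda>i. lmap (\<lambda>a. block_start ?ks i + a) (U i)) [0..<?n]) =
      map leaves (map (\<lambda>i. Vertex () (map Leaf [block_start ?ks i..<block_start ?ks i + ?ks ! i])) [0..<length ?ks])"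
    proof (rule nth_equalityI)
      fix i assume "i < length (map leaves (map (\<lambda>i. lmap (\<lambda>a. block_start ?ks i + a) (U i)) [0..<?n]))"
      then have i: "i < ?n" by simp
      have "leaves (lmap (\<lambda>a. block_start ?ks i + a) (U i)) = map (\<lambda>a. block_start ?ks i + a) [0..<?ks ! i]"
        using U(1)[OF i] i by (simp add: leaves_map_tree)
      also have "\<dots> = [block_start ?ks i..<block_start ?ks i + ?ks ! i]" unfolding upt_shift ..
      also have "\<dots> = leaves (Vertex () (map Leaf [block_start ?ks i..<block_start ?ks i + ?ks ! i]))"
        by (simp add: o_def concat_map_singleton)
      finally show "map leaves (map (\<lambda>i. lmap (\<lambda>a. block_start ?ks i + a) (U i)) [0..<?n]) ! i =
        map leaves (map (\<lambda>i. Vertex () (map Leaf [block_start ?ks i..<block_start ?ks i + ?ks ! i])) [0..<length ?ks]) ! i"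
        using i by simp
    qed simp
    then show ?thesis unfolding T1_def two_level_def leaves.simps(2) by (rule arg_cong[where f = concat])
  qed
  then have l1: "leaves T1 = [0..<length ?L]" by (simp add: leaves_two_level length_concat)
  have "lmap ((!) ?L) T1 = Vertex v (map (\<lambda>i. ts ! i) [0..<?n])"
  proof -
    have "lmap ((!) ?L) (lmap (\<lambda>a. block_start ?ks i + a) (U i)) = ts ! i" if i: "i < ?n" for i
    proof -
      have "lmap ((!) ?L) (lmap (\<lambda>a. block_start ?ks i + a) (U i)) = lmap ((!) (leaves (ts ! i))) (U i)"
        unfolding tree.map_comp using concat_nth_block[of i "map leaves ts"] i U(1)[OF i]
        by (intro tree.map_cong0) (simp_all add: set2_tree)
      then show ?thesis using U(2)[OF i] by simp
    qed
    then show ?thesis unfolding T1_def by simp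
  qed
  then have "lmap ((!) ?L) T1 = Vertex v ts" by (simp only: map_nth)
  with l1 E1 show ?case by blast
qed

lemma EvX_of_wt:
  assumes w: "wt FX \<delta> \<gamma> T" and L: "leaves T \<in> perms n"
  shows "EvX \<delta> T (act FX (eval FX \<delta> \<gamma> T) (leaves T))"
proof -
  let ?e = "eval FX \<delta> \<gamma> T" and ?L = "leaves T"
  note e = F.eval_props[OF w]
  have n: "n = length ?L" using perms_length[OF L] by simp
  have o: "opn ?e = length ?L" using e(2) len_inp[of ?e] by simp
  obtain T1 where T1: "leaves T1 = [0..<length ?L]" "lmap ((!) ?L) T1 = T" "EvX \<delta> T1 ?e"
    using EvX_eval[OF w] by blast
  have E: "EvX (\<lambda>_. ?e) (Vertex () (map Leaf ?L)) (act FX ?e ?L)"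
    by (rule EvX_act) (use e(1) L o n in simp_all)
  have "EvX \<delta> (sub (\<lambda>_ _. T1) (Vertex () (map Leaf ?L))) (act FX ?e ?L)"
    by (rule EvX_sub[OF _ E]) (rule T1(3))
  moreover have "sub (\<lambda>_ _. T1) (Vertex () (map Leaf ?L)) = T"
    by (subst sub_leaf_vertex) (simp_all add: T1)
  ultimately show ?thesis by simp
qed

text \<open>Evaluation by gluing agrees with evaluation in the operad \<open>FX\<close>: with the
  same leaf colours both values have the same inputs, and \<open>EvX_same_inp\<close> identifies
  them, also over the tree without vertices.\<close>

lemma EvX_iff_Ev: "EvX \<delta> T x \<longleftrightarrow> F.Ev \<delta> T x"
proof
  assume E: "EvX \<delta> T x"
  note W = EvX_Wt[OF E]
  let ?x = "act FX (eval FX \<delta> ((!) (inp FX x)) T) (leaves T)"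
  have w: "wt FX \<delta> ((!) (inp FX x)) T" "leaves T \<in> perms (arity FX x)" using W unfolding Wt_def by blast+
  note v = F.Ev_of_wt[OF w]
  have i: "inp FX x = inp FX ?x"
    using v(2,3) unfolding arity_def by (intro nth_equalityI) (blast intro: sym)+
  have "x = ?x" by (rule EvX_same_inp[OF E EvX_of_wt[OF w] i])
  then show "F.Ev \<delta> T x" using W unfolding F.Ev_def by blast
next
  assume E: "F.Ev \<delta> T x"
  then have w: "wt FX \<delta> ((!) (inp FX x)) T" "leaves T \<in> perms (arity FX x)"
    and x: "x = act FX (eval FX \<delta> ((!) (inp FX x)) T) (leaves T)"
    unfolding F.Ev_def Wt_def by blast+
  show "EvX \<delta> T x" by (rule ssubst[OF x, of "EvX \<delta> T"]) (rule EvX_of_wt[OF w])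
qed

text \<open>The isomorphism from \<open>X\<close> to the nerve of \<open>FX\<close>: its total and
  its decorations form the same kind of list as an element of a nerve.\<close>

definition decomposition :: "(nat, nat) tree \<Rightarrow> 'a \<Rightarrow> 'a" where
  "decomposition = (\<lambda>T\<in>Ops sOp. \<lambda>\<xi>\<in>fob X T. enc (tot T \<xi> # map (deco T \<xi>) [0..<length (vertices T)]))"

lemma decomposition_elem:
  assumes T: "T \<in> Ops sOp" and \<xi>: "\<xi> \<in> fob X T"
  shows "F.elem T (map (deco T \<xi>) [0..<length (vertices T)]) (tot T \<xi>)"
  unfolding F.elem_def
proof
  have "F.Ev (deco T \<xi>) T (tot T \<xi>)" using EvX_deco[OF T \<xi>] unfolding EvX_iff_Ev .
  then show "F.Ev ((!) (map (deco T \<xi>) [0..<length (vertices T)])) T (tot T \<xi>)"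
    by (rule F.Ev_cong[THEN iffD1, rotated]) (use perms_set[OF sOp_Ops_vlabels[OF T]] in simp)
qed simp

text \<open>Uniqueness of gluing gives injectivity and existence gives surjectivity. Over the tree
  without vertices the total still remembers the colour.\<close>

lemma decomposition_bij:
  assumes T: "T \<in> Ops sOp" shows "bij_betw (decomposition T) (fob X T) (nerve_ob FX T)"
  unfolding bij_betw_def
proof
  let ?m = "length (vertices T)"
  have D: "decomposition T \<xi> = enc (tot T \<xi> # map (deco T \<xi>) [0..<?m])" if "\<xi> \<in> fob X T" for \<xi>
    using T that by (simp add: decomposition_def)
  show "inj_on (decomposition T) (fob X T)"
  proof
    fix \<xi> \<xi>' assume \<xi>: "\<xi> \<in> fob X T" "\<xi>' \<in> fob X T" and "decomposition T \<xi> = decomposition T \<xi>'"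
    then have e: "tot T \<xi> = tot T \<xi>'" "\<And>i. i < ?m \<Longrightarrow> deco T \<xi> i = deco T \<xi>' i"
      unfolding D[OF \<xi>(1)] D[OF \<xi>(2)] by simp_all
    show "\<xi> = \<xi>'"
    proof (cases "T = Leaf 0")
      case True
      then show ?thesis using tot_Leaf(3) \<xi> e(1) by metis
    next
      case False
      show ?thesis by (rule glue_unique[OF T False \<xi> e(2)])
    qed
  qed
  show "decomposition T ` fob X T = nerve_ob FX T"
  proof (intro equalityI subsetI)
    fix d assume "d \<in> decomposition T ` fob X T"
    then show "d \<in> nerve_ob FX T" using D nerve_obI[OF decomposition_elem[OF T]] by auto
  next
    fix d assume "d \<in> nerve_ob FX T"
    then obtain x \<delta> where d: "d = enc (x # \<delta>)" "F.elem T \<delta> x" by (rule nerve_obE)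
    then have len: "length \<delta> = ?m" and E: "F.Ev ((!) \<delta>) T x" unfolding F.elem_def by auto
    show "d \<in> decomposition T ` fob X T"
    proof (cases "T = Leaf 0")
      case True
      then obtain c where c: "c \<in> fob X T" "x = tot T c"
        using E unfolding EvX_iff_Ev[symmetric] True EvX_Leaf by blast
      have "d = decomposition T c" unfolding D[OF c(1)] d(1) c(2) using len True by simp
      then show ?thesis using c(1) by blast
    next
      case False
      have "wt FX ((!) \<delta>) ((!) (inp FX x)) T" using F.Ev_Wt[OF E] unfolding Wt_def by blast
      from glue_exists[OF T False this] obtain \<xi> where \<xi>: "\<xi> \<in> fob X T"
        "\<And>i. i < ?m \<Longrightarrow> deco T \<xi> i = \<delta> ! i" by blast
      have \<delta>: "map (deco T \<xi>) [0..<?m] = \<delta>" using \<xi>(2) len by (intro nth_equalityI) simp_all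
      have "F.Ev ((!) \<delta>) T (tot T \<xi>)"
        using decomposition_elem[OF T \<xi>(1)] unfolding F.elem_def \<delta> by blast
      moreover have "T \<noteq> Leaf l" for l using sOp_Ops_no_vertices[OF T] False by auto
      ultimately have "tot T \<xi> = x" using F.Ev_unique E by blast
      then have "d = decomposition T \<xi>" unfolding D[OF \<xi>(1)] \<delta> d(1) by simp
      then show ?thesis using \<xi>(1) by blast
    qed
  qed
qed

text \<open>\<open>EvX_upp\<close> and \<open>EvX_low\<close> are the two conditions that
  \<open>restr\<close> imposes along \<open>f\<close>, and a restriction in the nerve is
  unique.\<close>

lemma decomposition_natural:
  "decomposition \<in> nat_trans (opposite (Tw sOp)) set_category X (nerve FX)"
  unfolding nat_trans_def opposite_simps set_category_simps Tw_simps fob_nerve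
proof (intro CollectI conjI ballI)
  show "decomposition \<in> extensional (Ops sOp)" by (simp add: decomposition_def)
  show "decomposition T \<in> fob X T \<rightarrow>\<^sub>E nerve_ob FX T" if T: "T \<in> Ops sOp" for T
    using bij_betw_imp_funcset[OF decomposition_bij[OF T]] T by (simp add: decomposition_def PiE_def)
  fix t p f assume t: "t \<in> Ops sOp" and p: "p \<in> Ops sOp" and f: "f \<in> hom (Tw sOp) p t"
  note l = lhom_of_hom(1)[OF f t]
  show "compose (fob X t) (decomposition p) (fmor X t p f) =
      compose (fob X t) (fmor (nerve FX) t p f) (decomposition t)"
  proof (rule extensionalityI[OF compose_extensional compose_extensional])
    fix \<xi> assume \<xi>: "\<xi> \<in> fob X t"
    let ?\<xi> = "fmor X t p f \<xi>"
    have \<xi>': "?\<xi> \<in> fob X p" by (rule pb_in[OF f p t \<xi>])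
    let ?\<delta> = "map (deco t \<xi>) [0..<length (vertices t)]"
    let ?ys = "map (deco p ?\<xi>) [0..<length (vertices p)]"
    have lt: "v < length (vertices t)" if "(v, n) \<in> set (vertices t)" for v n
      using sOp_inp_nth(2)[OF t that] .
    have "F.restr f p ?\<delta> (tot t \<xi>) ?ys (tot p ?\<xi>)"
      unfolding F.restr_def
    proof (intro conjI allI impI)
      show "F.elem p ?ys (tot p ?\<xi>)" by (rule decomposition_elem[OF p \<xi>'])
      fix i assume i: "i < length (vertices p)"
      have "F.Ev (deco t \<xi>) (uppL f i) (deco p ?\<xi> i)"
        using EvX_upp[OF f p t \<xi> i] unfolding EvX_iff_Ev .
      moreover have "deco t \<xi> v = ?\<delta> ! v" if "v \<in> set (vlabels (uppL f i))" for v
      proof -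
        from that obtain n where "(v, n) \<in> set (vertices (uppL f i))" by auto
        then have "v < length (vertices t)" using lhom_vertices(1)[OF l i] lt by blast
        then show ?thesis by simp
      qed
      ultimately have "F.Ev ((!) ?\<delta>) (uppL f i) (deco p ?\<xi> i)"
        using F.Ev_cong[of "uppL f i" "deco t \<xi>"] by blast
      then show "F.Ev ((!) ?\<delta>) (uppL f i) (?ys ! i)" using i by simp
    next
      have "F.Ev (case_option (tot p ?\<xi>) (deco t \<xi>)) (lowL f) (tot t \<xi>)"
        using EvX_low[OF f p t \<xi>] unfolding EvX_iff_Ev .
      moreover have "case_option (tot p ?\<xi>) (deco t \<xi>) v = case_option (tot p ?\<xi>) ((!) ?\<delta>) v"
        if "v \<in> set (vlabels (lowL f))" for v
      proof (cases v)
        case (Some j)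
        then obtain n where "(Some j, n) \<in> set (vertices (lowL f))" using \<open>v \<in> _\<close> by auto
        then have "j < length (vertices t)" using lhom_vertices(2)[OF l] lt by blast
        then show ?thesis using Some by simp
      qed simp
      ultimately show "F.Ev (case_option (tot p ?\<xi>) ((!) ?\<delta>)) (lowL f) (tot t \<xi>)"
        using F.Ev_cong[of "lowL f" "case_option (tot p ?\<xi>) (deco t \<xi>)"] by blast
    qed
    from fmor_nerve[OF FX_operad f t decomposition_elem[OF t \<xi>] this]
    have "fmor (nerve FX) t p f (decomposition t \<xi>) = decomposition p ?\<xi>"
      using t p \<xi> \<xi>' by (simp add: decomposition_def)
    then show "compose (fob X t) (decomposition p) (fmor X t p f) \<xi> =
        compose (fob X t) (fmor (nerve FX) t p f) (decomposition t) \<xi>"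
      using \<xi> by (simp add: compose_def)
  qed
qed

end

section \<open>The equivalence\<close>

lemma set_category_category: "category set_category"
proof
  fix A B D E :: "'u set" and f g h
  show "idn set_category A \<in> hom set_category A A" by simp
  assume f: "f \<in> hom set_category A B"
  then have f': "f \<in> A \<rightarrow> B" "f \<in> extensional A" by (simp_all add: PiE_def)
  show "cmp set_category A B B (idn set_category B) f = f"
    "cmp set_category A A B f (idn set_category A) = f"
    using Id_compose[OF f'] compose_Id[OF f'] by simp_all
  assume "g \<in> hom set_category B D"
  then have g: "g \<in> B \<rightarrow> D" by (simp add: PiE_def)
  show "cmp set_category A B D g f \<in> hom set_category A D"
    using funcset_compose[OF f'(1) g] compose_extensional by (simp add: PiE_def)
  show "cmp set_category A D E h (cmp set_category A B D g f) =
      cmp set_category A B E (cmp set_category B D E h g) f"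
    using compose_assoc[OF f'(1), of h g] by simp
qed

lemma is_functorD:
  assumes "is_functor C D F"
  shows "a \<in> ob C \<Longrightarrow> fob F a \<in> ob D"
    "a \<in> ob C \<Longrightarrow> b \<in> ob C \<Longrightarrow> f \<in> hom C a b \<Longrightarrow> fmor F a b f \<in> hom D (fob F a) (fob F b)"
    "a \<in> ob C \<Longrightarrow> fmor F a a (idn C a) = idn D (fob F a)"
    "a \<in> ob C \<Longrightarrow> b \<in> ob C \<Longrightarrow> c \<in> ob C \<Longrightarrow> f \<in> hom C a b \<Longrightarrow> g \<in> hom C b c \<Longrightarrow>
      fmor F a c (cmp C a b c g f) = cmp D (fob F a) (fob F b) (fob F c) (fmor F b c g) (fmor F a b f)"
  using assms unfolding is_functor_def by blast+

lemma nat_transD: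
  assumes "\<alpha> \<in> nat_trans C D F G"
  shows "\<alpha> \<in> extensional (ob C)" "a \<in> ob C \<Longrightarrow> \<alpha> a \<in> hom D (fob F a) (fob G a)"
    "a \<in> ob C \<Longrightarrow> b \<in> ob C \<Longrightarrow> f \<in> hom C a b \<Longrightarrow>
      cmp D (fob F a) (fob F b) (fob G b) (\<alpha> b) (fmor F a b f) =
      cmp D (fob F a) (fob G a) (fob G b) (fmor G a b f) (\<alpha> a)"
  using assms unfolding nat_trans_def by blast+

lemma functor_category_category:
  assumes D: "category D" shows "category (functor_category C D)"
proof -
  interpret D: category D by (rule D)
  show ?thesis
  proof
    fix F assume "F \<in> ob (functor_category C D)"
    then have F: "is_functor C D F" by (simp add: functor_category_def)
    note F = is_functorD[OF F]
    have "idn D (fob F a) \<in> hom D (fob F a) (fob F a)" if "a \<in> ob C" for a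
      by (rule D.idn_hom[OF F(1)[OF that]])
    moreover have "cmp D (fob F a) (fob F b) (fob F b) (idn D (fob F b)) (fmor F a b f) =
        cmp D (fob F a) (fob F a) (fob F b) (fmor F a b f) (idn D (fob F a))"
      if a: "a \<in> ob C" and b: "b \<in> ob C" and f: "f \<in> hom C a b" for a b f
      using D.cmp_idn_left[OF F(1)[OF a] F(1)[OF b] F(2)[OF a b f]]
        D.cmp_idn_right[OF F(1)[OF a] F(1)[OF b] F(2)[OF a b f]] by (rule trans[OF _ sym])
    ultimately show "idn (functor_category C D) F \<in> hom (functor_category C D) F F"
      by (simp add: functor_category_def nat_trans_def)
  next
    fix F G H \<alpha> \<beta>
    assume "F \<in> ob (functor_category C D)" "G \<in> ob (functor_category C D)" "H \<in> ob (functor_category C D)"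
      and "\<alpha> \<in> hom (functor_category C D) F G" "\<beta> \<in> hom (functor_category C D) G H"
    then have F: "is_functor C D F" and G: "is_functor C D G" and H: "is_functor C D H"
      and \<alpha>: "\<alpha> \<in> nat_trans C D F G" and \<beta>: "\<beta> \<in> nat_trans C D G H" by (simp_all add: functor_category_def)
    note F = is_functorD[OF F] and G = is_functorD[OF G] and H = is_functorD[OF H]
    note \<alpha> = nat_transD[OF \<alpha>] and \<beta> = nat_transD[OF \<beta>]
    let ?c = "\<lambda>a. cmp D (fob F a) (fob G a) (fob H a) (\<beta> a) (\<alpha> a)"
    have "cmp D (fob F a) (fob F b) (fob H b) (?c b) (fmor F a b f) =
        cmp D (fob F a) (fob H a) (fob H b) (fmor H a b f) (?c a)"
      if a: "a \<in> ob C" and b: "b \<in> ob C" and f: "f \<in> hom C a b" for a b f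
    proof -
      have "cmp D (fob F a) (fob F b) (fob H b) (?c b) (fmor F a b f) = cmp D (fob F a) (fob G b) (fob H b) (\<beta> b)
          (cmp D (fob F a) (fob F b) (fob G b) (\<alpha> b) (fmor F a b f))"
        by (rule D.cmp_assoc[symmetric, OF F(1)[OF a] F(1)[OF b] G(1)[OF b] H(1)[OF b]
          F(2)[OF a b f] \<alpha>(2)[OF b] \<beta>(2)[OF b]])
      also have "\<dots> = cmp D (fob F a) (fob G b) (fob H b) (\<beta> b)
          (cmp D (fob F a) (fob G a) (fob G b) (fmor G a b f) (\<alpha> a))" unfolding \<alpha>(3)[OF a b f] ..
      also have "\<dots> = cmp D (fob F a) (fob G a) (fob H b)
          (cmp D (fob G a) (fob G b) (fob H b) (\<beta> b) (fmor G a b f)) (\<alpha> a)"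
        by (rule D.cmp_assoc[OF F(1)[OF a] G(1)[OF a] G(1)[OF b] H(1)[OF b]
          \<alpha>(2)[OF a] G(2)[OF a b f] \<beta>(2)[OF b]])
      also have "\<dots> = cmp D (fob F a) (fob G a) (fob H b)
          (cmp D (fob G a) (fob H a) (fob H b) (fmor H a b f) (\<beta> a)) (\<alpha> a)" unfolding \<beta>(3)[OF a b f] ..
      also have "\<dots> = cmp D (fob F a) (fob H a) (fob H b) (fmor H a b f) (?c a)"
        by (rule D.cmp_assoc[symmetric, OF F(1)[OF a] G(1)[OF a] H(1)[OF a] H(1)[OF b]
          \<alpha>(2)[OF a] \<beta>(2)[OF a] H(2)[OF a b f]])
      finally show ?thesis .
    qed
    moreover have "?c a \<in> hom D (fob F a) (fob H a)" if a: "a \<in> ob C" for a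
      by (rule D.cmp_hom[OF F(1)[OF a] G(1)[OF a] H(1)[OF a] \<alpha>(2)[OF a] \<beta>(2)[OF a]])
    ultimately show "cmp (functor_category C D) F G H \<beta> \<alpha> \<in> hom (functor_category C D) F H"
      by (simp add: functor_category_def nat_trans_def)
  next
    fix F G \<alpha>
    assume "F \<in> ob (functor_category C D)" "G \<in> ob (functor_category C D)" "\<alpha> \<in> hom (functor_category C D) F G"
    then have F: "is_functor C D F" and G: "is_functor C D G" and \<alpha>: "\<alpha> \<in> nat_trans C D F G"
      by (simp_all add: functor_category_def)
    note F = is_functorD[OF F] and G = is_functorD[OF G] and \<alpha> = nat_transD[OF \<alpha>]
    show "cmp (functor_category C D) F G G (idn (functor_category C D) G) \<alpha> = \<alpha>"
      using D.cmp_idn_left[OF F(1) G(1) \<alpha>(2)]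
      by (intro extensionalityI[OF _ \<alpha>(1)]) (simp_all add: functor_category_def)
    show "cmp (functor_category C D) F F G \<alpha> (idn (functor_category C D) F) = \<alpha>"
      using D.cmp_idn_right[OF F(1) G(1) \<alpha>(2)]
      by (intro extensionalityI[OF _ \<alpha>(1)]) (simp_all add: functor_category_def)
  next
    fix F G H K \<alpha> \<beta> \<theta>
    assume "F \<in> ob (functor_category C D)" "G \<in> ob (functor_category C D)"
      "H \<in> ob (functor_category C D)" "K \<in> ob (functor_category C D)"
      "\<alpha> \<in> hom (functor_category C D) F G" "\<beta> \<in> hom (functor_category C D) G H" "\<theta> \<in> hom (functor_category C D) H K"
    then have F: "is_functor C D F" and G: "is_functor C D G" and H: "is_functor C D H" and K: "is_functor C D K"
      and \<alpha>: "\<alpha> \<in> nat_trans C D F G" and \<beta>: "\<beta> \<in> nat_trans C D G H" and \<theta>: "\<theta> \<in> nat_trans C D H K"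
      by (simp_all add: functor_category_def)
    show "cmp (functor_category C D) F H K \<theta> (cmp (functor_category C D) F G H \<beta> \<alpha>) =
        cmp (functor_category C D) F G K (cmp (functor_category C D) G H K \<theta> \<beta>) \<alpha>"
      using D.cmp_assoc[OF is_functorD(1)[OF F] is_functorD(1)[OF G] is_functorD(1)[OF H] is_functorD(1)[OF K]
          nat_transD(2)[OF \<alpha>] nat_transD(2)[OF \<beta>] nat_transD(2)[OF \<theta>]]
      by (simp add: functor_category_def restrict_def fun_eq_iff)
  qed
qed

lemma full_subcategory_category:
  assumes "category C" shows "category (full_subcategory C S)"
  using assms unfolding category_def full_subcategory_def by simp

lemma segal_category_category: "category (segal_category P \<psi>)"
  unfolding segal_category_def presheaf_category_def
  by (intro full_subcategory_category functor_category_category set_category_category)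

lemma segal_category_simps:
  "X \<in> ob (segal_category P \<psi>) \<longleftrightarrow> is_functor (opposite (Tw P)) set_category X \<and> is_segal P \<psi> X"
  "hom (segal_category P \<psi>) = nat_trans (opposite (Tw P)) set_category"
  "idn (segal_category P \<psi>) X = (\<lambda>T\<in>ob (Tw P). \<lambda>x\<in>fob X T. x)"
  "cmp (segal_category P \<psi>) X Y Z \<beta> \<alpha> = (\<lambda>T\<in>ob (Tw P). compose (fob X T) (\<beta> T) (\<alpha> T))"
  by (simp_all add: segal_category_def presheaf_category_def functor_category_def full_subcategory_def)

lemma nat_trans_inverse:
  assumes F: "is_functor (opposite C) set_category F" and G: "is_functor (opposite C) set_category G"
    and \<alpha>: "\<alpha> \<in> nat_trans (opposite C) set_category F G"
    and bij: "\<And>a. a \<in> ob C \<Longrightarrow> bij_betw (\<alpha> a) (fob F a) (fob G a)"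
  obtains \<beta> where "\<beta> \<in> nat_trans (opposite C) set_category G F"
    "\<And>a x. a \<in> ob C \<Longrightarrow> x \<in> fob F a \<Longrightarrow> \<beta> a (\<alpha> a x) = x"
    "\<And>a y. a \<in> ob C \<Longrightarrow> y \<in> fob G a \<Longrightarrow> \<alpha> a (\<beta> a y) = y"
proof
  let ?\<beta> = "\<lambda>a\<in>ob C. \<lambda>y\<in>fob G a. inv_into (fob F a) (\<alpha> a) y"
  have \<alpha>in: "\<alpha> a x \<in> fob G a" if "a \<in> ob C" "x \<in> fob F a" for a x
    using bij_betw_apply[OF bij] that by blast
  show \<beta>\<alpha>: "?\<beta> a (\<alpha> a x) = x" if "a \<in> ob C" "x \<in> fob F a" for a x
    using that bij_betw_inv_into_left[OF bij] \<alpha>in by simp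
  show \<alpha>\<beta>: "\<alpha> a (?\<beta> a y) = y" if "a \<in> ob C" "y \<in> fob G a" for a y
    using that bij_betw_inv_into_right[OF bij] by simp
  have \<beta>in: "?\<beta> a y \<in> fob F a" if "a \<in> ob C" "y \<in> fob G a" for a y
    using that bij_betw_apply[OF bij_betw_inv_into[OF bij]] by simp
  show "?\<beta> \<in> nat_trans (opposite C) set_category G F"
    unfolding nat_trans_def opposite_simps set_category_simps
  proof (intro CollectI conjI ballI)
    show "?\<beta> a \<in> fob G a \<rightarrow>\<^sub>E fob F a" if a: "a \<in> ob C" for a
    proof
      show "?\<beta> a y \<in> fob F a" if "y \<in> fob G a" for y by (rule \<beta>in[OF a that])
      show "?\<beta> a y = undefined" if "y \<notin> fob G a" for y using a that by simp
    qed
    fix a b f assume a: "a \<in> ob C" and b: "b \<in> ob C" and f: "f \<in> hom C b a"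
    have Fm: "fmor F a b f \<in> fob F a \<rightarrow>\<^sub>E fob F b" and Gm: "fmor G a b f \<in> fob G a \<rightarrow>\<^sub>E fob G b"
      using is_functorD(2)[OF F, of a b f] is_functorD(2)[OF G, of a b f] a b f by simp_all
    have nat: "\<alpha> b (fmor F a b f x) = fmor G a b f (\<alpha> a x)" if "x \<in> fob F a" for x
      using fun_cong[OF nat_transD(3)[OF \<alpha>, of a b f], of x] a b f that by (simp add: compose_def)
    show "compose (fob G a) (?\<beta> b) (fmor G a b f) = compose (fob G a) (fmor F a b f) (?\<beta> a)"
    proof (rule extensionalityI[OF compose_extensional compose_extensional])
      fix y assume y: "y \<in> fob G a"
      have x: "?\<beta> a y \<in> fob F a" by (rule \<beta>in[OF a y])
      have Fx: "fmor F a b f (?\<beta> a y) \<in> fob F b" using Fm x by blast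
      have "?\<beta> b (fmor G a b f y) = ?\<beta> b (fmor G a b f (\<alpha> a (?\<beta> a y)))" by (simp only: \<alpha>\<beta>[OF a y])
      also have "\<dots> = ?\<beta> b (\<alpha> b (fmor F a b f (?\<beta> a y)))" by (simp only: nat[OF x])
      also have "\<dots> = fmor F a b f (?\<beta> a y)" by (rule \<beta>\<alpha>[OF b Fx])
      finally show "compose (fob G a) (?\<beta> b) (fmor G a b f) y = compose (fob G a) (fmor F a b f) (?\<beta> a) y"
        unfolding compose_def using y by simp
    qed
  qed simp
qed

lemma operad_homI:
  assumes "f \<in> Col P \<rightarrow>\<^sub>E Col Q" "g \<in> Ops P \<rightarrow>\<^sub>E Ops Q"
    "\<And>p. p \<in> Ops P \<Longrightarrow> inp Q (g p) = map f (inp P p)" "\<And>p. p \<in> Ops P \<Longrightarrow> out Q (g p) = f (out P p)"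
    "\<And>c. c \<in> Col P \<Longrightarrow> g (ident P c) = ident Q (f c)"
    "\<And>p qs. composable P p qs \<Longrightarrow> g (comp P p qs) = comp Q (g p) (map g qs)"
    "\<And>p L. p \<in> Ops P \<Longrightarrow> L \<in> perms (arity P p) \<Longrightarrow> g (act P p L) = act Q (g p) L"
  shows "(f, g) \<in> operad_hom P Q"
  using assms by (simp add: operad_hom_def)

lemma operad_hom_id:
  assumes "coloured_operad P" shows "(\<lambda>c\<in>Col P. c, \<lambda>p\<in>Ops P. p) \<in> operad_hom P P"
proof -
  interpret coloured_operad P by (rule assms)
  have m: "map (\<lambda>p\<in>Ops P. p) qs = qs" if "set qs \<subseteq> Ops P" for qs using that by (intro map_idI) auto
  show ?thesis
  proof (rule operad_homI)
    fix p assume p: "p \<in> Ops P"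
    show "inp P ((\<lambda>p\<in>Ops P. p) p) = map (\<lambda>c\<in>Col P. c) (inp P p)"
      using p inp_Col[OF p] by (simp add: map_idI subset_eq)
  qed (use out_Col ident_Ops comp_Ops act_Ops m in \<open>auto simp: composable_def\<close>)
qed

lemma operad_hom_composable:
  assumes h: "(f, g) \<in> operad_hom P Q" and c: "composable P p qs" shows "composable Q (g p) (map g qs)"
proof -
  note h = operad_homD[OF h]
  have p: "p \<in> Ops P" "set qs \<subseteq> Ops P" "map (out P) qs = inp P p" using c unfolding composable_def by blast+
  have "map (out Q) (map g qs) = map f (map (out P) qs)" using h(4) p(2) by auto
  then show ?thesis unfolding composable_def using h(2,3) p by (auto simp: PiE_iff)
qed

lemma operad_hom_comp:
  assumes P: "coloured_operad P" and h: "(f, g) \<in> operad_hom P Q" and h': "(f', g') \<in> operad_hom Q R"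
  shows "(compose (Col P) f' f, compose (Ops P) g' g) \<in> operad_hom P R"
proof -
  interpret coloured_operad P by (rule P)
  note hc = operad_hom_composable[OF h]
  note h = operad_homD[OF h] and h' = operad_homD[OF h']
  have f: "f c \<in> Col Q" if "c \<in> Col P" for c using h(1) that by blast
  have g: "g p \<in> Ops Q" if "p \<in> Ops P" for p using h(2) that by blast
  show ?thesis
  proof (rule operad_homI)
    show "compose (Col P) f' f \<in> Col P \<rightarrow>\<^sub>E Col R" using f h'(1) by (auto simp: compose_def)
    show "compose (Ops P) g' g \<in> Ops P \<rightarrow>\<^sub>E Ops R" using g h'(2) by (auto simp: compose_def)
    fix p assume p: "p \<in> Ops P"
    show "inp R (compose (Ops P) g' g p) = map (compose (Col P) f' f) (inp P p)"
      using h'(3)[OF g[OF p]] h(3)[OF p] inp_Col[OF p] p by (auto simp: compose_def)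
    show "out R (compose (Ops P) g' g p) = compose (Col P) f' f (out P p)"
      using h'(4)[OF g[OF p]] h(4)[OF p] out_Col[OF p] p by (simp add: compose_def)
    fix L assume L: "L \<in> perms (arity P p)"
    have "arity Q (g p) = arity P p" using h(3)[OF p] by (simp add: arity_def)
    with L have "L \<in> perms (arity Q (g p))" by simp
    then show "compose (Ops P) g' g (act P p L) = act R (compose (Ops P) g' g p) L"
      using h'(7)[OF g[OF p]] h(7)[OF p L] act_Ops[OF p L] p by (simp add: compose_def)
  next
    fix c assume c: "c \<in> Col P"
    show "compose (Ops P) g' g (ident P c) = ident R (compose (Col P) f' f c)"
      using h'(5)[OF f[OF c]] h(5)[OF c] ident_Ops[OF c] c by (simp add: compose_def)
  next
    fix p qs assume c: "composable P p qs"
    then have "p \<in> Ops P" "set qs \<subseteq> Ops P" unfolding composable_def by blast+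
    then have m: "map (compose (Ops P) g' g) qs = map g' (map g qs)" "compose (Ops P) g' g p = g' (g p)"
      by (auto simp: compose_def)
    then show "compose (Ops P) g' g (comp P p qs) = comp R (compose (Ops P) g' g p) (map (compose (Ops P) g' g) qs)"
      unfolding m using h'(6)[OF hc[OF c]] h(6)[OF c] comp_Ops[OF c] by (simp add: compose_eq)
  qed
qed

lemma operad_category_simps:
  "P \<in> ob operad_category \<longleftrightarrow> coloured_operad P" "hom operad_category = operad_hom"
  "idn operad_category P = (\<lambda>c\<in>Col P. c, \<lambda>p\<in>Ops P. p)"
  "cmp operad_category P Q R (f', g') (f, g) = (compose (Col P) f' f, compose (Ops P) g' g)"
  by (simp_all add: operad_category_def)

lemma operad_category_category: "category operad_category"
proof
  fix P Q R S :: "('u, 'u) operad" and h h' h''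
  show "P \<in> ob operad_category \<Longrightarrow> idn operad_category P \<in> hom operad_category P P"
    using operad_hom_id by (simp add: operad_category_simps)
  assume P: "P \<in> ob operad_category" and Q: "Q \<in> ob operad_category" and h: "h \<in> hom operad_category P Q"
  obtain f g where hh: "h = (f, g)" by (cases h)
  note hD = operad_homD[OF h[unfolded operad_category_simps hh]]
  show "cmp operad_category P Q Q (idn operad_category Q) h = h"
    "cmp operad_category P P Q h (idn operad_category P) = h"
    unfolding hh operad_category_simps using hD(1,2)
    by (auto simp: PiE_def intro: Id_compose compose_Id)
  assume R: "R \<in> ob operad_category" and h': "h' \<in> hom operad_category Q R"
  obtain f' g' where hh': "h' = (f', g')" by (cases h')
  show "cmp operad_category P Q R h' h \<in> hom operad_category P R"
    using operad_hom_comp P h h' unfolding hh hh' operad_category_simps by blast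
  assume "h'' \<in> hom operad_category R S"
  obtain f'' g'' where hh'': "h'' = (f'', g'')" by (cases h'')
  have "f \<in> Col P \<rightarrow> Col Q" "g \<in> Ops P \<rightarrow> Ops Q" using hD(1,2) unfolding PiE_def by blast+
  then show "cmp operad_category P R S h'' (cmp operad_category P Q R h' h) =
      cmp operad_category P Q S (cmp operad_category Q R S h'' h') h"
    unfolding hh hh' hh'' operad_category_simps by (simp add: compose_assoc)
qed


section \<open>The nerve as a functor between the two categories\<close>

context coding
begin

definition nerve_functor_of_operads ::
    "(('u, 'u) operad, ('u \<Rightarrow> 'u) \<times> ('u \<Rightarrow> 'u),
      ((nat, nat) tree, (nat, nat) tree tw_mor, 'u) presheaf, (nat, nat) tree \<Rightarrow> 'u \<Rightarrow> 'u) fnctr" where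
  "nerve_functor_of_operads = \<lparr>fob = nerve, fmor = (\<lambda>P Q h. nerve_mor P h)\<rparr>"

lemma elem_Ops:
  assumes P: "coloured_operad P" and T: "T \<in> Ops sOp" and e: "coloured_operad.elem P T \<delta> x"
  shows "set (x # \<delta>) \<subseteq> Ops P"
proof -
  interpret coloured_operad P by (rule P)
  from e have E: "Ev ((!) \<delta>) T x" and len: "length \<delta> = length (vertices T)" unfolding elem_def by blast+
  have "\<delta> ! i \<in> Ops P" if "i < length \<delta>" for i
    using Ev_vertex[OF E sOp_vertex[OF T]] that len by simp
  moreover have "x \<in> Ops P" using Ev_Wt[OF E] unfolding Wt_def by blast
  ultimately show ?thesis by (auto simp: in_set_conv_nth)
qed

lemma nerve_mor_id:
  assumes P: "coloured_operad P"
  shows "nerve_mor P (\<lambda>c\<in>Col P. c, \<lambda>p\<in>Ops P. p) = (\<lambda>T\<in>Ops sOp. \<lambda>d\<in>nerve_ob P T. d)"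
  unfolding nerve_mor_def
proof (intro restrict_ext)
  fix T d assume T: "T \<in> Ops sOp" and "d \<in> nerve_ob P T"
  then obtain x \<delta> where d: "d = enc (x # \<delta>)" "coloured_operad.elem P T \<delta> x" using nerve_obE by blast
  have "map (\<lambda>p\<in>Ops P. p) (x # \<delta>) = x # \<delta>" using elem_Ops[OF P T d(2)] by (intro map_idI) auto
  then show "enc (map (snd (\<lambda>c\<in>Col P. c, \<lambda>p\<in>Ops P. p)) (dec d)) = d"
    unfolding d(1) dec_enc snd_conv by simp
qed

lemma nerve_mor_comp:
  assumes P: "coloured_operad P" and Q: "coloured_operad Q" and h: "(f, g) \<in> operad_hom P Q"
  shows "nerve_mor P (compose (Col P) f' f, compose (Ops P) g' g) =
    (\<lambda>T\<in>Ops sOp. compose (nerve_ob P T) (nerve_mor Q (f', g') T) (nerve_mor P (f, g) T))"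
  unfolding nerve_mor_def[of P "(compose _ _ _, _)"]
proof (intro restrict_ext)
  fix T assume T: "T \<in> Ops sOp"
  show "(\<lambda>d\<in>nerve_ob P T. enc (map (snd (compose (Col P) f' f, compose (Ops P) g' g)) (dec d))) =
      compose (nerve_ob P T) (nerve_mor Q (f', g') T) (nerve_mor P (f, g) T)"
    unfolding compose_def[of "nerve_ob P T"]
  proof (intro restrict_ext)
    fix d assume d': "d \<in> nerve_ob P T"
    then obtain x \<delta> where d: "d = enc (x # \<delta>)" "coloured_operad.elem P T \<delta> x" using nerve_obE by blast
    have "nerve_mor P (f, g) T d = enc (map g (x # \<delta>))"
      using T d' unfolding nerve_mor_def by (simp add: d(1))
    moreover have "enc (map g (x # \<delta>)) \<in> nerve_ob Q T"
      using nerve_obI[OF elem_hom[OF P Q h T d(2)]] by simp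
    ultimately have "nerve_mor Q (f', g') T (nerve_mor P (f, g) T d) = enc (map g' (map g (x # \<delta>)))"
      using T unfolding nerve_mor_def[of Q] by simp
    moreover have "map (compose (Ops P) g' g) (x # \<delta>) = map g' (map g (x # \<delta>))"
      using elem_Ops[OF P T d(2)] by (auto simp: compose_def)
    ultimately show "enc (map (snd (compose (Col P) f' f, compose (Ops P) g' g)) (dec d)) =
        nerve_mor Q (f', g') T (nerve_mor P (f, g) T d)"
      unfolding d(1) dec_enc snd_conv by simp
  qed
qed

lemma nerve_is_functor:
  "is_functor operad_category (segal_category sOp sOp_grading) nerve_functor_of_operads"
  unfolding is_functor_def
proof (intro conjI ballI)
  fix P :: "('u, 'u) operad" assume "P \<in> ob operad_category"
  then have P: "coloured_operad P" by (simp add: operad_category_simps)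
  show "fob nerve_functor_of_operads P \<in> ob (segal_category sOp sOp_grading)"
    using nerve_functor[OF P] nerve_segal[OF P]
    by (simp add: nerve_functor_of_operads_def segal_category_simps)
  show "fmor nerve_functor_of_operads P P (idn operad_category P) =
      idn (segal_category sOp sOp_grading) (fob nerve_functor_of_operads P)"
    using nerve_mor_id[OF P]
    by (simp add: nerve_functor_of_operads_def segal_category_simps operad_category_simps)
  fix Q h assume "Q \<in> ob operad_category" and h: "h \<in> hom operad_category P Q"
  then have Q: "coloured_operad Q" by (simp add: operad_category_simps)
  show "fmor nerve_functor_of_operads P Q h \<in> hom (segal_category sOp sOp_grading)
      (fob nerve_functor_of_operads P) (fob nerve_functor_of_operads Q)"
    using nerve_mor_nat[OF P Q] h
    by (simp add: nerve_functor_of_operads_def segal_category_simps operad_category_simps)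
  fix R h' assume "R \<in> ob operad_category" and "h' \<in> hom operad_category Q R"
  obtain f g f' g' where fg: "h = (f, g)" "h' = (f', g')" by (cases h, cases h')
  have "(f, g) \<in> operad_hom P Q" using h by (simp add: fg operad_category_simps)
  from nerve_mor_comp[OF P Q this, of f' g']
  show "fmor nerve_functor_of_operads P R (cmp operad_category P Q R h' h) =
      cmp (segal_category sOp sOp_grading) (fob nerve_functor_of_operads P)
        (fob nerve_functor_of_operads Q) (fob nerve_functor_of_operads R)
        (fmor nerve_functor_of_operads Q R h') (fmor nerve_functor_of_operads P Q h)"
    by (simp add: fg nerve_functor_of_operads_def segal_category_simps operad_category_simps)
qed

lemma nerve_fully_faithful:
  assumes "P \<in> ob operad_category" "Q \<in> ob operad_category"
  shows "bij_betw (fmor nerve_functor_of_operads P Q) (hom operad_category P Q)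
    (hom (segal_category sOp sOp_grading) (fob nerve_functor_of_operads P) (fob nerve_functor_of_operads Q))"
proof -
  have P: "coloured_operad P" and Q: "coloured_operad Q" using assms by (simp_all add: operad_category_simps)
  have "nerve_mor P ` operad_hom P Q = nat_trans (opposite (Tw sOp)) set_category (nerve P) (nerve Q)"
    using nerve_mor_nat[OF P Q] nerve_mor_full[OF P Q] by blast
  moreover have "inj_on (nerve_mor P) (operad_hom P Q)"
    using nerve_mor_faithful[OF P Q] by (intro inj_onI)
  ultimately show ?thesis
    by (simp add: bij_betw_def nerve_functor_of_operads_def operad_category_simps segal_category_simps)
qed

lemma nerve_essentially_surjective:
  assumes "X \<in> ob (segal_category sOp sOp_grading)"
  shows "\<exists>P \<in> ob operad_category.
    iso_set (segal_category sOp sOp_grading) X (fob nerve_functor_of_operads P) \<noteq> {}"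
proof -
  have X: "is_functor (opposite (Tw sOp)) set_category X" "is_segal sOp sOp_grading X"
    using assms by (simp_all add: segal_category_simps)
  interpret segal_coding enc X by unfold_locales (rule X)+
  note N = nerve_functor[OF FX_operad]
  obtain \<beta> where \<beta>: "\<beta> \<in> nat_trans (opposite (Tw sOp)) set_category (nerve FX) X"
    "\<And>T x. T \<in> ob (Tw sOp) \<Longrightarrow> x \<in> fob X T \<Longrightarrow> \<beta> T (decomposition T x) = x"
    "\<And>T y. T \<in> ob (Tw sOp) \<Longrightarrow> y \<in> fob (nerve FX) T \<Longrightarrow> decomposition T (\<beta> T y) = y"
    by (rule nat_trans_inverse[OF X(1) N decomposition_natural]) (use decomposition_bij in simp_all)
  have "decomposition \<in> iso_set (segal_category sOp sOp_grading) X (nerve FX)"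
    unfolding iso_set_def segal_category_simps
  proof (intro CollectI conjI bexI[of _ \<beta>])
    show "(\<lambda>T\<in>ob (Tw sOp). compose (fob X T) (\<beta> T) (decomposition T)) = (\<lambda>T\<in>ob (Tw sOp). \<lambda>x\<in>fob X T. x)"
      using \<beta>(2) by (intro restrict_ext) (simp add: compose_def restrict_def fun_eq_iff)
    show "(\<lambda>T\<in>ob (Tw sOp). compose (fob (nerve FX) T) (decomposition T) (\<beta> T)) =
        (\<lambda>T\<in>ob (Tw sOp). \<lambda>x\<in>fob (nerve FX) T. x)"
      using \<beta>(3) by (intro restrict_ext) (simp add: compose_def restrict_def fun_eq_iff)
  qed (use decomposition_natural \<beta>(1) in blast)+
  then show ?thesis
    using FX_operad by (intro bexI[of _ FX]) (auto simp: nerve_functor_of_operads_def operad_category_simps)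
qed

end

section \<open>Fully faithful and essentially surjective functors are equivalences\<close>

locale equivalence_data = C: category C + D: category D
  for C :: "('o, 'm) cat" and D :: "('p, 'n) cat" +
  fixes G :: "('p, 'n, 'o, 'm) fnctr" and F0 :: "'o \<Rightarrow> 'p" and e i :: "'o \<Rightarrow> 'm"
  assumes G: "is_functor D C G"
    and full: "a \<in> ob D \<Longrightarrow> b \<in> ob D \<Longrightarrow>
      bij_betw (fmor G a b) (hom D a b) (hom C (fob G a) (fob G b))"
    and F0: "c \<in> ob C \<Longrightarrow> F0 c \<in> ob D"
    and e: "c \<in> ob C \<Longrightarrow> e c \<in> hom C c (fob G (F0 c))"
    and i: "c \<in> ob C \<Longrightarrow> i c \<in> hom C (fob G (F0 c)) c"
    and ie: "c \<in> ob C \<Longrightarrow> cmp C c (fob G (F0 c)) c (i c) (e c) = idn C c"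
    and ei: "c \<in> ob C \<Longrightarrow> cmp C (fob G (F0 c)) c (fob G (F0 c)) (e c) (i c) = idn C (fob G (F0 c))"
begin

abbreviation G0 :: "'p \<Rightarrow> 'o" where "G0 \<equiv> fob G"
abbreviation GF :: "'o \<Rightarrow> 'o" where "GF c \<equiv> fob G (F0 c)"

definition lift :: "'p \<Rightarrow> 'p \<Rightarrow> 'm \<Rightarrow> 'n" where
  "lift a b = inv_into (hom D a b) (fmor G a b)"

lemmas G1 = is_functorD(1)[OF G] and G2 = is_functorD(2)[OF G]
  and G3 = is_functorD(3)[OF G] and G4 = is_functorD(4)[OF G]

lemma lift:
  assumes "a \<in> ob D" "b \<in> ob D" "f \<in> hom C (G0 a) (G0 b)"
  shows "lift a b f \<in> hom D a b" "fmor G a b (lift a b f) = f"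
  using full[OF assms(1,2)] assms(3) unfolding lift_def
  by (metis bij_betw_def inv_into_into, metis bij_betw_inv_into_right)

lemma faithful:
  assumes "a \<in> ob D" "b \<in> ob D" "h \<in> hom D a b" "h' \<in> hom D a b" "fmor G a b h = fmor G a b h'"
  shows "h = h'"
  using full[OF assms(1,2)] assms(3-5) unfolding bij_betw_def inj_on_def by blast

text \<open>\<open>f\<close> is transported to the image of \<open>G\<close> along the chosen
  isomorphisms \<open>e\<close> with inverses \<open>i\<close>. The quasi-inverse sends
  \<open>f\<close> to the preimage of this under the fully faithful \<open>G\<close>.\<close>

definition conj_map :: "'o \<Rightarrow> 'o \<Rightarrow> 'm \<Rightarrow> 'm" where
  "conj_map a b f = cmp C (GF a) a (GF b) (cmp C a b (GF b) (e b) f) (i a)"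

context
  fixes a b f assumes a: "a \<in> ob C" and b: "b \<in> ob C" and f: "f \<in> hom C a b"
begin

lemma GF_ob: "GF a \<in> ob C" "GF b \<in> ob C" using G1 F0 a b by blast+

lemma ef: "cmp C a b (GF b) (e b) f \<in> hom C a (GF b)"
  by (rule C.cmp_hom[OF a b GF_ob(2) f e[OF b]])

lemma conj_map_hom: "conj_map a b f \<in> hom C (GF a) (GF b)"
  unfolding conj_map_def by (rule C.cmp_hom[OF GF_ob(1) a GF_ob(2) i[OF a] ef])

lemma conj_map_e: "cmp C a (GF a) (GF b) (conj_map a b f) (e a) = cmp C a b (GF b) (e b) f"
proof -
  have "cmp C a (GF a) (GF b) (conj_map a b f) (e a) =
      cmp C a a (GF b) (cmp C a b (GF b) (e b) f) (cmp C a (GF a) a (i a) (e a))"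
    unfolding conj_map_def by (rule C.cmp_assoc[symmetric, OF a GF_ob(1) a GF_ob(2) e[OF a] i[OF a] ef])
  then show ?thesis unfolding ie[OF a] C.cmp_idn_right[OF a GF_ob(2) ef] .
qed

lemma i_conj_map: "cmp C (GF a) (GF b) b (i b) (conj_map a b f) = cmp C (GF a) a b f (i a)"
proof -
  have "cmp C (GF a) (GF b) b (i b) (conj_map a b f) =
      cmp C (GF a) a b (cmp C a (GF b) b (i b) (cmp C a b (GF b) (e b) f)) (i a)"
    unfolding conj_map_def by (rule C.cmp_assoc[OF GF_ob(1) a GF_ob(2) b i[OF a] ef i[OF b]])
  also have "cmp C a (GF b) b (i b) (cmp C a b (GF b) (e b) f) =
      cmp C a b b (cmp C b (GF b) b (i b) (e b)) f"
    by (rule C.cmp_assoc[OF a b GF_ob(2) b f e[OF b] i[OF b]])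
  also have "\<dots> = f" unfolding ie[OF b] by (rule C.cmp_idn_left[OF a b f])
  finally show ?thesis .
qed

end

lemma conj_map_id: "a \<in> ob C \<Longrightarrow> conj_map a a (idn C a) = idn C (GF a)"
  unfolding conj_map_def using C.cmp_idn_right[OF _ _ e] G1[OF F0] ei by simp

lemma conj_map_comp:
  assumes a: "a \<in> ob C" and b: "b \<in> ob C" and c: "c \<in> ob C" and f: "f \<in> hom C a b" and g: "g \<in> hom C b c"
  shows "conj_map a c (cmp C a b c g f) = cmp C (GF a) (GF b) (GF c) (conj_map b c g) (conj_map a b f)"
proof -
  note GFa = GF_ob(1)[OF a b f] and GFb = GF_ob(2)[OF a b f] and GFc = GF_ob(2)[OF b c g]
  note eg = ef[OF b c g] and gf = conj_map_hom[OF b c g]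
  have "cmp C a c (GF c) (e c) (cmp C a b c g f) = cmp C a b (GF c) (cmp C b c (GF c) (e c) g) f"
    by (rule C.cmp_assoc[OF a b c GFc f g e[OF c]])
  also have "\<dots> = cmp C a b (GF c) (cmp C b (GF b) (GF c) (conj_map b c g) (e b)) f"
    unfolding conj_map_e[OF b c g] ..
  also have "\<dots> = cmp C a (GF b) (GF c) (conj_map b c g) (cmp C a b (GF b) (e b) f)"
    by (rule C.cmp_assoc[symmetric, OF a b GFb GFc f e[OF b] gf])
  finally have "conj_map a c (cmp C a b c g f) = cmp C (GF a) a (GF c)
      (cmp C a (GF b) (GF c) (conj_map b c g) (cmp C a b (GF b) (e b) f)) (i a)"
    unfolding conj_map_def[of a c] by simp
  also have "\<dots> = cmp C (GF a) (GF b) (GF c) (conj_map b c g) (conj_map a b f)"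
    unfolding conj_map_def[of a b]
    by (rule C.cmp_assoc[symmetric, OF GFa a GFb GFc i[OF a] ef[OF a b f] gf])
  finally show ?thesis .
qed

definition F :: "('o, 'm, 'p, 'n) fnctr" where
  "F = \<lparr>fob = F0, fmor = (\<lambda>a b f. lift (F0 a) (F0 b) (conj_map a b f))\<rparr>"

lemma F_simps: "fob F a = F0 a" "fmor F a b f = lift (F0 a) (F0 b) (conj_map a b f)"
  by (simp_all add: F_def)

lemma F_mor:
  assumes "a \<in> ob C" "b \<in> ob C" "f \<in> hom C a b"
  shows "fmor F a b f \<in> hom D (F0 a) (F0 b)" "fmor G (F0 a) (F0 b) (fmor F a b f) = conj_map a b f"
  unfolding F_simps using lift[OF F0[OF assms(1)] F0[OF assms(2)] conj_map_hom[OF assms]] by blast+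

lemma F_functor: "is_functor C D F"
  unfolding is_functor_def F_simps(1)
proof (intro conjI ballI)
  fix a assume a: "a \<in> ob C"
  show "F0 a \<in> ob D" by (rule F0[OF a])
  show "fmor F a a (idn C a) = idn D (F0 a)"
    by (rule faithful[OF F0[OF a] F0[OF a] F_mor(1)[OF a a C.idn_hom[OF a]] D.idn_hom[OF F0[OF a]]])
      (simp only: F_mor(2)[OF a a C.idn_hom[OF a]] conj_map_id[OF a] G3[OF F0[OF a]])
  fix b f assume b: "b \<in> ob C" and f: "f \<in> hom C a b"
  show "fmor F a b f \<in> hom D (F0 a) (F0 b)" by (rule F_mor(1)[OF a b f])
  fix c g assume c: "c \<in> ob C" and g: "g \<in> hom C b c"
  note gf = C.cmp_hom[OF a b c f g]
  show "fmor F a c (cmp C a b c g f) = cmp D (F0 a) (F0 b) (F0 c) (fmor F b c g) (fmor F a b f)"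
    by (rule faithful[OF F0[OF a] F0[OF c] F_mor(1)[OF a c gf]
        D.cmp_hom[OF F0[OF a] F0[OF b] F0[OF c] F_mor(1)[OF a b f] F_mor(1)[OF b c g]]])
      (simp only: F_mor(2)[OF a c gf] G4[OF F0[OF a] F0[OF b] F0[OF c] F_mor(1)[OF a b f] F_mor(1)[OF b c g]]
        F_mor(2)[OF a b f] F_mor(2)[OF b c g] conj_map_comp[OF a b c f g])
qed

lemma unit_iso: "restrict e (ob C) \<in> nat_iso C C id_functor (comp_functor G F)"
  unfolding nat_iso_def nat_trans_def
proof (intro CollectI conjI ballI)
  fix a assume a: "a \<in> ob C"
  show "restrict e (ob C) a \<in> hom C (fob id_functor a) (fob (comp_functor G F) a)"
    using a e by (simp add: id_functor_def comp_functor_def F_simps)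
  show "restrict e (ob C) a \<in> iso_set C (fob id_functor a) (fob (comp_functor G F) a)"
    using a e[OF a] i[OF a] ie[OF a] ei[OF a]
    by (auto simp: id_functor_def comp_functor_def F_simps(1) iso_set_def)
  fix b f assume b: "b \<in> ob C" and f: "f \<in> hom C a b"
  show "cmp C (fob id_functor a) (fob id_functor b) (fob (comp_functor G F) b) (restrict e (ob C) b)
      (fmor id_functor a b f) = cmp C (fob id_functor a) (fob (comp_functor G F) a) (fob (comp_functor G F) b)
      (fmor (comp_functor G F) a b f) (restrict e (ob C) a)"
    using a b F_mor(2)[OF a b f] conj_map_e[OF a b f] by (simp add: id_functor_def comp_functor_def F_simps(1))
qed simp

abbreviation counit :: "'p \<Rightarrow> 'n" where "counit d \<equiv> lift (F0 (G0 d)) d (i (G0 d))"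

text \<open>The counit lifts the chosen inverses \<open>i\<close>. As \<open>G\<close> is faithful,
  naturality and the inverse laws may be checked after applying \<open>G\<close>.\<close>

lemma counit_iso: "restrict counit (ob D) \<in> nat_iso D D (comp_functor F G) id_functor"
proof -
  have c: "counit d \<in> hom D (F0 (G0 d)) d" "fmor G (F0 (G0 d)) d (counit d) = i (G0 d)" if "d \<in> ob D" for d
    using lift[OF F0[OF G1[OF that]] that i[OF G1[OF that]]] by blast+
  have "counit d \<in> iso_set D (F0 (G0 d)) d" if d: "d \<in> ob D" for d
  proof -
    note Gd = G1[OF d]
    note Fd = F0[OF Gd]
    let ?k = "lift d (F0 (G0 d)) (e (G0 d))"
    note k = lift[OF d Fd e[OF Gd]]
    have "cmp D (F0 (G0 d)) d (F0 (G0 d)) ?k (counit d) = idn D (F0 (G0 d))"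
      by (rule faithful[OF Fd Fd D.cmp_hom[OF Fd d Fd c(1)[OF d] k(1)] D.idn_hom[OF Fd]])
        (simp only: G4[OF Fd d Fd c(1)[OF d] k(1)] k(2) c(2)[OF d] G3[OF Fd] ei[OF Gd])
    moreover have "cmp D d (F0 (G0 d)) d (counit d) ?k = idn D d"
      by (rule faithful[OF d d D.cmp_hom[OF d Fd d k(1) c(1)[OF d]] D.idn_hom[OF d]])
        (simp only: G4[OF d Fd d k(1) c(1)[OF d]] k(2) c(2)[OF d] G3[OF d] ie[OF Gd])
    ultimately show ?thesis unfolding iso_set_def using c(1)[OF d] k(1) by blast
  qed
  moreover have "cmp D (F0 (G0 a)) (F0 (G0 b)) b (counit b) (fmor F (G0 a) (G0 b) (fmor G a b f)) =
      cmp D (F0 (G0 a)) a b f (counit a)" if a: "a \<in> ob D" and b: "b \<in> ob D" and f: "f \<in> hom D a b" for a b f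
  proof -
    note Ga = G1[OF a] and Gb = G1[OF b] and Gf = G2[OF a b f]
    note Fa = F0[OF Ga] and Fb = F0[OF Gb] and Ff = F_mor[OF Ga Gb Gf]
    show ?thesis
      by (rule faithful[OF Fa b D.cmp_hom[OF Fa Fb b Ff(1) c(1)[OF b]] D.cmp_hom[OF Fa a b c(1)[OF a] f]])
        (simp only: G4[OF Fa Fb b Ff(1) c(1)[OF b]] G4[OF Fa a b c(1)[OF a] f] Ff(2)
          c(2)[OF a] c(2)[OF b] i_conj_map[OF Ga Gb Gf])
  qed
  ultimately show ?thesis using c(1)
    by (simp add: nat_iso_def nat_trans_def id_functor_def comp_functor_def F_simps(1))
qed

lemma equivalence: "equivalent_categories C D"
  unfolding equivalent_categories_def
  using C.category_axioms D.category_axioms F_functor G unit_iso counit_iso by blast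

end

lemma fully_faithful_equivalence:
  assumes C: "category C" and D: "category D" and G: "is_functor D C G"
    and full: "\<And>a b. a \<in> ob D \<Longrightarrow> b \<in> ob D \<Longrightarrow>
      bij_betw (fmor G a b) (hom D a b) (hom C (fob G a) (fob G b))"
    and surj: "\<And>c. c \<in> ob C \<Longrightarrow> \<exists>d \<in> ob D. iso_set C c (fob G d) \<noteq> {}"
  shows "equivalent_categories C D"
proof -
  have "\<forall>c. \<exists>d e i. c \<in> ob C \<longrightarrow> d \<in> ob D \<and> e \<in> hom C c (fob G d) \<and> i \<in> hom C (fob G d) c \<and>
      cmp C c (fob G d) c i e = idn C c \<and> cmp C (fob G d) c (fob G d) e i = idn C (fob G d)"
    using surj unfolding iso_set_def by blast
  then obtain F0 e i where "\<And>c. c \<in> ob C \<Longrightarrow> F0 c \<in> ob D \<and> e c \<in> hom C c (fob G (F0 c)) \<and>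
      i c \<in> hom C (fob G (F0 c)) c \<and> cmp C c (fob G (F0 c)) c (i c) (e c) = idn C c \<and>
      cmp C (fob G (F0 c)) c (fob G (F0 c)) (e c) (i c) = idn C (fob G (F0 c))"
    by (simp only: choice_iff) blast
  then interpret equivalence_data C D G F0 e i
    using C D G full by (intro equivalence_data.intro equivalence_data_axioms.intro) blast+
  show ?thesis by (rule equivalence)
qed

text \<open>An infinite set is in bijection with its square, which codes pairs. Iterating this codes
  lists of a common length, and the length is recorded next to the result through an injection of
  the natural numbers.\<close>

lemma infinite_list_coding:
  assumes "infinite (UNIV :: 'u set)"
  obtains enc :: "'u list \<Rightarrow> 'u" where "inj enc"
proof -
  obtain h :: "'u \<times> 'u \<Rightarrow> 'u" where "bij_betw h (UNIV \<times> UNIV) UNIV"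
    using card_of_ordIso[THEN iffD2, OF card_of_Times_same_infinite[OF assms]] by blast
  then have h: "h x = h y \<longleftrightarrow> x = y" for x y by (auto simp: bij_betw_def dest: injD)
  obtain n :: "nat \<Rightarrow> 'u" where n: "inj n" using infinite_countable_subset[OF assms] by blast
  \<comment> \<open>The starting value \<open>n 0\<close> is arbitrary, since only lists of equal
    length are compared.\<close>
  let ?r = "\<lambda>xs. foldr (\<lambda>x a. h (x, a)) xs (n 0)"
  have "xs = ys" if "length xs = length ys" "?r xs = ?r ys" for xs ys
    using that by (induction xs ys rule: list_induct2) (auto simp: h)
  then have "inj (\<lambda>xs. h (n (length xs), ?r xs))" by (auto simp: inj_def h dest: injD[OF n])
  then show ?thesis by (rule that)
qed

theorem proposition3p49:
  assumes "infinite (UNIV :: 'u set)"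
  shows "equivalent_categories
    (segal_category sOp sOp_grading :: (((nat, nat) tree, (nat, nat) tree tw_mor, 'u) presheaf,
      (nat, nat) tree \<Rightarrow> 'u \<Rightarrow> 'u) cat)
    (operad_category :: (('u, 'u) operad, ('u \<Rightarrow> 'u) \<times> ('u \<Rightarrow> 'u)) cat)"
proof -
  obtain enc :: "'u list \<Rightarrow> 'u" where "inj enc" by (rule infinite_list_coding[OF assms])
  then interpret coding enc by unfold_locales
  show ?thesis
    by (rule fully_faithful_equivalence[OF segal_category_category operad_category_category
        nerve_is_functor nerve_fully_faithful nerve_essentially_surjective])
qed

end
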